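(* There exists $C>0$ such that for every $\beta$ larger than some $\beta_0$ the following holds. Let $(W_1,\dots,W_r)$ be an admissible collection of walls, and let $\mathbf W=(W_z)_{z\in A}$ be an admissible wall collection (indexed by a set $A$ of faces of $\mathcal L_{0,n}$) such that $\rho(\mathbf W)\cap\bigcup_{i\le r}\rho(\mathrm{hull}(W_i))=\emptyset$. Then \[\mu^\mp_n\big(W_1,\dots,W_r\text{ are walls of }\mathcal I\mid\mathbf I_{\mathbf W}\big)\le\exp\Big(-(\beta-C)\sum_{i\le r}\mathfrak m(W_i)\Big).\]
   Context: Lattice conventions. Cells of $\mathbb Z^3$ are unit cubes with vertices in $\mathbb Z^3$; faces are unit squares with vertices in $\mathbb Z^3$; a face is horizontal if its normal is $\pm e_3$. Faces are $*$-adjacent if they share a vertex. $\mathcal L_0$ is the plane $\mathbb Z^2\times\{0\}$ (its faces and edges), $\mathcal L_{0,n}$ the faces of $\mathcal L_0$ in $[-n,n]^2\times\{0\}$, and $\rho(A)=\{(x_1,x_2,0):(x_1,x_2,x_3)\in A\}$. Ising measures. For $\beta>0$, $\mu^\mp_n$ is the limit as $m\to\infty$ of the Ising measures on spins of the cells of $[-n,n]^2\times[-m,m]$ with weight $\propto e^{-\beta\sum\mathbf 1\{\sigma_u\ne\sigma_v\}}$ over pairs of face-sharing cells at least one inside, with boundary spins $-1$ on outside cells with positive third coordinate and $+1$ with negative third coordinate. Interfaces. Given $\sigma$, the interface $\mathcal I$ is the $*$-connected component, among faces separating cells of different spin, containing the faces of $\mathcal L_0$ outside the box. Walls and ceilings.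 A face $f\in\mathcal I$ is a ceiling face if it is horizontal and no other face of $\mathcal I$ has the same projection; otherwise a wall face. Walls (ceilings) are maximal $*$-connected sets of wall (ceiling) faces. An edge/face $u$ of $\mathcal L_0$ is interior to a wall $W$ if $u$ is not in the unbounded component of the complement of $\rho(W)$. Face $x$ of $\mathcal L_0$ is assigned $W_x=W$ if $x$ is interior to $W$ and shares an edge with $\rho(W)$, else $W_x=\varnothing$. $\Theta_{\rm st}W$ translates $W$ vertically so its floor (adjacent ceiling corresponding to the unbounded component of the complement of $\rho(W)$) is at height 0; interfaces are in bijection with collections of standardized walls with pairwise vertex-disjoint projections (admissible collections). The excess area is $\mathfrak m(W)=|W|-|\{\text{faces of }\mathcal L_0\text{ in }\rho(W)\}|$. The projection of the hull of $W$, $\rho(\mathrm{hull}(W))$, is $\rho(W)$ together with all bounded connected components of its complement in $\mathcal L_0$. Conditioning. For an admissible wall collection $\mathbf W=(W_z)_{z\in A}$, $\mathbf I_{\mathbf W}$ is the event that for every $z\in A$ the wall assigned to $z$ in $\mathcal I$ is $W_z$. *)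

theory Defs
  imports "HOL-Analysis.Analysis"
begin

type_synonym pt = "int \<times> int \<times> int"

text \<open>A cell (unit cube) is indexed by its lower corner c, i.e. it is
 [c1,c1+1] x [c2,c2+1] x [c3,c3+1].  A face is a pair (v,d): the unit square
 with lower corner v and normal direction d.\<close>

datatype dir = D1 | D2 | D3

type_synonym face = "pt \<times> dir"

definition padd :: "pt \<Rightarrow> pt \<Rightarrow> pt" where
  "padd u v = (case u of (a,b,c) \<Rightarrow> case v of (a',b',c') \<Rightarrow> (a+a', b+b', c+c'))"

definition psub :: "pt \<Rightarrow> pt \<Rightarrow> pt" where
  "psub u v = (case u of (a,b,c) \<Rightarrow> case v of (a',b',c') \<Rightarrow> (a-a', b-b', c-c'))"

definition unitv :: "dir \<Rightarrow> pt" where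
  "unitv d = (case d of D1 \<Rightarrow> (1,0,0) | D2 \<Rightarrow> (0,1,0) | D3 \<Rightarrow> (0,0,1))"

fun odirs :: "dir \<Rightarrow> dir \<times> dir" where
  "odirs D1 = (D2, D3)" | "odirs D2 = (D1, D3)" | "odirs D3 = (D1, D2)"

definition face_verts :: "face \<Rightarrow> pt set" where
  "face_verts f = (case f of (v, d) \<Rightarrow> (case odirs d of (a, b) \<Rightarrow>
     {v, padd v (unitv a), padd v (unitv b), padd (padd v (unitv a)) (unitv b)}))"

definition star_adj :: "face \<Rightarrow> face \<Rightarrow> bool" where
  "star_adj f g \<longleftrightarrow> f \<noteq> g \<and> face_verts f \<inter> face_verts g \<noteq> {}"

definition cell_above :: "face \<Rightarrow> pt" where "cell_above f = fst f"
definition cell_below :: "face \<Rightarrow> pt" where "cell_below f = psub (fst f) (unitv (snd f))"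

definition horizontal :: "face \<Rightarrow> bool" where "horizontal f \<longleftrightarrow> snd f = D3"

definition height :: "face \<Rightarrow> int" where "height f = snd (snd (fst f))"

definition shift :: "int \<Rightarrow> face set \<Rightarrow> face set" where
  "shift k W = (\<lambda>((a,b,c),d). ((a,b,c+k),d)) ` W"

definition inbox :: "nat \<Rightarrow> nat \<Rightarrow> pt \<Rightarrow> bool" where
  "inbox n m c = (case c of (a,b,h) \<Rightarrow>
     - int n \<le> a \<and> a \<le> int n - 1 \<and> - int n \<le> b \<and> b \<le> int n - 1 \<and>
     - int m \<le> h \<and> h \<le> int m - 1)"

text \<open>Spins: True = +1, False = -1.  Boundary: -1 on cells with positive third
 coordinate (c3 >= 0, centre c3+1/2 > 0), +1 on cells with negative third coordinate.\<close>
definition bc :: "pt \<Rightarrow> bool" where "bc c = (snd (snd c) < 0)"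

definition configs :: "nat \<Rightarrow> nat \<Rightarrow> (pt \<Rightarrow> bool) set" where
  "configs n m = {\<sigma>. \<forall>c. \<not> inbox n m c \<longrightarrow> \<sigma> c = bc c}"

definition separating :: "(pt \<Rightarrow> bool) \<Rightarrow> face \<Rightarrow> bool" where
  "separating \<sigma> f \<longleftrightarrow> \<sigma> (cell_above f) \<noteq> \<sigma> (cell_below f)"

definition touches :: "nat \<Rightarrow> nat \<Rightarrow> face \<Rightarrow> bool" where
  "touches n m f \<longleftrightarrow> inbox n m (cell_above f) \<or> inbox n m (cell_below f)"

definition hamiltonian :: "nat \<Rightarrow> nat \<Rightarrow> (pt \<Rightarrow> bool) \<Rightarrow> nat" where
  "hamiltonian n m \<sigma> = card {f. touches n m f \<and> separating \<sigma> f}"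

definition weight :: "real \<Rightarrow> nat \<Rightarrow> nat \<Rightarrow> (pt \<Rightarrow> bool) \<Rightarrow> real" where
  "weight \<beta> n m \<sigma> = exp (- \<beta> * real (hamiltonian n m \<sigma>))"

definition prob :: "real \<Rightarrow> nat \<Rightarrow> nat \<Rightarrow> ((pt \<Rightarrow> bool) \<Rightarrow> bool) \<Rightarrow> real" where
  "prob \<beta> n m E = (\<Sum>\<sigma>\<in>{\<sigma>\<in>configs n m. E \<sigma>}. weight \<beta> n m \<sigma>)
                     / (\<Sum>\<sigma>\<in>configs n m. weight \<beta> n m \<sigma>)"

definition condprob :: "real \<Rightarrow> nat \<Rightarrow> nat \<Rightarrow> ((pt \<Rightarrow> bool) \<Rightarrow> bool) \<Rightarrow> ((pt \<Rightarrow> bool) \<Rightarrow> bool) \<Rightarrow> real" where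
  "condprob \<beta> n m E F = prob \<beta> n m (\<lambda>\<sigma>. E \<sigma> \<and> F \<sigma>) / prob \<beta> n m F"

text \<open>Conditional probability under the limiting measure mu^-+_n (m \<rightarrow> \<infinity>);
 rendered as the limsup of the finite-volume conditional probabilities
 (equal to the limit whenever it exists).\<close>
definition mu_cond :: "real \<Rightarrow> nat \<Rightarrow> ((pt \<Rightarrow> bool) \<Rightarrow> bool) \<Rightarrow> ((pt \<Rightarrow> bool) \<Rightarrow> bool) \<Rightarrow> ereal" where
  "mu_cond \<beta> n E F = limsup (\<lambda>m. ereal (condprob \<beta> n m E F))"

definition L0_face :: "face \<Rightarrow> bool" where
  "L0_face f \<longleftrightarrow> horizontal f \<and> height f = 0"

definition L0n :: "nat \<Rightarrow> face set" where
  "L0n n = {((a,b,0),D3) | a b. - int n \<le> a \<and> a \<le> int n - 1 \<and> - int n \<le> b \<and> b \<le> int n - 1}"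

definition outside_L0 :: "nat \<Rightarrow> face \<Rightarrow> bool" where
  "outside_L0 n f \<longleftrightarrow> L0_face f \<and> f \<notin> L0n n"

text \<open>Faces and edges of L_0: LF i j = [i,i+1]x[j,j+1]; LE1 i j = edge (i,j)-(i+1,j);
 LE2 i j = edge (i,j)-(i,j+1).\<close>
datatype l0cell = LF int int | LE1 int int | LE2 int int

fun rho_face :: "face \<Rightarrow> l0cell" where
  "rho_face ((a,b,c),D3) = LF a b"
| "rho_face ((a,b,c),D1) = LE2 a b"
| "rho_face ((a,b,c),D2) = LE1 a b"

definition rho :: "face set \<Rightarrow> l0cell set" where
  "rho W = rho_face ` W"

fun cell_pts :: "l0cell \<Rightarrow> (real \<times> real) set" where
  "cell_pts (LF i j) = {(x,y). of_int i \<le> x \<and> x \<le> of_int i + 1 \<and> of_int j \<le> y \<and> y \<le> of_int j + 1}"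
| "cell_pts (LE1 i j) = {(x,y). of_int i \<le> x \<and> x \<le> of_int i + 1 \<and> y = of_int j}"
| "cell_pts (LE2 i j) = {(x,y). x = of_int i \<and> of_int j \<le> y \<and> y \<le> of_int j + 1}"

fun midpt :: "l0cell \<Rightarrow> real \<times> real" where
  "midpt (LF i j) = (of_int i + 1/2, of_int j + 1/2)"
| "midpt (LE1 i j) = (of_int i + 1/2, of_int j)"
| "midpt (LE2 i j) = (of_int i, of_int j + 1/2)"

fun face_edges :: "l0cell \<Rightarrow> l0cell set" where
  "face_edges (LF i j) = {LE1 i j, LE1 i (j+1), LE2 i j, LE2 (i+1) j}"
| "face_edges (LE1 i j) = {}"
| "face_edges (LE2 i j) = {}"

definition rho_pts :: "face set \<Rightarrow> (real \<times> real) set" where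
  "rho_pts W = \<Union> (cell_pts ` rho W)"

definition interior_to :: "l0cell \<Rightarrow> face set \<Rightarrow> bool" where
  "interior_to u W \<longleftrightarrow> midpt u \<in> rho_pts W \<or>
      bounded (connected_component_set (- rho_pts W) (midpt u))"

definition hull_rho :: "face set \<Rightarrow> l0cell set" where
  "hull_rho W = {u. interior_to u W}"

definition is_L0_face_cell :: "l0cell \<Rightarrow> bool" where
  "is_L0_face_cell u \<longleftrightarrow> (\<exists>i j. u = LF i j)"

definition excess :: "face set \<Rightarrow> real" where
  "excess W = real (card W) - real (card {u \<in> rho W. is_L0_face_cell u})"

definition interface :: "nat \<Rightarrow> (pt \<Rightarrow> bool) \<Rightarrow> face set" where
  "interface n \<sigma> = {f. separating \<sigma> f \<and>
      (\<exists>g. outside_L0 n g \<and>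
         (\<lambda>a b. separating \<sigma> a \<and> separating \<sigma> b \<and> star_adj a b)\<^sup>*\<^sup>* g f)}"

definition ceiling_faces :: "face set \<Rightarrow> face set" where
  "ceiling_faces I = {f \<in> I. horizontal f \<and> (\<forall>g \<in> I. g \<noteq> f \<longrightarrow> rho_face g \<noteq> rho_face f)}"

definition wall_faces :: "face set \<Rightarrow> face set" where
  "wall_faces I = I - ceiling_faces I"

definition walls :: "face set \<Rightarrow> face set set" where
  "walls I = {{g. (\<lambda>a b. a \<in> wall_faces I \<and> b \<in> wall_faces I \<and> star_adj a b)\<^sup>*\<^sup>* f g}
               | f. f \<in> wall_faces I}"

definition floor_height :: "face set \<Rightarrow> face set \<Rightarrow> int \<Rightarrow> bool" where
  "floor_height I W h \<longleftrightarrow> (\<exists>f \<in> ceiling_faces I. (\<exists>g \<in> W. star_adj f g)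
      \<and> \<not> interior_to (rho_face f) W \<and> height f = h)"

definition std_walls :: "face set \<Rightarrow> face set set" where
  "std_walls I = {shift (- h) W | W h. W \<in> walls I \<and> floor_height I W h}"

definition assigned :: "face \<Rightarrow> face set \<Rightarrow> bool" where
  "assigned x W \<longleftrightarrow> interior_to (rho_face x) W \<and>
      (\<exists>e \<in> face_edges (rho_face x). cell_pts e \<subseteq> rho_pts W)"

definition assigned_std :: "face set \<Rightarrow> face \<Rightarrow> face set set" where
  "assigned_std I z = {shift (- h) W | W h. W \<in> walls I \<and> floor_height I W h \<and> assigned z W}"

text \<open>The event I_W: for all z in A, the (standardized) wall assigned to z is W_z
 (W_z = {} encodes the empty wall).\<close>
definition event_IW :: "nat \<Rightarrow> face set \<Rightarrow> (face \<Rightarrow> face set) \<Rightarrow> (pt \<Rightarrow> bool) \<Rightarrow> bool" where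
  "event_IW n A WW \<sigma> \<longleftrightarrow> (\<forall>z \<in> A. assigned_std (interface n \<sigma>) z =
       (if WW z = {} then {} else {WW z}))"

definition event_walls :: "nat \<Rightarrow> face set list \<Rightarrow> (pt \<Rightarrow> bool) \<Rightarrow> bool" where
  "event_walls n Ws \<sigma> \<longleftrightarrow> (\<forall>W \<in> set Ws. W \<in> std_walls (interface n \<sigma>))"

definition is_std_wall :: "face set \<Rightarrow> bool" where
  "is_std_wall W \<longleftrightarrow> finite W \<and> W \<noteq> {} \<and>
     (\<exists>n m \<sigma>. \<sigma> \<in> configs n m \<and> W \<in> std_walls (interface n \<sigma>))"

definition vdisjoint :: "face set \<Rightarrow> face set \<Rightarrow> bool" where
  "vdisjoint W W' \<longleftrightarrow> rho_pts W \<inter> rho_pts W' = {}"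

definition admissible_list :: "face set list \<Rightarrow> bool" where
  "admissible_list Ws \<longleftrightarrow> (\<forall>i < length Ws. is_std_wall (Ws ! i)) \<and>
     (\<forall>i < length Ws. \<forall>j < length Ws. i \<noteq> j \<longrightarrow> vdisjoint (Ws ! i) (Ws ! j))"

definition admissible_family :: "face set \<Rightarrow> (face \<Rightarrow> face set) \<Rightarrow> bool" where
  "admissible_family A WW \<longleftrightarrow> (\<forall>z \<in> A. WW z = {} \<or> is_std_wall (WW z)) \<and>
     (\<forall>z \<in> A. \<forall>z' \<in> A. WW z \<noteq> {} \<longrightarrow> WW z' \<noteq> {} \<longrightarrow> WW z \<noteq> WW z' \<longrightarrow>
        vdisjoint (WW z) (WW z'))"

end

theory Submission
  imports Defs
begin

text \<open>
  The walls are removed from the interface one at a time, beginning with the smallest hull.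
  Removing a wall W lowers the energy of the interface by m(W); the only other effect is on the
  partition function of the spins on the cells not touching the interface. Relative to the full
  cylinder, this is the probability that the cells touching the interface carry no minus spin
  in an Ising model with constant boundary condition. Positive association (the four functions
  theorem) and a Peierls argument show that this probability factorises across the projection of W
  up to exp (C m(W)) and a product, over the walls V nested in W, of factors exp a(V) with a(V)
  exponentially small in the distance from V to W. The moment of this product is bounded by
  applying the estimate itself to the nested walls, which is an induction on the size of the hull.
  No convergent cluster expansion is involved.
\<close>

section \<open>The four functions theorem and counting connected sets\<close>

text \<open>Three obstacles shape the proof. The wall structure is planar topology, treated modulo
  2: spins are potentials of even sets of faces, the grid is simply connected, and all columns of an
  even set have the same parity. This gives that an interface has exactly one wall over each
  component of its wall projection, and that closing the gap left by a wall yields an interface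
  again. Deletion moves the parts over the interior of the wall vertically by different amounts, so
  the comparison of partition functions needs vertical translation invariance. It is available only
  in the limit of infinite height, where the probabilities converge by monotonicity. The induction
  needs a statement stable under conditioning and under restriction to the interior of a larger
  wall. Hence the peeling estimate concerns every finite family closed under deleting walls inside
  the hull, and weights whose partition function feels the interface only over a region containing
  the hull. The conditioning event enters only through this closure.\<close>

lemma four_functions_two_point:
  fixes a0 a1 b0 b1 c0 c1 d0 d1 :: real
  assumes nn: "a0 \<ge> 0" "a1 \<ge> 0" "b0 \<ge> 0" "b1 \<ge> 0" "c0 \<ge> 0" "c1 \<ge> 0" "d0 \<ge> 0" "d1 \<ge> 0"
    and h: "a0 * b0 \<le> c0 * d0" "a0 * b1 \<le> c1 * d0" "a1 * b0 \<le> c1 * d0" "a1 * b1 \<le> c1 * d1"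
  shows "(a0 + a1) * (b0 + b1) \<le> (c0 + c1) * (d0 + d1)"
proof -
  define u where "u = a0 * b1"
  define v where "v = a1 * b0"
  \<comment> \<open>Both mixed products are at most \<open>p\<close>, and their product is at most
    \<open>p * (c0 * d1)\<close>; so \<open>(p - u) * (p - v) \<ge> 0\<close> bounds
    \<open>u + v\<close> by \<open>p + c0 * d1\<close>.\<close>
  define p where "p = c1 * d0"
  have nnp: "u \<ge> 0" "v \<ge> 0" "p \<ge> 0" using nn by (auto simp: u_def v_def p_def)
  have "u + v \<le> p + c0 * d1"
  proof (cases "p = 0")
    case True
    then have "u = 0" "v = 0" using h nnp by (auto simp: u_def v_def p_def)
    then show ?thesis using True nn by simp
  next
    case False
    then have "p > 0" using nnp by simp
    have "u * v = (a0 * b0) * (a1 * b1)" by (simp add: u_def v_def)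
    also have "\<dots> \<le> (c0 * d0) * (c1 * d1)" 
      by (rule mult_mono[OF h(1) h(4)]) (use nn in auto)
    also have "\<dots> = p * (c0 * d1)" by (simp add: p_def)
    finally have 1: "u * v \<le> p * (c0 * d1)" .
    have "(p - u) * (p - v) \<ge> 0" using h by (intro mult_nonneg_nonneg) (auto simp: u_def v_def p_def)
    then have "p * (u + v) \<le> p * p + u * v" by (simp add: algebra_simps)
    also have "\<dots> \<le> p * (p + c0 * d1)" using 1 by (simp add: algebra_simps)
    finally show ?thesis using \<open>p > 0\<close> by simp
  qed
  then show ?thesis using h by (simp add: u_def v_def p_def algebra_simps)
qed

text \<open>Induction on the ground set: summing out one point leaves four functions on the smaller
  set that satisfy the same hypothesis, by the two-point case.\<close>

lemma four_functions:
  fixes \<alpha> \<beta> \<gamma> \<delta> :: "'a set \<Rightarrow> real"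
  assumes "finite A"
    and "\<And>X. \<alpha> X \<ge> 0" "\<And>X. \<beta> X \<ge> 0" "\<And>X. \<gamma> X \<ge> 0" "\<And>X. \<delta> X \<ge> 0"
    and "\<And>X Y. X \<subseteq> A \<Longrightarrow> Y \<subseteq> A \<Longrightarrow> \<alpha> X * \<beta> Y \<le> \<gamma> (X \<union> Y) * \<delta> (X \<inter> Y)"
  shows "sum \<alpha> (Pow A) * sum \<beta> (Pow A) \<le> sum \<gamma> (Pow A) * sum \<delta> (Pow A)"
  using assms
proof (induction A arbitrary: \<alpha> \<beta> \<gamma> \<delta> rule: finite_induct)
  case empty
  then show ?case by (auto dest: meta_spec[of _ "{}"])
next
  case (insert x A)
  have split: "sum f (Pow (insert x A)) = (\<Sum>X\<in>Pow A. f X + f (insert x X))" for f :: "'a set \<Rightarrow> real"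
  proof -
    have "sum f (Pow (insert x A)) = sum f (Pow A) + sum f (insert x ` Pow A)"
      unfolding Pow_insert using insert.hyps by (intro sum.union_disjoint) auto
    also have "sum f (insert x ` Pow A) = (\<Sum>X\<in>Pow A. f (insert x X))"
      using insert.hyps by (subst sum.reindex) (auto simp: inj_on_def)
    finally show ?thesis by (simp add: sum.distrib)
  qed
  have "(\<Sum>X\<in>Pow A. \<alpha> X + \<alpha> (insert x X)) * (\<Sum>X\<in>Pow A. \<beta> X + \<beta> (insert x X))
      \<le> (\<Sum>X\<in>Pow A. \<gamma> X + \<gamma> (insert x X)) * (\<Sum>X\<in>Pow A. \<delta> X + \<delta> (insert x X))"
  proof (rule insert.IH)
    fix X Y assume XY: "X \<subseteq> A" "Y \<subseteq> A"
    have nx: "x \<notin> X" "x \<notin> Y" using XY insert.hyps by auto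
    show "(\<alpha> X + \<alpha> (insert x X)) * (\<beta> Y + \<beta> (insert x Y)) \<le>
      (\<gamma> (X \<union> Y) + \<gamma> (insert x (X \<union> Y))) * (\<delta> (X \<inter> Y) + \<delta> (insert x (X \<inter> Y)))"
    proof (rule four_functions_two_point)
      show "\<alpha> X * \<beta> Y \<le> \<gamma> (X \<union> Y) * \<delta> (X \<inter> Y)" using XY by (intro insert.prems) auto
      have "insert x X \<inter> Y = X \<inter> Y" "X \<inter> insert x Y = X \<inter> Y" using nx by auto
      then show "\<alpha> X * \<beta> (insert x Y) \<le> \<gamma> (insert x (X \<union> Y)) * \<delta> (X \<inter> Y)"
        "\<alpha> (insert x X) * \<beta> Y \<le> \<gamma> (insert x (X \<union> Y)) * \<delta> (X \<inter> Y)"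
        using insert.prems(5)[of X "insert x Y"] insert.prems(5)[of "insert x X" Y] XY by auto
      show "\<alpha> (insert x X) * \<beta> (insert x Y) \<le> \<gamma> (insert x (X \<union> Y)) * \<delta> (insert x (X \<inter> Y))"
        using insert.prems(5)[of "insert x X" "insert x Y"] XY by auto
    qed (use insert.prems in auto)
  qed (use insert.prems in auto)
  then show ?case by (simp add: split)
qed

section \<open>Connectedness inside a set, and counting connected sets\<close>

definition linked :: "('a \<Rightarrow> 'a \<Rightarrow> bool) \<Rightarrow> 'a set \<Rightarrow> 'a \<Rightarrow> 'a \<Rightarrow> bool" where
  "linked R S = (\<lambda>a b. a \<in> S \<and> b \<in> S \<and> R a b)\<^sup>*\<^sup>*"

text \<open>Reflexivity holds also off \<open>S\<close>, while every proper step needs both ends in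
  \<open>S\<close>. This is why membership of the starting point is a separate hypothesis
  below.\<close>

lemma linked_refl [simp, intro]: "linked R S x x"
  by (simp add: linked_def)

lemma linked_step: "x \<in> S \<Longrightarrow> y \<in> S \<Longrightarrow> R x y \<Longrightarrow> linked R S x y"
  unfolding linked_def by (rule r_into_rtranclp) simp

lemma linked_trans: "linked R S x y \<Longrightarrow> linked R S y z \<Longrightarrow> linked R S x z"
  unfolding linked_def by (rule rtranclp_trans)

lemma linked_sym: "symp R \<Longrightarrow> linked R S x y \<Longrightarrow> linked R S y x"
  unfolding linked_def
  by (rule sympD[OF symp_rtranclp]) (auto simp: symp_def)

lemma linked_induct [consumes 1, case_names base step]:
  assumes "linked R S x y"
    and "P x"
    and "\<And>y z. linked R S x y \<Longrightarrow> y \<in> S \<Longrightarrow> z \<in> S \<Longrightarrow> R y z \<Longrightarrow> P y \<Longrightarrow> P z"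
  shows "P y"
  using assms(1) unfolding linked_def
proof (induction rule: rtranclp_induct)
  case base then show ?case by (rule assms(2))
next
  case (step y z)
  then show ?case using assms(3)[of y z] unfolding linked_def by auto
qed

lemma linked_in: "linked R S x y \<Longrightarrow> x \<in> S \<Longrightarrow> y \<in> S"
  by (induction rule: linked_induct) auto

lemma linked_mono: "linked R S x y \<Longrightarrow> S \<subseteq> T \<Longrightarrow> linked R T x y"
  by (induction rule: linked_induct) (auto intro: linked_trans linked_step)

text \<open>Transfers a chain from \<open>S\<close> to a set \<open>T\<close> that absorbs those
  neighbours of its points that lie in \<open>S\<close>; the standard way below to show that a class
  stays inside a given set.\<close>

lemma linked_restrict:
  assumes "linked R S x y" "x \<in> T" "\<And>y z. y \<in> T \<Longrightarrow> z \<in> S \<Longrightarrow> R y z \<Longrightarrow> z \<in> T"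
  shows "linked R T x y \<and> y \<in> T"
  using assms(1)
proof (induction rule: linked_induct)
  case base show ?case using assms(2) by simp
next
  case (step y z)
  then have "z \<in> T" using assms(3) by blast
  then show ?case using step by (auto intro: linked_trans linked_step)
qed

lemma linked_int_ivt:
  fixes g :: "'a \<Rightarrow> int"
  assumes "linked R S x y" "x \<in> S" "\<And>a b. R a b \<Longrightarrow> \<bar>g a - g b\<bar> \<le> 1"
    and "min (g x) (g y) \<le> t" "t \<le> max (g x) (g y)"
  shows "\<exists>z\<in>S. g z = t"
  using assms(1,4,5)
proof (induction rule: linked_induct)
  case base
  then show ?case using assms(2) by auto
next
  case (step y z)
  have "\<bar>g y - g z\<bar> \<le> 1" using step assms(3) by blast
  then have "t = g z \<or> t = g y \<or> (min (g x) (g y) \<le> t \<and> t \<le> max (g x) (g y))"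
    using step.prems by linarith
  then show ?case using step by blast
qed

lemma linked_int_card:
  fixes g :: "'a \<Rightarrow> int"
  assumes "linked R S x y" "x \<in> S" "\<And>a b. R a b \<Longrightarrow> \<bar>g a - g b\<bar> \<le> 1" "finite S"
  shows "\<bar>g x - g y\<bar> + 1 \<le> int (card S)"
proof -
  have "{min (g x) (g y)..max (g x) (g y)} \<subseteq> g ` S"
  proof
    fix t assume "t \<in> {min (g x) (g y)..max (g x) (g y)}"
    then have "\<exists>z\<in>S. g z = t" using linked_int_ivt[OF assms(1,2), of g t] assms(3) by auto
    then show "t \<in> g ` S" by auto
  qed
  then have "card {min (g x) (g y)..max (g x) (g y)} \<le> card S"
    using assms(4) by (meson card_image_le card_mono finite_imageI le_trans)
  then show ?thesis by auto
qed

text \<open>A connected set is explored by a walk that, for each new point \<open>s\<close>, inserts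
  the detour \<open>t, s, t\<close> at a visited neighbour \<open>t\<close>. Each new point
  lengthens the walk by two.\<close>

lemma linked_walk:
  assumes "finite S" "x \<in> S" "\<And>y. y \<in> S \<Longrightarrow> linked R S x y" "symp R" "j < card S"
  shows "\<exists>xs. xs \<noteq> [] \<and> hd xs = x \<and> length xs = 2 * j + 1 \<and> successively R xs \<and> set xs \<subseteq> S
     \<and> card (set xs) = Suc j"
  using assms(5)
proof (induction j)
  case 0
  then show ?case using assms(2) by (intro exI[of _ "[x]"]) auto
next
  case (Suc j)
  then obtain xs where xs: "xs \<noteq> []" "hd xs = x" "length xs = 2 * j + 1" "successively R xs"
    "set xs \<subseteq> S" "card (set xs) = Suc j" by auto
  have "\<exists>t\<in>set xs. \<exists>s\<in>S - set xs. R t s"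
  proof (rule ccontr)
    assume neg: "\<not> ?thesis"
    have "y \<in> set xs" if "linked R S x y" for y
      using that
    proof (induction rule: linked_induct)
      case base then show ?case using xs by auto
    next
      case (step y z) then show ?case using neg by blast
    qed
    then have "S \<subseteq> set xs" using assms(3) by blast
    then have "card S \<le> Suc j" using xs by (metis card_mono List.finite_set)
    then show False using Suc.prems by simp
  qed
  then obtain t s where ts: "t \<in> set xs" "s \<in> S" "s \<notin> set xs" "R t s" by blast
  obtain as bs where ab: "xs = as @ t # bs" using ts(1) by (meson split_list)
  have st: "R s t" using ts assms(4) by (auto dest: sympD)
  let ?ys = "as @ t # s # t # bs"
  have "successively R ?ys" using xs(4) ts(4) st unfolding ab
    by (auto simp: successively_append_iff successively_Cons)
  moreover have "hd ?ys = x" using xs(2) unfolding ab by (cases as) auto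
  moreover have "set ?ys = insert s (set xs)" unfolding ab by auto
  ultimately show ?case using xs ts ab
    by (intro exI[of _ ?ys]) auto
qed

lemma walks_card:
  assumes "\<And>x. finite {y. R x y}" "\<And>x. card {y. R x y} \<le> \<Delta>"
  shows "finite {xs. xs \<noteq> [] \<and> hd xs = x \<and> length xs = Suc n \<and> successively R xs} \<and>
     card {xs. xs \<noteq> [] \<and> hd xs = x \<and> length xs = Suc n \<and> successively R xs} \<le> \<Delta> ^ n"
proof (induction n arbitrary: x)
  case 0
  have "{xs. xs \<noteq> [] \<and> hd xs = x \<and> length xs = Suc 0 \<and> successively R xs} = {[x]}"
    by (auto simp: length_Suc_conv)
  then show ?case by simp
next
  case (Suc n)
  let ?W = "\<lambda>n x. {xs. xs \<noteq> [] \<and> hd xs = x \<and> length xs = Suc n \<and> successively R xs}"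
  have sub: "?W (Suc n) x \<subseteq> (\<Union>y\<in>{y. R x y}. (#) x ` ?W n y)"
  proof
    fix xs assume "xs \<in> ?W (Suc n) x"
    then obtain ys where ys: "xs = x # ys" "length ys = Suc n" "successively R (x # ys)"
      by (cases xs) auto
    then have "ys \<in> ?W n (hd ys)" "R x (hd ys)" by (cases ys; auto)+
    then show "xs \<in> (\<Union>y\<in>{y. R x y}. (#) x ` ?W n y)" using ys by blast
  qed
  have fin: "finite (\<Union>y\<in>{y. R x y}. (#) x ` ?W n y)"
    using assms(1) Suc.IH by blast
  have "card (?W (Suc n) x) \<le> card (\<Union>y\<in>{y. R x y}. (#) x ` ?W n y)"
    by (rule card_mono[OF fin sub])
  also have "\<dots> \<le> (\<Sum>y\<in>{y. R x y}. card ((#) x ` ?W n y))"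
    by (rule card_UN_le[OF assms(1)])
  also have "\<dots> \<le> (\<Sum>y\<in>{y. R x y}. \<Delta> ^ n)"
    using Suc.IH by (intro sum_mono) (meson card_image_le le_trans)
  also have "\<dots> \<le> \<Delta> * \<Delta> ^ n" using assms(2) by (simp add: mult_right_mono)
  finally show ?case using finite_subset[OF sub fin] by simp
qed

text \<open>The set is recovered as the range of its exploring walk, and there are at most
  \<open>\<Delta>\<close> choices at each of fewer than \<open>2 * k\<close> steps.\<close>

lemma linked_sets_card:
  assumes "\<And>x. finite {y. R x y}" "\<And>x. card {y. R x y} \<le> \<Delta>" "symp R" "\<Delta> \<ge> 1"
  shows "finite {S. finite S \<and> x \<in> S \<and> card S = k \<and> (\<forall>y\<in>S. linked R S x y)} \<and>
    card {S. finite S \<and> x \<in> S \<and> card S = k \<and> (\<forall>y\<in>S. linked R S x y)} \<le> (\<Delta>\<^sup>2) ^ k"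
proof (cases k)
  case 0
  then have "{S. finite S \<and> x \<in> S \<and> card S = k \<and> (\<forall>y\<in>S. linked R S x y)} = {}" by auto
  then show ?thesis by (simp only: ) simp
next
  case (Suc j)
  let ?A = "{S. finite S \<and> x \<in> S \<and> card S = k \<and> (\<forall>y\<in>S. linked R S x y)}"
  let ?W = "{xs. xs \<noteq> [] \<and> hd xs = x \<and> length xs = Suc (2 * j) \<and> successively R xs}"
  have "?A \<subseteq> set ` ?W"
  proof
    fix S assume S: "S \<in> ?A"
    then obtain xs where xs: "xs \<noteq> []" "hd xs = x" "length xs = 2 * j + 1" "successively R xs" "set xs \<subseteq> S"
      "card (set xs) = Suc j" using linked_walk[of S x R j] assms(3) Suc by auto
    then have "set xs = S" using S Suc by (intro card_subset_eq) auto
    then show "S \<in> set ` ?W" using xs by auto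
  qed
  have W: "finite ?W" "card ?W \<le> \<Delta> ^ (2 * j)" using walks_card[of R \<Delta> x "2 * j", OF assms(1,2)] by auto
  have "finite ?A" using \<open>?A \<subseteq> set ` ?W\<close> W(1) by (meson finite_imageI finite_subset)
  moreover have "card ?A \<le> \<Delta> ^ (2 * j)"
    using card_mono[OF finite_imageI[OF W(1)] \<open>?A \<subseteq> set ` ?W\<close>] card_image_le[OF W(1), of set] W(2) by linarith
  moreover have "\<Delta> ^ (2 * j) \<le> \<Delta> ^ (2 * k)" using Suc assms(4) by (intro power_increasing) auto
  ultimately show ?thesis by (simp add: power_mult)
qed

text \<open>A geometric series, the common form of the counting arguments below: at most
  \<open>M ^ k\<close> objects of size \<open>k\<close>, none smaller than \<open>k0\<close>. The
  ratio \<open>M * y\<close> is at most one half, which gives the factor 2.\<close>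

lemma sum_power_le:
  fixes y :: real and V :: "'a set" and g :: "'a \<Rightarrow> nat"
  assumes fin: "finite V" and ge: "\<And>S. S \<in> V \<Longrightarrow> g S \<ge> k0"
    and cnt: "\<And>k. card {S \<in> V. g S = k} \<le> M ^ k" and y: "0 \<le> y" "real M * y \<le> 1/2"
  shows "(\<Sum>S\<in>V. y ^ g S) \<le> 2 * (real M * y) ^ k0"
proof -
  define N where "N = Max (insert k0 (g ` V))"
  have "(\<Sum>S\<in>V. y ^ g S) = (\<Sum>k\<in>{k0..N}. \<Sum>S\<in>{S \<in> V. g S = k}. y ^ g S)"
    using fin ge by (intro sum.group[symmetric]) (auto simp: N_def)
  also have "\<dots> = (\<Sum>k\<in>{k0..N}. real (card {S \<in> V. g S = k}) * y ^ k)"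
    by (intro sum.cong) auto
  also have "\<dots> \<le> (\<Sum>k\<in>{k0..N}. (real M * y) ^ k)"
    using cnt y by (intro sum_mono) (auto simp: power_mult_distrib intro!: mult_right_mono
       simp flip: of_nat_power)
  also have "\<dots> \<le> 2 * (real M * y) ^ k0"
  proof -
    define q where "q = real M * y"
    have q: "0 \<le> q" "q \<le> 1/2" using y by (auto simp: q_def)
    have "k0 \<le> N" using fin by (auto simp: N_def)
    then have "(\<Sum>k\<in>{k0..N}. q ^ k) = (\<Sum>i\<in>{0..N-k0}. q ^ (i + k0))"
      using sum.shift_bounds_cl_nat_ivl[of "\<lambda>k. q ^ k" 0 k0 "N - k0"] by simp
    also have "\<dots> = (\<Sum>i\<in>{0..N-k0}. q ^ i) * q ^ k0" by (simp add: power_add sum_distrib_right)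
    also have "(\<Sum>i\<in>{0..N-k0}. q ^ i) \<le> 2"
    proof -
      have "(\<Sum>i\<in>{0..N-k0}. q ^ i) = (\<Sum>i<Suc (N-k0). q ^ i)" by (simp add: atLeast0AtMost lessThan_Suc_atMost)
      also have "\<dots> = (1 - q ^ Suc (N-k0)) / (1 - q)" using q by (subst sum_gp_strict) auto
      also have "\<dots> \<le> 1 / (1 - q)" using q by (intro divide_right_mono) auto
      also have "\<dots> \<le> 2" using q by (simp add: field_simps)
      finally show ?thesis .
    qed
    finally show ?thesis using q by (simp add: q_def mult_right_mono)
  qed
  finally show ?thesis .
qed

lemmas sum_power_card_le = sum_power_le[where g = card]

section \<open>The square grid\<close>

type_synonym gpt = "int \<times> int"

definition gadj :: "gpt \<Rightarrow> gpt \<Rightarrow> bool" where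
  "gadj p q \<longleftrightarrow> \<bar>fst p - fst q\<bar> + \<bar>snd p - snd q\<bar> = 1"

lemma symp_gadj: "symp gadj"
  by (auto simp: symp_def gadj_def)

lemma gadj_cases:
  assumes "gadj (i, j) q"
  obtains "q = (i + 1, j)" | "q = (i - 1, j)" | "q = (i, j + 1)" | "q = (i, j - 1)"
proof -
  obtain a b where q: "q = (a, b)" by (cases q)
  have "(a = i + 1 \<and> b = j) \<or> (a = i - 1 \<and> b = j) \<or> (a = i \<and> b = j + 1) \<or> (a = i \<and> b = j - 1)"
    using assms unfolding q gadj_def by auto
  then show thesis using that q by blast
qed

section \<open>Boolean potentials on the grid\<close>

lemma bool_antidifference:
  fixes f :: "int \<Rightarrow> bool"
  shows "\<exists>F. F 0 = b \<and> (\<forall>i. F (i + 1) = (F i \<noteq> f i))"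
proof -
  \<comment> \<open>Inequality of booleans is addition modulo 2; \<open>F i\<close> is the initial
    value plus the number of true values of \<open>f\<close> between 0 and \<open>i\<close>.\<close>
  define F where "F i = (b \<noteq> (if i \<ge> 0 then odd (card (Collect f \<inter> {0..<i})) else odd (card (Collect f \<inter> {i..<0}))))" for i
  have "F (i + 1) = (F i \<noteq> f i)" for i
  proof (cases "i \<ge> 0")
    case True
    then have "{0..<i + 1} = insert i {0..<i}" by (simp add: set_eq_iff) arith
    then show ?thesis using True by (simp add: F_def Int_insert_right)
  next
    case False
    then have 1: "{i..<0} = insert i {i + 1..<0}" by (simp add: set_eq_iff) arith
    show ?thesis
    proof (cases "i + 1 \<ge> 0")
      case True
      then have "i = -1" using False by simp
      then show ?thesis using 1 by (simp add: F_def Int_insert_right)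
    next
      case f2: False
      then show ?thesis using 1 False by (simp add: F_def Int_insert_right)
    qed
  qed
  moreover have "F 0 = b" by (simp add: F_def)
  ultimately show ?thesis by blast
qed

text \<open>The discrete Poincare lemma: the grid is simply connected.\<close>
lemma grid_potential:
  fixes h v :: "int \<Rightarrow> int \<Rightarrow> bool"
  assumes "\<And>i j. (h i j \<noteq> v (i + 1) j) = (v i j \<noteq> h i (j + 1))"
  obtains g where "\<And>i j. g (i + 1) j = (g i j \<noteq> h i j)" "\<And>i j. g i (j + 1) = (g i j \<noteq> v i j)"
proof -
  obtain A where A: "\<And>i. A (i + 1) = (A i \<noteq> h i 0)"
    using bool_antidifference[of undefined "\<lambda>i. h i 0"] by blast
  have "\<forall>i. \<exists>B. B 0 = A i \<and> (\<forall>j. B (j + 1) = (B j \<noteq> v i j))"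
    using bool_antidifference by blast
  then obtain g where g0: "\<And>i. g i 0 = A i" and gv: "\<And>i j. g i (j + 1) = (g i j \<noteq> v i j)"
    by metis
  have "g (i + 1) j = (g i j \<noteq> h i j)" for i j
  proof (induction j rule: int_induct[where k = 0])
    case base then show ?case by (simp add: g0 A)
  next
    case (step1 j)
    then show ?case using gv[of "i + 1" j] gv[of i j] assms[of i j] by auto
  next
    case (step2 j)
    then show ?case using gv[of "i + 1" "j - 1"] gv[of i "j - 1"] assms[of i "j - 1"] by auto
  qed
  with gv show thesis using that by blast
qed

text \<open>The cochain becomes a symmetric relation on neighbours: modulo 2 no orientation of the
  grid edges has to be chosen.\<close>

lemma grid_potential_rel:
  fixes \<phi> :: "gpt \<Rightarrow> gpt \<Rightarrow> bool"
  assumes sym: "\<And>x y. \<phi> x y = \<phi> y x"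
    and plaq: "\<And>i j. (\<phi> (i, j) (i + 1, j) \<noteq> \<phi> (i + 1, j) (i + 1, j + 1)) =
                     (\<phi> (i, j) (i, j + 1) \<noteq> \<phi> (i, j + 1) (i + 1, j + 1))"
  shows "\<exists>g. \<forall>x y. gadj x y \<longrightarrow> g y = (g x \<noteq> \<phi> x y)"
proof -
  obtain g where g: "\<And>i j. g (i + 1) j = (g i j \<noteq> \<phi> (i, j) (i + 1, j))"
     "\<And>i j. g i (j + 1) = (g i j \<noteq> \<phi> (i, j) (i, j + 1))"
    by (rule grid_potential[of "\<lambda>i j. \<phi> (i, j) (i + 1, j)" "\<lambda>i j. \<phi> (i, j) (i, j + 1)"])
      (rule plaq, blast)
  have "(\<lambda>(i, j). g i j) y = ((\<lambda>(i, j). g i j) x \<noteq> \<phi> x y)" if "gadj x y" for x y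
  proof -
    obtain i j where x: "x = (i, j)" by (cases x)
    from that[unfolded x] show ?thesis
    proof (cases rule: gadj_cases)
      case 1 then show ?thesis using g(1)[of i j] x by auto
    next
      case 2 then show ?thesis using g(1)[of "i - 1" j] x sym[of "(i, j)" "(i - 1, j)"] by auto
    next
      case 3 then show ?thesis using g(2)[of i j] x by auto
    next
      case 4 then show ?thesis using g(2)[of i "j - 1"] x sym[of "(i, j)" "(i, j - 1)"] by auto
    qed
  qed
  then show ?thesis by blast
qed

text \<open>The grid carries doubled coordinates: (even, even) points are vertices of the square lattice,
  (odd, odd) points are faces, the others are edges. A closed set contains with every cell its boundary.\<close>
definition gclosure :: "gpt \<Rightarrow> gpt set" where
  "gclosure p = {q. (fst q = fst p \<or> odd (fst p) \<and> \<bar>fst q - fst p\<bar> = 1) \<and>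
                    (snd q = snd p \<or> odd (snd p) \<and> \<bar>snd q - snd p\<bar> = 1)}"

definition gclosed :: "gpt set \<Rightarrow> bool" where
  "gclosed K \<longleftrightarrow> (\<forall>p\<in>K. gclosure p \<subseteq> K)"

lemma gclosure_refl [simp]: "p \<in> gclosure p"
  by (simp add: gclosure_def)

lemma gclosure_trans:
  assumes "q \<in> gclosure p" "r \<in> gclosure q"
  shows "r \<in> gclosure p"
proof -
  have *: "x = z \<or> odd z \<and> \<bar>x - z\<bar> = 1"
    if "y = z \<or> odd z \<and> \<bar>y - z\<bar> = 1" "x = y \<or> odd y \<and> \<bar>x - y\<bar> = 1" for x y z :: int
  proof (cases "y = z")
    case False
    then have "y = z + 1 \<or> y = z - 1" "odd z" using that(1) by auto
    then have "even y" by auto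
    then show ?thesis using that by auto
  qed (use that in auto)
  show ?thesis using assms *[of "fst q" "fst p" "fst r"] *[of "snd q" "snd p" "snd r"]
    unfolding gclosure_def mem_Collect_eq by blast
qed

lemma gclosure_subset: "gclosure p \<subseteq> {fst p - 1..fst p + 1} \<times> {snd p - 1..snd p + 1}"
proof
  fix q assume "q \<in> gclosure p"
  then have "\<bar>fst q - fst p\<bar> \<le> 1" "\<bar>snd q - snd p\<bar> \<le> 1" unfolding gclosure_def by auto
  then show "q \<in> {fst p - 1..fst p + 1} \<times> {snd p - 1..snd p + 1}" unfolding mem_Times_iff atLeastAtMost_iff by linarith
qed

lemma finite_gclosure: "finite (gclosure p)"
  by (rule finite_subset[OF gclosure_subset]) auto

lemma card_gclosure: "card (gclosure p) \<le> 9"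
proof -
  have "card (gclosure p) \<le> card ({fst p - 1..fst p + 1} \<times> {snd p - 1..snd p + 1})"
    by (rule card_mono[OF _ gclosure_subset]) auto
  also have "\<dots> = 9" by (subst card_cartesian_product) simp
  finally show ?thesis .
qed

text \<open>Each unit square of the grid has exactly one corner with both coordinates even, so the
  square condition need only be checked from such a corner, in the four directions given by the
  signs \<open>s\<close> and \<open>t\<close>.\<close>

lemma plaquette_shift:
  fixes P :: "gpt \<Rightarrow> gpt \<Rightarrow> bool"
  assumes sym: "\<And>x y. P x y = P y x"
    and base: "\<And>a b s t. even a \<Longrightarrow> even b \<Longrightarrow> \<bar>s\<bar> = 1 \<Longrightarrow> \<bar>t\<bar> = 1 \<Longrightarrow>
      (P (a, b) (a + s, b) \<noteq> P (a + s, b) (a + s, b + t)) = (P (a, b) (a, b + t) \<noteq> P (a, b + t) (a + s, b + t))"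
  shows "(P (i, j) (i + 1, j) \<noteq> P (i + 1, j) (i + 1, j + 1)) =
         (P (i, j) (i, j + 1) \<noteq> P (i, j + 1) (i + 1, j + 1))"
proof -
  have s: "P (i + 1, j) (i, j) = P (i, j) (i + 1, j)" "P (i + 1, j + 1) (i + 1, j) = P (i + 1, j) (i + 1, j + 1)"
    "P (i, j + 1) (i, j) = P (i, j) (i, j + 1)" "P (i + 1, j + 1) (i, j + 1) = P (i, j + 1) (i + 1, j + 1)"
    by (rule sym)+
  consider "even i" "even j" | "odd i" "even j" | "even i" "odd j" | "odd i" "odd j" by blast
  then show ?thesis
  proof cases
    case 1 then show ?thesis using base[of i j 1 1] by simp
  next
    case 2 then show ?thesis using base[of "i + 1" j "-1" 1] s by auto
  next
    case 3 then show ?thesis using base[of i "j + 1" 1 "-1"] s by auto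
  next
    case 4 then show ?thesis using base[of "i + 1" "j + 1" "-1" "-1"] s by auto
  qed
qed

text \<open>The label, extended by zero, is a closed cochain on the grid, hence exact.\<close>
lemma boundary_label_constant:
  fixes lab :: "gpt \<Rightarrow> gpt \<Rightarrow> 'a"
  assumes K: "gclosed K" "\<And>x y. x \<in> K \<Longrightarrow> y \<in> K \<Longrightarrow> linked gadj K x y"
    and l1: "\<And>a b s t. even a \<Longrightarrow> even b \<Longrightarrow> \<bar>s\<bar> = 1 \<Longrightarrow> \<bar>t\<bar> = 1 \<Longrightarrow> (a, b) \<in> K \<Longrightarrow> (a + s, b) \<in> K \<Longrightarrow>
      (a, b + t) \<in> K \<Longrightarrow> (a + s, b + t) \<notin> K \<Longrightarrow> lab (a + s, b + t) (a + s, b) = lab (a + s, b + t) (a, b + t)"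
    and l2: "\<And>a b s t. even a \<Longrightarrow> even b \<Longrightarrow> \<bar>s\<bar> = 1 \<Longrightarrow> \<bar>t\<bar> = 1 \<Longrightarrow> (a, b) \<in> K \<Longrightarrow> (a + s, b) \<in> K \<Longrightarrow>
      (a, b + t) \<notin> K \<Longrightarrow> (a + s, b + t) \<notin> K \<Longrightarrow> lab (a + s, b + t) (a + s, b) = lab (a, b + t) (a, b)"
    and l3: "\<And>a b s t. even a \<Longrightarrow> even b \<Longrightarrow> \<bar>s\<bar> = 1 \<Longrightarrow> \<bar>t\<bar> = 1 \<Longrightarrow> (a, b) \<in> K \<Longrightarrow> (a + s, b) \<notin> K \<Longrightarrow>
      (a, b + t) \<in> K \<Longrightarrow> (a + s, b + t) \<notin> K \<Longrightarrow> lab (a + s, b + t) (a, b + t) = lab (a + s, b) (a, b)"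
    and l4: "\<And>a b s t. even a \<Longrightarrow> even b \<Longrightarrow> \<bar>s\<bar> = 1 \<Longrightarrow> \<bar>t\<bar> = 1 \<Longrightarrow> (a, b) \<in> K \<Longrightarrow> (a + s, b) \<notin> K \<Longrightarrow>
      (a, b + t) \<notin> K \<Longrightarrow> (a + s, b + t) \<notin> K \<Longrightarrow> lab (a + s, b) (a, b) = lab (a, b + t) (a, b)"
    and x: "linked gadj (- K) x x'" "x \<notin> K" "y \<in> K" "y' \<in> K" "gadj x y" "gadj x' y'"
  shows "lab x y = lab x' y'"
proof -
  \<comment> \<open>The value \<open>True\<close> marks the crossings between \<open>K\<close> and
    its complement that carry the label of the first crossing. The hypotheses \<open>l1\<close> to
    \<open>l4\<close> are the square condition for the possible ways in which a closed set meets a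
    square whose vertex it contains.\<close>
  define \<phi> where "\<phi> p q = (if p \<in> K \<and> q \<notin> K then lab q p = lab x y
     else if p \<notin> K \<and> q \<in> K then lab p q = lab x y else False)" for p q
  have sym: "\<phi> p q = \<phi> q p" for p q by (auto simp: \<phi>_def)
  have dn: "q \<in> K" if "p \<in> K" "q \<in> gclosure p" for p q using K(1) that by (auto simp: gclosed_def)
  have base: "(\<phi> (a, b) (a + s, b) \<noteq> \<phi> (a + s, b) (a + s, b + t)) = (\<phi> (a, b) (a, b + t) \<noteq> \<phi> (a, b + t) (a + s, b + t))"
    if e: "even a" "even b" "\<bar>s\<bar> = 1" "\<bar>t\<bar> = 1" for a b s t
  proof -
    have odd: "odd (a + s)" "odd (b + t)" using e by presburger+
    have "(a, b) \<in> gclosure (a + s, b)" "(a, b) \<in> gclosure (a, b + t)"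
      "(a + s, b) \<in> gclosure (a + s, b + t)" "(a, b + t) \<in> gclosure (a + s, b + t)"
      using odd e(3,4) by (simp_all add: gclosure_def)
    note c1 = dn[OF _ this(1)] dn[OF _ this(2)] dn[OF _ this(3)] dn[OF _ this(4)]
    show ?thesis
    proof (cases "(a + s, b + t) \<in> K")
      case True
      then show ?thesis using c1 by (simp add: \<phi>_def)
    next
      case f: False
      show ?thesis
      proof (cases "(a, b) \<in> K")
        case False
        then have "(a + s, b) \<notin> K" "(a, b + t) \<notin> K" using c1 by blast+
        then show ?thesis using False f by (simp add: \<phi>_def)
      next
        case True
        consider "(a + s, b) \<in> K" "(a, b + t) \<in> K" | "(a + s, b) \<in> K" "(a, b + t) \<notin> K"
          | "(a + s, b) \<notin> K" "(a, b + t) \<in> K" | "(a + s, b) \<notin> K" "(a, b + t) \<notin> K" by blast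
        then show ?thesis
        proof cases
          case 1 then show ?thesis using l1[OF e True 1 f] True f by (simp add: \<phi>_def)
        next
          case 2 then show ?thesis using l2[OF e True 2 f] True f by (simp add: \<phi>_def)
        next
          case 3 then show ?thesis using l3[OF e True 3 f] True f by (simp add: \<phi>_def)
        next
          case 4 then show ?thesis using l4[OF e True 4 f] True f by (simp add: \<phi>_def)
        qed
      qed
    qed
  qed
  obtain g where g: "\<And>p q. gadj p q \<Longrightarrow> g q = (g p \<noteq> \<phi> p q)"
    using grid_potential_rel[of \<phi>, OF sym plaquette_shift[of \<phi>, OF sym base]] by blast
  \<comment> \<open>\<open>\<phi>\<close> vanishes on pairs inside \<open>K\<close> and on pairs
    inside the complement, so \<open>g\<close> is constant on \<open>K\<close> and on the component
    of \<open>x\<close>; hence it jumps equally at both crossings.\<close>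
  have cK: "g q = g p" if "linked gadj K p q" for p q
    using that
  proof (induction rule: linked_induct)
    case (step r s)
    then show ?case using g[of r s] by (auto simp: \<phi>_def)
  qed simp
  have cC: "g q = g p" if "linked gadj (- K) p q" for p q
    using that
  proof (induction rule: linked_induct)
    case (step r s)
    then show ?case using g[of r s] by (auto simp: \<phi>_def)
  qed simp
  have "x' \<notin> K" using linked_in[OF x(1)] x(2) by simp
  have "g x' = g x" using cC x(1) by blast
  moreover have "g y' = g y" using cK K(2) x by blast
  ultimately have "\<phi> x y = \<phi> x' y'" using g[OF x(5)] g[OF x(6)] by auto
  then show ?thesis using x \<open>x' \<notin> K\<close> by (auto simp: \<phi>_def)
qed


section \<open>Connectivity, hulls and distances in the grid\<close>

lemma linked_gclosure:
  assumes "q \<in> gclosure p"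
  shows "linked gadj (gclosure p) p q"
proof -
  have 1: "(fst q, snd p) \<in> gclosure p" using assms by (auto simp: gclosure_def)
  have 2: "fst q = fst p \<or> \<bar>fst q - fst p\<bar> = 1" "snd q = snd p \<or> \<bar>snd q - snd p\<bar> = 1"
    using assms by (auto simp: gclosure_def)
  have "linked gadj (gclosure p) p (fst q, snd p)"
  proof (cases "fst q = fst p")
    case False
    then show ?thesis using 1 2 by (intro linked_step) (auto simp: gadj_def)
  qed simp
  moreover have "linked gadj (gclosure p) (fst q, snd p) q"
  proof (cases "snd q = snd p")
    case True
    then have "(fst q, snd p) = q" by (simp add: prod_eq_iff)
    then show ?thesis by simp
  next
    case False
    then show ?thesis using 1 2 assms by (intro linked_step) (auto simp: gadj_def)
  qed
  ultimately show ?thesis by (rule linked_trans)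
qed

lemma linked_rectangle_row:
  assumes "i \<in> {a..b}" "i' \<in> {a..b}" "j \<in> {c..d}"
  shows "linked gadj ({a..b} \<times> {c..d}) (i, j) (i', j)"
proof -
  have *: "linked gadj ({a..b} \<times> {c..d}) (i, j) (k, j)" if "i \<le> k" "a \<le> i" "k \<le> b" for i k :: int
    using that
  proof (induction k rule: int_ge_induct)
    case (step k)
    have "linked gadj ({a..b} \<times> {c..d}) (k, j) (k + 1, j)"
      using step assms by (intro linked_step) (auto simp: gadj_def)
    then show ?case using step by (auto intro: linked_trans)
  qed simp
  show ?thesis
    using *[of i i'] linked_sym[OF symp_gadj *[of i' i]] assms by (cases "i \<le> i'") auto
qed

lemma linked_swap:
  assumes "linked gadj (A \<times> B) (i, j) (i', j')"
  shows "linked gadj (B \<times> A) (j, i) (j', i')"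
proof -
  have "linked gadj (B \<times> A) (j, i) (snd q, fst q)" if "linked gadj (A \<times> B) (i, j) q" for q
    using that
  proof (induction rule: linked_induct)
    case (step y z)
    then have "linked gadj (B \<times> A) (snd y, fst y) (snd z, fst z)"
      by (intro linked_step) (auto simp: gadj_def)
    then show ?case using step by (auto intro: linked_trans)
  qed simp
  from this[OF assms] show ?thesis by simp
qed

lemma linked_rectangle:
  assumes "p \<in> {a..b} \<times> {c..d}" "q \<in> {a..b} \<times> {c..d}"
  shows "linked gadj ({a..b} \<times> {c..d}) p q"
proof -
  obtain i j i' j' where pq: "p = (i, j)" "q = (i', j')" by (cases p, cases q)
  have "linked gadj ({a..b} \<times> {c..d}) (i, j) (i', j)"
    using assms pq by (intro linked_rectangle_row) auto
  moreover have "linked gadj ({a..b} \<times> {c..d}) (i', j) (i', j')"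
    by (rule linked_swap, rule linked_rectangle_row) (use assms pq in auto)
  ultimately show ?thesis unfolding pq by (rule linked_trans)
qed

lemma linked_UNIV: "linked gadj UNIV p q"
proof -
  let ?M = "\<bar>fst p\<bar> + \<bar>snd p\<bar> + \<bar>fst q\<bar> + \<bar>snd q\<bar>"
  have "linked gadj ({-?M..?M} \<times> {-?M..?M}) p q"
    by (rule linked_rectangle) (auto simp: mem_Times_iff)
  then show ?thesis by (rule linked_mono) simp
qed

definition gfar :: "int \<Rightarrow> gpt set" where
  "gfar N = {p. \<bar>fst p\<bar> > N \<or> \<bar>snd p\<bar> > N}"

lemma linked_gfar:
  assumes N: "N \<ge> 0" and "p \<in> gfar N" "q \<in> gfar N"
  shows "linked gadj (gfar N) p q"
proof -
  have to: "linked gadj (gfar N) (N + 1, N + 1) p" if p: "p \<in> gfar N" for p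
  proof -
    obtain i j where p_eq: "p = (i, j)" by (cases p)
    define M where "M = \<bar>i\<bar> + \<bar>j\<bar> + N + 1"
    have M: "i \<le> M" "j \<le> M" "- M \<le> i" "- M \<le> j" "N + 1 \<le> M" using N unfolding M_def by linarith+
    have r: "linked gadj (gfar N) x y"
      if "{a..b} \<times> {c..d} \<subseteq> gfar N" "x \<in> {a..b} \<times> {c..d}" "y \<in> {a..b} \<times> {c..d}" for x y a b c d
      using linked_mono[OF linked_rectangle] that by blast
    have right: "{N+1..M} \<times> {-M..M} \<subseteq> gfar N" by (auto simp: gfar_def)
    have left: "{-M..-N-1} \<times> {-M..M} \<subseteq> gfar N" by (auto simp: gfar_def)
    have up: "{-M..M} \<times> {N+1..M} \<subseteq> gfar N" by (auto simp: gfar_def)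
    have down: "{-M..M} \<times> {-M..-N-1} \<subseteq> gfar N" by (auto simp: gfar_def)
    consider "i > N" | "i < -N" | "j > N" | "j < -N"
      using p unfolding p_eq gfar_def by fastforce
    then show ?thesis
    proof cases
      case 1 then show ?thesis using M N p_eq by (intro r[OF right]) auto
    next
      case 3 then show ?thesis using M N p_eq by (intro r[OF up]) auto
    next
      case 2
      have "linked gadj (gfar N) (N + 1, N + 1) (-N-1, N+1)"
        using M N by (intro r[OF up]) auto
      moreover have "linked gadj (gfar N) (-N-1, N+1) p" using 2 M N p_eq by (intro r[OF left]) auto
      ultimately show ?thesis by (rule linked_trans)
    next
      case 4
      have "linked gadj (gfar N) (N + 1, N + 1) (N+1, -N-1)"
        using M N by (intro r[OF right]) auto
      moreover have "linked gadj (gfar N) (N+1, -N-1) p" using 4 M N p_eq by (intro r[OF down]) auto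
      ultimately show ?thesis by (rule linked_trans)
    qed
  qed
  show ?thesis by (rule linked_trans[OF linked_sym[OF symp_gadj to[OF assms(2)]] to[OF assms(3)]])
qed

lemma infinite_gfar: "infinite (gfar N)"
proof
  assume "finite (gfar N)"
  then have "finite ((\<lambda>k. (k, 0 :: int)) ` {N<..} )" (is "finite (?f ` _)")
    by (rule rev_finite_subset) (auto simp: gfar_def)
  then have "finite {N<..}" by (rule finite_imageD) (auto simp: inj_on_def)
  then show False using infinite_Ioi by blast
qed

lemma finite_int_pairs_bounded:
  assumes "finite (K :: gpt set)"
  obtains N where "N \<ge> 0" "gfar N \<inter> K = {}"
proof -
  define N where "N = Max (insert 0 ((\<lambda>p. max \<bar>fst p\<bar> \<bar>snd p\<bar>) ` K))"
  have "max \<bar>fst p\<bar> \<bar>snd p\<bar> \<le> N" if "p \<in> K" for p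
    unfolding N_def using assms that by (intro Max_ge) auto
  then have "gfar N \<inter> K = {}" by (fastforce simp: gfar_def)
  moreover have "N \<ge> 0" unfolding N_def using assms by (intro Max_ge) auto
  ultimately show thesis using that by blast
qed

definition ghull :: "gpt set \<Rightarrow> gpt set" where
  "ghull K = {x. x \<in> K \<or> finite {y. linked gadj (- K) x y}}"

lemma subset_ghull: "K \<subseteq> ghull K"
  by (auto simp: ghull_def)

text \<open>An infinite component leaves every finite square, and the grid outside a square is
  connected; so there is a single infinite component, the one that reaches
  \<open>gfar N\<close>.\<close>

lemma not_in_ghull_iff:
  assumes "N \<ge> 0" "gfar N \<inter> K = {}"
  shows "x \<notin> ghull K \<longleftrightarrow> x \<notin> K \<and> (\<exists>z\<in>gfar N. linked gadj (- K) x z)"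
proof
  assume x: "x \<notin> ghull K"
  then have "infinite {y. linked gadj (- K) x y}" "x \<notin> K" by (auto simp: ghull_def)
  moreover have "finite ({-N..N} \<times> {-N..N})" by simp
  ultimately obtain z where z: "linked gadj (- K) x z" "z \<notin> {-N..N} \<times> {-N..N}"
    by (metis (no_types, lifting) finite_subset mem_Collect_eq subsetI)
  then have "z \<in> gfar N" by (auto simp: gfar_def mem_Times_iff)
  then show "x \<notin> K \<and> (\<exists>z\<in>gfar N. linked gadj (- K) x z)" using z \<open>x \<notin> K\<close> by blast
next
  assume "x \<notin> K \<and> (\<exists>z\<in>gfar N. linked gadj (- K) x z)"
  then obtain z where z: "x \<notin> K" "z \<in> gfar N" "linked gadj (- K) x z" by blast
  have "linked gadj (- K) x y" if "y \<in> gfar N" for y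
    using linked_trans[OF z(3) linked_mono[OF linked_gfar[OF assms(1) z(2) that]]] assms(2) by blast
  then have "gfar N \<subseteq> {y. linked gadj (- K) x y}" by blast
  then show "x \<notin> ghull K" using z(1) infinite_gfar finite_subset by (auto simp: ghull_def)
qed

lemma gfar_not_in_ghull:
  assumes "N \<ge> 0" "gfar N \<inter> K = {}" "x \<in> gfar N"
  shows "x \<notin> ghull K"
  using not_in_ghull_iff[OF assms(1,2), of x] assms(2,3) by (auto intro: linked_refl)

lemma finite_ghull:
  assumes "finite K" shows "finite (ghull K)"
proof -
  obtain N where N: "N \<ge> 0" "gfar N \<inter> K = {}" using finite_int_pairs_bounded[OF assms] .
  have "ghull K \<subseteq> {-N..N} \<times> {-N..N}"
  proof
    fix p assume "p \<in> ghull K"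
    then have "p \<notin> gfar N" using gfar_not_in_ghull[OF N] by blast
    then show "p \<in> {-N..N} \<times> {-N..N}" by (auto simp: gfar_def mem_Times_iff)
  qed
  then show ?thesis by (rule finite_subset) auto
qed

lemma linked_outside_ghull:
  assumes "finite K" "x \<notin> ghull K" "y \<notin> ghull K"
  shows "linked gadj (- K) x y"
proof -
  obtain N where N: "N \<ge> 0" "gfar N \<inter> K = {}" using finite_int_pairs_bounded[OF assms(1)] .
  obtain z w where zw: "z \<in> gfar N" "linked gadj (- K) x z" "w \<in> gfar N" "linked gadj (- K) y w"
    using not_in_ghull_iff[OF N] assms by blast
  have 1: "linked gadj (- K) z w"
    using linked_mono[OF linked_gfar[OF N(1) zw(1,3)]] N(2) by blast
  show ?thesis by (rule linked_trans[OF zw(2) linked_trans[OF 1 linked_sym[OF symp_gadj zw(4)]]])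
qed

lemma ghull_linked:
  assumes "linked gadj (- K) x y" "x \<notin> K" shows "x \<in> ghull K \<longleftrightarrow> y \<in> ghull K"
proof -
  have "y \<notin> K" using linked_in[OF assms(1)] assms(2) by simp
  moreover have "{z. linked gadj (- K) x z} = {z. linked gadj (- K) y z}"
    using linked_trans[OF assms(1)] linked_trans[OF linked_sym[OF symp_gadj assms(1)]] by blast
  ultimately show ?thesis using assms(2) by (auto simp: ghull_def)
qed

text \<open>Follow a path in the full grid from a point of \<open>R\<close>. Whenever it leaves
  \<open>C\<close> it does so into \<open>R\<close>, and the path is started anew there.\<close>

lemma linked_complement_of_component:
  assumes "R \<noteq> {}" "y \<notin> C" and C: "\<And>p q. p \<in> C \<Longrightarrow> gadj p q \<Longrightarrow> q \<notin> C \<Longrightarrow> q \<in> R" and "R \<inter> C = {}"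
  shows "\<exists>r\<in>R. linked gadj (- C) y r"
proof -
  obtain r where r: "r \<in> R" using assms(1) by blast
  have "y \<notin> C \<longrightarrow> (\<exists>r\<in>R. linked gadj (- C) y r)"
    using linked_UNIV[of r y]
  proof (induction rule: linked_induct)
    case base then show ?case using r linked_refl[of gadj "- C" r] by blast
  next
    case (step p q)
    show ?case
    proof
      assume q: "q \<notin> C"
      show "\<exists>r\<in>R. linked gadj (- C) q r"
      proof (cases "p \<in> C")
        case True
        then have "q \<in> R" using C step q by blast
        then show ?thesis using linked_refl[of gadj "- C" q] by blast
      next
        case False
        then obtain r where r: "r \<in> R" "linked gadj (- C) p r" using step by blast
        have "linked gadj (- C) q p" using False q step symp_gadj
          by (intro linked_step) (auto dest: sympD)
        then show ?thesis using r linked_trans[of gadj "- C" q p r] by blast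
      qed
    qed
  qed
  then show ?thesis using assms(2) by blast
qed

lemma component_boundary:
  assumes "p \<in> {y. linked gadj (- R) x y}" "gadj p q" "q \<notin> {y. linked gadj (- R) x y}" "x \<notin> R"
  shows "q \<in> R"
proof (rule ccontr)
  assume "q \<notin> R"
  moreover have "p \<notin> R" using assms linked_in[of gadj "- R" x p] by auto
  ultimately have "linked gadj (- R) p q" using assms by (intro linked_step) auto
  then show False using assms linked_trans[of gadj "- R" x p q] by blast
qed

text \<open>\<open>S\<close> lies in one finite component \<open>C\<close> of the complement of
  \<open>R\<close>. Since \<open>R\<close> is connected, the complement of \<open>C\<close> is
  connected too, and it is infinite; hence \<open>S\<close> encloses nothing outside
  \<open>C\<close>.\<close>

lemma ghull_nested:
  assumes R: "finite R" "R \<noteq> {}" "\<And>x y. x \<in> R \<Longrightarrow> y \<in> R \<Longrightarrow> linked gadj R x y"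
    and S: "\<And>x y. x \<in> S \<Longrightarrow> y \<in> S \<Longrightarrow> linked gadj S x y"
    and disj: "R \<inter> S = {}" and x: "x \<in> S" "x \<in> ghull R"
  shows "ghull S \<subseteq> ghull R - R"
proof -
  define C where "C = {y. linked gadj (- R) x y}"
  have xR: "x \<notin> R" using x disj by auto
  have CR: "R \<inter> C = {}" using xR linked_in[of gadj "- R" x] by (auto simp: C_def)
  have finC: "finite C" using x xR by (auto simp: ghull_def C_def)
  have SC: "S \<subseteq> C" using S[OF x(1)] disj by (auto simp: C_def intro: linked_mono)
  have Csub: "C \<subseteq> ghull R - R" using CR ghull_linked[OF _ xR] x by (auto simp: C_def)
  have link: "linked gadj (- C) y z" if yz: "y \<notin> C" "z \<notin> C" for y z
  proof -
    have ex: "\<exists>r\<in>R. linked gadj (- C) w r" if w: "w \<notin> C" for w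
    proof (rule linked_complement_of_component[OF R(2) w _ CR])
      fix p q assume "p \<in> C" "gadj p q" "q \<notin> C"
      then show "q \<in> R" using component_boundary[of p R x q] xR unfolding C_def by blast
    qed
    obtain r where r: "r \<in> R" "linked gadj (- C) y r" using ex[OF yz(1)] by blast
    obtain r' where r': "r' \<in> R" "linked gadj (- C) z r'" using ex[OF yz(2)] by blast
    have rr: "linked gadj (- C) r r'" using linked_mono[OF R(3)[OF r(1) r'(1)]] CR by blast
    show ?thesis by (rule linked_trans[OF r(2) linked_trans[OF rr linked_sym[OF symp_gadj r'(2)]]])
  qed
  have "y \<notin> ghull S" if "y \<notin> C" for y
  proof -
    have "- C \<subseteq> {z. linked gadj (- S) y z}"
      using link[OF that] SC by (auto intro: linked_mono)
    moreover have "infinite (- C)" 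
    proof
      assume "finite (- C)"
      then have "finite (UNIV :: gpt set)" using finC by (metis finite_UnI Compl_partition)
      then show False using finite_subset[OF subset_UNIV, of "gfar 0"] infinite_gfar by blast
    qed
    ultimately show ?thesis using SC that finite_subset by (auto simp: ghull_def)
  qed
  then show ?thesis using Csub by blast
qed

definition gdist :: "gpt \<Rightarrow> gpt \<Rightarrow> int" where
  "gdist p q = max \<bar>fst p - fst q\<bar> \<bar>snd p - snd q\<bar>"

text \<open>If the square around \<open>x\<close> of radius \<open>gdist x z\<close> missed
  \<open>R\<close>, it would join \<open>x\<close> to \<open>z\<close> off \<open>R\<close>. This
  turns separation by a wall into a distance.\<close>

lemma gdist_boundary:
  assumes "x \<notin> R" "\<not> linked gadj (- R) x z"
  shows "\<exists>r\<in>R. gdist x r \<le> gdist x z"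
proof (rule ccontr)
  assume neg: "\<not> ?thesis"
  define d where "d = gdist x z"
  let ?B = "{fst x - d..fst x + d} \<times> {snd x - d..snd x + d}"
  have "gdist x p \<le> d" if "p \<in> ?B" for p
    using that unfolding gdist_def mem_Times_iff atLeastAtMost_iff by linarith
  then have "?B \<inter> R = {}" using neg by (auto simp: d_def)
  moreover have "linked gadj ?B x z"
    by (rule linked_rectangle) (unfold d_def gdist_def mem_Times_iff atLeastAtMost_iff, linarith+)
  ultimately have "linked gadj (- R) x z" by (auto intro: linked_mono)
  then show False using assms by simp
qed

text \<open>The topmost row of \<open>R\<close> is even because \<open>R\<close> is closed. The face
  to the upper right of a vertex in this row can escape upwards.\<close>

lemma exists_outer_corner:
  assumes "finite R" "R \<noteq> {}" "gclosed R"
  obtains a b where "even a" "even b" "(a, b) \<in> R" "(a + 1, b + 1) \<notin> ghull R"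
proof -
  define b where "b = Max (snd ` R)"
  have b: "snd p \<le> b" if "p \<in> R" for p using assms that by (auto simp: b_def)
  have "b \<in> snd ` R" unfolding b_def using assms by (intro Max_in) auto
  then obtain x where x: "(x, b) \<in> R" by auto
  have eb: "even b"
  proof (rule ccontr)
    assume "odd b"
    then have "(x, b + 1) \<in> gclosure (x, b)" by (auto simp: gclosure_def)
    then have "(x, b + 1) \<in> R" using x assms(3) by (auto simp: gclosed_def)
    then show False using b[of "(x, b + 1)"] by simp
  qed
  define a where "a = (if even x then x else x - 1)"
  have "(a, b) \<in> gclosure (x, b)" by (auto simp: gclosure_def a_def)
  then have ab: "(a, b) \<in> R" using x assms(3) by (auto simp: gclosed_def)
  have ea: "even a" by (auto simp: a_def)
  have nR: "(a + 1, j) \<notin> R" if "j \<ge> b + 1" for j using b[of "(a + 1, j)"] that by auto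
  have "linked gadj (- R) (a + 1, b + 1) (a + 1, j)" if "j \<ge> b + 1" for j
  proof -
    have "linked gadj ({a+1..a+1} \<times> {b+1..j}) (a + 1, b + 1) (a + 1, j)"
      using that by (intro linked_rectangle) auto
    then show ?thesis by (rule linked_mono) (use nR in auto)
  qed
  then have "(\<lambda>j. (a + 1, j)) ` {b + 1..} \<subseteq> {y. linked gadj (- R) (a + 1, b + 1) y}" by auto
  moreover have "infinite ((\<lambda>j. (a + 1, j)) ` {b + 1..})"
    using finite_imageD[of "\<lambda>j. (a + 1, j)" "{b + 1..}"] infinite_Ici[of "b + 1"] by (auto simp: inj_on_def)
  ultimately have "(a + 1, b + 1) \<notin> ghull R" using nR[of "b + 1"] finite_subset by (auto simp: ghull_def)
  then show thesis using that ea eb ab by blast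
qed

section \<open>Interfaces\<close>

text \<open>A face of the cubic lattice is encoded by its projection (in doubled coordinates) and its height;
  the height of a vertical face is that of its lower side.\<close>
type_synonym cface = "gpt \<times> int"

section \<open>Incidence of vertices, edges and faces in doubled coordinates\<close>

definition isv :: "gpt \<Rightarrow> bool" where "isv p \<longleftrightarrow> even (fst p) \<and> even (snd p)"
definition isF :: "gpt \<Rightarrow> bool" where "isF p \<longleftrightarrow> odd (fst p) \<and> odd (snd p)"
definition ise :: "gpt \<Rightarrow> bool" where "ise p \<longleftrightarrow> (even (fst p) \<longleftrightarrow> odd (snd p))"

text \<open>The faces beside an edge; \<open>tip\<close> gives its end points. An edge has exactly
  one odd coordinate: it runs along that coordinate, and its sides lie in the direction of the even
  one.\<close>

definition side :: "int \<Rightarrow> gpt \<Rightarrow> gpt" where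
  "side s e = (if even (fst e) then (fst e + s, snd e) else (fst e, snd e + s))"
definition tip :: "int \<Rightarrow> gpt \<Rightarrow> gpt" where
  "tip s e = (if odd (fst e) then (fst e + s, snd e) else (fst e, snd e + s))"

lemma kind_cases: "isv p \<or> ise p \<or> isF p"
  by (auto simp: isv_def ise_def isF_def)

lemma kind_disj: "isF p \<Longrightarrow> \<not> isv p" "isF p \<Longrightarrow> \<not> ise p" "ise p \<Longrightarrow> \<not> isv p" "ise p \<Longrightarrow> \<not> isF p"
  "isv p \<Longrightarrow> \<not> isF p" "isv p \<Longrightarrow> \<not> ise p"
  by (auto simp: isv_def ise_def isF_def)

lemma isF_side: "ise e \<Longrightarrow> \<bar>s\<bar> = 1 \<Longrightarrow> isF (side s e)"
  by (auto simp: ise_def isF_def side_def abs_if split: if_splits)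

lemma isv_tip: "ise e \<Longrightarrow> \<bar>s\<bar> = 1 \<Longrightarrow> isv (tip s e)"
  by (auto simp: ise_def isv_def tip_def abs_if split: if_splits)

lemma tip_in_gclosure: "ise e \<Longrightarrow> \<bar>s\<bar> = 1 \<Longrightarrow> tip s e \<in> gclosure e"
  by (auto simp: ise_def gclosure_def tip_def)

lemma edge_in_gclosure_side: "ise e \<Longrightarrow> \<bar>s\<bar> = 1 \<Longrightarrow> e \<in> gclosure (side s e)"
  by (auto simp: ise_def gclosure_def side_def)

lemma gadj_side: "\<bar>s\<bar> = 1 \<Longrightarrow> gadj (side s e) e"
  by (auto simp: gadj_def side_def)

lemma isv_gclosure_edge:
  assumes "ise e" "isv v" "v \<in> gclosure e" obtains s where "\<bar>s\<bar> = 1" "v = tip s e"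
proof -
  let ?s = "if odd (fst e) then fst v - fst e else snd v - snd e"
  have "v = tip ?s e \<and> \<bar>?s\<bar> = 1"
    using assms by (auto simp: ise_def isv_def gclosure_def tip_def prod_eq_iff)
  then show thesis using that by blast
qed

lemma ise_gclosure_face:
  assumes "ise e" "isF u" "e \<in> gclosure u" obtains s where "\<bar>s\<bar> = 1" "u = side s e"
proof -
  have *: "\<not> (odd x \<and> odd z \<and> \<bar>x - z\<bar> = 1)" for x z :: int
  proof
    assume a: "odd x \<and> odd z \<and> \<bar>x - z\<bar> = 1"
    then have "x = z + 1 \<or> x = z - 1" by auto
    then show False using a by auto
  qed
  let ?s = "if even (fst e) then fst u - fst e else snd u - snd e"
  have "u = side ?s e \<and> \<bar>?s\<bar> = 1"
    using assms *[of "fst e" "fst u"] *[of "snd e" "snd u"]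
    by (auto simp: ise_def isF_def gclosure_def side_def prod_eq_iff abs_minus_commute)
  then show thesis using that by blast
qed

lemma isF_gclosureD: "isF p \<Longrightarrow> p \<in> gclosure q \<Longrightarrow> p = q"
proof -
  have *: "x = z" if "odd x" "x = z \<or> odd z \<and> \<bar>x - z\<bar> = 1" for x z :: int
  proof (rule ccontr)
    assume "x \<noteq> z"
    then have "x = z + 1 \<or> x = z - 1" "odd z" using that by auto
    then show False using that by auto
  qed
  assume "isF p" "p \<in> gclosure q"
  then show ?thesis using *[of "fst p" "fst q"] *[of "snd p" "snd q"]
    unfolding isF_def gclosure_def by (simp add: prod_eq_iff)
qed

lemma ise_gclosureD: assumes "ise e" "e \<in> gclosure q" shows "q = e \<or> isF q"
proof -
  have *: "x = z \<or> even x \<and> odd z" if "x = z \<or> odd z \<and> \<bar>x - z\<bar> = 1" for x z :: int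
  proof (cases "x = z")
    case False
    then have "x = z + 1 \<or> x = z - 1" "odd z" using that by auto
    then show ?thesis by auto
  qed simp
  show ?thesis using assms *[of "fst e" "fst q"] *[of "snd e" "snd q"]
    unfolding ise_def isF_def gclosure_def by (auto simp: prod_eq_iff)
qed

lemma isv_gclosure_face:
  assumes "isF u" "isv v" "v \<in> gclosure u"
  obtains s t where "\<bar>s\<bar> = 1" "\<bar>t\<bar> = 1" "u = (fst v + s, snd v + t)"
proof -
  have "\<bar>fst u - fst v\<bar> = 1" "\<bar>snd u - snd v\<bar> = 1" using assms
    by (auto simp: isF_def isv_def gclosure_def abs_minus_commute)
  then show thesis using that[of "fst u - fst v" "snd u - snd v"] by simp
qed

lemma isv_star:
  assumes "isv v" "\<bar>s\<bar> = 1" "\<bar>t\<bar> = 1"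
  shows "ise (fst v + s, snd v)" "ise (fst v, snd v + t)" "isF (fst v + s, snd v + t)"
    "v \<in> gclosure (fst v + s, snd v)" "v \<in> gclosure (fst v, snd v + t)" "v \<in> gclosure (fst v + s, snd v + t)"
    "(fst v + s, snd v) \<in> gclosure (fst v + s, snd v + t)" "(fst v, snd v + t) \<in> gclosure (fst v + s, snd v + t)"
    "side t (fst v + s, snd v) = (fst v + s, snd v + t)" "side s (fst v, snd v + t) = (fst v + s, snd v + t)"
proof -
  have o: "odd s" "odd t" using assms(2,3) by presburger+
  show "ise (fst v + s, snd v)" "ise (fst v, snd v + t)" "isF (fst v + s, snd v + t)"
    using assms(1) o by (auto simp: isv_def ise_def isF_def)
  show "v \<in> gclosure (fst v + s, snd v)" "v \<in> gclosure (fst v, snd v + t)" "v \<in> gclosure (fst v + s, snd v + t)"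
    "(fst v + s, snd v) \<in> gclosure (fst v + s, snd v + t)" "(fst v, snd v + t) \<in> gclosure (fst v + s, snd v + t)"
    using assms o by (auto simp: isv_def gclosure_def)
  show "side t (fst v + s, snd v) = (fst v + s, snd v + t)" "side s (fst v, snd v + t) = (fst v + s, snd v + t)"
    using assms(1) o by (auto simp: isv_def side_def)
qed

lemma isv_gclosureD:
  assumes "isv v" "v \<in> gclosure q" "q \<noteq> v"
  obtains e where "ise e" "e \<in> gclosure q" "v \<in> gclosure e"
proof (cases "isF q")
  case True
  from isv_gclosure_face[OF True assms(1,2)] obtain s t where st: "\<bar>s\<bar> = 1" "\<bar>t\<bar> = 1" "q = (fst v + s, snd v + t)" .
  show thesis using that[of "(fst v + s, snd v)"] isv_star[OF assms(1) st(1,2)] st(3) by simp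
next
  case False
  have "\<not> isv q"
  proof
    assume "isv q"
    then have "gclosure q = {q}" by (auto simp: gclosure_def isv_def prod_eq_iff)
    then show False using assms by auto
  qed
  then have "ise q" using False kind_cases by blast
  then show thesis using that[of q] assms by simp
qed

text \<open>The vertices lie over the closure of the projection. A horizontal face has them all at
  its own height, a vertical face also one level up.\<close>

definition cverts :: "cface \<Rightarrow> (gpt \<times> int) set" where
  "cverts f = {(v, h). isv v \<and> v \<in> gclosure (fst f) \<and> (h = snd f \<or> \<not> isF (fst f) \<and> h = snd f + 1)}"

definition cadj :: "cface \<Rightarrow> cface \<Rightarrow> bool" where
  "cadj f g \<longleftrightarrow> f \<noteq> g \<and> cverts f \<inter> cverts g \<noteq> {}"

lemma symp_cadj: "symp cadj"
  by (auto simp: symp_def cadj_def)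

lemma linked_common_vertex:
  "f \<in> S \<Longrightarrow> g \<in> S \<Longrightarrow> p \<in> cverts f \<Longrightarrow> p \<in> cverts g \<Longrightarrow> linked cadj S f g"
  by (cases "f = g") (auto intro!: linked_step simp: cadj_def)

lemma cverts_face: "isF u \<Longrightarrow> (v, h) \<in> cverts (u, t) \<longleftrightarrow> isv v \<and> v \<in> gclosure u \<and> h = t"
  by (auto simp: cverts_def)

lemma cverts_edge: "ise e \<Longrightarrow> (v, h) \<in> cverts (e, t) \<longleftrightarrow> isv v \<and> v \<in> gclosure e \<and> (h = t \<or> h = t + 1)"
  using kind_disj(4)[of e] by (auto simp: cverts_def)

text \<open>Even sets are the cycles modulo 2 of the cubic lattice: an even number of faces meets at
  every vertical lattice edge (over a vertex of the plane) and at every horizontal one (two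
  horizontal faces beside it, one vertical face above and one below).\<close>

definition ceven :: "cface set \<Rightarrow> bool" where
  "ceven S \<longleftrightarrow> (\<forall>p\<in>S. \<not> isv (fst p)) \<and>
     (\<forall>v t. isv v \<longrightarrow>
        ((((fst v + 1, snd v), t) \<in> S) \<noteq> (((fst v - 1, snd v), t) \<in> S)) =
        ((((fst v, snd v + 1), t) \<in> S) \<noteq> (((fst v, snd v - 1), t) \<in> S))) \<and>
     (\<forall>e t. ise e \<longrightarrow> (((side 1 e, t) \<in> S) \<noteq> ((side (-1) e, t) \<in> S)) = (((e, t) \<in> S) \<noteq> ((e, t - 1) \<in> S)))"

lemma ceven_edge:
  assumes "ceven S" "ise e" "\<bar>s\<bar> = 1"
  shows "(((side s e, t) \<in> S) \<noteq> ((side (-s) e, t) \<in> S)) = (((e, t) \<in> S) \<noteq> ((e, t - 1) \<in> S))"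
proof -
  have *: "(((side 1 e, t) \<in> S) \<noteq> ((side (-1) e, t) \<in> S)) = (((e, t) \<in> S) \<noteq> ((e, t - 1) \<in> S))"
    using assms(1,2) unfolding ceven_def by blast
  have "s = 1 \<or> s = -1" using assms(3) by linarith
  then show ?thesis using * by auto
qed

text \<open>The spin configuration whose separating faces are those of an even set.\<close>
definition cpot :: "cface set \<Rightarrow> gpt \<Rightarrow> int \<Rightarrow> bool" where
  "cpot S u h \<longleftrightarrow> odd (card {t. h < t \<and> (u, t) \<in> S})"

lemma cpot_step:
  assumes "\<And>t. (u, t) \<in> S \<Longrightarrow> t \<le> N"
  shows "cpot S u (t - 1) = (cpot S u t \<noteq> ((u, t) \<in> S))"
proof -
  have fin: "finite {t'. t < t' \<and> (u, t') \<in> S}"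
    by (rule finite_subset[of _ "{t..N}"]) (use assms in auto)
  have "t - 1 < t' \<longleftrightarrow> t' = t \<or> t < t'" for t' by auto
  then have eq: "{t'. t - 1 < t' \<and> (u, t') \<in> S} = (if (u, t) \<in> S then insert t {t'. t < t' \<and> (u, t') \<in> S} else {t'. t < t' \<and> (u, t') \<in> S})"
    by auto
  show ?thesis unfolding cpot_def eq using fin by auto
qed

lemma cpot_top:
  assumes "\<And>t. (u, t) \<in> S \<Longrightarrow> t \<le> N" "N \<le> h"
  shows "\<not> cpot S u h"
proof -
  have "{t. h < t \<and> (u, t) \<in> S} = {}" using assms by fastforce
  then show ?thesis unfolding cpot_def by (simp only: card.empty) simp
qed

text \<open>Above all faces both sides are false. Going down one level, the two sides change by the
  horizontal faces crossed, and evenness at the lattice edge says that this matches the change of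
  the vertical faces.\<close>

lemma cpot_edge:
  assumes S: "ceven S" "\<And>p t. (p, t) \<in> S \<Longrightarrow> t \<le> N" and e: "ise e" "\<bar>s\<bar> = 1"
  shows "(cpot S (side s e) h \<noteq> cpot S (side (-s) e) h) \<longleftrightarrow> (e, h) \<in> S"
proof -
  have top: "(cpot S (side s e) h \<noteq> cpot S (side (-s) e) h) \<longleftrightarrow> (e, h) \<in> S" if "h > N" for h
    using cpot_top[of _ S N h] S(2)[of e h] S(2) that by fastforce
  have cs: "cpot S u (t - 1) = (cpot S u t \<noteq> ((u, t) \<in> S))" for u t
    by (rule cpot_step) (rule S(2))
  have "(cpot S (side s e) (N + 1 - int k) \<noteq> cpot S (side (-s) e) (N + 1 - int k)) \<longleftrightarrow> (e, N + 1 - int k) \<in> S" for k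
  proof (induction k)
    case 0 show ?case using top[of "N + 1"] by simp
  next
    case (Suc k)
    define t where "t = N + 1 - int k"
    have t: "N + 1 - int (Suc k) = t - 1" by (simp add: t_def)
    show ?case unfolding t using Suc[folded t_def] ceven_edge[OF S(1) e, of t]
      cs[of "side s e" t] cs[of "side (-s) e" t] by blast
  qed
  from this[of "nat (N + 1 - h)"] show ?thesis using top[of h] by (cases "h > N") auto
qed

lemma face_grid_induct:
  assumes "isF u" "isF w" and step: "\<And>e s. ise e \<Longrightarrow> \<bar>s\<bar> = 1 \<Longrightarrow> P (side s e) \<Longrightarrow> P (side (-s) e)" and "P u"
  shows "P w"
proof -
  have r: "P (a + 2 * i, b)" if "odd a" "odd b" "P (a, b)" for a b i :: int
  proof (induction i rule: int_induct[where k = 0])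
    case base then show ?case using that by simp
  next
    case (step1 i)
    then show ?case using step[of "(a + 2 * i + 1, b)" "-1"] that by (simp add: ise_def side_def algebra_simps)
  next
    case (step2 i)
    then show ?case using step[of "(a + 2 * i - 1, b)" 1] that by (simp add: ise_def side_def algebra_simps)
  qed
  have c: "P (a, b + 2 * i)" if "odd a" "odd b" "P (a, b)" for a b i :: int
  proof (induction i rule: int_induct[where k = 0])
    case base then show ?case using that by simp
  next
    case (step1 i)
    then show ?case using step[of "(a, b + 2 * i + 1)" "-1"] that by (simp add: ise_def side_def algebra_simps)
  next
    case (step2 i)
    then show ?case using step[of "(a, b + 2 * i - 1)" 1] that by (simp add: ise_def side_def algebra_simps)
  qed
  have "even (fst w - fst u)" "even (snd w - snd u)" using assms(1,2) by (auto simp: isF_def)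
  then obtain i j where ij: "fst w - fst u = 2 * i" "snd w - snd u = 2 * j" by (meson evenE)
  have "P (fst u + 2 * i, snd u)" using r[of "fst u" "snd u" i] assms by (auto simp: isF_def)
  then have "P (fst u + 2 * i, snd u + 2 * j)" using c[of "fst u + 2 * i" "snd u" j] assms by (auto simp: isF_def)
  moreover have "(fst u + 2 * i, snd u + 2 * j) = w" using ij by (auto simp: prod_eq_iff)
  ultimately show ?thesis by simp
qed

text \<open>Below all faces the potential does not change from column to column, since no vertical
  face is crossed there, and its value is the parity of the whole column.\<close>

lemma column_parity:
  assumes S: "ceven S" "\<And>p t. (p, t) \<in> S \<Longrightarrow> \<bar>t\<bar> \<le> N" and "isF u" "isF w"
  shows "odd (card {t. (u, t) \<in> S}) \<longleftrightarrow> odd (card {t. (w, t) \<in> S})"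
proof -
  have low: "cpot S p (- N - 1) \<longleftrightarrow> odd (card {t. (p, t) \<in> S})" for p
  proof -
    have "{t. - N - 1 < t \<and> (p, t) \<in> S} = {t. (p, t) \<in> S}" using S(2) by fastforce
    then show ?thesis by (simp add: cpot_def)
  qed
  have le: "\<And>p t. (p, t) \<in> S \<Longrightarrow> t \<le> N" using S(2) by fastforce
  have low_none: "(e, - N - 1) \<notin> S" for e using S(2)[of e "- N - 1"] by auto
  have st: "cpot S (side s e) (- N - 1) = cpot S (side (-s) e) (- N - 1)" if "ise e" "\<bar>s\<bar> = 1" for e s
  proof -
    have "(cpot S (side s e) (- N - 1) \<noteq> cpot S (side (-s) e) (- N - 1)) \<longleftrightarrow> (e, - N - 1) \<in> S"
      by (rule cpot_edge[OF S(1) _ that]) (rule le)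
    then show ?thesis using low_none by blast
  qed
  have "cpot S w (- N - 1) = cpot S u (- N - 1)"
  proof (rule face_grid_induct[OF assms(3,4), where P = "\<lambda>w. cpot S w (- N - 1) = cpot S u (- N - 1)"])
    fix e s assume "ise e" "\<bar>s :: int\<bar> = 1" "cpot S (side s e) (- N - 1) = cpot S u (- N - 1)"
    then show "cpot S (side (- s) e) (- N - 1) = cpot S u (- N - 1)" using st[of e s] by blast
  qed simp
  then show ?thesis by (simp add: low)
qed


definition outL :: "nat \<Rightarrow> cface set" where
  "outL n = {f. isF (fst f) \<and> fst f \<in> gfar (2 * int n) \<and> snd f = 0}"

text \<open>Interfaces described without spins. Evenness replaces the condition of separating two
  spins; the other clauses make \<open>I\<close> a finite perturbation of the flat plane inside the
  box, every face of which is connected to the plane outside.\<close>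

locale iface =
  fixes n :: nat and I :: "cface set"
  assumes even_I: "ceven I"
    and out: "outL n \<subseteq> I"
    and fin: "finite (I - outL n)"
    and box: "\<And>f. f \<in> I \<Longrightarrow> f \<in> outL n \<or> fst f \<notin> gfar (2 * int n)"
    and conn: "\<And>f. f \<in> I \<Longrightarrow> \<exists>g\<in>outL n. linked cadj I g f"
begin

definition wf :: "cface set" where
  "wf = {f \<in> I. \<not> (isF (fst f) \<and> (\<forall>g\<in>I. fst g = fst f \<longrightarrow> g = f))}"

definition wproj :: "gpt set" where "wproj = (\<Union>f\<in>wf. gclosure (fst f))"

lemma wf_subset: "wf \<subseteq> I"
  by (auto simp: wf_def)

lemma not_isv: "f \<in> I \<Longrightarrow> \<not> isv (fst f)"
  using even_I by (auto simp: ceven_def)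

lemma heights_bounded: "\<exists>N\<ge>0. \<forall>p t. (p, t) \<in> I \<longrightarrow> \<bar>t\<bar> \<le> N"
proof -
  define N where "N = Max (insert 0 ((\<lambda>f. \<bar>snd f\<bar>) ` (I - outL n)))"
  have ge: "x \<le> N" if "x \<in> insert 0 ((\<lambda>f. \<bar>snd f\<bar>) ` (I - outL n))" for x
    unfolding N_def using fin that by (intro Max_ge) auto
  have "\<bar>t\<bar> \<le> N" if "(p, t) \<in> I" for p t
  proof (cases "(p, t) \<in> outL n")
    case True
    then show ?thesis using ge[of 0] by (auto simp: outL_def)
  next
    case False
    then show ?thesis using ge that by (force intro!: ge)
  qed
  then show ?thesis using ge[of 0] by blast
qed

lemma far_column: "isF u \<Longrightarrow> u \<in> gfar (2 * int n) \<Longrightarrow> (u, t) \<in> I \<longleftrightarrow> t = 0"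
  using box[of "(u, t)"] subsetD[OF out, of "(u, 0)"] by (auto simp: outL_def)

lemma far_face: "isF (2 * int n + 1, 1)" "(2 * int n + 1, 1) \<in> gfar (2 * int n)"
  by (auto simp: isF_def gfar_def)

lemma column_odd: assumes "isF u" shows "odd (card {t. (u, t) \<in> I})"
proof -
  obtain N where N: "N \<ge> 0" "\<And>p t. (p, t) \<in> I \<Longrightarrow> \<bar>t\<bar> \<le> N" using heights_bounded by blast
  have "{t. ((2 * int n + 1, 1), t) \<in> I} = {0}" using far_column[OF far_face] by auto
  then show ?thesis using column_parity[OF even_I N(2) assms far_face(1)] by simp
qed

lemma column_nonempty: assumes "isF u" obtains t where "(u, t) \<in> I"
proof -
  have "{t. (u, t) \<in> I} \<noteq> {}" using column_odd[OF assms] by force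
  then show thesis using that by auto
qed

lemma wf_box: assumes "f \<in> wf" shows "f \<notin> outL n" "fst f \<notin> gfar (2 * int n)"
proof -
  have fI: "f \<in> I" using assms wf_subset by blast
  show 1: "f \<notin> outL n"
  proof
    assume f: "f \<in> outL n"
    then have "isF (fst f)" "fst f \<in> gfar (2 * int n)" by (auto simp: outL_def)
    note far = far_column[OF this]
    have "g = f" if "g \<in> I" "fst g = fst f" for g
    proof -
      have "snd g = 0" using far[of "snd g"] that by (metis prod.collapse)
      then show ?thesis using that(2) f by (simp add: outL_def prod_eq_iff)
    qed
    then have "\<forall>g\<in>I. fst g = fst f \<longrightarrow> g = f" by blast
    then show False using assms \<open>isF (fst f)\<close> by (auto simp: wf_def)
  qed
  show "fst f \<notin> gfar (2 * int n)" using box[OF fI] 1 by blast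
qed

lemma finite_wf: "finite wf"
proof (rule finite_subset[OF _ fin])
  show "wf \<subseteq> I - outL n" using wf_subset wf_box(1) by blast
qed

lemma gclosed_wproj: "gclosed wproj"
  unfolding wproj_def gclosed_def using gclosure_trans by blast

lemma wproj_box: "wproj \<inter> gfar (2 * int n) = {}"
proof -
  have "q \<notin> gfar (2 * int n)" if "q \<in> gclosure p" "p \<notin> gfar (2 * int n)" for p q
  proof -
    \<comment> \<open>An odd coordinate of modulus at most \<open>2 * int n\<close> is strictly
      smaller, so the closure of a cell of the box does not leave the box.\<close>
    have *: "\<bar>x\<bar> \<le> 2 * int n" if a: "x = y \<or> odd y \<and> \<bar>x - y\<bar> = 1" and b: "\<bar>y\<bar> \<le> 2 * int n" for x y :: int
    proof (cases "odd y")
      case True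
      then have "\<bar>y\<bar> \<noteq> 2 * int n" by (metis abs_if dvd_minus_iff dvd_triv_left)
      then show ?thesis using a b by linarith
    qed (use a b in auto)
    show ?thesis using that *[of "fst q" "fst p"] *[of "snd q" "snd p"]
      unfolding gclosure_def gfar_def by auto
  qed
  then show ?thesis using wf_box by (auto simp: wproj_def)
qed

end

text \<open>A connected component of the projection of all wall faces.\<close>
locale iface_comp = iface +
  fixes K :: "gpt set"
  assumes K_ne: "K \<noteq> {}"
    and K_sub: "K \<subseteq> wproj"
    and K_closed: "gclosed K"
    and K_conn: "\<And>x y. x \<in> K \<Longrightarrow> y \<in> K \<Longrightarrow> linked gadj K x y"
    and K_max: "\<And>f q. f \<in> wf \<Longrightarrow> q \<in> gclosure (fst f) \<Longrightarrow> q \<in> K \<Longrightarrow> fst f \<in> K"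
begin

section \<open>Ceilings next to a component of the wall projection\<close>

definition touch :: "gpt \<Rightarrow> bool" where "touch u \<longleftrightarrow> u \<notin> K \<and> gclosure u \<inter> K \<noteq> {}"

lemma K_down: "p \<in> K \<Longrightarrow> q \<in> gclosure p \<Longrightarrow> q \<in> K"
  using K_closed by (auto simp: gclosed_def)

lemma touchI: "u \<notin> K \<Longrightarrow> q \<in> gclosure u \<Longrightarrow> q \<in> K \<Longrightarrow> touch u"
  by (auto simp: touch_def)

lemma touch_coface: "touch e \<Longrightarrow> e \<in> gclosure u \<Longrightarrow> touch u"
  using K_down gclosure_trans unfolding touch_def by blast

lemma finite_K: "finite K"
proof -
  have "finite wproj" unfolding wproj_def using finite_wf finite_gclosure by blast
  then show ?thesis using K_sub finite_subset by blast
qed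

lemma K_far: "gfar (2 * int n) \<inter> K = {}"
  using wproj_box K_sub by blast

lemma K_wf: assumes "f \<in> I" "fst f \<in> K" shows "f \<in> wf"
proof -
  obtain g where g: "g \<in> wf" "fst f \<in> gclosure (fst g)" using assms K_sub by (auto simp: wproj_def)
  show ?thesis
  proof (cases "isF (fst f)")
    case True
    then have "fst f = fst g" using isF_gclosureD g by blast
    then show ?thesis using g assms(1) by (auto simp: wf_def)
  next
    case False
    then show ?thesis using assms by (auto simp: wf_def)
  qed
qed

lemma touch_not_wf: "touch u \<Longrightarrow> (u, t) \<notin> wf"
  using K_max[of "(u, t)"] by (auto simp: touch_def)

text \<open>The height of the ceiling next to \<open>K\<close>. It is meaningful only where
  \<open>touch\<close> holds: there a face column carries a single face, and both sides of an edge
  have the same height, so the choice of \<open>side 1\<close> is immaterial.\<close>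

definition H :: "gpt \<Rightarrow> int" where
  "H x = (if isF x then THE t. (x, t) \<in> I else THE t. (side 1 x, t) \<in> I)"

lemma touch_face: assumes "isF u" "touch u" shows "(u, t) \<in> I \<longleftrightarrow> t = H u"
proof -
  obtain t0 where t0: "(u, t0) \<in> I" using column_nonempty[OF assms(1)] .
  have "(u, t0) \<notin> wf" using touch_not_wf[OF assms(2)] .
  then have *: "\<forall>g\<in>I. fst g = u \<longrightarrow> g = (u, t0)" using t0 assms(1) by (auto simp: wf_def)
  then have eq: "(u, t) \<in> I \<longleftrightarrow> t = t0" for t using t0 by auto
  then have "H u = t0" using assms(1) by (simp add: H_def)
  then show ?thesis using eq by simp
qed

lemma touch_edge:
  assumes "ise e" "touch e"
  shows "(e, t) \<notin> I" "\<bar>s\<bar> = 1 \<Longrightarrow> touch (side s e)" "\<bar>s\<bar> = 1 \<Longrightarrow> H (side s e) = H e"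
proof -
  show no: "(e, t) \<notin> I" for t
    using touch_not_wf[OF assms(2), of t] kind_disj(4)[OF assms(1)] by (auto simp: wf_def)
  show t: "touch (side s e)" if "\<bar>s\<bar> = 1" for s
    using touch_coface[OF assms(2) edge_in_gclosure_side[OF assms(1) that]] .
  have fF: "isF (side s e)" if "\<bar>s\<bar> = 1" for s using isF_side[OF assms(1) that] .
  have "H (side 1 e) = H (side (-1) e)"
    using ceven_edge[OF even_I assms(1), of 1 "H (side 1 e)"] no
      touch_face[OF fF t, of 1 "H (side 1 e)"] touch_face[OF fF t, of "-1" "H (side 1 e)"] by simp
  moreover have "H e = H (side 1 e)" using fF[of 1] kind_disj(4)[OF assms(1)] by (simp add: H_def)
  ultimately have "H (side 1 e) = H e" "H (side (-1) e) = H e" by auto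
  then show "H (side s e) = H e" if "\<bar>s\<bar> = 1"
    using that by (metis abs_eq_iff' abs_1 abs_if minus_equation_iff)
qed

text \<open>By evenness at the lattice edge over \<open>e\<close> at ceiling height, the ceiling
  beside \<open>e\<close> must continue, in a vertical face over \<open>e\<close> or in the
  horizontal face opposite. If the latter is again a ceiling, no vertical face stands over
  \<open>e\<close>, and then no wall face can account for \<open>e \<in> K\<close>.\<close>

lemma touch_K_edge:
  assumes e: "ise e" "e \<in> K" and s: "\<bar>s\<bar> = 1" "side s e \<notin> K"
  obtains g where "g \<in> wf" "fst g \<in> K" "\<And>v. isv v \<Longrightarrow> v \<in> gclosure e \<Longrightarrow> (v, H (side s e)) \<in> cverts g"
    "e \<in> gclosure (fst g)"
proof -
  let ?u = "side s e" and ?w = "side (-s) e"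
  have ms: "\<bar>-s\<bar> = 1" using s by simp
  have u: "isF ?u" "e \<in> gclosure ?u" using isF_side[OF e(1) s(1)] edge_in_gclosure_side[OF e(1) s(1)] by auto
  have w: "isF ?w" "e \<in> gclosure ?w" using isF_side[OF e(1) ms] edge_in_gclosure_side[OF e(1) ms] by auto
  have tu: "touch ?u" using touchI[OF s(2) u(2) e(2)] .
  have uI: "(?u, H ?u) \<in> I" using touch_face[OF u(1) tu] by simp
  show thesis
  proof (cases "(e, H ?u) \<in> I \<or> (e, H ?u - 1) \<in> I")
    case True
    then obtain t where t: "(e, t) \<in> I" "H ?u = t \<or> H ?u = t + 1" by fastforce
    have "(e, t) \<in> wf" using K_wf t e by auto
    then show thesis using that[of "(e, t)"] t e by (auto simp: cverts_edge)
  next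
    case False
    then have wI: "(?w, H ?u) \<in> I" using ceven_edge[OF even_I e(1) s(1), of "H ?u"] uI by blast
    show thesis
    proof (cases "?w \<in> K")
      case True
      then have "(?w, H ?u) \<in> wf" using K_wf wI by auto
      then show thesis using that[of "(?w, H ?u)"] True w gclosure_trans by (auto simp: cverts_face)
    next
      case f: False
      have tw: "touch ?w" using touchI[OF f w(2) e(2)] .
      have Hw: "H ?w = H ?u" using touch_face[OF w(1) tw, of "H ?u"] wI by simp
      \<comment> \<open>With ceilings of equal height on both sides, the presence of a vertical face
        over \<open>e\<close> does not depend on its height; far up there is none.\<close>
      have st: "(e, t) \<in> I \<longleftrightarrow> (e, t - 1) \<in> I" for t
        using ceven_edge[OF even_I e(1) s(1), of t] touch_face[OF u(1) tu, of t] touch_face[OF w(1) tw, of t] Hw by simp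
      obtain N where N: "N \<ge> 0" "\<And>p t. (p, t) \<in> I \<Longrightarrow> \<bar>t\<bar> \<le> N" using heights_bounded by blast
      have none: "(e, t) \<notin> I" for t
      proof -
        have "(e, N + 1) \<notin> I" using N by fastforce
        then show ?thesis
        proof (induction t rule: int_induct[where k = "N + 1"])
          case (step1 i) then show ?case using st[of "i + 1"] by simp
        next
          case (step2 i) then show ?case using st[of i] by simp
        qed
      qed
      obtain g where g: "g \<in> wf" "e \<in> gclosure (fst g)" using e K_sub by (auto simp: wproj_def)
      have "isF (fst g)" using ise_gclosureD[OF e(1) g(2)] none[of "snd g"] g(1) wf_subset
        by (metis prod.collapse subsetD)
      then obtain s' where s': "\<bar>s'\<bar> = 1" "fst g = side s' e" using ise_gclosure_face[OF e(1) _ g(2)] by blast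
      have "s' = s \<or> s' = - s" using s' s by linarith
      then have "fst g \<notin> K" using s'(2) s(2) f by auto
      then show thesis using K_max[OF g(1) g(2)] e by blast
    qed
  qed
qed

text \<open>Turn around \<open>v\<close> through the quadrants, starting from \<open>u\<close>. As
  long as the edges crossed are not in \<open>K\<close>, the ceiling height is unchanged; some edge
  at \<open>v\<close> does lie in \<open>K\<close>, because a wall face over \<open>K\<close> has
  \<open>v\<close> in its closure.\<close>

lemma touch_corner:
  assumes "isF u" "u \<notin> K" "isv v" "v \<in> K" "v \<in> gclosure u"
  shows "\<exists>g\<in>wf. fst g \<in> K \<and> (v, H u) \<in> cverts g"
proof -
  obtain s t where st: "\<bar>s\<bar> = 1" "\<bar>t\<bar> = 1" "u = (fst v + s, snd v + t)"
    using isv_gclosure_face[OF assms(1,3,5)] .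
  have mst: "\<bar>-s\<bar> = 1" "\<bar>-t\<bar> = 1" using st by auto
  have step: "\<exists>g\<in>wf. fst g \<in> K \<and> (v, H u) \<in> cverts g" if e: "ise e" "e \<in> K" "v \<in> gclosure e" "\<bar>r\<bar> = 1" "side r e \<notin> K" "H (side r e) = H u" for e r
  proof -
    obtain g where "g \<in> wf" "fst g \<in> K" "\<And>w. isv w \<Longrightarrow> w \<in> gclosure e \<Longrightarrow> (w, H (side r e)) \<in> cverts g"
      using touch_K_edge[OF e(1,2,4,5)] by blast
    then show ?thesis using e(3,6) assms(3) by metis
  qed
  note A = isv_star[OF assms(3) st(1,2)]
  note B = isv_star[OF assms(3) st(1) mst(2)]
  note C = isv_star[OF assms(3) mst(1) mst(2)]
  note D = isv_star[OF assms(3) mst(1) st(2)]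
  let ?e1 = "(fst v + s, snd v)" and ?e2 = "(fst v, snd v + t)" and ?e3 = "(fst v, snd v + - t)" and ?e4 = "(fst v + - s, snd v)"
  show ?thesis
  proof (cases "?e1 \<in> K")
    case True then show ?thesis using step[OF A(1) True A(4) st(2)] A(9) st(3) assms(2) by simp
  next
    case f1: False
    show ?thesis
    proof (cases "?e2 \<in> K")
      case True then show ?thesis using step[OF A(2) True A(5) st(1)] A(10) st(3) assms(2) by simp
    next
      case f2: False
      have t1: "touch ?e1" "touch ?e2" using touchI[OF f1 A(4) assms(4)] touchI[OF f2 A(5) assms(4)] .
      have H1: "H (fst v + s, snd v + - t) = H u"
        using touch_edge(3)[OF A(1) t1(1) st(2)] touch_edge(3)[OF A(1) t1(1) mst(2)] A(9) B(9) st(3) by simp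
      have n1: "(fst v + s, snd v + - t) \<notin> K" using touch_edge(2)[OF A(1) t1(1) mst(2)] B(9) by (simp add: touch_def)
      show ?thesis
      proof (cases "?e3 \<in> K")
        case True then show ?thesis using step[OF B(2) True B(5) st(1)] B(10) n1 H1 by simp
      next
        case f3: False
        have t3: "touch ?e3" using touchI[OF f3 B(5) assms(4)] .
        have H3: "H (fst v + - s, snd v + - t) = H u"
          using touch_edge(3)[OF B(2) t3 st(1)] touch_edge(3)[OF B(2) t3 mst(1)] B(10) C(10) H1 by simp
        have n3: "(fst v + - s, snd v + - t) \<notin> K" using touch_edge(2)[OF B(2) t3 mst(1)] C(10) by (simp add: touch_def)
        show ?thesis
        proof (cases "?e4 \<in> K")
          case True then show ?thesis using step[OF C(1) True C(4) mst(2)] C(9) n3 H3 by simp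
        next
          case f4: False
          obtain g where g: "g \<in> wf" "v \<in> gclosure (fst g)" using assms(4) K_sub by (auto simp: wproj_def)
          have gK: "fst g \<in> K" using K_max[OF g assms(4)] .
          have "fst g \<noteq> v" using not_isv g(1) wf_subset assms(3) by blast
          from isv_gclosureD[OF assms(3) g(2) this] obtain e where e: "ise e" "e \<in> gclosure (fst g)" "v \<in> gclosure e" .
          have "e \<in> K" using K_down[OF gK e(2)] .
          obtain r where r: "\<bar>r\<bar> = 1" "v = tip r e" using isv_gclosure_edge[OF e(1) assms(3) e(3)] .
          have sr: "- r = s \<or> - r = - s" "- r = t \<or> - r = - t" using st r by linarith+
          have "e = (fst v + - r, snd v) \<or> e = (fst v, snd v + - r)" using r(2) by (simp add: tip_def)
          then have "e = ?e1 \<or> e = ?e2 \<or> e = ?e3 \<or> e = ?e4" using sr by metis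
          then show ?thesis using \<open>e \<in> K\<close> f1 f2 f3 f4 by auto
        qed
      qed
    qed
  qed
qed

end

section \<open>Walls\<close>

lemma gclosure_isv: "isv v \<Longrightarrow> gclosure v = {v}"
  by (auto simp: gclosure_def isv_def prod_eq_iff)

lemma gadj_gclosure:
  assumes "gadj x y" shows "y \<in> gclosure x \<and> ((isF x \<and> ise y) \<or> (ise x \<and> isv y)) \<or> x \<in> gclosure y"
proof -
  obtain i j where x: "x = (i, j)" by (cases x)
  from assms[unfolded x] show ?thesis
    by (cases rule: gadj_cases) (auto simp: x gclosure_def isF_def ise_def isv_def)
qed

lemma cverts_isv: "(v, h) \<in> cverts g \<Longrightarrow> isv v \<and> v \<in> gclosure (fst g)"
  by (auto simp: cverts_def)

context iface_comp begin

text \<open>Simple connectivity in the form used below: a label on the frontier of \<open>K\<close>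
  is constant along each component of the complement if at every vertex it is a function of the
  ceiling height.\<close>

lemma frontier_label_constant:
  fixes lab :: "gpt \<Rightarrow> gpt \<Rightarrow> 'a" and L :: "gpt \<Rightarrow> int \<Rightarrow> 'a"
  assumes A: "\<And>f e v. isF f \<Longrightarrow> touch f \<Longrightarrow> ise e \<Longrightarrow> e \<in> K \<Longrightarrow> e \<in> gclosure f \<Longrightarrow> isv v \<Longrightarrow> v \<in> gclosure e \<Longrightarrow>
      lab f e = L v (H f)"
    and B: "\<And>e v. ise e \<Longrightarrow> touch e \<Longrightarrow> isv v \<Longrightarrow> v \<in> K \<Longrightarrow> v \<in> gclosure e \<Longrightarrow> lab e v = L v (H e)"
    and x: "linked gadj (- K) x x'" "x \<notin> K" "y \<in> K" "y' \<in> K" "gadj x y" "gadj x' y'"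
  shows "lab x y = lab x' y'"
proof -
  have FE: "((a + s, b) \<in> K \<longrightarrow> lab (a + s, b + t) (a + s, b) = L (a, b) (H (a + s, b + t))) \<and>
    ((a, b + t) \<in> K \<longrightarrow> lab (a + s, b + t) (a, b + t) = L (a, b) (H (a + s, b + t))) \<and>
    ((a + s, b) \<notin> K \<longrightarrow> lab (a + s, b) (a, b) = L (a, b) (H (a + s, b + t))) \<and>
    ((a, b + t) \<notin> K \<longrightarrow> lab (a, b + t) (a, b) = L (a, b) (H (a + s, b + t)))"
    if e: "even a" "even b" "\<bar>s\<bar> = 1" "\<bar>t\<bar> = 1" and v: "(a, b) \<in> K" and f: "(a + s, b + t) \<notin> K" for a b s t
  proof -
    have v': "isv (a, b)" using e by (simp add: isv_def)
    note S = isv_star[OF v' e(3,4), simplified]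
    have tf: "touch (a + s, b + t)" using touchI[OF f S(6) v] .
    have te: "touch (a + s, b)" if "(a + s, b) \<notin> K" using touchI[OF that S(4) v] .
    have te': "touch (a, b + t)" if "(a, b + t) \<notin> K" using touchI[OF that S(5) v] .
    show ?thesis
      using A[OF S(3) tf S(1) _ S(7) v' S(4)] A[OF S(3) tf S(2) _ S(8) v' S(5)]
        B[OF S(1) te v' v S(4)] B[OF S(2) te' v' v S(5)]
        touch_edge(3)[OF S(1) te e(4), unfolded S(9)] touch_edge(3)[OF S(2) te' e(3), unfolded S(10)]
      by auto
  qed
  show ?thesis
    by (rule boundary_label_constant[OF K_closed K_conn _ _ _ _ x]) (use FE in \<open>simp_all\<close>)
qed

text \<open>The label is the ceiling height itself. Each touching face first has to be joined to a
  frontier pair of the grid that has the same height.\<close>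

lemma heights_constant:
  assumes "isF u" "touch u" "isF w" "touch w" "linked gadj (- K) u w"
  shows "H u = H w"
proof -
  have inc: "\<exists>x y. linked gadj (- K) u x \<and> x \<notin> K \<and> y \<in> K \<and> gadj x y \<and> H x = H u" if u: "isF u" "touch u" for u
  proof -
    obtain q where q: "q \<in> gclosure u" "q \<in> K" using u by (auto simp: touch_def)
    have "q \<noteq> u" using q u by (auto simp: touch_def)
    then have "\<not> isF q" using isF_gclosureD q by blast
    then consider "isv q" | "ise q" using kind_cases by blast
    then have "\<exists>v. isv v \<and> v \<in> gclosure q"
    proof cases
      case 1 then show ?thesis using gclosure_refl by blast
    next
      case 2 then show ?thesis using isv_tip[of q 1] tip_in_gclosure[of q 1] by (intro exI[of _ "tip 1 q"]) simp
    qed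
    then obtain v where v: "isv v" "v \<in> gclosure q" by blast
    have vK: "v \<in> K" using K_down q v by blast
    obtain s t where st: "\<bar>s\<bar> = 1" "\<bar>t\<bar> = 1" "u = (fst v + s, snd v + t)"
      using isv_gclosure_face[OF u(1) v(1) gclosure_trans[OF q(1) v(2)]] .
    note S = isv_star[OF v(1) st(1,2)]
    let ?e = "(fst v + s, snd v)"
    have g: "gadj u ?e" using gadj_side[OF st(2), of ?e] S(9) st(3) by simp
    show ?thesis
    proof (cases "?e \<in> K")
      case True
      then show ?thesis using g u by (intro exI[of _ u] exI[of _ ?e]) (auto simp: touch_def)
    next
      case False
      have te: "touch ?e" using touchI[OF False S(4) vK] .
      have "linked gadj (- K) u ?e" using g False u by (intro linked_step) (auto simp: touch_def)
      moreover have "gadj ?e v" using st by (auto simp: gadj_def)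
      moreover have "H ?e = H u" using touch_edge(3)[OF S(1) te st(2)] S(9) st(3) by simp
      ultimately show ?thesis using False vK by blast
    qed
  qed
  obtain x y where xy: "linked gadj (- K) u x" "x \<notin> K" "y \<in> K" "gadj x y" "H x = H u"
    using inc[OF assms(1,2)] by blast
  obtain x' y' where xy': "linked gadj (- K) w x'" "x' \<notin> K" "y' \<in> K" "gadj x' y'" "H x' = H w"
    using inc[OF assms(3,4)] by blast
  have "linked gadj (- K) x x'"
    by (rule linked_trans[OF linked_sym[OF symp_gadj xy(1)] linked_trans[OF assms(5) xy'(1)]])
  then have "H x = H x'"
    using frontier_label_constant[where lab = "\<lambda>x y. H x" and L = "\<lambda>v h. h", of x x' y y'] xy xy' by simp
  then show ?thesis using xy xy' by simp
qed

text \<open>\<open>G\<close> is attached to the ceiling at \<open>x\<close> across the frontier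
  pair: it has a vertex over the closure of \<open>y\<close> at the height of that ceiling.\<close>

definition lab :: "cface set \<Rightarrow> gpt \<Rightarrow> gpt \<Rightarrow> bool" where
  "lab G x y \<longleftrightarrow> (\<exists>v g. v \<in> gclosure y \<and> g \<in> G \<and> (v, H x) \<in> cverts g)"

text \<open>These are the unions of star-connected classes of wall faces over \<open>K\<close>. The
  aim is to show that there is only one such class.\<close>

definition group :: "cface set \<Rightarrow> bool" where
  "group G \<longleftrightarrow> G \<subseteq> wf \<and> (\<forall>g\<in>G. fst g \<in> K) \<and> (\<forall>g\<in>G. \<forall>f\<in>wf. cadj g f \<longrightarrow> f \<in> G)"

lemma groupD:
  assumes "group G" "g \<in> G" "f \<in> wf" "p \<in> cverts g" "p \<in> cverts f"
  shows "f \<in> G"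
proof (cases "f = g")
  case False
  then have "cadj g f" using IntI[OF assms(4,5)] unfolding cadj_def by (metis empty_iff)
  then show ?thesis using assms(1-3) unfolding group_def by simp
qed (use assms in simp)

text \<open>The end point does not matter: the wall face from \<open>touch_K_edge\<close> contains
  both ends of \<open>e\<close> at ceiling height, so a group that meets one of them contains that
  face.\<close>

lemma lab_face:
  assumes G: "group G" and f: "isF f" "touch f" and e: "ise e" "e \<in> K" "e \<in> gclosure f" and v: "isv v" "v \<in> gclosure e"
  shows "lab G f e \<longleftrightarrow> (\<exists>g\<in>G. (v, H f) \<in> cverts g)"
proof
  assume "lab G f e"
  then obtain w g where w: "w \<in> gclosure e" "g \<in> G" "(w, H f) \<in> cverts g" by (auto simp: lab_def)
  obtain s where s: "\<bar>s\<bar> = 1" "f = side s e" using ise_gclosure_face[OF e(1) f(1) e(3)] .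
  have fK: "side s e \<notin> K" using f s by (auto simp: touch_def)
  obtain k where k: "k \<in> wf" "\<And>v. isv v \<Longrightarrow> v \<in> gclosure e \<Longrightarrow> (v, H f) \<in> cverts k"
    using touch_K_edge[OF e(1,2) s(1) fK] s(2) by blast
  have "k \<in> G" using groupD[OF G w(2) k(1) w(3)] k(2) w cverts_isv by blast
  then show "\<exists>g\<in>G. (v, H f) \<in> cverts g" using k v by blast
next
  assume "\<exists>g\<in>G. (v, H f) \<in> cverts g"
  then show "lab G f e" using v unfolding lab_def by blast
qed

lemma lab_edge: "isv v \<Longrightarrow> lab G e v \<longleftrightarrow> (\<exists>g\<in>G. (v, H e) \<in> cverts g)"
  by (auto simp: lab_def gclosure_isv)

lemma lab_constant:
  assumes "group G" "linked gadj (- K) x x'" "x \<notin> K" "y \<in> K" "y' \<in> K" "gadj x y" "gadj x' y'"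
  shows "lab G x y = lab G x' y'"
  by (rule frontier_label_constant[where L = "\<lambda>v h. \<exists>g\<in>G. (v, h) \<in> cverts g", OF _ _ assms(2-7)])
     (use lab_face[OF assms(1)] lab_edge in auto)

text \<open>The heart of the planar topology. Cover the components of the complement of
  \<open>K\<close> to which \<open>G\<close> is attached by lids at ceiling height. The result is
  even; a column over such a component meets it exactly once, but a far column not at all, so there
  are no such components. Then \<open>G\<close> touches no ceiling and is a closed part of the
  connected interface that avoids the plane outside the box, hence empty.\<close>

lemma unattached_group_empty:
  assumes G: "group G" and un: "\<And>x y. x \<notin> ghull K \<Longrightarrow> y \<in> K \<Longrightarrow> gadj x y \<Longrightarrow> \<not> lab G x y"
  shows "G = {}"
proof -
  have GI: "G \<subseteq> I" and GK: "\<And>g. g \<in> G \<Longrightarrow> fst g \<in> K" using G wf_subset by (auto simp: group_def)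
  have GKp: "p \<in> K" if "(p, t) \<in> G" for p t using GK[OF that] by simp
  define att where "att x \<longleftrightarrow> x \<notin> K \<and> (\<exists>x' y. linked gadj (- K) x x' \<and> y \<in> K \<and> gadj x' y \<and> lab G x' y)" for x
  have att_lab: "lab G z y" if "att x" "linked gadj (- K) x z" "y \<in> K" "gadj z y" for x y z
  proof -
    obtain x' y' where x': "linked gadj (- K) x x'" "y' \<in> K" "gadj x' y'" "lab G x' y'" "x \<notin> K"
      using \<open>att x\<close> by (auto simp: att_def)
    have "z \<notin> K" using linked_in[OF that(2)] x'(5) by auto
    have l: "linked gadj (- K) z x'" by (rule linked_trans[OF linked_sym[OF symp_gadj that(2)] x'(1)])
    show ?thesis using lab_constant[OF G l \<open>z \<notin> K\<close> that(3) x'(2) that(4) x'(3)] x'(4) by simp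
  qed
  have att_link: "att z" if "att x" "linked gadj (- K) x z" for x z
  proof -
    obtain x' y' where x': "linked gadj (- K) x x'" "y' \<in> K" "gadj x' y'" "lab G x' y'" "x \<notin> K"
      using \<open>att x\<close> by (auto simp: att_def)
    have l: "linked gadj (- K) z x'" by (rule linked_trans[OF linked_sym[OF symp_gadj that(2)] x'(1)])
    have "z \<notin> K" using linked_in[OF that(2)] x'(5) by auto
    then show ?thesis using l x' unfolding att_def by blast
  qed
  have att_hull: "x \<in> ghull K" if x: "att x" for x
  proof (rule ccontr)
    assume nh: "x \<notin> ghull K"
    obtain x' y' where x': "linked gadj (- K) x x'" "y' \<in> K" "gadj x' y'" "lab G x' y'" "x \<notin> K"
      using x by (auto simp: att_def)
    then show False using un[of x' y'] ghull_linked[OF x'(1,5)] nh by blast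
  qed
  have attI: "att x" if "x \<notin> K" "y \<in> K" "gadj x y" "lab G x y" for x y
    unfolding att_def using that linked_refl[of gadj "- K" x] by blast
  \<comment> \<open>A lid fills a whole component at the common height of the ceilings next to
    \<open>K\<close> there.\<close>
  define Lid where "Lid = {(u, h). isF u \<and> att u \<and> (\<exists>w. isF w \<and> touch w \<and> linked gadj (- K) u w \<and> h = H w)}"
  have att_face: "lab G u e" if h: "isF u" "att u" "ise e" "e \<in> K" "e \<in> gclosure u" for u e
  proof -
    obtain s where s: "\<bar>s\<bar> = 1" "u = side s e" using ise_gclosure_face[OF h(3,1,5)] .
    show ?thesis using att_lab[OF h(2) linked_refl h(4)] gadj_side[OF s(1), of e] s(2) by simp
  qed
  have Lid_touch: "(u, h) \<in> Lid \<longleftrightarrow> h = H u" if u: "isF u" "att u" "touch u" for u h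
  proof
    assume "(u, h) \<in> Lid"
    then obtain w where "isF w" "touch w" "linked gadj (- K) u w" "h = H w" by (auto simp: Lid_def)
    then show "h = H u" using heights_constant[OF u(1,3)] by simp
  next
    assume "h = H u"
    then show "(u, h) \<in> Lid" unfolding Lid_def mem_Collect_eq prod.case
      using u linked_refl[of gadj "- K" u] by blast
  qed
  have Lid_one: "\<exists>h. {t. (u, t) \<in> Lid} = {h}" if u: "isF u" "att u" for u
  proof -
    obtain x y where x: "linked gadj (- K) u x" "y \<in> K" "gadj x y" "u \<notin> K"
      using u by (auto simp: att_def)
    have xK: "x \<notin> K" using linked_in[OF x(1)] x(4) by auto
    have "x \<notin> gclosure y" using K_down x(2) xK by blast
    then have y: "y \<in> gclosure x" "(isF x \<and> ise y) \<or> (ise x \<and> isv y)" using gadj_gclosure[OF x(3)] by auto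
    have tx: "touch x" using touchI[OF xK y(1) x(2)] .
    have "\<exists>w. isF w \<and> touch w \<and> linked gadj (- K) u w"
    proof (cases "isF x")
      case True then show ?thesis using tx x by blast
    next
      case False
      then have ex: "ise x" using y by auto
      have tw: "touch (side 1 x)" using touch_edge(2)[OF ex tx, of 1] by simp
      have "gadj x (side 1 x)" using sympD[OF symp_gadj gadj_side[of 1 x]] by simp
      then have "linked gadj (- K) x (side 1 x)" using tw xK by (intro linked_step) (auto simp: touch_def)
      then have "linked gadj (- K) u (side 1 x)" by (rule linked_trans[OF x(1)])
      moreover have "isF (side 1 x)" using isF_side[OF ex, of 1] by simp
      ultimately show ?thesis using tw by blast
    qed
    then obtain w where w: "isF w" "touch w" "linked gadj (- K) u w" by blast
    have eq: "H w' = H w" if w': "isF w'" "touch w'" "linked gadj (- K) u w'" for w'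
      using heights_constant[OF w'(1,2) w(1,2) linked_trans[OF linked_sym[OF symp_gadj w'(3)] w(3)]] .
    have "(u, t) \<in> Lid \<longleftrightarrow> t = H w" for t
    proof
      assume "(u, t) \<in> Lid"
      then obtain w' where "isF w'" "touch w'" "linked gadj (- K) u w'" "t = H w'" by (auto simp: Lid_def)
      then show "t = H w" using eq by simp
    next
      assume "t = H w"
      then show "(u, t) \<in> Lid" unfolding Lid_def mem_Collect_eq prod.case using u w by blast
    qed
    then have "{t. (u, t) \<in> Lid} = {H w}" by blast
    then show ?thesis by blast
  qed
  define S where "S = G \<union> Lid"
  have LidF: "isF (fst f)" "fst f \<notin> K" if "f \<in> Lid" for f using that by (auto simp: Lid_def att_def)
  have sub: "f \<in> S \<longleftrightarrow> f \<in> G" if "\<not> isF (fst f) \<or> fst f \<in> K" for f using that LidF[of f] unfolding S_def by blast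
  \<comment> \<open>At a horizontal lattice edge off \<open>K\<close> only lids occur, on both sides
    or on neither. Over an edge of \<open>K\<close>, the set \<open>S\<close> coincides with
    \<open>I\<close> if a face of \<open>G\<close> is present, and otherwise it has no face
    there.\<close>
  have evS: "ceven S"
    unfolding ceven_def
  proof (intro conjI ballI allI impI)
    fix p assume "p \<in> S" then show "\<not> isv (fst p)"
      using GI not_isv[of p] LidF[of p] kind_disj(1)[of "fst p"] unfolding S_def by blast
  next
    fix v :: gpt and t :: int assume v: "isv v"
    let ?Q = "{((fst v + 1, snd v), t), ((fst v - 1, snd v), t), ((fst v, snd v + 1), t), ((fst v, snd v - 1), t)}"
    have ed: "ise (fst q)" "(v, t) \<in> cverts q" if "q \<in> ?Q" for q :: cface
    proof -
      note S = isv_star[OF v, of 1 1] isv_star[OF v, of "-1" "-1"]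
      show "ise (fst q)" using that S by auto
      moreover have "v \<in> gclosure (fst q)" "snd q = t" using that S by auto
      ultimately show "(v, t) \<in> cverts q" using cverts_edge[of "fst q" v t t] v by (metis prod.collapse)
    qed
    have S_G: "q \<in> S \<longleftrightarrow> q \<in> G" if "q \<in> ?Q" for q using sub[of q] ed(1)[OF that] kind_disj(4) by blast
    have ev: "((((fst v + 1, snd v), t) \<in> I) \<noteq> (((fst v - 1, snd v), t) \<in> I)) =
        ((((fst v, snd v + 1), t) \<in> I) \<noteq> (((fst v, snd v - 1), t) \<in> I))"
      using even_I v unfolding ceven_def by blast
    show "((((fst v + 1, snd v), t) \<in> S) \<noteq> (((fst v - 1, snd v), t) \<in> S)) =
        ((((fst v, snd v + 1), t) \<in> S) \<noteq> (((fst v, snd v - 1), t) \<in> S))"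
    proof (cases "\<exists>q\<in>?Q. q \<in> G")
      case False
      then show ?thesis using S_G by simp
    next
      case True
      then obtain q where q: "q \<in> ?Q" "q \<in> G" by blast
      have "q' \<in> G \<longleftrightarrow> q' \<in> I" if q': "q' \<in> ?Q" for q'
      proof
        assume "q' \<in> I"
        then have "q' \<in> wf" using ed(1)[OF q'] kind_disj(4) by (auto simp: wf_def)
        then show "q' \<in> G" using groupD[OF G q(2)] ed(2)[OF q(1)] ed(2)[OF q'] by blast
      qed (use GI in auto)
      then have "q' \<in> S \<longleftrightarrow> q' \<in> I" if "q' \<in> ?Q" for q' using S_G that by blast
      then show ?thesis using ev by simp
    qed
  next
    fix e :: gpt and t :: int assume e: "ise e"
    let ?u = "side 1 e" and ?w = "side (-1) e"
    have uw: "isF ?u" "isF ?w" "e \<in> gclosure ?u" "e \<in> gclosure ?w"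
      using isF_side[OF e, of 1] isF_side[OF e, of "-1"] edge_in_gclosure_side[OF e, of 1] edge_in_gclosure_side[OF e, of "-1"] by auto
    show "(((?u, t) \<in> S) \<noteq> ((?w, t) \<in> S)) = (((e, t) \<in> S) \<noteq> ((e, t - 1) \<in> S))"
    proof (cases "e \<in> K")
      case False
      have nK: "?u \<notin> K" "?w \<notin> K" using uw False K_down by blast+
      have ne: "(e, t) \<notin> S" "(e, t - 1) \<notin> S" using sub[of "(e, t)"] sub[of "(e, t - 1)"] kind_disj(4)[OF e] GKp[of e t] GKp[of e "t - 1"] False by auto
      have g: "gadj ?u e" "gadj e ?w" using gadj_side[of 1 e] gadj_side[of "-1" e] sympD[OF symp_gadj] by auto
      have "linked gadj (- K) ?u e" "linked gadj (- K) e ?w" using g nK False by (auto intro: linked_step)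
      then have l: "linked gadj (- K) ?u ?w" by (rule linked_trans)
      note l' = linked_sym[OF symp_gadj l]
      have "(?u, t) \<in> Lid \<longleftrightarrow> (?w, t) \<in> Lid"
      proof -
        have "att ?u \<longleftrightarrow> att ?w" using att_link[OF _ l] att_link[OF _ l'] by blast
        moreover have "linked gadj (- K) ?u w \<longleftrightarrow> linked gadj (- K) ?w w" for w
          using linked_trans[OF l] linked_trans[OF l'] by metis
        ultimately show ?thesis using uw unfolding Lid_def by simp
      qed
      then show ?thesis using ne nK GKp unfolding S_def by blast
    next
      case True
      define v where "v = tip 1 e"
      have v: "isv v" "v \<in> gclosure e" using isv_tip[OF e, of 1] tip_in_gclosure[OF e, of 1] by (auto simp: v_def)
      let ?Q = "{(?u, t), (?w, t), (e, t), (e, t - 1)}"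
      have Qv: "(v, t) \<in> cverts q" if "q \<in> ?Q" for q
        using that v uw gclosure_trans[OF uw(3) v(2)] gclosure_trans[OF uw(4) v(2)]
        by (auto simp: cverts_face cverts_edge[OF e])
      have Qk: "isF (fst q) \<and> snd q = t \<and> e \<in> gclosure (fst q) \<or> fst q = e" if "q \<in> ?Q" for q using that uw by auto
      show ?thesis
      proof (cases "\<exists>q\<in>?Q. q \<in> G")
        case T: True
        then obtain q where q: "q \<in> ?Q" "q \<in> G" by blast
        have "q' \<in> S \<longleftrightarrow> q' \<in> I" if q': "q' \<in> ?Q" for q'
        proof (cases "isF (fst q') \<and> fst q' \<notin> K")
          case False
          then have "q' \<in> S \<longleftrightarrow> q' \<in> G" using sub by blast
          moreover have "q' \<in> G" if "q' \<in> I"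
          proof -
            have "fst q' \<in> K" using False Qk[OF q'] True by auto
            then show ?thesis using groupD[OF G q(2) K_wf[OF that] Qv[OF q(1)] Qv[OF q']] by blast
          qed
          ultimately show ?thesis using GI by blast
        next
          case F: True
          obtain u where u: "q' = (u, t)" "isF u" "u \<notin> K" "e \<in> gclosure u"
            using F Qk[OF q'] kind_disj(4)[OF e] by (metis prod.collapse)
          have tu: "touch u" using touchI[OF u(3,4) True] .
          show ?thesis
          proof
            assume "q' \<in> I"
            then have tH: "t = H u" using touch_face[OF u(2) tu] u(1) by simp
            have "lab G u e" using lab_face[OF G u(2) tu e True u(4) v] q(2) Qv[OF q(1)] tH by blast
            moreover obtain s where "\<bar>s\<bar> = 1" "u = side s e" using ise_gclosure_face[OF e u(2,4)] .
            ultimately have "att u" using attI[OF u(3) True] gadj_side by blast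
            then show "q' \<in> S" using Lid_touch[OF u(2) _ tu] tH u(1) by (simp add: S_def)
          next
            assume "q' \<in> S"
            then have "q' \<in> Lid" using GKp u unfolding S_def by blast
            then have "t = H u" using Lid_touch[OF u(2) _ tu] u(1) by (auto simp: Lid_def)
            then show "q' \<in> I" using touch_face[OF u(2) tu] u(1) by simp
          qed
        qed
        then show ?thesis using ceven_edge[OF even_I e, of 1 t] by simp
      next
        case none: False
        have "q \<notin> Lid" if q: "q \<in> ?Q" for q
        proof
          assume qL: "q \<in> Lid"
          then obtain u where u: "q = (u, t)" "isF u" "u \<notin> K" "e \<in> gclosure u" "att u"
            using LidF[OF qL] Qk[OF q] kind_disj(4)[OF e] by (auto simp: Lid_def)
          have tu: "touch u" using touchI[OF u(3,4) True] .
          have tH: "t = H u" using Lid_touch[OF u(2,5) tu] qL u(1) by simp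
          obtain g where g: "g \<in> G" "(v, t) \<in> cverts g"
            using lab_face[OF G u(2) tu e True u(4) v] att_face[OF u(2,5) e True u(4)] tH by blast
          obtain s where s: "\<bar>s\<bar> = 1" "u = side s e" using ise_gclosure_face[OF e u(2,4)] .
          obtain k where k: "k \<in> wf" "(v, t) \<in> cverts k" "e \<in> gclosure (fst k)"
            using touch_K_edge[OF e True s(1)] s(2) u(3) v tH by metis
          have kG: "k \<in> G" using groupD[OF G g(1) k(1) g(2) k(2)] .
          have "k \<in> ?Q"
          proof (cases "isF (fst k)")
            case True
            then have "snd k = t" using cverts_face[of "fst k" v t "snd k"] k(2) by simp
            moreover obtain s' where s': "\<bar>s'\<bar> = 1" "fst k = side s' e" using ise_gclosure_face[OF e True k(3)] .
            moreover have "s' = 1 \<or> s' = -1" using s' by linarith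
            ultimately show ?thesis by (auto simp: prod_eq_iff)
          next
            case False
            then have "fst k = e" using ise_gclosureD[OF e k(3)] by blast
            moreover have "t = snd k \<or> t = snd k + 1" using k(2) by (auto simp: cverts_def)
            ultimately show ?thesis by (auto simp: prod_eq_iff)
          qed
          then show False using none kG by blast
        qed
        then have "q \<notin> S" if "q \<in> ?Q" for q using none that unfolding S_def by blast
        then show ?thesis by simp
      qed
    qed
  qed
  obtain N where N: "\<And>p t. (p, t) \<in> I \<Longrightarrow> \<bar>t\<bar> \<le> N" using heights_bounded by blast
  have bS: "\<bar>t\<bar> \<le> N" if "(p, t) \<in> S" for p t
  proof (cases "(p, t) \<in> G")
    case True then show ?thesis using N GI by blast
  next
    case False
    then have "(p, t) \<in> Lid" using that unfolding S_def by blast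
    then obtain w where "isF w" "touch w" "t = H w" unfolding Lid_def by blast
    then show ?thesis using N[of w "H w"] touch_face by blast
  qed
  have no_att: "\<not> att u" if u: "isF u" for u
  proof
    assume a: "att u"
    then obtain h where h: "{t. (u, t) \<in> Lid} = {h}" using Lid_one[OF u] by blast
    have "u \<notin> K" using a by (simp add: att_def)
    then have "{t. (u, t) \<in> S} = {h}" using h GKp unfolding S_def by blast
    moreover let ?w = "(2 * int n + 1, 1) :: gpt"
    have "{t. (?w, t) \<in> S} = {}"
    proof -
      have "?w \<notin> K" using far_face(2) K_far by blast
      moreover have "\<not> att ?w" using att_hull[of ?w] gfar_not_in_ghull[OF _ K_far far_face(2)] by auto
      ultimately show ?thesis using GKp unfolding S_def Lid_def by blast
    qed
    ultimately show False using column_parity[OF evS bS u far_face(1)] by simp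
  qed
  have no_lab: "\<not> lab G x y" if x: "x \<notin> K" "y \<in> K" "gadj x y" for x y
  proof
    assume "lab G x y"
    then have a: "att x" using attI x by blast
    have "x \<notin> gclosure y" using K_down x by blast
    then have y: "y \<in> gclosure x" "(isF x \<and> ise y) \<or> (ise x \<and> isv y)" using gadj_gclosure[OF x(3)] by auto
    have tx: "touch x" using touchI[OF x(1) y(1) x(2)] .
    show False
    proof (cases "isF x")
      case True then show False using no_att a by blast
    next
      case False
      then have ex: "ise x" using y by auto
      have tw: "touch (side 1 x)" using touch_edge(2)[OF ex tx, of 1] by simp
      have "gadj x (side 1 x)" using sympD[OF symp_gadj gadj_side[of 1 x]] by simp
      then have "linked gadj (- K) x (side 1 x)" using tw x by (intro linked_step) (auto simp: touch_def)
      then show False using att_link[OF a] no_att[OF isF_side[OF ex, of 1]] by auto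
    qed
  qed
  have closed: "c \<in> G" if g: "g \<in> G" and c: "c \<in> I" "cadj g c" for g c
  proof (rule ccontr)
    assume nc: "c \<notin> G"
    obtain v h where vh: "(v, h) \<in> cverts g" "(v, h) \<in> cverts c" using c(2) by (auto simp: cadj_def)
    have v: "isv v" "v \<in> gclosure (fst g)" "v \<in> gclosure (fst c)" using vh by (auto simp: cverts_def)
    have vK: "v \<in> K" using K_down GK g v by blast
    have cw: "c \<notin> wf" using groupD[OF G g _ vh] nc by blast
    then have cF: "isF (fst c)" using c(1) by (auto simp: wf_def)
    have cK: "fst c \<notin> K" using K_wf[OF c(1)] cw by blast
    have tc: "touch (fst c)" using touchI[OF cK v(3) vK] .
    have "h = snd c" using vh(2) cF by (simp add: cverts_def)
    moreover have "snd c = H (fst c)" using touch_face[OF cF tc, of "snd c"] c(1) by simp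
    ultimately have h: "h = H (fst c)" by simp
    obtain s t where st: "\<bar>s\<bar> = 1" "\<bar>t\<bar> = 1" "fst c = (fst v + s, snd v + t)"
      using isv_gclosure_face[OF cF v(1,3)] .
    note S = isv_star[OF v(1) st(1,2)]
    let ?e = "(fst v + s, snd v)"
    have ec: "?e \<in> gclosure (fst c)" using S(7) st(3) by simp
    show False
    proof (cases "?e \<in> K")
      case True
      have "lab G (fst c) ?e" using lab_face[OF G cF tc S(1) True ec v(1) S(4)] g vh(1) h by blast
      moreover have "gadj (fst c) ?e" using gadj_side[OF st(2), of ?e] S(9) st(3) by simp
      ultimately show False using no_lab cK True by blast
    next
      case False
      have te: "touch ?e" using touchI[OF False S(4) vK] .
      have "H ?e = H (fst c)" using touch_edge(3)[OF S(1) te st(2)] S(9) st(3) by simp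
      then have "lab G ?e v" using lab_edge[OF v(1)] g vh(1) h by metis
      moreover have "gadj ?e v" using st by (auto simp: gadj_def)
      ultimately show False using no_lab False vK by blast
    qed
  qed
  show "G = {}"
  proof (rule ccontr)
    assume "G \<noteq> {}"
    then obtain g where g: "g \<in> G" by blast
    then obtain o' where o: "o' \<in> outL n" "linked cadj I o' g" using conn GI by blast
    have "linked cadj G g o' \<and> o' \<in> G"
      by (rule linked_restrict[OF linked_sym[OF symp_cadj o(2)] g]) (rule closed)
    then have "o' \<in> wf" using G unfolding group_def by blast
    then show False using wf_box(1) o(1) by blast
  qed
qed

lemma outer_incidence:
  obtains x y where "x \<notin> ghull K" "y \<in> K" "gadj x y" "isF x \<and> ise y \<and> y \<in> gclosure x \<or> ise x \<and> isv y"
proof -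
  obtain a b where ab: "even a" "even b" "(a, b) \<in> K" "(a + 1, b + 1) \<notin> ghull K"
    using exists_outer_corner[OF finite_K K_ne K_closed] .
  have v: "isv (a, b)" using ab by (simp add: isv_def)
  note S = isv_star[OF v, of 1 1, simplified]
  have g: "gadj (a + 1, b + 1) (a + 1, b)" "gadj (a + 1, b) (a, b)" by (auto simp: gadj_def)
  show thesis
  proof (cases "(a + 1, b) \<in> K")
    case True
    then show thesis using that[OF ab(4) True g(1)] S by auto
  next
    case False
    have "(a + 1, b + 1) \<notin> K" using ab(4) subset_ghull by blast
    then have "linked gadj (- K) (a + 1, b + 1) (a + 1, b)" using g(1) False by (intro linked_step) auto
    then have "(a + 1, b) \<notin> ghull K" using ghull_linked ab(4) \<open>(a + 1, b + 1) \<notin> K\<close> by blast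
    then show thesis using that[OF _ ab(3) g(2)] S v by auto
  qed
qed

text \<open>Every class over \<open>K\<close> is attached to the outer ceiling and, by constancy of
  the label, at one and the same frontier pair; so any two classes share a vertex. Thus walls
  correspond to components of the wall projection.\<close>

lemma wall_faces_linked:
  assumes "g1 \<in> wf" "fst g1 \<in> K" "g2 \<in> wf" "fst g2 \<in> K"
  shows "linked cadj wf g1 g2"
proof -
  define G where "G g = {f \<in> wf. linked cadj wf g f}" for g
  have gr: "group (G g)" if g: "g \<in> wf" "fst g \<in> K" for g
    unfolding group_def
  proof (intro conjI ballI impI)
    show "G g \<subseteq> wf" by (auto simp: G_def)
  next
    fix f assume "f \<in> G g"
    then have "linked cadj wf g f" by (simp add: G_def)
    then show "fst f \<in> K"
    proof (induction rule: linked_induct)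
      case base show ?case by (rule g(2))
    next
      case (step y z)
      then obtain v h where vh: "(v, h) \<in> cverts y" "(v, h) \<in> cverts z" by (auto simp: cadj_def)
      have "v \<in> K" using K_down step cverts_isv[OF vh(1)] by blast
      then show ?case using K_max[OF step(3)] cverts_isv[OF vh(2)] by blast
    qed
  next
    fix f f' assume "f \<in> G g" "f' \<in> wf" "cadj f f'"
    then show "f' \<in> G g" using linked_trans[of cadj wf g f f'] linked_step[of f wf f' cadj] by (auto simp: G_def)
  qed
  obtain x y where xy: "x \<notin> ghull K" "y \<in> K" "gadj x y" "isF x \<and> ise y \<and> y \<in> gclosure x \<or> ise x \<and> isv y"
    using outer_incidence .
  have xK: "x \<notin> K" using xy(1) subset_ghull by blast
  have la: "lab (G g) x y" if g: "g \<in> wf" "fst g \<in> K" for g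
  proof -
    have "g \<in> G g" using g linked_refl unfolding G_def by blast
    then have "G g \<noteq> {}" by blast
    then obtain x' y' where x': "x' \<notin> ghull K" "y' \<in> K" "gadj x' y'" "lab (G g) x' y'"
      using unattached_group_empty[OF gr[OF g]] by blast
    have "x' \<notin> K" using x' subset_ghull by blast
    then show ?thesis
      using lab_constant[OF gr[OF g] linked_outside_ghull[OF finite_K x'(1) xy(1)] _ x'(2) xy(2) x'(3) xy(3)] x'(4) by simp
  qed
  have "\<exists>v. \<forall>g. g \<in> wf \<and> fst g \<in> K \<longrightarrow> (\<exists>f\<in>G g. (v, H x) \<in> cverts f)"
  proof (cases "isF x")
    case True
    then have y: "ise y" "y \<in> gclosure x" using xy(4) kind_disj(2) by auto
    have "touch x" using touchI[OF xK y(2) xy(2)] .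
    then show ?thesis
      using lab_face[OF gr True _ y(1) xy(2) y(2) isv_tip[OF y(1), of 1] tip_in_gclosure[OF y(1), of 1]] la
      by (intro exI[of _ "tip 1 y"]) auto
  next
    case False
    then have "isv y" using xy(4) by blast
    then show ?thesis using lab_edge la by (intro exI[of _ y]) auto
  qed
  then obtain v where v: "\<And>g. g \<in> wf \<Longrightarrow> fst g \<in> K \<Longrightarrow> \<exists>f\<in>G g. (v, H x) \<in> cverts f" by blast
  obtain f1 where f1: "f1 \<in> G g1" "(v, H x) \<in> cverts f1" using v[OF assms(1,2)] by blast
  obtain f2 where f2: "f2 \<in> G g2" "(v, H x) \<in> cverts f2" using v[OF assms(3,4)] by blast
  have "linked cadj wf f1 f2" using linked_common_vertex[OF _ _ f1(2) f2(2)] f1 f2 by (auto simp: G_def)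
  moreover have "linked cadj wf g1 f1" "linked cadj wf f2 g2"
    using f1 f2 linked_sym[OF symp_cadj] by (auto simp: G_def)
  ultimately show ?thesis using linked_trans[of cadj wf] by metis
qed

end

section \<open>Deleting a wall\<close>

lemma cadjI: "f \<noteq> g \<Longrightarrow> p \<in> cverts f \<Longrightarrow> p \<in> cverts g \<Longrightarrow> cadj f g"
  unfolding cadj_def by (metis IntI empty_iff)

lemma linked_class:
  assumes "symp R" "linked R S a b" shows "{g. linked R S a g} = {g. linked R S b g}"
proof (intro set_eqI iffI)
  fix g assume "g \<in> {g. linked R S a g}"
  then show "g \<in> {g. linked R S b g}" using linked_trans[OF linked_sym[OF assms], of g] by simp
next
  fix g assume "g \<in> {g. linked R S b g}"
  then show "g \<in> {g. linked R S a g}" using linked_trans[OF assms(2), of g] by simp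
qed

lemma linked_coface:
  assumes "gclosed K" "q \<notin> K" "q \<in> gclosure p"
  shows "linked gadj (- K) p q"
proof -
  have up: "r \<notin> K" if "q \<in> gclosure r" for r using assms(1,2) that by (auto simp: gclosed_def)
  let ?m = "(fst q, snd p)"
  have m: "q \<in> gclosure ?m" "?m \<in> gclosure p" using assms(3) by (auto simp: gclosure_def)
  have 1: "linked gadj (- K) p ?m"
  proof (cases "fst q = fst p")
    case False
    then have "\<bar>fst q - fst p\<bar> = 1" using assms(3) by (auto simp: gclosure_def)
    then show ?thesis using up assms(3) m by (intro linked_step) (auto simp: gadj_def)
  qed simp
  have 2: "linked gadj (- K) ?m q"
  proof (cases "snd q = snd p")
    case True
    then have "?m = q" by (simp add: prod_eq_iff)
    then show ?thesis by simp
  next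
    case False
    then have "\<bar>snd q - snd p\<bar> = 1" using assms(3) by (auto simp: gclosure_def)
    then show ?thesis using up[OF m(1)] assms(2) by (intro linked_step) (auto simp: gadj_def)
  qed
  show ?thesis using 1 2 by (rule linked_trans)
qed

section \<open>Walls, floors and standard walls of an interface\<close>

definition cwalls :: "cface set \<Rightarrow> cface set set" where
  "cwalls I = {{g. linked cadj (iface.wf I) f g} | f. f \<in> iface.wf I}"

definition cproj :: "cface set \<Rightarrow> gpt set" where
  "cproj W = (\<Union>g\<in>W. gclosure (fst g))"

lemma gclosed_cproj: "gclosed (cproj W)"
  unfolding cproj_def gclosed_def using gclosure_trans by blast

definition cshift :: "int \<Rightarrow> cface set \<Rightarrow> cface set" where
  "cshift k W = (\<lambda>f. (fst f, snd f + k)) ` W"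

lemma mem_cshift: "(p, t) \<in> cshift k W \<longleftrightarrow> (p, t - k) \<in> W"
  by (force simp: cshift_def image_iff)

lemma cshift_cshift: "cshift k (cshift l W) = cshift (k + l) W"
  by (auto simp: mem_cshift algebra_simps set_eq_iff)

lemma cshift_0 [simp]: "cshift 0 W = W"
  by (auto simp: mem_cshift)

lemma cproj_cshift [simp]: "cproj (cshift k W) = cproj W"
  by (auto simp: cproj_def cshift_def)

definition cfloor :: "cface set \<Rightarrow> cface set \<Rightarrow> int \<Rightarrow> bool" where
  "cfloor I W h \<longleftrightarrow> (\<exists>f\<in>I - iface.wf I. (\<exists>g\<in>W. cadj f g) \<and> fst f \<notin> ghull (cproj W) \<and> snd f = h)"

definition cstd :: "cface set \<Rightarrow> cface set set" where
  "cstd I = {cshift (- h) W | W h. W \<in> cwalls I \<and> cfloor I W h}"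

context iface begin

text \<open>Adjacent wall faces have linked projections, so a wall stays over one component of the
  wall projection; by \<open>wall_faces_linked\<close> it contains everything over that
  component.\<close>

lemma wall_component:
  assumes "W \<in> cwalls I"
  shows "iface_comp n I (cproj W)" "W = {g \<in> I. fst g \<in> cproj W}" "W \<subseteq> wf" "finite W" "W \<noteq> {}"
proof -
  obtain f where f: "f \<in> wf" "W = {g. linked cadj wf f g}" using assms by (auto simp: cwalls_def)
  show Wwf: "W \<subseteq> wf" using f linked_in[of cadj wf f] by auto
  show "finite W" using Wwf finite_wf finite_subset by blast
  show "W \<noteq> {}" using f linked_refl[of cadj wf f] by blast
  define K where "K = {y. linked gadj wproj (fst f) y}"
  have fK: "fst f \<in> wproj" using f(1) gclosure_refl unfolding wproj_def by blast
  have cl: "gclosure (fst g) \<subseteq> wproj" if "g \<in> wf" for g using that unfolding wproj_def by blast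
  have Kext: "z \<in> K" if "y \<in> K" "linked gadj wproj y z" for y z
    using linked_trans[OF _ that(2)] that(1) unfolding K_def by blast
  have Ksub: "K \<subseteq> wproj" using linked_in[OF _ fK] unfolding K_def by blast
  interpret C: iface_comp n I K
  proof unfold_locales
    show "K \<noteq> {}" using linked_refl[of gadj wproj "fst f"] unfolding K_def by blast
    show "K \<subseteq> wproj" by (rule Ksub)
    show "gclosed K"
      unfolding gclosed_def
    proof (intro ballI subsetI)
      fix p q assume pq: "p \<in> K" "q \<in> gclosure p"
      have "gclosure p \<subseteq> wproj" using gclosed_wproj Ksub pq(1) unfolding gclosed_def by blast
      then show "q \<in> K" using Kext[OF pq(1) linked_mono[OF linked_gclosure[OF pq(2)]]] by blast
    qed
    have to: "linked gadj K (fst f) x" if x: "x \<in> K" for x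
    proof -
      have "linked gadj wproj (fst f) x" using x unfolding K_def by blast
      moreover have "fst f \<in> K" unfolding K_def by simp
      moreover have "z \<in> K" if "y \<in> K" "z \<in> wproj" "gadj y z" for y z
        using Kext[OF that(1) linked_step[of y wproj z gadj]] that Ksub by blast
      ultimately show ?thesis using linked_restrict[of gadj wproj "fst f" x K] by blast
    qed
    show "linked gadj K x y" if "x \<in> K" "y \<in> K" for x y
      by (rule linked_trans[OF linked_sym[OF symp_gadj to[OF that(1)]] to[OF that(2)]])
    show "fst g \<in> K" if "g \<in> wf" "q \<in> gclosure (fst g)" "q \<in> K" for g q
      using Kext[OF that(3) linked_mono[OF linked_sym[OF symp_gadj linked_gclosure[OF that(2)]] cl[OF that(1)]]] .
  qed
  have fK': "fst f \<in> K" unfolding K_def by simp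
  have WK: "fst g \<in> K" if "g \<in> W" for g
  proof -
    have "linked cadj wf f g" using that f by blast
    then show ?thesis
    proof (induction rule: linked_induct)
      case base show ?case by (rule fK')
    next
      case (step y z)
      then obtain v where v: "v \<in> cverts y" "v \<in> cverts z" by (auto simp: cadj_def)
      have "fst v \<in> K" using C.K_down step cverts_isv v(1) by (metis prod.collapse)
      then show ?case using C.K_max[OF step(3)] cverts_isv v(2) by (metis prod.collapse)
    qed
  qed
  have W_eq: "W = {g \<in> I. fst g \<in> K}"
  proof (intro set_eqI iffI)
    fix g assume "g \<in> W" then show "g \<in> {g \<in> I. fst g \<in> K}" using WK Wwf wf_subset by blast
  next
    fix g assume "g \<in> {g \<in> I. fst g \<in> K}"
    then show "g \<in> W" using C.wall_faces_linked[OF f(1) fK' C.K_wf[of g]] f(2) by blast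
  qed
  have "cproj W = K"
  proof
    show "cproj W \<subseteq> K" using WK C.K_down unfolding cproj_def by blast
    show "K \<subseteq> cproj W"
    proof
      fix y assume y: "y \<in> K"
      then obtain g where g: "g \<in> wf" "y \<in> gclosure (fst g)" using Ksub unfolding wproj_def by blast
      then have "fst g \<in> K" using C.K_max y by blast
      then have "g \<in> W" using g W_eq wf_subset by blast
      then show "y \<in> cproj W" using g unfolding cproj_def by blast
    qed
  qed
  then show "iface_comp n I (cproj W)" "W = {g \<in> I. fst g \<in> cproj W}" using C.iface_comp_axioms W_eq by simp_all
qed

lemma wall_of: "f \<in> wf \<Longrightarrow> {g. linked cadj wf f g} \<in> cwalls I"
  unfolding cwalls_def by blast

lemma cwalls_disjoint:
  assumes "V \<in> cwalls I" "W \<in> cwalls I" "V \<noteq> W" shows "cproj V \<inter> cproj W = {}"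
proof (rule ccontr)
  assume "\<not> ?thesis"
  then obtain q where q: "q \<in> cproj V" "q \<in> cproj W" by blast
  interpret V: iface_comp n I "cproj V" by (rule wall_component[OF assms(1)])
  interpret W: iface_comp n I "cproj W" by (rule wall_component[OF assms(2)])
  obtain g where g: "g \<in> V" "q \<in> gclosure (fst g)" using q(1) unfolding cproj_def by blast
  have gw: "g \<in> wf" using g wall_component(3)[OF assms(1)] by blast
  have "fst g \<in> cproj W" using W.K_max[OF gw g(2) q(2)] .
  then have gW: "g \<in> W" using wall_component(2)[OF assms(2)] gw wf_subset by blast
  obtain f where f: "f \<in> wf" "V = {g. linked cadj wf f g}" using assms by (auto simp: cwalls_def)
  obtain f' where f': "f' \<in> wf" "W = {g. linked cadj wf f' g}" using assms by (auto simp: cwalls_def)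
  have 1: "linked cadj wf f f'"
    using linked_trans[of cadj wf f g f'] linked_sym[OF symp_cadj, of wf f' g] f f' g(1) gW by blast
  have "V = W"
    unfolding f(2) f'(2) by (rule linked_class[OF symp_cadj 1])
  then show False using assms by blast
qed

end

context iface_comp begin

section \<open>Floor height and vertical shifts\<close>

definition h0 :: int where "h0 = H (SOME u. isF u \<and> touch u \<and> u \<notin> ghull K)"

lemma outer_face: obtains u v where "isF u" "touch u" "u \<notin> ghull K" "isv v" "v \<in> K" "v \<in> gclosure u"
proof -
  obtain a b where ab: "even a" "even b" "(a, b) \<in> K" "(a + 1, b + 1) \<notin> ghull K"
    using exists_outer_corner[OF finite_K K_ne K_closed] .
  have v: "isv (a, b)" using ab by (simp add: isv_def)
  note S = isv_star[OF v, of 1 1, simplified]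
  have "(a + 1, b + 1) \<notin> K" using ab(4) subset_ghull by blast
  then show thesis using that[OF S(3) touchI[OF _ S(6) ab(3)] ab(4) v ab(3) S(6)] by blast
qed

lemma H_outer: assumes "isF u" "touch u" "u \<notin> ghull K" shows "H u = h0"
proof -
  define w where "w = (SOME u. isF u \<and> touch u \<and> u \<notin> ghull K)"
  have w: "isF w \<and> touch w \<and> w \<notin> ghull K" unfolding w_def by (rule someI) (use assms in blast)
  show ?thesis unfolding h0_def w_def[symmetric]
    using heights_constant[OF assms(1,2) _ _ linked_outside_ghull[OF finite_K assms(3)]] w by blast
qed

text \<open>How far the ceilings next to \<open>K\<close> over the component of \<open>x\<close> lie
  above the floor. The choice depends on \<open>x\<close> only through its component, so the shift
  is constant there.\<close>

definition sft :: "gpt \<Rightarrow> int" where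
  "sft x = H (SOME u. isF u \<and> touch u \<and> linked gadj (- K) x u) - h0"

lemma sft_linked: assumes "linked gadj (- K) x y" shows "sft x = sft y"
proof -
  have "linked gadj (- K) x = linked gadj (- K) y"
    by (rule ext) (metis linked_trans[OF assms] linked_trans[OF linked_sym[OF symp_gadj assms]])
  then show ?thesis by (simp add: sft_def)
qed

lemma sft_touch: assumes "isF u" "touch u" shows "sft u = H u - h0"
proof -
  define w where "w = (SOME w. isF w \<and> touch w \<and> linked gadj (- K) u w)"
  have w: "isF w \<and> touch w \<and> linked gadj (- K) u w" unfolding w_def by (rule someI) (use assms linked_refl in blast)
  then have "H u = H w" using heights_constant[OF assms] by blast
  then show ?thesis by (simp add: sft_def w_def[symmetric])
qed

lemma sft_outer: assumes "x \<notin> ghull K" shows "sft x = 0"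
proof -
  obtain u v where u: "isF u" "touch u" "u \<notin> ghull K" using outer_face by metis
  have "sft x = sft u" by (rule sft_linked[OF linked_outside_ghull[OF finite_K assms u(3)]])
  then show ?thesis using sft_touch[OF u(1,2)] H_outer[OF u] by simp
qed

lemma sft_coface: "q \<notin> K \<Longrightarrow> q \<in> gclosure p \<Longrightarrow> sft p = sft q"
  by (rule sft_linked[OF linked_coface[OF K_closed]])

lemma floor_iff: "cfloor I {g \<in> I. fst g \<in> K} h \<longleftrightarrow> h = h0"
proof -
  have pr: "cproj {g \<in> I. fst g \<in> K} = K"
  proof
    show "cproj {g \<in> I. fst g \<in> K} \<subseteq> K" using K_down unfolding cproj_def by blast
    show "K \<subseteq> cproj {g \<in> I. fst g \<in> K}"
    proof
      fix y assume y: "y \<in> K"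
      then obtain g where g: "g \<in> wf" "y \<in> gclosure (fst g)" using K_sub unfolding wproj_def by blast
      then have "fst g \<in> K" using K_max y by blast
      then show "y \<in> cproj {g \<in> I. fst g \<in> K}" using g wf_subset unfolding cproj_def by blast
    qed
  qed
  show ?thesis
  proof
    assume "cfloor I {g \<in> I. fst g \<in> K} h"
    then obtain f g where fg: "f \<in> I" "f \<notin> wf" "g \<in> I" "fst g \<in> K" "cadj f g" "fst f \<notin> ghull K" "snd f = h"
      unfolding cfloor_def pr by blast
    have F: "isF (fst f)" using fg by (auto simp: wf_def)
    obtain p where p: "p \<in> cverts f" "p \<in> cverts g" using fg(5) unfolding cadj_def by blast
    have v: "fst p \<in> gclosure (fst f)" "fst p \<in> gclosure (fst g)" using p cverts_isv by (metis prod.collapse)+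
    have "fst f \<notin> K" using fg(6) subset_ghull by blast
    then have t: "touch (fst f)" using touchI v K_down fg(4) by blast
    have "h = H (fst f)" using touch_face[OF F t, of h] fg(1,7) by (metis prod.collapse)
    then show "h = h0" using H_outer[OF F t fg(6)] by simp
  next
    assume h: "h = h0"
    obtain u v where u: "isF u" "touch u" "u \<notin> ghull K" "isv v" "v \<in> K" "v \<in> gclosure u" using outer_face .
    have uK: "u \<notin> K" using u(2) by (simp add: touch_def)
    obtain g where g: "g \<in> wf" "fst g \<in> K" "(v, H u) \<in> cverts g" using touch_corner[OF u(1) uK u(4,5,6)] by blast
    have uI: "(u, H u) \<in> I" using touch_face[OF u(1,2)] by simp
    have "(u, H u) \<notin> wf" using touch_not_wf[OF u(2)] .
    moreover have "cadj (u, H u) g"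
      by (rule cadjI[OF _ _ g(3)]) (use g(2) uK u in \<open>auto simp: cverts_face\<close>)
    ultimately show "cfloor I {g \<in> I. fst g \<in> K} h"
      unfolding cfloor_def pr using uI g u(3) wf_subset H_outer[OF u(1-3)] h
      by (intro bexI[of _ "(u, H u)"] conjI bexI[of _ g]) auto
  qed
qed

text \<open>The gap over \<open>K\<close> is closed by horizontal faces at floor height, and every
  component is moved so that its ceilings next to \<open>K\<close> come to that height.\<close>

definition J :: "cface set" where
  "J = {f. if fst f \<in> K then isF (fst f) \<and> snd f = h0 else (fst f, snd f + sft (fst f)) \<in> I}"

lemma J_in: "p \<in> K \<Longrightarrow> (p, t) \<in> J \<longleftrightarrow> isF p \<and> t = h0"
  by (simp add: J_def)

lemma J_notin: "p \<notin> K \<Longrightarrow> (p, t) \<in> J \<longleftrightarrow> (p, t + sft p) \<in> I"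
  by (simp add: J_def)

lemma J_near_face: "isF u \<Longrightarrow> u \<in> K \<or> touch u \<Longrightarrow> (u, t) \<in> J \<longleftrightarrow> t = h0"
  using J_in[of u t] J_notin[of u t] touch_face[of u "t + sft u"] sft_touch[of u] by (cases "u \<in> K") auto

lemma J_near_edge: "ise e \<Longrightarrow> e \<in> K \<or> touch e \<Longrightarrow> (e, t) \<notin> J"
  using J_in[of e t] J_notin[of e t] touch_edge(1)[of e "t + sft e"] kind_disj(4)[of e] by (auto simp: touch_def)

lemma near: "q \<in> K \<Longrightarrow> q \<in> gclosure p \<Longrightarrow> p \<in> K \<or> touch p"
  using touchI by blast

text \<open>Near \<open>K\<close> the new set is flat at height \<open>h0\<close>. Around a vertex
  or an edge off \<open>K\<close> everything is moved by the same amount, so evenness is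
  inherited.\<close>

lemma ceven_J: "ceven J"
  unfolding ceven_def
proof (intro conjI ballI allI impI)
  fix p assume p: "p \<in> J" then show "\<not> isv (fst p)"
    using not_isv[of "(fst p, snd p + sft (fst p))"] kind_disj(1)[of "fst p"]
    by (cases "fst p \<in> K") (auto simp: J_def)
next
  fix v :: gpt and t :: int assume v: "isv v"
  note S1 = isv_star[OF v, of 1 1, simplified] and S2 = isv_star[OF v, of "-1" "-1", simplified]
  show "((((fst v + 1, snd v), t) \<in> J) \<noteq> (((fst v - 1, snd v), t) \<in> J)) =
        ((((fst v, snd v + 1), t) \<in> J) \<noteq> (((fst v, snd v - 1), t) \<in> J))"
  proof (cases "v \<in> K")
    case True
    then show ?thesis
      using J_near_edge[OF S1(1) near[OF True S1(4)], of t] J_near_edge[OF S1(2) near[OF True S1(5)], of t]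
        J_near_edge[OF S2(1) near[OF True S2(4)], of t] J_near_edge[OF S2(2) near[OF True S2(5)], of t] by simp
  next
    case False
    have m: "(p, t) \<in> J \<longleftrightarrow> (p, t + sft v) \<in> I" if "v \<in> gclosure p" for p
      using J_notin[of p t] sft_coface[OF False that] K_down[of p v] that False by auto
    have ev: "((((fst v + 1, snd v), t + sft v) \<in> I) \<noteq> (((fst v - 1, snd v), t + sft v) \<in> I)) =
        ((((fst v, snd v + 1), t + sft v) \<in> I) \<noteq> (((fst v, snd v - 1), t + sft v) \<in> I))"
      using even_I v unfolding ceven_def by blast
    show ?thesis using ev m[OF S1(4)] m[OF S1(5)] m[OF S2(4)] m[OF S2(5)] by simp
  qed
next
  fix e :: gpt and t :: int assume e: "ise e"
  let ?u = "side 1 e" and ?w = "side (-1) e"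
  have uw: "isF ?u" "isF ?w" "e \<in> gclosure ?u" "e \<in> gclosure ?w"
    using isF_side[OF e, of 1] isF_side[OF e, of "-1"] edge_in_gclosure_side[OF e, of 1] edge_in_gclosure_side[OF e, of "-1"] by auto
  show "(((?u, t) \<in> J) \<noteq> ((?w, t) \<in> J)) = (((e, t) \<in> J) \<noteq> ((e, t - 1) \<in> J))"
  proof (cases "e \<in> K")
    case True
    then show ?thesis
      using J_near_face[OF uw(1) near[OF True uw(3)], of t] J_near_face[OF uw(2) near[OF True uw(4)], of t]
        J_near_edge[OF e, of t] J_near_edge[OF e, of "t - 1"] by simp
  next
    case False
    have m: "(p, t) \<in> J \<longleftrightarrow> (p, t + sft e) \<in> I" if "e \<in> gclosure p" for p t
      using J_notin[of p t] sft_coface[OF False that] K_down[of p e] that False by auto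
    have c: "t - 1 + sft e = t + sft e - 1" by simp
    show ?thesis using m[OF uw(3), of t] m[OF uw(4), of t] m[OF gclosure_refl, of t] m[OF gclosure_refl, of "t - 1", unfolded c]
        ceven_edge[OF even_I e, of 1 "t + sft e"] by simp
  qed
qed

lemma far_outer: "p \<in> gfar (2 * int n) \<Longrightarrow> p \<notin> K \<and> p \<notin> ghull K \<and> sft p = 0"
  using gfar_not_in_ghull[OF _ K_far, of p] K_far sft_outer by auto

lemma outL_J: "outL n \<subseteq> J"
proof
  fix f assume f: "f \<in> outL n"
  then have "fst f \<in> gfar (2 * int n)" by (simp add: outL_def)
  then show "f \<in> J" using far_outer f out by (auto simp: J_def)
qed

lemma J_outL: assumes "p \<notin> K" shows "(p, t) \<in> outL n \<longleftrightarrow> (p, t + sft p) \<in> outL n"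
  using far_outer[of p] by (auto simp: outL_def)

definition C :: "cface \<Rightarrow> bool" where "C j \<longleftrightarrow> (\<exists>g\<in>outL n. linked cadj J g j)"

lemma C_step: "C j \<Longrightarrow> j \<in> J \<Longrightarrow> j' \<in> J \<Longrightarrow> p \<in> cverts j \<Longrightarrow> p \<in> cverts j' \<Longrightarrow> C j'"
  unfolding C_def using linked_trans linked_common_vertex[of j J j' p] by metis

lemma common_coface:
  assumes "\<not> isv p" "isv v" "v \<in> gclosure p" "isv v'" "v' \<in> gclosure p"
  obtains u where "isF u" "v \<in> gclosure u" "v' \<in> gclosure u"
proof (cases "isF p")
  case True then show thesis using that assms by blast
next
  case False
  then have "ise p" using assms(1) kind_cases by blast
  then have "isF (side 1 p)" "p \<in> gclosure (side 1 p)" using isF_side[of p 1] edge_in_gclosure_side[of p 1] by auto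
  then show thesis using that[of "side 1 p"] gclosure_trans assms(3,5) by blast
qed

lemma C_around:
  assumes "\<not> isv p" "p \<in> K" "isv v" "v \<in> gclosure p" "isF u" "v \<in> gclosure u" "C (u, h0)"
    and "isv v'" "v' \<in> gclosure p" "isF u'" "v' \<in> gclosure u'"
  shows "C (u', h0)"
proof -
  obtain w where w: "isF w" "v \<in> gclosure w" "v' \<in> gclosure w" using common_coface[OF assms(1,3,4,8,9)] .
  have vK: "v \<in> K" "v' \<in> K" using K_down assms by blast+
  have J: "(u, h0) \<in> J" "(w, h0) \<in> J" "(u', h0) \<in> J"
    using J_near_face[OF assms(5) near[OF vK(1) assms(6)], of h0] J_near_face[OF w(1) near[OF vK(1) w(2)], of h0]
      J_near_face[OF assms(10) near[OF vK(2) assms(11)], of h0] by simp_all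
  have "C (w, h0)" by (rule C_step[OF assms(7) J(1,2), of "(v, h0)"]) (use assms w in \<open>auto simp: cverts_face\<close>)
  then show ?thesis by (rule C_step[OF _ J(2,3), of "(v', h0)"]) (use assms w in \<open>auto simp: cverts_face\<close>)
qed

text \<open>A path in \<open>I\<close> is carried over to \<open>J\<close> step by step. A face over
  \<open>K\<close> has no image; for it the invariant \<open>Q\<close> says that all floor faces at
  the vertices of its projection have been reached.\<close>

lemma J_connected: assumes j: "j \<in> J" shows "\<exists>g\<in>outL n. linked cadj J g j"
proof -
  define Q where "Q f \<longleftrightarrow> (if fst f \<in> K then \<forall>v u. isv v \<longrightarrow> v \<in> gclosure (fst f) \<longrightarrow> isF u \<longrightarrow> v \<in> gclosure u \<longrightarrow> C (u, h0)
     else C (fst f, snd f - sft (fst f)))" for f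
  have Jd: "(fst f, snd f - sft (fst f)) \<in> J" if "f \<in> I" "fst f \<notin> K" for f
    using J_notin[OF that(2), of "snd f - sft (fst f)"] that(1) by simp
  have ceil: "isF (fst f) \<and> snd f - sft (fst f) = h0" if f: "f \<in> I" "fst f \<notin> K" "v \<in> K" "v \<in> gclosure (fst f)" for f v
  proof -
    have t: "touch (fst f)" using touchI f by blast
    have "f \<notin> wf" using touch_not_wf[OF t, of "snd f"] by simp
    then have F: "isF (fst f)" using f(1) by (auto simp: wf_def)
    then show ?thesis using touch_face[OF F t, of "snd f"] sft_touch[OF F t] f(1) by simp
  qed
  have Qall: "Q f" if "linked cadj I g f" "g \<in> outL n" for f g
    using that(1)
  proof (induction rule: linked_induct)
    case base
    have "fst g \<in> gfar (2 * int n)" using that(2) by (simp add: outL_def)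
    then show ?case using that(2) far_outer[of "fst g"] linked_refl[of cadj J g] by (auto simp: Q_def C_def)
  next
    case (step f k)
    then obtain v h where vh: "(v, h) \<in> cverts f" "(v, h) \<in> cverts k" unfolding cadj_def by force
    have v: "isv v" "v \<in> gclosure (fst f)" "v \<in> gclosure (fst k)" using vh by (auto simp: cverts_def)
    have ni: "\<not> isv (fst f)" "\<not> isv (fst k)" using step not_isv by blast+
    show ?case
    proof (cases "v \<in> K")
      case False
      then have nK: "fst f \<notin> K" "fst k \<notin> K" using v K_down by blast+
      have s: "sft (fst f) = sft v" "sft (fst k) = sft v" using sft_coface[OF False] v by blast+
      have "C (fst f, snd f - sft (fst f))" using step nK by (simp add: Q_def)
      then have "C (fst k, snd k - sft (fst k))"
        by (rule C_step[OF _ Jd[OF step(2) nK(1)] Jd[OF step(3) nK(2)], of "(v, h - sft v)"])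
           (use vh s in \<open>auto simp: cverts_def\<close>)
      then show ?thesis using nK by (simp add: Q_def)
    next
      case vK: True
      have uf: "\<exists>u. isF u \<and> v \<in> gclosure u \<and> C (u, h0)"
      proof (cases "fst f \<in> K")
        case True
        obtain w where w: "isF w" "v \<in> gclosure w" using common_coface[OF ni(1) v(1,2) v(1,2)] .
        then have "C (w, h0)" using step.IH True v unfolding Q_def by metis
        then show ?thesis using w by blast
      next
        case False
        then have "C (fst f, h0)" "isF (fst f)" using step ceil[OF step(2) False vK v(2)] by (auto simp: Q_def)
        then show ?thesis using v by blast
      qed
      then obtain u where u: "isF u" "v \<in> gclosure u" "C (u, h0)" by blast
      show ?thesis
      proof (cases "fst k \<in> K")
        case True
        then show ?thesis unfolding Q_def using C_around[OF ni(2) True v(1,3) u] by simp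
      next
        case False
        note c = ceil[OF step(3) False vK v(3)]
        have "(u, h0) \<in> J" using J_near_face[OF u(1) near[OF vK u(2)]] by simp
        moreover have "(fst k, h0) \<in> J" using Jd[OF step(3) False] c by simp
        ultimately have "C (fst k, h0)"
          using C_step[OF u(3), of "(fst k, h0)" "(v, h0)"] c u v by (simp add: cverts_face)
        then show ?thesis using False c by (simp add: Q_def)
      qed
    qed
  qed
  have Q: "Q f" if "f \<in> I" for f using Qall conn[OF that] by blast
  show ?thesis
  proof (cases "fst j \<in> K")
    case False
    then have "(fst j, snd j + sft (fst j)) \<in> I" using j by (simp add: J_def)
    from Q[OF this] show ?thesis using False by (simp add: Q_def C_def)
  next
    case True
    then have F: "isF (fst j)" "snd j = h0" using j by (auto simp: J_def)
    \<comment> \<open>No column is empty, so the old wall has a face over this floor face, and the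
      invariant at that face reaches the floor.\<close>
    obtain t where t: "(fst j, t) \<in> I" using column_nonempty[OF F(1)] .
    let ?v = "(fst (fst j) + 1, snd (fst j) + 1)"
    have "isv ?v" "?v \<in> gclosure (fst j)" using F(1) by (simp_all add: isv_def isF_def gclosure_def)
    then have "C (fst j, h0)" using Q[OF t] True F unfolding Q_def fst_conv by metis
    then show ?thesis using F unfolding C_def by (metis prod.collapse)
  qed
qed

lemma J_split: "J - outL n = {f. fst f \<in> K \<and> isF (fst f) \<and> snd f = h0} \<union>
    (\<lambda>f. (fst f, snd f - sft (fst f))) ` {f \<in> I - outL n. fst f \<notin> K}" (is "_ = ?L \<union> ?d ` ?A")
proof (intro set_eqI iffI)
  fix f assume f: "f \<in> J - outL n"
  show "f \<in> ?L \<union> ?d ` ?A"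
  proof (cases "fst f \<in> K")
    case False
    then have "(fst f, snd f + sft (fst f)) \<in> ?A"
      using f J_outL[OF False, of "snd f"] by (auto simp: J_def)
    then have "?d (fst f, snd f + sft (fst f)) \<in> ?d ` ?A" by (rule imageI)
    then show ?thesis by simp
  qed (use f in \<open>auto simp: J_def\<close>)
next
  fix f assume f: "f \<in> ?L \<union> ?d ` ?A"
  show "f \<in> J - outL n"
  proof (cases "f \<in> ?L")
    case True
    then have "fst f \<notin> gfar (2 * int n)" using far_outer[of "fst f"] by auto
    then show ?thesis using True by (auto simp: J_def outL_def)
  next
    case False
    then obtain g where g: "g \<in> I" "g \<notin> outL n" "fst g \<notin> K" "f = ?d g" using f by blast
    then show ?thesis using J_outL[OF g(3), of "snd g - sft (fst g)"] by (auto simp: J_def)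
  qed
qed

lemma iface_J: "iface n J"
proof
  show "ceven J" by (rule ceven_J)
  show "outL n \<subseteq> J" by (rule outL_J)
  have "finite {f. fst f \<in> K \<and> isF (fst f) \<and> snd f = h0}"
    by (rule finite_subset[of _ "K \<times> {h0}"]) (use finite_K in auto)
  moreover have "finite {f \<in> I - outL n. fst f \<notin> K}" by (rule finite_subset[OF _ fin]) auto
  ultimately show "finite (J - outL n)" unfolding J_split by blast
  show "f \<in> outL n \<or> fst f \<notin> gfar (2 * int n)" if "f \<in> J" for f
  proof (cases "fst f \<in> K")
    case True then show ?thesis using far_outer by blast
  next
    case False
    then have I: "(fst f, snd f + sft (fst f)) \<in> I" using that by (simp add: J_def)
    show ?thesis using box[OF I] J_outL[OF False, of "snd f"] by simp
  qed
  show "\<exists>g\<in>outL n. linked cadj J g f" if "f \<in> J" for f using J_connected[OF that] .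
qed

text \<open>Off \<open>K\<close> the faces correspond one to one; over \<open>K\<close> the wall is
  exchanged for one horizontal face per face of the projection. The difference is the excess
  area.\<close>

lemma card_J: "card (I - outL n) + card {u \<in> K. isF u} = card (J - outL n) + card {g \<in> I. fst g \<in> K}"
proof -
  let ?L = "{f. fst f \<in> K \<and> isF (fst f) \<and> snd f = h0}" and ?A = "{f \<in> I - outL n. fst f \<notin> K}" and ?W = "{g \<in> I. fst g \<in> K}"
  let ?d = "\<lambda>f :: cface. (fst f, snd f - sft (fst f))"
  have finL: "finite ?L" by (rule finite_subset[of _ "K \<times> {h0}"]) (use finite_K in auto)
  have "?L = (\<lambda>u. (u, h0)) ` {u \<in> K. isF u}" by force
  then have cL: "card ?L = card {u \<in> K. isF u}" by (simp add: card_image inj_on_def)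
  have inj: "inj_on ?d ?A" by (auto simp: inj_on_def)
  have "card (J - outL n) = card ?L + card (?d ` ?A)"
    unfolding J_split
  proof (rule card_Un_disjoint[OF finL])
    have "finite ?A" by (rule finite_subset[OF _ fin]) auto
    then show "finite (?d ` ?A)" by blast
  qed auto
  then have 1: "card (J - outL n) = card {u \<in> K. isF u} + card ?A" using cL card_image[OF inj] by simp
  have W: "?W \<inter> outL n = {}" using far_outer by (auto simp: outL_def)
  then have eq: "I - outL n = ?W \<union> ?A" by blast
  have fW: "finite ?W" "finite ?A" using W by (auto intro!: finite_subset[OF _ fin])
  have "card (I - outL n) = card (?W \<union> ?A)" by (rule arg_cong[OF eq])
  also have "\<dots> = card ?W + card ?A" using fW by (intro card_Un_disjoint) auto
  finally have "card (I - outL n) = card ?W + card ?A" .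
  then show ?thesis using 1 by simp
qed

lemma wf_J: "j \<in> iface.wf J \<longleftrightarrow> fst j \<notin> K \<and> (fst j, snd j + sft (fst j)) \<in> wf"
proof -
  interpret J: iface n J by (rule iface_J)
  show ?thesis
  proof (cases "fst j \<in> K")
    case True
    have "j \<notin> J.wf"
    proof
      assume "j \<in> J.wf"
      then have j: "j \<in> J" "\<not> (isF (fst j) \<and> (\<forall>g\<in>J. fst g = fst j \<longrightarrow> g = j))" by (auto simp: J.wf_def)
      have "isF (fst j)" "snd j = h0" using j(1) True by (auto simp: J_def)
      moreover have "g = j" if "g \<in> J" "fst g = fst j" for g
        using that True \<open>snd j = h0\<close> by (auto simp: J_def prod_eq_iff)
      ultimately show False using j(2) by blast
    qed
    then show ?thesis using True by blast
  next
    case False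
    let ?u = "\<lambda>f :: cface. (fst f, snd f + sft (fst f))"
    have m: "g \<in> J \<longleftrightarrow> ?u g \<in> I" if "fst g = fst j" for g using False that by (simp add: J_def)
    have "(\<forall>g\<in>J. fst g = fst j \<longrightarrow> g = j) \<longleftrightarrow> (\<forall>g\<in>I. fst g = fst j \<longrightarrow> g = ?u j)"
    proof
      assume A: "\<forall>g\<in>J. fst g = fst j \<longrightarrow> g = j"
      show "\<forall>g\<in>I. fst g = fst j \<longrightarrow> g = ?u j"
      proof (intro ballI impI)
        fix g assume g: "g \<in> I" "fst g = fst j"
        have "(fst j, snd g) \<in> I" using g by (metis prod.collapse)
        then have "(fst g, snd g - sft (fst g)) \<in> J" using False g(2) by (simp add: J_def)
        then have "(fst g, snd g - sft (fst g)) = j" using A g(2) by simp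
        then have "j = (fst g, snd g - sft (fst g))" by (rule sym)
        then show "g = ?u j" by simp
      qed
    next
      assume A: "\<forall>g\<in>I. fst g = fst j \<longrightarrow> g = ?u j"
      show "\<forall>g\<in>J. fst g = fst j \<longrightarrow> g = j"
      proof (intro ballI impI)
        fix g assume g: "g \<in> J" "fst g = fst j"
        then have "?u g = ?u j" using A m by simp
        then show "g = j" using g(2) by (auto simp: prod_eq_iff)
      qed
    qed
    then show ?thesis using False m[of j] unfolding J.wf_def wf_def mem_Collect_eq fst_conv by blast
  qed
qed


lemma wf_I_J: assumes "f \<in> wf" "fst f \<notin> K" shows "(fst f, snd f - sft (fst f)) \<in> iface.wf J"
  using wf_J[of "(fst f, snd f - sft (fst f))"] assms by simp

lemma shift_vertex:
  assumes "v \<notin> K" "(v, h) \<in> cverts f"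
  shows "(v, h - sft v) \<in> cverts (fst f, snd f - sft (fst f))" "fst f \<notin> K" "sft (fst f) = sft v"
proof -
  have v: "v \<in> gclosure (fst f)" using cverts_isv[OF assms(2)] by blast
  show "fst f \<notin> K" using assms(1) v K_down by blast
  show s: "sft (fst f) = sft v" by (rule sft_coface[OF assms(1) v])
  show "(v, h - sft v) \<in> cverts (fst f, snd f - sft (fst f))" using assms(2) s by (auto simp: cverts_def)
qed

lemma unshift_vertex:
  assumes "v \<notin> K" "(v, h) \<in> cverts j"
  shows "(v, h + sft v) \<in> cverts (fst j, snd j + sft (fst j))"
proof -
  have "v \<in> gclosure (fst j)" using cverts_isv[OF assms(2)] by blast
  then have "sft (fst j) = sft v" by (rule sft_coface[OF assms(1)])
  then show ?thesis using assms(2) by (auto simp: cverts_def)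
qed

lemma wf_near: assumes "f \<in> wf" "fst f \<notin> K" "v \<in> gclosure (fst f)" shows "v \<notin> K"
  using K_max assms by blast

lemma linked_down:
  assumes "linked cadj wf f g" "f \<in> wf" "fst f \<notin> K"
  shows "linked cadj (iface.wf J) (fst f, snd f - sft (fst f)) (fst g, snd g - sft (fst g)) \<and> fst g \<notin> K \<and> sft (fst g) = sft (fst f)"
  using assms(1)
proof (induction rule: linked_induct)
  case (step y z)
  then obtain v h where vh: "(v, h) \<in> cverts y" "(v, h) \<in> cverts z" unfolding cadj_def by force
  have "fst y \<notin> K" using step.IH by simp
  have v: "v \<notin> K" by (rule wf_near[OF step(2) \<open>fst y \<notin> K\<close>]) (use cverts_isv[OF vh(1)] in blast)
  note a = shift_vertex[OF v vh(1)] and b = shift_vertex[OF v vh(2)]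
  have "linked cadj (iface.wf J) (fst y, snd y - sft (fst y)) (fst z, snd z - sft (fst z))"
    by (rule linked_common_vertex[OF wf_I_J[OF step(2) a(2)] wf_I_J[OF step(3) b(2)] a(1) b(1)])
  then have "linked cadj (iface.wf J) (fst f, snd f - sft (fst f)) (fst z, snd z - sft (fst z))"
    by (rule linked_trans[OF conjunct1[OF step.IH]])
  then show ?case using step.IH a(2,3) b(2,3) by simp
qed (use assms in simp)

lemma linked_up:
  assumes "linked cadj (iface.wf J) j k" "j \<in> iface.wf J"
  shows "linked cadj wf (fst j, snd j + sft (fst j)) (fst k, snd k + sft (fst k)) \<and> fst k \<notin> K \<and> sft (fst k) = sft (fst j)"
  using assms(1)
proof (induction rule: linked_induct)
  case base
  then show ?case using assms(2) wf_J[of j] by simp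
next
  case (step y z)
  then obtain v h where vh: "(v, h) \<in> cverts y" "(v, h) \<in> cverts z" unfolding cadj_def by force
  have y: "fst y \<notin> K" "(fst y, snd y + sft (fst y)) \<in> wf" and z: "fst z \<notin> K" "(fst z, snd z + sft (fst z)) \<in> wf"
    using wf_J step by blast+
  have v: "v \<notin> K" using wf_near[OF y(2)] y(1) cverts_isv[OF vh(1)] by simp
  have "linked cadj wf (fst y, snd y + sft (fst y)) (fst z, snd z + sft (fst z))"
    by (rule linked_common_vertex[OF y(2) z(2) unshift_vertex[OF v vh(1)] unshift_vertex[OF v vh(2)]])
  then have "linked cadj wf (fst j, snd j + sft (fst j)) (fst z, snd z + sft (fst z))"
    by (rule linked_trans[OF conjunct1[OF step.IH]])
  moreover have "sft (fst y) = sft v" "sft (fst z) = sft v"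
    using cverts_isv[OF vh(1)] cverts_isv[OF vh(2)] by (blast intro: sft_coface[OF v])+
  ultimately show ?case using step.IH z by simp
qed

text \<open>Another wall avoids \<open>K\<close> together with the closures of its projections, so
  the shift is the same for all of its faces and it moves rigidly.\<close>

lemma wall_down:
  assumes "V \<in> cwalls I" "\<exists>f\<in>V. fst f \<notin> K"
  obtains s where "cshift (- s) V \<in> cwalls J" "\<And>f. f \<in> V \<Longrightarrow> fst f \<notin> K \<and> sft (fst f) = s"
proof -
  obtain f0 where f0: "f0 \<in> V" "fst f0 \<notin> K" using assms by blast
  obtain f1 where f1: "f1 \<in> wf" "V = {g. linked cadj wf f1 g}" using assms(1) by (auto simp: cwalls_def)
  have f0w: "f0 \<in> wf" using linked_in[of cadj wf f1 f0] f0 f1 by blast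
  have V: "V = {g. linked cadj wf f0 g}"
  proof -
    have l: "linked cadj wf f1 f0" using f0 f1 by blast
    show ?thesis unfolding f1(2) by (rule linked_class[OF symp_cadj l])
  qed
  define s where "s = sft (fst f0)"
  have Vs: "fst f \<notin> K \<and> sft (fst f) = s" if "f \<in> V" for f
    using linked_down[OF _ f0w f0(2), of f] that V s_def by blast
  let ?j = "(fst f0, snd f0 - s)"
  have jw: "?j \<in> iface.wf J" using wf_I_J[OF f0w f0(2)] s_def by simp
  have "cshift (- s) V = {k. linked cadj (iface.wf J) ?j k}"
  proof (intro set_eqI iffI)
    fix k assume "k \<in> cshift (- s) V"
    then have "(fst k, snd k + s) \<in> V" using mem_cshift[of "fst k" "snd k" "- s" V] by simp
    then have k: "linked cadj wf f0 (fst k, snd k + s)" using V by blast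
    have "sft (fst k) = s" using linked_down[OF k f0w f0(2)] by (simp add: s_def)
    then show "k \<in> {k. linked cadj (iface.wf J) ?j k}"
      using linked_down[OF k f0w f0(2)] by (simp add: s_def)
  next
    fix k assume "k \<in> {k. linked cadj (iface.wf J) ?j k}"
    then have k: "linked cadj (iface.wf J) ?j k" by simp
    have ks: "sft (fst k) = sft (fst f0)" using linked_up[OF k jw] by (simp add: s_def)
    have "linked cadj wf f0 (fst k, snd k + s)" using conjunct1[OF linked_up[OF k jw], unfolded ks] by (simp add: s_def)
    then have "(fst k, snd k + s) \<in> V" using V by blast
    then show "k \<in> cshift (- s) V" using mem_cshift[of "fst k" "snd k" "- s" V] by simp
  qed
  then have "cshift (- s) V \<in> cwalls J" using jw unfolding cwalls_def by blast
  then show thesis using that Vs by blast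
qed

lemma floor_down:
  assumes V: "V \<in> cwalls I" and s: "\<And>f. f \<in> V \<Longrightarrow> fst f \<notin> K \<and> sft (fst f) = s" and h: "cfloor I V h"
  shows "cfloor J (cshift (- s) V) (h - s)"
proof -
  obtain f g where fg: "f \<in> I" "f \<notin> wf" "g \<in> V" "cadj f g" "fst f \<notin> ghull (cproj V)" "snd f = h"
    using h unfolding cfloor_def by blast
  have gw: "g \<in> wf" using wall_component(3)[OF V] fg by blast
  obtain v t where vt: "(v, t) \<in> cverts f" "(v, t) \<in> cverts g" using fg(4) unfolding cadj_def by force
  have v: "v \<notin> K" using wf_near[OF gw] s[OF fg(3)] cverts_isv[OF vt(2)] by blast
  note a = shift_vertex[OF v vt(1)] and b = shift_vertex[OF v vt(2)]
  have sv: "sft v = s" using b(3) s[OF fg(3)] by simp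
  let ?f = "(fst f, snd f - s)" and ?g = "(fst g, snd g - s)"
  have "?f \<in> J" using J_notin[OF a(2), of "snd f - s"] a(3) sv fg(1) by simp
  moreover have "?f \<notin> iface.wf J" using wf_J[of ?f] a(3) sv fg(2) by simp
  moreover have "?g \<in> cshift (- s) V" using fg(3) mem_cshift[of "fst g" "snd g - s" "- s" V] by simp
  moreover have "cadj ?f ?g"
  proof (rule cadjI)
    show "?f \<noteq> ?g" using fg(4) by (auto simp: cadj_def prod_eq_iff)
    show "(v, t - sft v) \<in> cverts ?f" "(v, t - sft v) \<in> cverts ?g" using a(1,3) b(1,3) sv by simp_all
  qed
  ultimately show ?thesis using fg(5,6) unfolding cfloor_def by auto
qed

end

context iface begin

lemma floor_unique: assumes "W \<in> cwalls I" shows "\<exists>h. \<forall>k. cfloor I W k \<longleftrightarrow> k = h"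
proof -
  interpret W: iface_comp n I "cproj W" by (rule wall_component[OF assms])
  show ?thesis using W.floor_iff wall_component(2)[OF assms] by metis
qed

end

lemma cshift_disjoint_neq: "cproj V \<inter> cproj W = {} \<Longrightarrow> V \<noteq> {} \<Longrightarrow> cshift k V \<noteq> cshift l W"
proof
  assume a: "cproj V \<inter> cproj W = {}" "V \<noteq> {}" "cshift k V = cshift l W"
  then have "cproj V = cproj W" using cproj_cshift by metis
  moreover have "cproj V \<noteq> {}" using a(2) gclosure_refl unfolding cproj_def by blast
  ultimately show False using a(1) by blast
qed

section \<open>The standard walls determine the interface\<close>

context iface begin

text \<open>The floor of another wall moves together with that wall, so translating the floor to
  height 0 cancels the shift and the standard wall is unchanged.\<close>

lemma cstd_delete:
  assumes W: "W \<in> cwalls I" "cfloor I W h"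
  shows "cstd (iface_comp.J I (cproj W)) = cstd I - {cshift (- h) W}" "iface_comp.h0 I (cproj W) = h"
proof -
  interpret W: iface_comp n I "cproj W" by (rule wall_component[OF W(1)])
  interpret J: iface n W.J by (rule W.iface_J)
  show h: "W.h0 = h" using W.floor_iff wall_component(2)[OF W(1)] W(2) by metis
  have notK: "fst f \<notin> cproj W" if V: "V \<in> cwalls I" "V \<noteq> W" "f \<in> V" for V f
    using cwalls_disjoint[OF V(1) W(1) V(2)] V(3) gclosure_refl unfolding cproj_def by blast
  show "cstd W.J = cstd I - {cshift (- h) W}"
  proof (intro set_eqI iffI)
    fix X assume "X \<in> cstd I - {cshift (- h) W}"
    then obtain V k where V: "V \<in> cwalls I" "cfloor I V k" "X = cshift (- k) V" "X \<noteq> cshift (- h) W"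
      unfolding cstd_def by blast
    have "V \<noteq> W"
    proof
      assume "V = W"
      then have "k = h" using floor_unique[OF W(1)] V(2) W(2) by metis
      then show False using V \<open>V = W\<close> by simp
    qed
    then have "\<exists>f\<in>V. fst f \<notin> cproj W" using notK[OF V(1)] wall_component(5)[OF V(1)] by blast
    from W.wall_down[OF V(1) this] obtain s where s: "cshift (- s) V \<in> cwalls W.J"
      "\<And>f. f \<in> V \<Longrightarrow> fst f \<notin> cproj W \<and> W.sft (fst f) = s" by blast
    have "cfloor W.J (cshift (- s) V) (k - s)" by (rule W.floor_down[OF V(1) s(2) V(2)])
    moreover have "X = cshift (- (k - s)) (cshift (- s) V)" by (simp add: V(3) cshift_cshift)
    ultimately show "X \<in> cstd W.J" using s(1) unfolding cstd_def by blast
  next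
    fix X assume "X \<in> cstd W.J"
    then obtain V' k' where V': "V' \<in> cwalls W.J" "cfloor W.J V' k'" "X = cshift (- k') V'" unfolding cstd_def by blast
    obtain j where j: "j \<in> J.wf" "V' = {k. linked cadj J.wf j k}" using V'(1) by (auto simp: cwalls_def)
    have ju: "fst j \<notin> cproj W" "(fst j, snd j + W.sft (fst j)) \<in> wf" using j(1) W.wf_J by blast+
    define V where "V = {g. linked cadj wf (fst j, snd j + W.sft (fst j)) g}"
    have V: "V \<in> cwalls I" unfolding V_def by (rule wall_of[OF ju(2)])
    have jV: "(fst j, snd j + W.sft (fst j)) \<in> V" unfolding V_def by simp
    have ex: "\<exists>f\<in>V. fst f \<notin> cproj W" using jV ju(1) by (intro bexI[OF _ jV]) simp
    from W.wall_down[OF V ex] obtain s where s: "cshift (- s) V \<in> cwalls W.J"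
      "\<And>f. f \<in> V \<Longrightarrow> fst f \<notin> cproj W \<and> W.sft (fst f) = s" by blast
    have "W.sft (fst j) = s" using s(2)[OF jV] by simp
    then have "j \<in> cshift (- s) V" using jV mem_cshift[of "fst j" "snd j" "- s" V] by simp
    then have "fst j \<in> cproj (cshift (- s) V)" using gclosure_refl unfolding cproj_def by blast
    moreover have "fst j \<in> cproj V'" using j gclosure_refl linked_refl unfolding cproj_def by blast
    ultimately have V'eq: "V' = cshift (- s) V" using J.cwalls_disjoint[OF s(1) V'(1)] by blast
    obtain k where k: "cfloor I V k" using floor_unique[OF V] by blast
    have "cfloor W.J V' (k - s)" unfolding V'eq by (rule W.floor_down[OF V s(2) k])
    then have "k' = k - s" using J.floor_unique[OF V'(1)] V'(2) by metis
    then have X: "X = cshift (- k) V" by (simp add: V'(3) V'eq cshift_cshift)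
    have "V \<noteq> W"
    proof
      assume "V = W"
      then have "fst j \<in> cproj W" using jV gclosure_refl unfolding cproj_def by force
      then show False using ju(1) by blast
    qed
    then have "X \<noteq> cshift (- h) W" unfolding X
      by (intro cshift_disjoint_neq cwalls_disjoint[OF V W(1)] wall_component(5)[OF V])
    then show "X \<in> cstd I - {cshift (- h) W}" using X V k unfolding cstd_def by blast
  qed
qed

lemma finite_cstd: "finite (cstd I)"
proof -
  define hh where "hh W = (THE h. cfloor I W h)" for W
  have hh: "cfloor I W k \<longleftrightarrow> k = hh W" if "W \<in> cwalls I" for W k
    using floor_unique[OF that] unfolding hh_def by (metis the_equality)
  have "cstd I \<subseteq> (\<lambda>W. cshift (- hh W) W) ` cwalls I"
  proof
    fix X assume "X \<in> cstd I"
    then obtain W k where W: "W \<in> cwalls I" "cfloor I W k" "X = cshift (- k) W" unfolding cstd_def by blast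
    then have "X = cshift (- hh W) W" using hh[OF W(1)] by simp
    then show "X \<in> (\<lambda>W. cshift (- hh W) W) ` cwalls I" using W(1) by blast
  qed
  moreover have "cwalls I \<subseteq> (\<lambda>f. {g. linked cadj wf f g}) ` wf" unfolding cwalls_def by blast
  then have "finite (cwalls I)" using finite_wf finite_subset by blast
  ultimately show ?thesis using finite_subset by blast
qed

lemma cstd_empty: assumes "cstd I = {}" shows "I = {(u, 0) | u. isF u}"
proof -
  have "cwalls I = {}" using assms floor_unique unfolding cstd_def by blast
  then have wf0: "wf = {}" using wall_of by blast
  have F: "isF (fst f)" "\<And>g. g \<in> I \<Longrightarrow> fst g = fst f \<Longrightarrow> g = f" if "f \<in> I" for f
    using that wf0 unfolding wf_def by blast+
  have z: "(u, 0) \<in> I" if u: "isF u" for u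
  proof (rule face_grid_induct[OF far_face(1) u, where P = "\<lambda>u. (u, 0) \<in> I"])
    show "((2 * int n + 1, 1), 0) \<in> I" using far_column[OF far_face, of 0] by simp
    fix e s assume e: "ise e" "\<bar>s :: int\<bar> = 1" "(side s e, 0) \<in> I"
    have "(e, t) \<notin> I" for t using F(1)[of "(e, t)"] kind_disj(4)[OF e(1)] by auto
    then show "(side (- s) e, 0) \<in> I" using ceven_edge[OF even_I e(1,2), of 0] e(3) by simp
  qed
  show ?thesis
  proof (intro set_eqI iffI)
    fix f :: cface assume f: "f \<in> I"
    have "(fst f, 0) = f" using F(2)[OF f, of "(fst f, 0)"] z[OF F(1)[OF f]] by simp
    then show "f \<in> {(u, 0) | u. isF u}" using F(1)[OF f] unfolding mem_Collect_eq by metis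
  next
    fix f :: cface assume "f \<in> {(u, 0) | u. isF u}"
    then show "f \<in> I" using z by blast
  qed
qed

end

text \<open>Induction on the number of walls. After deletion of the same standard wall the two
  interfaces are equal, and it remains to recover the floor height, which is read off next to
  \<open>K\<close>, and the shifts.\<close>

lemma cstd_inject:
  assumes "iface n I" "iface n I'" "cstd I = cstd I'"
  shows "I = I'"
  using assms
proof (induction "card (cstd I)" arbitrary: I I' rule: less_induct)
  case less
  interpret A: iface n I by fact
  interpret B: iface n I' by fact
  show ?case
  proof (cases "cstd I = {}")
    case True
    then show ?thesis using A.cstd_empty B.cstd_empty less.prems(3) by simp
  next
    case False
    then obtain X where X: "X \<in> cstd I" by blast
    then obtain W h where W: "W \<in> cwalls I" "cfloor I W h" "X = cshift (- h) W" unfolding cstd_def by blast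
    obtain W' h' where W': "W' \<in> cwalls I'" "cfloor I' W' h'" "X = cshift (- h') W'"
      using X less.prems(3) unfolding cstd_def by blast
    define K where "K = cproj X"
    have K: "cproj W = K" unfolding K_def W(3) by simp
    have K': "cproj W' = K" unfolding K_def W'(3) by simp
    note K = K K'
    interpret C: iface_comp n I K using A.wall_component(1)[OF W(1)] K by simp
    interpret D: iface_comp n I' K using B.wall_component(1)[OF W'(1)] K by simp
    note c = A.cstd_delete[OF W(1,2), unfolded K] and d = B.cstd_delete[OF W'(1,2), unfolded K]
    have std: "cstd C.J = cstd D.J" using c(1) d(1) W(3) W'(3) less.prems(3) by simp
    have "card (cstd C.J) < card (cstd I)"
      using c(1) X W(3) A.finite_cstd by (metis card_Diff1_less)
    then have J: "C.J = D.J" using less.hyps[OF _ C.iface_J D.iface_J std] by blast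
    obtain u0 v0 where u0: "isF u0" "C.touch u0" "u0 \<notin> ghull K" by (rule C.outer_face)
    have tt: "C.touch u \<longleftrightarrow> D.touch u" for u by (simp add: C.touch_def D.touch_def)
    have hh: "C.h0 = D.h0" using C.J_near_face[OF u0(1), of C.h0] D.J_near_face[OF u0(1), of C.h0] u0 tt J by simp
    have WW: "W = W'" using W(3) W'(3) c(2) d(2) hh by (metis add.right_inverse cshift_0 cshift_cshift)
    have onK: "(p, t) \<in> I \<longleftrightarrow> (p, t) \<in> I'" if "p \<in> K" for p t
      using A.wall_component(2)[OF W(1)] B.wall_component(2)[OF W'(1)] WW K that by auto
    \<comment> \<open>A disagreement of the shifts would propagate from face to face: over an edge
      of \<open>K\<close> the vertical faces agree, so evenness carries the discrepancy across. It
      would reach a far face, where both shifts vanish.\<close>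
    have sF: "C.sft u = D.sft u" if u: "isF u" "u \<notin> K" for u
    proof (rule ccontr)
      assume ne: "C.sft u \<noteq> D.sft u"
      have "(2 * int n + 1, 1) \<notin> K \<and> C.sft (2 * int n + 1, 1) \<noteq> D.sft (2 * int n + 1, 1)"
      proof (rule face_grid_induct[OF u(1) A.far_face(1), where P = "\<lambda>u. u \<notin> K \<and> C.sft u \<noteq> D.sft u"])
        show "u \<notin> K \<and> C.sft u \<noteq> D.sft u" using u ne by simp
        fix e s assume e: "ise e" "\<bar>s :: int\<bar> = 1" and P: "side s e \<notin> K \<and> C.sft (side s e) \<noteq> D.sft (side s e)"
        have ms: "\<bar>- s\<bar> = 1" using e(2) by simp
        note eu = edge_in_gclosure_side[OF e(1,2)] and ew = edge_in_gclosure_side[OF e(1) ms]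
        note uF = isF_side[OF e(1,2)] and wF = isF_side[OF e(1) ms]
        show "side (- s) e \<notin> K \<and> C.sft (side (- s) e) \<noteq> D.sft (side (- s) e)"
        proof (cases "e \<in> K")
          case False
          then show ?thesis using P C.sft_coface[OF False eu] C.sft_coface[OF False ew]
              D.sft_coface[OF False eu] D.sft_coface[OF False ew] C.K_down[of "side (- s) e" e] ew by auto
        next
          case True
          have tu: "C.touch (side s e)" using C.touchI[OF _ eu True] P by blast
          then have tu': "D.touch (side s e)" using tt by simp
          have Hne: "C.H (side s e) \<noteq> D.H (side s e)"
            using C.sft_touch[OF uF tu] D.sft_touch[OF uF tu'] P hh by auto
          have ev: "((t = C.H (side s e)) \<noteq> ((side (- s) e, t) \<in> I)) = ((t = D.H (side s e)) \<noteq> ((side (- s) e, t) \<in> I'))" for t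
            using ceven_edge[OF A.even_I e, of t] ceven_edge[OF B.even_I e, of t] onK[OF True]
              C.touch_face[OF uF tu, of t] D.touch_face[OF uF tu', of t] by blast
          have wK: "side (- s) e \<notin> K"
          proof
            assume "side (- s) e \<in> K"
            then show False using ev[of "C.H (side s e)"] onK Hne by auto
          qed
          have tw: "C.touch (side (- s) e)" using C.touchI[OF wK ew True] .
          then have tw': "D.touch (side (- s) e)" using tt by simp
          have "C.H (side (- s) e) \<noteq> D.H (side (- s) e)"
            using ev[of "C.H (side s e)"] Hne C.touch_face[OF wF tw, of "C.H (side s e)"]
              D.touch_face[OF wF tw', of "C.H (side s e)"] by auto
          then show ?thesis using wK C.sft_touch[OF wF tw] D.sft_touch[OF wF tw'] hh by auto
        qed
      qed
      then show False using C.far_outer[OF A.far_face(2)] D.far_outer[OF A.far_face(2)] by simp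
    qed
    have s: "C.sft p = D.sft p" if p: "p \<notin> K" for p
    proof -
      have "\<exists>u. isF u \<and> p \<in> gclosure u"
      proof -
        consider "isF p" | "ise p" | "isv p" using kind_cases by blast
        then show ?thesis
        proof cases
          case 1 then show ?thesis by (intro exI[of _ p]) simp
        next
          case 2 then show ?thesis using isF_side[of p 1] edge_in_gclosure_side[of p 1] by (intro exI[of _ "side 1 p"]) simp
        next
          case 3 then show ?thesis using isv_star(3,6)[of p 1 1] by (intro exI[of _ "(fst p + 1, snd p + 1)"]) simp
        qed
      qed
      then obtain u where u: "isF u" "p \<in> gclosure u" by blast
      have "u \<notin> K" using C.K_down u(2) p by blast
      then show ?thesis using sF[OF u(1)] C.sft_coface[OF p u(2)] D.sft_coface[OF p u(2)] by simp
    qed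
    show ?thesis
    proof (intro set_eqI)
      fix f
      show "f \<in> I \<longleftrightarrow> f \<in> I'"
      proof (cases "fst f \<in> K")
        case True then show ?thesis using onK[OF True, of "snd f"] by simp
      next
        case False
        then show ?thesis using C.J_notin[OF False, of "snd f - C.sft (fst f)"] D.J_notin[OF False, of "snd f - C.sft (fst f)"]
            s[OF False] J by simp
      qed
    qed
  qed
qed

section \<open>Contours\<close>

lemma cadj_near:
  assumes "cadj f g"
  shows "g \<in> ({fst (fst f) - 2..fst (fst f) + 2} \<times> {snd (fst f) - 2..snd (fst f) + 2}) \<times> {snd f - 1..snd f + 1}"
proof -
  obtain v h where vh: "(v, h) \<in> cverts f" "(v, h) \<in> cverts g" using assms unfolding cadj_def by force
  have c: "\<bar>fst q - fst p\<bar> \<le> 1 \<and> \<bar>snd q - snd p\<bar> \<le> 1" if "q \<in> gclosure p" for p q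
    using that unfolding gclosure_def by auto
  have h: "h = snd f \<or> h = snd f + 1" "h = snd g \<or> h = snd g + 1" using vh by (auto simp: cverts_def)
  have "v \<in> gclosure (fst f)" "v \<in> gclosure (fst g)" using vh by (auto simp: cverts_def)
  from c[OF this(1)] c[OF this(2)] h show ?thesis unfolding mem_Times_iff atLeastAtMost_iff by linarith
qed

text \<open>75 = 5 * 5 * 3: projections differ by at most 2 in each doubled coordinate, heights by
  at most 1. The square 5625 is the base of the exponential counts below.\<close>

lemma cadj_card: "finite {g. cadj f g}" "card {g. cadj f g} \<le> 75"
proof -
  let ?B = "({fst (fst f) - 2..fst (fst f) + 2} \<times> {snd (fst f) - 2..snd (fst f) + 2}) \<times> {snd f - 1..snd f + 1}"
  have sub: "{g. cadj f g} \<subseteq> ?B" using cadj_near by blast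
  have "card ?B = 75" by (simp only: card_cartesian_product card_atLeastAtMost_int) simp
  then show "finite {g. cadj f g}" "card {g. cadj f g} \<le> 75"
    using finite_subset[OF sub] card_mono[OF _ sub] by auto
qed

lemma star_sets_card:
  "finite {S. finite S \<and> f \<in> S \<and> card S = k \<and> (\<forall>y\<in>S. linked cadj S f y)}"
  "card {S. finite S \<and> f \<in> S \<and> card S = k \<and> (\<forall>y\<in>S. linked cadj S f y)} \<le> 5625 ^ k"
  using linked_sets_card[of cadj 75 f k] cadj_card symp_cadj by auto

text \<open>A cell is encoded by its projection and the height of its bottom face.\<close>
definition fc1 :: "cface \<Rightarrow> cface" where
  "fc1 f = (if isF (fst f) then f else (side 1 (fst f), snd f))"
definition fc2 :: "cface \<Rightarrow> cface" where
  "fc2 f = (if isF (fst f) then (fst f, snd f - 1) else (side (-1) (fst f), snd f))"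

definition cbd :: "cface set \<Rightarrow> cface set" where
  "cbd M = {f. \<not> isv (fst f) \<and> (fc1 f \<in> M) \<noteq> (fc2 f \<in> M)}"

definition cnb :: "cface \<Rightarrow> cface \<Rightarrow> bool" where
  "cnb c d \<longleftrightarrow> (\<exists>f. \<not> isv (fst f) \<and> (c = fc1 f \<and> d = fc2 f \<or> c = fc2 f \<and> d = fc1 f))"

lemma cbd_face: "isF u \<Longrightarrow> (u, t) \<in> cbd M \<longleftrightarrow> ((u, t) \<in> M) \<noteq> ((u, t - 1) \<in> M)"
  using kind_disj(1)[of u] by (simp add: cbd_def fc1_def fc2_def)

lemma cbd_edge: "ise e \<Longrightarrow> (e, t) \<in> cbd M \<longleftrightarrow> ((side 1 e, t) \<in> M) \<noteq> ((side (-1) e, t) \<in> M)"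
  using kind_disj(3,4)[of e] by (simp add: cbd_def fc1_def fc2_def)

lemma ceven_cbd: "ceven (cbd M)"
  unfolding ceven_def
proof (intro conjI ballI allI impI)
  fix p assume "p \<in> cbd M" then show "\<not> isv (fst p)" by (simp add: cbd_def)
next
  fix v :: gpt and t :: int assume v: "isv v"
  note S1 = isv_star[OF v, of 1 1, simplified] and S2 = isv_star[OF v, of "-1" "-1", simplified]
    and S3 = isv_star[OF v, of 1 "-1", simplified] and S4 = isv_star[OF v, of "-1" 1, simplified]
  show "((((fst v + 1, snd v), t) \<in> cbd M) \<noteq> (((fst v - 1, snd v), t) \<in> cbd M)) =
        ((((fst v, snd v + 1), t) \<in> cbd M) \<noteq> (((fst v, snd v - 1), t) \<in> cbd M))"
    using cbd_edge[OF S1(1), of t M] cbd_edge[OF S2(1), of t M] cbd_edge[OF S1(2), of t M] cbd_edge[OF S2(2), of t M]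
      S1(9,10) S2(9,10) S3(9,10) S4(9,10) by auto
next
  fix e :: gpt and t :: int assume e: "ise e"
  have uw: "isF (side 1 e)" "isF (side (-1) e)" using isF_side[OF e] by auto
  show "(((side 1 e, t) \<in> cbd M) \<noteq> ((side (-1) e, t) \<in> cbd M)) = (((e, t) \<in> cbd M) \<noteq> ((e, t - 1) \<in> cbd M))"
    using cbd_face[OF uw(1), of t M] cbd_face[OF uw(2), of t M] cbd_edge[OF e, of t M] cbd_edge[OF e, of "t - 1" M] by auto
qed

section \<open>Boundaries of sets of cells, and their insides\<close>

definition symd :: "'a set \<Rightarrow> 'a set \<Rightarrow> 'a set" where "symd A B = (A - B) \<union> (B - A)"

lemma mem_symd: "x \<in> symd A B \<longleftrightarrow> (x \<in> A) \<noteq> (x \<in> B)"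
  by (auto simp: symd_def)

lemma symd_symd: "symd (symd A B) B = A"
  by (auto simp: mem_symd set_eq_iff)

lemma cbd_symd: "cbd (symd M L) = symd (cbd M) (cbd L)"
  by (auto simp: cbd_def mem_symd set_eq_iff)

definition cells :: "cface set" where "cells = {c. isF (fst c)}"

lemma fc_cells: "\<not> isv (fst f) \<Longrightarrow> fc1 f \<in> cells \<and> fc2 f \<in> cells"
  using isF_side[of "fst f" 1] isF_side[of "fst f" "-1"] kind_cases[of "fst f"]
  by (auto simp: fc1_def fc2_def cells_def)

lemma finite_cbd: assumes "finite M" shows "finite (cbd M)"
proof -
  have *: "finite {f. \<not> isv (fst f) \<and> (fc1 f = c \<or> fc2 f = c)}" for c
  proof (rule finite_subset)
    show "{f. \<not> isv (fst f) \<and> (fc1 f = c \<or> fc2 f = c)} \<subseteq>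
      ({fst (fst c) - 1..fst (fst c) + 1} \<times> {snd (fst c) - 1..snd (fst c) + 1}) \<times> {snd c..snd c + 1}"
      by (auto simp: fc1_def fc2_def side_def split: if_splits)
  qed auto
  have "cbd M \<subseteq> (\<Union>c\<in>M. {f. \<not> isv (fst f) \<and> (fc1 f = c \<or> fc2 f = c)})" by (auto simp: cbd_def)
  then show ?thesis by (rule finite_subset) (use assms * in auto)
qed

text \<open>Submodularity of cuts, checked face by face. It makes the Ising weights satisfy the
  hypothesis of the four functions theorem.\<close>

lemma card_cbd_submodular:
  assumes "finite M" "finite L"
  shows "card (cbd (M \<union> L)) + card (cbd (M \<inter> L)) \<le> card (cbd M) + card (cbd L)"
proof -
  have fin: "finite (cbd M)" "finite (cbd L)" using assms finite_cbd by auto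
  have 1: "cbd (M \<union> L) \<union> cbd (M \<inter> L) \<subseteq> cbd M \<union> cbd L" by (auto simp: cbd_def)
  have 2: "cbd (M \<union> L) \<inter> cbd (M \<inter> L) \<subseteq> cbd M \<inter> cbd L" by (auto simp: cbd_def)
  have fin': "finite (cbd (M \<union> L))" "finite (cbd (M \<inter> L))" using assms finite_cbd by auto
  have "card (cbd (M \<union> L)) + card (cbd (M \<inter> L)) = card (cbd (M \<union> L) \<union> cbd (M \<inter> L)) + card (cbd (M \<union> L) \<inter> cbd (M \<inter> L))"
    using fin' by (rule card_Un_Int)
  also have "\<dots> \<le> card (cbd M \<union> cbd L) + card (cbd M \<inter> cbd L)"
    using fin 1 2 by (intro add_mono card_mono) auto
  also have "\<dots> = card (cbd M) + card (cbd L)" using card_Un_Int[OF fin] by simp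
  finally show ?thesis .
qed

text \<open>The inside of \<open>S\<close> in the sense of parity: an odd number of faces of
  \<open>S\<close> lies above the cell. For the boundary of a finite set of cells this recovers the
  set, by \<open>cpot_cbd\<close>.\<close>

definition cfill :: "cface set \<Rightarrow> cface set" where
  "cfill S = {c. isF (fst c) \<and> cpot S (fst c) (snd c)}"

lemma cbd_cfill:
  assumes S: "ceven S" "\<And>p t. (p, t) \<in> S \<Longrightarrow> t \<le> N"
  shows "cbd (cfill S) = S"
proof (intro set_eqI)
  fix f :: cface
  obtain p t where f: "f = (p, t)" by (cases f)
  have le: "\<And>t. (p, t) \<in> S \<Longrightarrow> t \<le> N" using S(2) by blast
  consider "isv p" | "isF p" | "ise p" using kind_cases by blast
  then show "f \<in> cbd (cfill S) \<longleftrightarrow> f \<in> S"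
  proof cases
    case 1 then show ?thesis using S(1) f unfolding ceven_def cbd_def by auto
  next
    case 2
    then show ?thesis using cbd_face[OF 2, of t] cpot_step[of p S N t, OF le] f by (auto simp: cfill_def)
  next
    case 3
    have "(cpot S (side 1 p) t \<noteq> cpot S (side (-1) p) t) \<longleftrightarrow> (p, t) \<in> S"
      using cpot_edge[OF S(1) _ 3, of N 1 t] S(2) by simp
    then show ?thesis using cbd_edge[OF 3, of t] isF_side[OF 3, of 1] isF_side[OF 3, of "-1"] f by (auto simp: cfill_def)
  qed
qed

lemma cpot_cbd:
  assumes "finite M" "isF u"
  shows "cpot (cbd M) u h \<longleftrightarrow> (u, h) \<in> M"
proof -
  obtain N where N: "\<And>p t. (p, t) \<in> M \<union> cbd M \<Longrightarrow> t \<le> N"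
  proof -
    have "finite (snd ` (M \<union> cbd M))" using assms finite_cbd by auto
    then have "\<forall>x\<in>snd ` (M \<union> cbd M). x \<le> Max (insert 0 (snd ` (M \<union> cbd M)))" by auto
    then show thesis using that by (metis image_eqI snd_conv)
  qed
  have le: "\<And>t. (u, t) \<in> cbd M \<Longrightarrow> t \<le> N" using N by blast
  have top: "cpot (cbd M) u k \<longleftrightarrow> (u, k) \<in> M" if "k > N" for k
    using cpot_top[of u "cbd M" N k] le N[of u k] that by auto
  have "cpot (cbd M) u (N + 1 - int k) \<longleftrightarrow> (u, N + 1 - int k) \<in> M" for k
  proof (induction k)
    case 0 show ?case using top[of "N + 1"] by simp
  next
    case (Suc k)
    define t where "t = N + 1 - int k"
    have t: "N + 1 - int (Suc k) = t - 1" by (simp add: t_def)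
    show ?case unfolding t using Suc[folded t_def] cpot_step[of u "cbd M" N t] le cbd_face[OF assms(2), of t M] by blast
  qed
  from this[of "nat (N + 1 - h)"] show ?thesis using top[of h] by (cases "h > N") auto
qed

text \<open>The faces around a lattice edge share a vertex, so a star-closed part contains all of
  those present in \<open>S\<close> or none of them.\<close>

lemma ceven_closed_subset:
  assumes S: "ceven S" and G: "G \<subseteq> S" "\<And>f g. f \<in> G \<Longrightarrow> g \<in> S \<Longrightarrow> cadj f g \<Longrightarrow> g \<in> G"
  shows "ceven G"
proof -
  have cl: "g \<in> G \<longleftrightarrow> g \<in> S" if "f \<in> G" "p \<in> cverts f" "p \<in> cverts g" for f g p
    using G that cadjI[of f g p] by (cases "f = g") blast+
  have all: "(\<forall>q\<in>Q. q \<notin> G) \<or> (\<forall>q\<in>Q. q \<in> G \<longleftrightarrow> q \<in> S)" if "\<And>q. q \<in> Q \<Longrightarrow> p \<in> cverts q" for Q p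
    using cl that by blast
  show ?thesis
    unfolding ceven_def
  proof (intro conjI ballI allI impI)
    fix p assume "p \<in> G" then show "\<not> isv (fst p)" using S G(1) unfolding ceven_def by blast
  next
    fix v :: gpt and t :: int assume v: "isv v"
    note S1 = isv_star[OF v, of 1 1, simplified] and S2 = isv_star[OF v, of "-1" "-1", simplified]
    let ?Q = "{((fst v + 1, snd v), t), ((fst v - 1, snd v), t), ((fst v, snd v + 1), t), ((fst v, snd v - 1), t)}"
    have "(v, t) \<in> cverts q" if "q \<in> ?Q" for q
      using that v S1 S2 by (auto simp: cverts_edge)
    from all[OF this] show "((((fst v + 1, snd v), t) \<in> G) \<noteq> (((fst v - 1, snd v), t) \<in> G)) =
        ((((fst v, snd v + 1), t) \<in> G) \<noteq> (((fst v, snd v - 1), t) \<in> G))"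
    proof
      assume "\<forall>q\<in>?Q. q \<in> G \<longleftrightarrow> q \<in> S"
      moreover have "((((fst v + 1, snd v), t) \<in> S) \<noteq> (((fst v - 1, snd v), t) \<in> S)) =
        ((((fst v, snd v + 1), t) \<in> S) \<noteq> (((fst v, snd v - 1), t) \<in> S))" using S v unfolding ceven_def by blast
      ultimately show ?thesis by simp
    next
      assume none: "\<forall>q\<in>?Q. q \<notin> G"
      have "((fst v + 1, snd v), t) \<notin> G" by (rule bspec[OF none]) simp
      moreover have "((fst v - 1, snd v), t) \<notin> G" by (rule bspec[OF none]) simp
      moreover have "((fst v, snd v + 1), t) \<notin> G" by (rule bspec[OF none]) simp
      moreover have "((fst v, snd v - 1), t) \<notin> G" by (rule bspec[OF none]) simp
      ultimately show ?thesis by blast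
    qed
  next
    fix e :: gpt and t :: int assume e: "ise e"
    let ?Q = "{(side 1 e, t), (side (-1) e, t), (e, t), (e, t - 1)}"
    have v: "isv (tip 1 e)" "tip 1 e \<in> gclosure e" using isv_tip[OF e, of 1] tip_in_gclosure[OF e, of 1] by auto
    have uw: "isF (side 1 e)" "isF (side (-1) e)" "e \<in> gclosure (side 1 e)" "e \<in> gclosure (side (-1) e)"
      using isF_side[OF e] edge_in_gclosure_side[OF e] by auto
    have "(tip 1 e, t) \<in> cverts q" if "q \<in> ?Q" for q
      using that v uw gclosure_trans[OF uw(3) v(2)] gclosure_trans[OF uw(4) v(2)]
      by (auto simp: cverts_face cverts_edge[OF e])
    from all[OF this] show "(((side 1 e, t) \<in> G) \<noteq> ((side (-1) e, t) \<in> G)) = (((e, t) \<in> G) \<noteq> ((e, t - 1) \<in> G))"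
    proof
      assume "\<forall>q\<in>?Q. q \<in> G \<longleftrightarrow> q \<in> S"
      then show ?thesis using ceven_edge[OF S e, of 1 t] by simp
    next
      assume none: "\<forall>q\<in>?Q. q \<notin> G"
      have "(side 1 e, t) \<notin> G" by (rule bspec[OF none]) simp
      moreover have "(side (-1) e, t) \<notin> G" by (rule bspec[OF none]) simp
      moreover have "(e, t) \<notin> G" by (rule bspec[OF none]) simp
      moreover have "(e, t - 1) \<notin> G" by (rule bspec[OF none]) simp
      ultimately show ?thesis by blast
    qed
  qed
qed

lemma odd_class:
  assumes "finite T" "odd (card T)"
  shows "\<exists>t\<in>T. odd (card {s \<in> T. cls s = cls t})"
proof (rule ccontr)
  assume neg: "\<not> ?thesis"
  have "card T = (\<Sum>y\<in>cls ` T. card {x. x \<in> T \<and> cls x = y})"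
    using sum.image_gen[OF assms(1), of "\<lambda>_. 1 :: nat" cls] by simp
  moreover have "even (\<Sum>y\<in>cls ` T. card {x. x \<in> T \<and> cls x = y})"
    using neg by (intro dvd_sum) auto
  ultimately show False using assms(2) by simp
qed

text \<open>A star-connected component of the boundary of \<open>M\<close> that encloses the cell
  \<open>b\<close>.\<close>

definition contour :: "cface set \<Rightarrow> cface \<Rightarrow> cface set \<Rightarrow> bool" where
  "contour M b \<gamma> \<longleftrightarrow> \<gamma> \<subseteq> cbd M \<and> (\<exists>f\<in>\<gamma>. \<gamma> = {g. linked cadj (cbd M) f g}) \<and> b \<in> cfill \<gamma>"

text \<open>An odd number of boundary faces lies above \<open>b\<close>; sorted by components, some
  component contributes an odd number.\<close>

lemma contour_exists:
  assumes "finite M" "b \<in> M" "isF (fst b)"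
  shows "\<exists>\<gamma>. contour M b \<gamma>"
proof -
  let ?T = "{t. snd b < t \<and> (fst b, t) \<in> cbd M}"
  let ?cls = "\<lambda>t. {g. linked cadj (cbd M) (fst b, t) g}"
  have "odd (card ?T)" using cpot_cbd[OF assms(1,3), of "snd b"] assms(2) by (simp add: cpot_def)
  moreover have "finite ?T"
  proof -
    have "?T \<subseteq> snd ` cbd M" by force
    then show ?thesis using finite_cbd[OF assms(1)] finite_subset by blast
  qed
  ultimately obtain t where t: "t \<in> ?T" "odd (card {s \<in> ?T. ?cls s = ?cls t})" using odd_class[of ?T ?cls] by blast
  have "{s \<in> ?T. ?cls s = ?cls t} = {s. snd b < s \<and> (fst b, s) \<in> ?cls t}"
  proof (intro set_eqI iffI)
    fix s assume s: "s \<in> {s \<in> ?T. ?cls s = ?cls t}"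
    have "(fst b, s) \<in> ?cls s" by simp
    also have "?cls s = ?cls t" using s by blast
    finally have "(fst b, s) \<in> ?cls t" .
    then show "s \<in> {s. snd b < s \<and> (fst b, s) \<in> ?cls t}" using s by blast
  next
    fix s assume s: "s \<in> {s. snd b < s \<and> (fst b, s) \<in> ?cls t}"
    then have l: "linked cadj (cbd M) (fst b, t) (fst b, s)" by blast
    then have "(fst b, s) \<in> cbd M" using linked_in[OF l] t by blast
    then show "s \<in> {s \<in> ?T. ?cls s = ?cls t}" using s linked_class[OF symp_cadj l] by blast
  qed
  then have "cpot (?cls t) (fst b) (snd b)" using t(2) by (simp add: cpot_def)
  then have "b \<in> cfill (?cls t)" using assms(3) by (simp add: cfill_def)
  moreover have "?cls t \<subseteq> cbd M" using linked_in[of cadj "cbd M" "(fst b, t)"] t by blast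
  moreover have "(fst b, t) \<in> ?cls t" by simp
  ultimately show ?thesis unfolding contour_def by blast
qed

text \<open>Flipping the inside removes exactly \<open>\<gamma>\<close> from the boundary, which is
  the energy gain of the Peierls argument. A path of cells of \<open>M\<close> crosses no boundary
  face, so the cluster of \<open>b\<close> stays inside.\<close>

lemma contour_facts:
  assumes "finite M" "contour M b \<gamma>"
  shows "finite \<gamma>" "ceven \<gamma>" "cbd (cfill \<gamma>) = \<gamma>" "\<And>f g. f \<in> \<gamma> \<Longrightarrow> g \<in> \<gamma> \<Longrightarrow> linked cadj \<gamma> f g"
    "cbd (symd M (cfill \<gamma>)) = cbd M - \<gamma>"
    "\<And>c d. linked cnb M c d \<Longrightarrow> c \<in> cfill \<gamma> \<Longrightarrow> c \<in> M \<Longrightarrow> d \<in> cfill \<gamma>"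
proof -
  obtain f0 where f0: "\<gamma> \<subseteq> cbd M" "f0 \<in> \<gamma>" "\<gamma> = {g. linked cadj (cbd M) f0 g}" using assms(2) by (auto simp: contour_def)
  show fin: "finite \<gamma>" using f0(1) finite_cbd[OF assms(1)] finite_subset by blast
  have cl: "g \<in> \<gamma>" if "f \<in> \<gamma>" "g \<in> cbd M" "cadj f g" for f g
    using linked_trans[of cadj "cbd M" f0 f g] linked_step[of f "cbd M" g cadj] that f0 by blast
  show ev: "ceven \<gamma>" by (rule ceven_closed_subset[OF ceven_cbd f0(1) cl])
  obtain N where N: "\<And>p t. (p, t) \<in> \<gamma> \<Longrightarrow> t \<le> N"
  proof -
    have "\<forall>x\<in>snd ` \<gamma>. x \<le> Max (insert 0 (snd ` \<gamma>))" using fin by auto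
    then show thesis using that by (metis image_eqI snd_conv)
  qed
  show bd: "cbd (cfill \<gamma>) = \<gamma>" by (rule cbd_cfill[OF ev N])
  show "linked cadj \<gamma> f g" if "f \<in> \<gamma>" "g \<in> \<gamma>" for f g
  proof -
    have "linked cadj (cbd M) f0 f" "linked cadj (cbd M) f0 g" using that f0 by blast+
    then have "linked cadj (cbd M) f g" using linked_trans[OF linked_sym[OF symp_cadj]] by blast
    from linked_restrict[OF this that(1)] cl show ?thesis by blast
  qed
  show "cbd (symd M (cfill \<gamma>)) = cbd M - \<gamma>" using f0(1) unfolding cbd_symd bd by (auto simp: symd_def)
  show "d \<in> cfill \<gamma>" if "linked cnb M c d" "c \<in> cfill \<gamma>" "c \<in> M" for c d
    using that(1)
  proof (induction rule: linked_induct)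
    case base show ?case by fact
  next
    case (step y z)
    then obtain f where f: "\<not> isv (fst f)" "y = fc1 f \<and> z = fc2 f \<or> y = fc2 f \<and> z = fc1 f" unfolding cnb_def by blast
    then have "f \<notin> cbd M" using step by (auto simp: cbd_def)
    then have "f \<notin> cbd (cfill \<gamma>)" using f0(1) bd by blast
    then show ?case using f step by (auto simp: cbd_def)
  qed
qed

section \<open>Correlation estimates\<close>

lemma odd_card_nonempty: "odd (card A) \<Longrightarrow> A \<noteq> {}"
  by (metis card.empty even_zero)

text \<open>The cluster from \<open>b\<close> to \<open>s\<close> lies inside the contour, so each
  column it passes contains a face of the contour. Columns are two grid units apart, whence the
  division by 2.\<close>

lemma contour_size:
  assumes M: "finite M" "b \<in> M" and c: "contour M b \<gamma>"
    and s: "linked cnb M b s" and g: "g = fst \<or> g = snd" and d: "2 * int d \<le> \<bar>g (fst b) - g (fst s)\<bar>"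
  shows "Suc d \<le> card \<gamma>"
proof -
  note cf = contour_facts[OF M(1) c]
  have bL: "b \<in> cfill \<gamma>" using c by (simp add: contour_def)
  define p where "p c = g (fst c) div 2" for c :: cface
  have stp: "\<bar>p x - p y\<bar> \<le> 1" if xy: "cnb x y" for x y
  proof -
    obtain f where "x = fc1 f \<and> y = fc2 f \<or> x = fc2 f \<and> y = fc1 f" using xy unfolding cnb_def by blast
    moreover have "g (fst (fc1 f)) = g (fst (fc2 f)) \<or> g (fst (fc1 f)) = g (fst (fc2 f)) + 2"
      using g by (auto simp: fc1_def fc2_def side_def)
    ultimately have "g (fst x) = g (fst y) \<or> g (fst x) = g (fst y) + 2 \<or> g (fst y) = g (fst x) + 2" by metis
    then show ?thesis by (auto simp: p_def)
  qed
  have "{min (p b) (p s)..max (p b) (p s)} \<subseteq> (\<lambda>f. g (fst f) div 2) ` \<gamma>"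
  proof
    fix t assume "t \<in> {min (p b) (p s)..max (p b) (p s)}"
    moreover have "linked cnb {z. linked cnb M b z} b s \<and> s \<in> {z. linked cnb M b z}"
      using linked_restrict[OF s, of "{z. linked cnb M b z}"] linked_in[of cnb M b] M(2)
      by (metis (no_types, lifting) linked_refl linked_step linked_trans mem_Collect_eq)
    ultimately obtain z where z: "linked cnb M b z" "p z = t"
      using linked_int_ivt[of cnb "{z. linked cnb M b z}" b s p t] stp by auto
    have "z \<in> cfill \<gamma>" by (rule cf(6)[OF z(1) bL M(2)])
    then have "odd (card {t. snd z < t \<and> (fst z, t) \<in> \<gamma>})" by (simp add: cfill_def cpot_def)
    then have "{t. snd z < t \<and> (fst z, t) \<in> \<gamma>} \<noteq> {}" by (rule odd_card_nonempty)
    then obtain h where "(fst z, h) \<in> \<gamma>" by blast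
    then show "t \<in> (\<lambda>f. g (fst f) div 2) ` \<gamma>" using z(2) by (intro image_eqI[of _ _ "(fst z, h)"]) (auto simp: p_def)
  qed
  then have "card {min (p b) (p s)..max (p b) (p s)} \<le> card \<gamma>"
    using cf(1) by (meson card_image_le card_mono finite_imageI le_trans)
  moreover have "int d \<le> \<bar>p b - p s\<bar>" using d unfolding p_def by linarith
  then have "Suc d \<le> card {min (p b) (p s)..max (p b) (p s)}" by simp
  ultimately show ?thesis by linarith
qed

text \<open>Let \<open>t\<close> be the lowest face of the contour above \<open>b\<close>. At each
  level from \<open>b\<close> up to \<open>t\<close> the column is inside, and leaving it
  horizontally crosses a face of the contour at that level; so there are at most
  \<open>card \<gamma>\<close> levels. This anchors the contour in the column of
  \<open>b\<close>.\<close>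

lemma contour_height:
  assumes M: "finite M" "b \<in> M" and c: "contour M b \<gamma>"
  shows "\<exists>t. snd b < t \<and> t \<le> snd b + int (card \<gamma>) \<and> (fst b, t) \<in> \<gamma>"
proof -
  note cf = contour_facts[OF M(1) c]
  have bL: "isF (fst b)" "cpot \<gamma> (fst b) (snd b)" using c by (simp_all add: contour_def cfill_def)
  let ?T = "{t. snd b < t \<and> (fst b, t) \<in> \<gamma>}"
  have finT: "finite ?T"
  proof -
    have "?T \<subseteq> snd ` \<gamma>" by force
    then show ?thesis using cf(1) finite_subset by blast
  qed
  have "odd (card ?T)" using bL(2) by (simp add: cpot_def)
  then have "?T \<noteq> {}" by (rule odd_card_nonempty)
  define t where "t = Min ?T"
  have t: "t \<in> ?T" "\<And>t'. t' \<in> ?T \<Longrightarrow> t \<le> t'"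
    unfolding t_def by (rule Min_in[OF finT \<open>?T \<noteq> {}\<close>], rule Min_le[OF finT])
  obtain X where X: "\<And>f. f \<in> \<gamma> \<Longrightarrow> fst (fst f) < X"
  proof -
    have "\<forall>x\<in>(\<lambda>f. fst (fst f)) ` \<gamma>. x \<le> Max (insert 0 ((\<lambda>f. fst (fst f)) ` \<gamma>))" using cf(1) by auto
    then have "\<forall>f\<in>\<gamma>. fst (fst f) < Max (insert 0 ((\<lambda>f. fst (fst f)) ` \<gamma>)) + 1" by fastforce
    then show thesis using that by blast
  qed
  have "{snd b..t - 1} \<subseteq> snd ` \<gamma>"
  proof
    fix k assume k: "k \<in> {snd b..t - 1}"
    have "{s. k < s \<and> (fst b, s) \<in> \<gamma>} = ?T" using t(2) k by fastforce
    then have inL: "(fst b, k) \<in> cfill \<gamma>" using bL by (simp add: cfill_def cpot_def)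
    show "k \<in> snd ` \<gamma>"
    proof (rule ccontr)
      assume no: "k \<notin> snd ` \<gamma>"
      have "((fst (fst b) + 2 * int j, snd (fst b)), k) \<in> cfill \<gamma>" for j
      proof (induction j)
        case 0 then show ?case using inL by simp
      next
        case (Suc j)
        let ?e = "(fst (fst b) + 2 * int j + 1, snd (fst b))"
        have e: "ise ?e" using bL(1) by (simp add: ise_def isF_def)
        have "(?e, k) \<notin> \<gamma>" using no by force
        then have "(?e, k) \<notin> cbd (cfill \<gamma>)" using cf(3) by simp
        moreover have "side 1 ?e = (fst (fst b) + 2 * int (Suc j), snd (fst b))" "side (-1) ?e = (fst (fst b) + 2 * int j, snd (fst b))"
          using bL(1) by (simp_all add: side_def isF_def)
        ultimately show ?case using cbd_edge[OF e, of k] Suc by simp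
      qed
      from this[of "nat (X - fst (fst b))"] have "odd (card {s. k < s \<and> ((fst (fst b) + 2 * int (nat (X - fst (fst b))), snd (fst b)), s) \<in> \<gamma>})"
        by (simp add: cfill_def cpot_def)
      then have "{s. k < s \<and> ((fst (fst b) + 2 * int (nat (X - fst (fst b))), snd (fst b)), s) \<in> \<gamma>} \<noteq> {}"
        by (rule odd_card_nonempty)
      then obtain s where "((fst (fst b) + 2 * int (nat (X - fst (fst b))), snd (fst b)), s) \<in> \<gamma>" by blast
      from X[OF this] have "fst (fst b) + 2 * int (nat (X - fst (fst b))) < X" by simp
      moreover have "X - fst (fst b) > 0" using X[of "(fst b, t)"] t(1) by simp
      ultimately show False by simp
    qed
  qed
  then have "card {snd b..t - 1} \<le> card \<gamma>" using cf(1) by (meson card_image_le card_mono finite_imageI le_trans)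
  then have "t \<le> snd b + int (card \<gamma>)" using t(1) by simp
  then show ?thesis using t(1) by blast
qed

definition cyl :: "gpt set \<Rightarrow> nat \<Rightarrow> cface set" where
  "cyl U m = U \<times> {- int m..<int m}"

lemma cyl_mono: "m \<le> m' \<Longrightarrow> cyl U m \<subseteq> cyl U m'"
  by (auto simp: cyl_def)

text \<open>It ensures that the flipped configuration stays in the cylinder. A cell of the inside
  below the cylinder would make its whole column odd, and by \<open>column_parity\<close> also a
  column outside the base, where the contour has no horizontal face.\<close>

lemma contour_cyl:
  assumes U: "finite U" "\<And>u. u \<in> U \<Longrightarrow> isF u" and M: "M \<subseteq> cyl U m" and c: "contour M b \<gamma>"
  shows "cfill \<gamma> \<subseteq> cyl U m"
proof
  have finM: "finite M" by (rule finite_subset[OF M]) (simp add: cyl_def U)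
  note cf = contour_facts[OF finM c]
  have gM: "\<gamma> \<subseteq> cbd M" using c by (simp add: contour_def)
  have face: "u \<in> U \<and> - int m \<le> t \<and> t \<le> int m" if "isF u" "(u, t) \<in> \<gamma>" for u t
    using cbd_face[OF that(1), of t M] that(2) gM M by (auto simp: cyl_def)
  fix z assume "z \<in> cfill \<gamma>"
  then have z: "isF (fst z)" "odd (card {t. snd z < t \<and> (fst z, t) \<in> \<gamma>})" by (auto simp: cfill_def cpot_def)
  have "{t. snd z < t \<and> (fst z, t) \<in> \<gamma>} \<noteq> {}" by (rule odd_card_nonempty[OF z(2)])
  then obtain t where t: "snd z < t" "(fst z, t) \<in> \<gamma>" by blast
  have zU: "fst z \<in> U" "snd z < int m" using face[OF z(1) t(2)] t(1) by auto
  have "- int m \<le> snd z"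
  proof (rule ccontr)
    assume neg: "\<not> - int m \<le> snd z"
    have "{t. snd z < t \<and> (fst z, t) \<in> \<gamma>} = {t. (fst z, t) \<in> \<gamma>}" using face[OF z(1)] neg by fastforce
    then have odd: "odd (card {t. (fst z, t) \<in> \<gamma>})" using z(2) by simp
    obtain N where N: "\<And>p t. (p, t) \<in> \<gamma> \<Longrightarrow> \<bar>t\<bar> \<le> N"
    proof -
      have "\<forall>x\<in>(\<lambda>f. \<bar>snd f\<bar>) ` \<gamma>. x \<le> Max (insert 0 ((\<lambda>f. \<bar>snd f\<bar>) ` \<gamma>))" using cf(1) by auto
      then have "\<And>p t. (p, t) \<in> \<gamma> \<Longrightarrow> \<bar>t\<bar> \<le> Max (insert 0 ((\<lambda>f. \<bar>snd f\<bar>) ` \<gamma>))" by (metis image_eqI snd_conv)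
      then show thesis using that by blast
    qed
    obtain K where K: "K \<ge> 0" "gfar K \<inter> U = {}" using finite_int_pairs_bounded[OF U(1)] .
    let ?w = "(2 * K + 1, 1) :: gpt"
    have w: "isF ?w" "?w \<in> gfar K" using K(1) by (auto simp: isF_def gfar_def)
    have "{t. (?w, t) \<in> \<gamma>} = {}" using face[OF w(1)] K(2) w(2) by blast
    then have "even (card {t. (?w, t) \<in> \<gamma>})" by simp
    moreover have "odd (card {t. (fst z, t) \<in> \<gamma>}) \<longleftrightarrow> odd (card {t. (?w, t) \<in> \<gamma>})"
      by (rule column_parity[OF cf(2) _ z(1) w(1)]) (rule N)
    ultimately show False using odd by blast
  qed
  then show "z \<in> cyl U m" using zU by (auto simp: cyl_def mem_Times_iff)
qed

text \<open>Ising weights relative to a constant boundary condition: \<open>M\<close> is the set of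
  cells that deviate from it, and \<open>Zp\<close> is the partition function of a region outside
  which no cell deviates.\<close>

definition wt :: "real \<Rightarrow> cface set \<Rightarrow> real" where "wt \<beta> M = exp (- \<beta> * real (card (cbd M)))"
definition Zp :: "real \<Rightarrow> cface set \<Rightarrow> real" where "Zp \<beta> A = sum (wt \<beta>) (Pow A)"

text \<open>11250 = 2 * 5625: a contour of size \<open>k\<close> has at most \<open>k\<close>
  anchoring heights, and \<open>k * 5625 ^ k \<le> 11250 ^ k\<close>. The bound 1/8 ensures that a
  given cell does not deviate with probability at least one half.\<close>

locale ising =
  fixes \<beta> :: real and U :: "gpt set"
  assumes U: "finite U" "\<And>u. u \<in> U \<Longrightarrow> isF u"
    and beta: "11250 * exp (- \<beta>) \<le> 1/8"
begin

definition x :: real where "x = 11250 * exp (- \<beta>)"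

lemma x_bounds: "0 < x" "x \<le> 1/8" "0 \<le> \<beta>"
proof -
  show "0 < x" by (simp add: x_def)
  show "x \<le> 1/8" using beta by (simp add: x_def)
  show "0 \<le> \<beta>"
  proof (rule ccontr)
    assume "\<not> 0 \<le> \<beta>"
    then have "exp (- \<beta>) \<ge> 1" by simp
    then show False using beta by linarith
  qed
qed

abbreviation "w \<equiv> wt \<beta>"
abbreviation "Z \<equiv> Zp \<beta>"

lemma w_pos [simp]: "0 < w M" "0 \<le> w M"
  by (simp_all add: wt_def)

lemma w_supermodular:
  assumes "finite M" "finite L" shows "w M * w L \<le> w (M \<union> L) * w (M \<inter> L)"
proof -
  have "real (card (cbd (M \<union> L))) + real (card (cbd (M \<inter> L))) \<le> real (card (cbd M)) + real (card (cbd L))"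
    using card_cbd_submodular[OF assms] by linarith
  then have "\<beta> * (real (card (cbd (M \<union> L))) + real (card (cbd (M \<inter> L)))) \<le> \<beta> * (real (card (cbd M)) + real (card (cbd L)))"
    using x_bounds(3) by (rule mult_left_mono)
  then show ?thesis unfolding wt_def exp_add[symmetric] exp_le_cancel_iff by (simp add: distrib_left)
qed

lemma Z_pos: "finite A \<Longrightarrow> 0 < Z A"
  unfolding Zp_def by (rule sum_pos) auto

lemma Z_mono: "finite B \<Longrightarrow> A \<subseteq> B \<Longrightarrow> Z A \<le> Z B"
  unfolding Zp_def by (rule sum_mono2) auto

lemma sum_indicator_Pow:
  "finite C \<Longrightarrow> A \<subseteq> C \<Longrightarrow> (\<Sum>M\<in>Pow C. if M \<subseteq> A \<and> E M then w M else 0) = (\<Sum>M\<in>{M \<in> Pow A. E M}. w M)"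
  by (rule sum.mono_neutral_cong_right) auto

text \<open>Positive association: an increasing event becomes more likely in a larger region. In the
  four functions theorem the union receives the event and the larger region, the intersection the
  smaller region.\<close>

lemma event_monotone:
  assumes B: "finite B" "A \<subseteq> B" and E: "\<And>M L. E M \<Longrightarrow> M \<subseteq> L \<Longrightarrow> E L"
  shows "(\<Sum>M\<in>{M \<in> Pow A. E M}. w M) * Z B \<le> (\<Sum>M\<in>{M \<in> Pow B. E M}. w M) * Z A"
proof -
  let ?i = "\<lambda>A E M. if M \<subseteq> A \<and> E M then w M else 0"
  have "sum (?i A E) (Pow B) * sum (?i B (\<lambda>_. True)) (Pow B) \<le> sum (?i B E) (Pow B) * sum (?i A (\<lambda>_. True)) (Pow B)"
  proof (rule four_functions[OF B(1)])
    fix X Y assume "X \<subseteq> B" "Y \<subseteq> B"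
    then have "w X * w Y \<le> w (X \<union> Y) * w (X \<inter> Y)" using B(1) finite_subset by (intro w_supermodular) blast+
    then show "?i A E X * ?i B (\<lambda>_. True) Y \<le> ?i B E (X \<union> Y) * ?i A (\<lambda>_. True) (X \<inter> Y)"
      using E[of X "X \<union> Y"] \<open>X \<subseteq> B\<close> \<open>Y \<subseteq> B\<close> by auto
  qed auto
  then show ?thesis
    using sum_indicator_Pow[OF B, of E] sum_indicator_Pow[OF B, of "\<lambda>_. True"]
      sum_indicator_Pow[OF B(1), of B E] sum_indicator_Pow[OF B(1), of B "\<lambda>_. True"]
    by (simp add: Zp_def Pow_def)
qed

lemma Z_supermodular:
  assumes "finite A" "finite B" shows "Z A * Z B \<le> Z (A \<union> B) * Z (A \<inter> B)"
proof -
  let ?i = "\<lambda>A M. if M \<subseteq> A \<and> True then w M else 0"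
  have fin: "finite (A \<union> B)" using assms by simp
  have "sum (?i A) (Pow (A \<union> B)) * sum (?i B) (Pow (A \<union> B)) \<le> sum (?i (A \<union> B)) (Pow (A \<union> B)) * sum (?i (A \<inter> B)) (Pow (A \<union> B))"
  proof (rule four_functions[OF fin])
    fix X Y assume "X \<subseteq> A \<union> B" "Y \<subseteq> A \<union> B"
    then have "w X * w Y \<le> w (X \<union> Y) * w (X \<inter> Y)" using fin finite_subset by (intro w_supermodular) blast+
    then show "?i A X * ?i B Y \<le> ?i (A \<union> B) (X \<union> Y) * ?i (A \<inter> B) (X \<inter> Y)" by auto
  qed auto
  then show ?thesis
    using sum_indicator_Pow[OF fin, of A "\<lambda>_. True"] sum_indicator_Pow[OF fin, of B "\<lambda>_. True"]
      sum_indicator_Pow[OF fin, of "A \<union> B" "\<lambda>_. True"] sum_indicator_Pow[OF fin, of "A \<inter> B" "\<lambda>_. True"]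
    by (simp add: Zp_def Pow_def le_infI1)
qed

definition meets :: "cface \<Rightarrow> cface set \<Rightarrow> cface set \<Rightarrow> bool" where
  "meets b S M \<longleftrightarrow> b \<in> M \<and> (\<exists>s\<in>S. linked cnb M b s)"

text \<open>For a fixed contour, flipping its inside is injective and gains a factor
  \<open>exp (- \<beta>)\<close> per face. The contours are then summed by size and anchoring
  height.\<close>

lemma peierls:
  assumes S: "\<And>s. s \<in> S \<Longrightarrow> s \<in> cyl U m \<Longrightarrow> 2 * int d \<le> gdist (fst b) (fst s)"
  shows "(\<Sum>M\<in>{M \<in> Pow (cyl U m). meets b S M}. w M) \<le> 2 * x ^ Suc d * Z (cyl U m)"
proof -
  let ?L = "cyl U m" and ?E = "{M \<in> Pow (cyl U m). meets b S M}"
  have finL: "finite ?L" by (simp add: cyl_def U)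
  have finE: "finite ?E" using finL by simp
  have "\<exists>\<gamma>. contour M b \<gamma>" if "M \<in> ?E" for M
  proof (rule contour_exists)
    show "finite M" using that finL finite_subset by blast
    show "b \<in> M" using that by (simp add: meets_def)
    then show "isF (fst b)" using that U(2) by (auto simp: cyl_def)
  qed
  then obtain G where G: "\<And>M. M \<in> ?E \<Longrightarrow> contour M b (G M)" by metis
  have fM: "finite M" "b \<in> M" if "M \<in> ?E" for M using that finL finite_subset by (auto simp: meets_def)
  have wM: "w M = exp (- \<beta>) ^ card (G M) * w (symd M (cfill (G M)))" if M: "M \<in> ?E" for M
  proof -
    note cf = contour_facts[OF fM(1)[OF M] G[OF M]]
    have sub: "G M \<subseteq> cbd M" using G[OF M] by (simp add: contour_def)
    have "card (cbd M) = card (G M) + card (cbd M - G M)"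
      using sub finite_cbd[OF fM(1)[OF M]] cf(1) by (simp add: card_Diff_subset card_mono)
    then show ?thesis unfolding wt_def cf(5) by (simp add: algebra_simps flip: exp_of_nat_mult exp_add)
  qed
  have "(\<Sum>M\<in>?E. w M) = (\<Sum>\<gamma>\<in>G ` ?E. \<Sum>M\<in>{M \<in> ?E. G M = \<gamma>}. w M)"
    by (rule sum.image_gen[OF finE])
  also have "\<dots> \<le> (\<Sum>\<gamma>\<in>G ` ?E. exp (- \<beta>) ^ card \<gamma> * Z ?L)"
  proof (rule sum_mono)
    fix \<gamma> assume "\<gamma> \<in> G ` ?E"
    have "(\<Sum>M\<in>{M \<in> ?E. G M = \<gamma>}. w M) = exp (- \<beta>) ^ card \<gamma> * (\<Sum>M\<in>{M \<in> ?E. G M = \<gamma>}. w (symd M (cfill \<gamma>)))"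
      unfolding sum_distrib_left by (rule sum.cong) (use wM in auto)
    also have "(\<Sum>M\<in>{M \<in> ?E. G M = \<gamma>}. w (symd M (cfill \<gamma>))) = (\<Sum>M'\<in>(\<lambda>M. symd M (cfill \<gamma>)) ` {M \<in> ?E. G M = \<gamma>}. w M')"
    proof (subst sum.reindex)
      show "inj_on (\<lambda>M. symd M (cfill \<gamma>)) {M \<in> ?E. G M = \<gamma>}"
        by (rule inj_on_inverseI[where g = "\<lambda>M. symd M (cfill \<gamma>)"]) (rule symd_symd)
    qed (simp add: o_def)
    also have "\<dots> \<le> Z ?L"
      unfolding Zp_def
    proof (rule sum_mono2)
      have "symd M (cfill (G M)) \<subseteq> ?L" if M: "M \<in> ?E" for M
      proof -
        have "M \<subseteq> ?L" using M by blast
        moreover have "cfill (G M) \<subseteq> ?L" by (rule contour_cyl[OF U \<open>M \<subseteq> ?L\<close> G[OF M]])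
        ultimately show ?thesis unfolding symd_def by blast
      qed
      then show "(\<lambda>M. symd M (cfill \<gamma>)) ` {M \<in> ?E. G M = \<gamma>} \<subseteq> Pow ?L" by blast
    qed (use finL in auto)
    finally show "(\<Sum>M\<in>{M \<in> ?E. G M = \<gamma>}. w M) \<le> exp (- \<beta>) ^ card \<gamma> * Z ?L" by (simp add: mult_left_mono)
  qed
  also have "\<dots> = (\<Sum>\<gamma>\<in>G ` ?E. exp (- \<beta>) ^ card \<gamma>) * Z ?L" by (rule sum_distrib_right[symmetric])
  finally have 1: "(\<Sum>M\<in>?E. w M) \<le> (\<Sum>\<gamma>\<in>G ` ?E. exp (- \<beta>) ^ card \<gamma>) * Z ?L" .
  have "(\<Sum>\<gamma>\<in>G ` ?E. exp (- \<beta>) ^ card \<gamma>) \<le> 2 * (real 11250 * exp (- \<beta>)) ^ Suc d"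
  proof (rule sum_power_card_le)
    show "finite (G ` ?E)" using finE by simp
    show "Suc d \<le> card \<gamma>" if "\<gamma> \<in> G ` ?E" for \<gamma>
    proof -
      from that obtain M where M: "M \<in> ?E" "\<gamma> = G M" by (rule imageE)
      have MP: "M \<subseteq> ?L" "meets b S M" using M(1) by simp_all
      obtain s where s: "s \<in> S" "linked cnb M b s" using MP(2) unfolding meets_def by blast
      have "s \<in> cyl U m" by (rule subsetD[OF MP(1) linked_in[OF s(2) fM(2)[OF M(1)]]])
      then have "2 * int d \<le> \<bar>fst (fst b) - fst (fst s)\<bar> \<or> 2 * int d \<le> \<bar>snd (fst b) - snd (fst s)\<bar>"
        using S[OF s(1)] unfolding gdist_def by linarith
      then show ?thesis unfolding M(2)
      proof
        assume "2 * int d \<le> \<bar>fst (fst b) - fst (fst s)\<bar>"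
        then show "Suc d \<le> card (G M)" by (rule contour_size[OF fM[OF M(1)] G[OF M(1)] s(2) disjI1[OF refl]])
      next
        assume "2 * int d \<le> \<bar>snd (fst b) - snd (fst s)\<bar>"
        then show "Suc d \<le> card (G M)" by (rule contour_size[OF fM[OF M(1)] G[OF M(1)] s(2) disjI2[OF refl]])
      qed
    qed
    show "card {\<gamma> \<in> G ` ?E. card \<gamma> = k} \<le> 11250 ^ k" for k
    proof -
      let ?X = "\<lambda>t. {\<gamma>. finite \<gamma> \<and> (fst b, t) \<in> \<gamma> \<and> card \<gamma> = k \<and> (\<forall>y\<in>\<gamma>. linked cadj \<gamma> (fst b, t) y)}"
      have "{\<gamma> \<in> G ` ?E. card \<gamma> = k} \<subseteq> (\<Union>t\<in>{snd b + 1..snd b + int k}. ?X t)"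
      proof
        fix \<gamma> assume "\<gamma> \<in> {\<gamma> \<in> G ` ?E. card \<gamma> = k}"
        then have g: "\<gamma> \<in> G ` ?E" "card \<gamma> = k" by simp_all
        from g(1) obtain M where M: "M \<in> ?E" "\<gamma> = G M" by (rule imageE)
        note cf = contour_facts[OF fM(1)[OF M(1)] G[OF M(1)]]
        obtain t where t: "snd b < t" "t \<le> snd b + int k" "(fst b, t) \<in> \<gamma>"
          using contour_height[OF fM[OF M(1)] G[OF M(1)]] unfolding M(2)[symmetric] g(2) by blast
        have "\<forall>y\<in>\<gamma>. linked cadj \<gamma> (fst b, t) y" using cf(4) t(3) unfolding M(2) by simp
        then have "\<gamma> \<in> ?X t" using cf(1) M(2) g(2) t(3) by simp
        moreover have "t \<in> {snd b + 1..snd b + int k}" using t(1,2) by simp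
        ultimately show "\<gamma> \<in> (\<Union>t\<in>{snd b + 1..snd b + int k}. ?X t)" by (rule UN_I[rotated])
      qed
      then have "card {\<gamma> \<in> G ` ?E. card \<gamma> = k} \<le> card (\<Union>t\<in>{snd b + 1..snd b + int k}. ?X t)"
        by (rule card_mono[rotated]) (intro finite_UN_I finite_atLeastAtMost_int star_sets_card(1))
      also have "\<dots> \<le> (\<Sum>t\<in>{snd b + 1..snd b + int k}. card (?X t))" by (rule card_UN_le) simp
      also have "\<dots> \<le> (\<Sum>t\<in>{snd b + 1..snd b + int k}. 5625 ^ k)" by (rule sum_mono) (rule star_sets_card(2))
      also have "\<dots> = k * 5625 ^ k" unfolding sum_constant by simp
      also have "\<dots> \<le> 2 ^ k * 5625 ^ k" by (rule mult_right_mono[OF less_imp_le[OF less_exp]]) simp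
      also have "\<dots> = (2 * 5625) ^ k" by (rule power_mult_distrib[symmetric])
      also have "(2 * 5625 :: nat) = 11250" by simp
      finally show ?thesis .
    qed
    show "0 \<le> exp (- \<beta>)" by simp
    show "real 11250 * exp (- \<beta>) \<le> 1 / 2" using beta by linarith
  qed
  then have "(\<Sum>\<gamma>\<in>G ` ?E. exp (- \<beta>) ^ card \<gamma>) \<le> 2 * x ^ Suc d" unfolding x_def of_nat_numeral .
  then have "(\<Sum>\<gamma>\<in>G ` ?E. exp (- \<beta>) ^ card \<gamma>) * Z ?L \<le> 2 * x ^ Suc d * Z ?L"
    by (rule mult_right_mono[OF _ less_imp_le[OF Z_pos[OF finL]]])
  then show ?thesis using 1 by linarith
qed

lemma meets_mono: assumes "meets b S M" "M \<subseteq> L" shows "meets b S L"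
proof -
  obtain s where s: "s \<in> S" "linked cnb M b s" "b \<in> M" using assms(1) unfolding meets_def by blast
  have "linked cnb L b s" by (rule linked_mono[OF s(2) assms(2)])
  then show ?thesis using s assms(2) unfolding meets_def by blast
qed

text \<open>The inside of a contour may leave the region \<open>A\<close>, so the flip is made in
  the full cylinder and the estimate is carried over by monotonicity.\<close>

lemma peierls_sub:
  assumes S: "\<And>s. s \<in> S \<Longrightarrow> s \<in> cyl U m \<Longrightarrow> 2 * int d \<le> gdist (fst b) (fst s)" and A: "A \<subseteq> cyl U m"
  shows "(\<Sum>M\<in>{M \<in> Pow A. meets b S M}. w M) \<le> 2 * x ^ Suc d * Z A"
proof -
  have fin: "finite (cyl U m)" by (simp add: cyl_def U)
  have "(\<Sum>M\<in>{M \<in> Pow A. meets b S M}. w M) * Z (cyl U m) \<le> (\<Sum>M\<in>{M \<in> Pow (cyl U m). meets b S M}. w M) * Z A"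
    by (rule event_monotone[OF fin A meets_mono])
  also have "\<dots> \<le> (2 * x ^ Suc d * Z (cyl U m)) * Z A"
    by (rule mult_right_mono[OF peierls[OF S] less_imp_le[OF Z_pos[OF finite_subset[OF A fin]]]])
  also have "\<dots> = (2 * x ^ Suc d * Z A) * Z (cyl U m)" by (simp only: mult.assoc mult.commute[of "Z A"])
  finally show ?thesis using Z_pos[OF fin] by (rule mult_right_le_imp_le)
qed

lemma Z_remove_ge:
  assumes A: "A \<subseteq> cyl U m"
  shows "Z A \<le> 2 * Z (A - {b})" "Z A - Z (A - {b}) \<le> 2 * x * Z A"
proof -
  have fin: "finite A" by (rule finite_subset[OF A]) (simp add: cyl_def U)
  have "(\<Sum>M\<in>{M \<in> Pow A. meets b {b} M}. w M) \<le> 2 * x ^ Suc 0 * Z A"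
    by (rule peierls_sub[OF _ A]) (simp add: gdist_def)
  moreover have "{M \<in> Pow A. meets b {b} M} = Pow A - Pow (A - {b})" by (auto simp: meets_def)
  moreover have "(\<Sum>M\<in>Pow A - Pow (A - {b}). w M) = Z A - Z (A - {b})"
    unfolding Zp_def using fin by (intro sum_diff) auto
  ultimately show 1: "Z A - Z (A - {b}) \<le> 2 * x * Z A" by simp
  have "2 * x * Z A \<le> (1/2) * Z A" using x_bounds Z_pos[OF fin] by (intro mult_right_mono) auto
  then show "Z A \<le> 2 * Z (A - {b})" using 1 by simp
qed


section \<open>Clusters of deviating cells and decoupling\<close>

definition clus :: "cface set \<Rightarrow> cface \<Rightarrow> cface set" where "clus M b = {c. linked cnb M b c}"
lemma mem_clus: "c \<in> clus M b \<longleftrightarrow> linked cnb M b c" by (simp add: clus_def)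

definition nbr :: "cface set \<Rightarrow> cface set" where "nbr K = K \<union> {c. \<exists>k\<in>K. cnb k c}"

lemma w_union:
  assumes "finite K" "finite M" "M \<inter> nbr K = {}"
  shows "w (K \<union> M) = w K * w M"
proof -
  have nn: "\<not> (k \<in> K \<and> c \<in> M \<and> cnb k c)" "\<not> (c \<in> K \<and> c \<in> M)" for k c using assms(3) unfolding nbr_def by blast+
  have cn: "cnb (fc1 f) (fc2 f)" "cnb (fc2 f) (fc1 f)" if "\<not> isv (fst f)" for f using that unfolding cnb_def by blast+
  have eq: "f \<in> cbd (K \<union> M) \<longleftrightarrow> f \<in> cbd K \<or> f \<in> cbd M" and disj: "\<not> (f \<in> cbd K \<and> f \<in> cbd M)" for f
  proof -
    show "f \<in> cbd (K \<union> M) \<longleftrightarrow> f \<in> cbd K \<or> f \<in> cbd M"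
      using cn[of f] nn(1)[of "fc1 f" "fc2 f"] nn(1)[of "fc2 f" "fc1 f"] nn(2)[of "fc1 f"] nn(2)[of "fc2 f"]
      unfolding cbd_def mem_Collect_eq Un_iff by blast
    show "\<not> (f \<in> cbd K \<and> f \<in> cbd M)"
      using cn[of f] nn(1)[of "fc1 f" "fc2 f"] nn(1)[of "fc2 f" "fc1 f"] nn(2)[of "fc1 f"] nn(2)[of "fc2 f"]
      unfolding cbd_def mem_Collect_eq by blast
  qed
  have "cbd (K \<union> M) = cbd K \<union> cbd M" using eq by blast
  moreover have "cbd K \<inter> cbd M = {}" using disj by blast
  ultimately have "card (cbd (K \<union> M)) = card (cbd K) + card (cbd M)"
    using assms(1,2) by (simp add: card_Un_disjoint finite_cbd)
  then show ?thesis by (simp add: wt_def algebra_simps flip: exp_add)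
qed

text \<open>Once the cluster of \<open>b\<close> is fixed, its neighbours do not deviate and the
  rest of the region is unconstrained.\<close>

lemma cluster_sum:
  assumes A: "finite A" and K: "K \<subseteq> A" "b \<in> K" "clus K b = K"
  shows "(\<Sum>M\<in>{M \<in> Pow A. b \<in> M \<and> clus M b = K}. w M) = w K * Z (A - nbr K)"
proof -
  have finK: "finite K" using A K(1) finite_subset by blast
  have "(\<Sum>M\<in>{M \<in> Pow A. b \<in> M \<and> clus M b = K}. w M) = (\<Sum>M'\<in>Pow (A - nbr K). w K * w M')"
  proof (rule sum.reindex_bij_witness[where i = "\<lambda>M'. K \<union> M'" and j = "\<lambda>M. M - K"])
    fix M assume M: "M \<in> {M \<in> Pow A. b \<in> M \<and> clus M b = K}"
    then have MA: "M \<subseteq> A" "b \<in> M" and Keq: "clus M b = K" by simp_all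
    have lk: "linked cnb M b c \<longleftrightarrow> c \<in> K" for c using mem_clus[of c M b] unfolding Keq by simp
    have KM: "K \<subseteq> M"
    proof
      fix c assume "c \<in> K"
      then have "linked cnb M b c" by (simp only: lk)
      then show "c \<in> M" by (rule linked_in[OF _ MA(2)])
    qed
    show "K \<union> (M - K) = M" using KM by blast
    have "c \<in> K" if c: "c \<in> M" "k \<in> K" "cnb k c" for c k
    proof -
      have "linked cnb M b k" using c(2) by (simp only: lk)
      moreover have "linked cnb M k c" using c KM by (intro linked_step) blast+
      ultimately have "linked cnb M b c" by (rule linked_trans)
      then show ?thesis by (simp only: lk)
    qed
    then have sub: "M - K \<subseteq> A - nbr K" using MA unfolding nbr_def by blast
    then show "M - K \<in> Pow (A - nbr K)" by simp
    have "w (K \<union> (M - K)) = w K * w (M - K)"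
      by (rule w_union[OF finK finite_subset[OF _ A]]) (use sub MA(1) in blast)+
    then show "w K * w (M - K) = w M" using \<open>K \<union> (M - K) = M\<close> by simp
  next
    fix M' assume M': "M' \<in> Pow (A - nbr K)"
    have nn: "z \<notin> M'" if "y \<in> K" "cnb y z" for y z using that M' unfolding nbr_def by blast
    have KM: "K \<inter> M' = {}" using M' unfolding nbr_def by blast
    show "K \<union> M' - K = M'" using KM by blast
    have "clus (K \<union> M') b = K"
    proof
      show "clus (K \<union> M') b \<subseteq> K"
      proof
        fix c assume "c \<in> clus (K \<union> M') b"
        then have "linked cnb (K \<union> M') b c" by (simp add: clus_def)
        from linked_restrict[OF this K(2)] nn show "c \<in> K" by blast
      qed
      show "K \<subseteq> clus (K \<union> M') b"
      proof
        fix c assume "c \<in> K"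
        then have "linked cnb K b c" using K(3) mem_clus[of c K b] by blast
        then show "c \<in> clus (K \<union> M') b" unfolding clus_def by (simp add: linked_mono)
      qed
    qed
    then show "K \<union> M' \<in> {M \<in> Pow A. b \<in> M \<and> clus M b = K}" using K M' by blast
  qed
  then show ?thesis by (simp add: Zp_def sum_distrib_left)
qed

text \<open>In probabilities: forbidding deviations on a distant set \<open>S\<close> hardly raises
  the chance that \<open>b\<close> does not deviate. A cluster of \<open>b\<close> that avoids
  \<open>S\<close> is at least as likely in \<open>A - S\<close> as in \<open>A\<close>; clusters
  that reach \<open>S\<close> are large and have probability at most \<open>2 * x ^ Suc d\<close>.
  The factor 4 arises from dividing by a probability of at least one half.\<close>

lemma decouple_cell:
  assumes S: "\<And>s. s \<in> S \<Longrightarrow> s \<in> cyl U m \<Longrightarrow> 2 * int d \<le> gdist (fst b) (fst s)" and A: "A \<subseteq> cyl U m"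
  shows "Z (A - S - {b}) * Z A \<le> (1 + 4 * x ^ Suc d) * (Z (A - S) * Z (A - {b}))"
proof -
  have fin: "finite A" by (rule finite_subset[OF A]) (simp add: cyl_def U)
  let ?NS = "{M \<in> Pow A. b \<in> M \<and> clus M b \<inter> S = {}}" and ?MS = "{M \<in> Pow A. meets b S M}"
  let ?R = "{M \<in> Pow (A - S). b \<in> M}"
  define KK where "KK = (\<lambda>M. clus M b) ` ?NS"
  have finNS: "finite ?NS" "finite ?MS" "finite ?R" using fin by auto
  have finKK: "finite KK" unfolding KK_def using finNS(1) by (rule finite_imageI)
  have KK: "K \<subseteq> A - S \<and> b \<in> K \<and> clus K b = K" if K: "K \<in> KK" for K
  proof -
    from K obtain M where M: "M \<in> ?NS" "K = clus M b" unfolding KK_def by (rule imageE)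
    have bK: "b \<in> K" unfolding M(2) clus_def by simp
    have "K \<subseteq> M" using linked_in[of cnb M b] M unfolding clus_def by blast
    moreover have "K \<inter> S = {}" using M by simp
    moreover have "linked cnb K b c" if c: "c \<in> K" for c
    proof -
      have l: "linked cnb M b c" using c M(2) by (simp add: clus_def)
      have "z \<in> K" if "y \<in> K" "z \<in> M" "cnb y z" for y z
      proof -
        have "linked cnb M b y" using that(1) M(2) by (simp add: clus_def)
        moreover have "linked cnb M y z" using that \<open>K \<subseteq> M\<close> by (intro linked_step) blast+
        ultimately have "linked cnb M b z" by (rule linked_trans)
        then show ?thesis unfolding M(2) clus_def by simp
      qed
      then show ?thesis using linked_restrict[OF l bK] by blast
    qed
    then have "K \<subseteq> clus K b" unfolding clus_def by blast
    moreover have "clus K b \<subseteq> K" using linked_in[of cnb K b] bK unfolding clus_def by blast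
    ultimately show ?thesis using M(1) bK by blast
  qed
  have "(\<Sum>M\<in>?NS. w M) = (\<Sum>K\<in>KK. \<Sum>M\<in>{M \<in> ?NS. clus M b = K}. w M)"
    unfolding KK_def by (rule sum.image_gen[OF finNS(1)])
  also have "\<dots> = (\<Sum>K\<in>KK. w K * Z (A - nbr K))"
  proof (rule sum.cong[OF refl])
    fix K assume K: "K \<in> KK"
    have "{M \<in> ?NS. clus M b = K} = {M \<in> Pow A. b \<in> M \<and> clus M b = K}" using KK[OF K] by blast
    moreover have "(\<Sum>M\<in>{M \<in> Pow A. b \<in> M \<and> clus M b = K}. w M) = w K * Z (A - nbr K)"
      by (rule cluster_sum[OF fin]) (use KK[OF K] in blast)+
    ultimately show "(\<Sum>M\<in>{M \<in> ?NS. clus M b = K}. w M) = w K * Z (A - nbr K)" by simp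
  qed
  finally have NS: "(\<Sum>M\<in>?NS. w M) = (\<Sum>K\<in>KK. w K * Z (A - nbr K))" .
  \<comment> \<open>Supermodularity for the two regions, whose union lies in \<open>A\<close>,
    compares the two systems cluster by cluster.\<close>
  have step: "w K * Z (A - nbr K) * Z (A - S) \<le> Z A * (w K * Z (A - S - nbr K))" for K
  proof -
    have "Z (A - nbr K) * Z (A - S) \<le> Z ((A - nbr K) \<union> (A - S)) * Z ((A - nbr K) \<inter> (A - S))"
      by (rule Z_supermodular) (use fin in auto)
    also have "(A - nbr K) \<inter> (A - S) = A - S - nbr K" by blast
    also have "Z ((A - nbr K) \<union> (A - S)) * Z (A - S - nbr K) \<le> Z A * Z (A - S - nbr K)"
      by (rule mult_right_mono[OF Z_mono[OF fin] less_imp_le[OF Z_pos]]) (use fin in auto)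
    finally have "w K * (Z (A - nbr K) * Z (A - S)) \<le> w K * (Z A * Z (A - S - nbr K))"
      by (rule mult_left_mono) simp
    then show ?thesis by (simp add: mult_ac)
  qed
  have "(\<Sum>K\<in>KK. w K * Z (A - S - nbr K)) = (\<Sum>K\<in>KK. \<Sum>M\<in>{M \<in> {M \<in> ?R. clus M b \<in> KK}. clus M b = K}. w M)"
  proof (rule sum.cong[OF refl])
    fix K assume K: "K \<in> KK"
    have "{M \<in> {M \<in> ?R. clus M b \<in> KK}. clus M b = K} = {M \<in> Pow (A - S). b \<in> M \<and> clus M b = K}" using K by blast
    moreover have "(\<Sum>M\<in>{M \<in> Pow (A - S). b \<in> M \<and> clus M b = K}. w M) = w K * Z (A - S - nbr K)"
      by (rule cluster_sum) (use KK[OF K] fin in auto)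
    ultimately show "w K * Z (A - S - nbr K) = (\<Sum>M\<in>{M \<in> {M \<in> ?R. clus M b \<in> KK}. clus M b = K}. w M)" by simp
  qed
  also have "\<dots> = (\<Sum>M\<in>{M \<in> ?R. clus M b \<in> KK}. w M)"
  proof (rule sum.group[OF _ finKK])
    show "finite {M \<in> ?R. clus M b \<in> KK}" by (rule finite_subset[OF _ finNS(3)]) blast
  qed blast
  also have "\<dots> \<le> (\<Sum>M\<in>?R. w M)" by (rule sum_mono2[OF finNS(3)]) (blast, simp)
  finally have R: "(\<Sum>K\<in>KK. w K * Z (A - S - nbr K)) \<le> (\<Sum>M\<in>?R. w M)" .
  have "(\<Sum>M\<in>?NS. w M) * Z (A - S) = (\<Sum>K\<in>KK. w K * Z (A - nbr K) * Z (A - S))"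
    unfolding NS by (rule sum_distrib_right)
  also have "\<dots> \<le> (\<Sum>K\<in>KK. Z A * (w K * Z (A - S - nbr K)))" by (rule sum_mono[OF step])
  also have "\<dots> = Z A * (\<Sum>K\<in>KK. w K * Z (A - S - nbr K))" by (rule sum_distrib_left[symmetric])
  also have "\<dots> \<le> Z A * (\<Sum>M\<in>?R. w M)" by (rule mult_left_mono[OF R less_imp_le[OF Z_pos[OF fin]]])
  finally have 1: "(\<Sum>M\<in>?NS. w M) * Z (A - S) \<le> Z A * (\<Sum>M\<in>?R. w M)" .
  have ex: "Z C - Z (C - {b}) = (\<Sum>M\<in>{M \<in> Pow C. b \<in> M}. w M)" if "finite C" for C
  proof -
    have "{M \<in> Pow C. b \<in> M} = Pow C - Pow (C - {b})" by blast
    then show ?thesis unfolding Zp_def using that by (simp add: sum_diff Pow_mono)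
  qed
  have "{M \<in> Pow A. b \<in> M} = ?NS \<union> ?MS" unfolding meets_def clus_def by blast
  moreover have "?NS \<inter> ?MS = {}" unfolding meets_def clus_def by blast
  ultimately have 2: "Z A - Z (A - {b}) = (\<Sum>M\<in>?NS. w M) + (\<Sum>M\<in>?MS. w M)"
    using ex[OF fin] finNS by (simp add: sum.union_disjoint)
  have 3: "(\<Sum>M\<in>?MS. w M) \<le> 2 * x ^ Suc d * Z A" by (rule peierls_sub[OF S A])
  have 4: "Z (A - S) - Z (A - S - {b}) = (\<Sum>M\<in>?R. w M)" by (rule ex) (use fin in simp)
  have p: "0 < Z A" "0 < Z (A - S)" "0 < Z (A - {b})" using Z_pos fin by simp_all
  have xp: "0 \<le> x ^ Suc d" using x_bounds(1) by simp
  have "(Z A - Z (A - {b})) * Z (A - S) \<le> Z A * (Z (A - S) - Z (A - S - {b})) + 2 * x ^ Suc d * Z A * Z (A - S)"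
    unfolding 2 4 distrib_right using 1 mult_right_mono[OF 3 less_imp_le[OF p(2)]] by linarith
  moreover have "2 * x ^ Suc d * Z A * Z (A - S) \<le> 2 * x ^ Suc d * (2 * Z (A - {b})) * Z (A - S)"
    by (rule mult_right_mono[OF mult_left_mono[OF Z_remove_ge(1)[OF A]]]) (use p xp in auto)
  ultimately show ?thesis by (simp add: algebra_simps)
qed

text \<open>The cells of \<open>B\<close> are removed one at a time, each from the region that the
  previous removals have left; the factors multiply.\<close>

lemma decouple:
  assumes A: "A \<subseteq> cyl U m" and "finite B"
    and S: "\<And>b s. b \<in> B \<Longrightarrow> s \<in> S \<Longrightarrow> s \<in> cyl U m \<Longrightarrow> 2 * int (d b) \<le> gdist (fst b) (fst s)"
  shows "Z (A - S - B) * Z A \<le> Z (A - S) * Z (A - B) * (\<Prod>b\<in>B. 1 + 4 * x ^ Suc (d b))"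
  using assms(2) S
proof (induction B rule: finite_induct)
  case empty
  then show ?case by simp
next
  case (insert b B)
  have fin: "finite A" by (rule finite_subset[OF A]) (simp add: cyl_def U)
  let ?P = "\<Prod>b\<in>B. 1 + 4 * x ^ Suc (d b)" and ?q = "1 + 4 * x ^ Suc (d b)"
  have P0: "0 \<le> ?q" "0 \<le> ?P" using x_bounds(1) by (auto intro!: prod_nonneg)
  have IH: "Z (A - S - B) * Z A \<le> Z (A - S) * Z (A - B) * ?P" using insert by auto
  have "Z (A - B - S - {b}) * Z (A - B) \<le> ?q * (Z (A - B - S) * Z (A - B - {b}))"
  proof (rule decouple_cell)
    show "2 * int (d b) \<le> gdist (fst b) (fst s)" if "s \<in> S" "s \<in> cyl U m" for s
      by (rule insert.prems[OF _ that]) simp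
    show "A - B \<subseteq> cyl U m" using A by blast
  qed
  then have one: "Z (A - S - insert b B) * Z (A - B) \<le> ?q * (Z (A - S - B) * Z (A - insert b B))"
    by (simp add: Diff_insert2[of _ b B] Diff_insert[of _ b B] set_diff_eq conj_ac)
  have p: "0 < Z A" "0 < Z (A - B)" "0 \<le> Z (A - insert b B)" using Z_pos fin by (simp_all add: less_imp_le)
  have "(Z (A - S - insert b B) * Z A) * Z (A - B) = (Z (A - S - insert b B) * Z (A - B)) * Z A" by simp
  also have "\<dots> \<le> (?q * (Z (A - S - B) * Z (A - insert b B))) * Z A"
    by (rule mult_right_mono[OF one less_imp_le[OF p(1)]])
  also have "\<dots> = (?q * Z (A - insert b B)) * (Z (A - S - B) * Z A)" by (simp only: mult_ac)
  also have "\<dots> \<le> (?q * Z (A - insert b B)) * (Z (A - S) * Z (A - B) * ?P)"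
    by (rule mult_left_mono[OF IH mult_nonneg_nonneg[OF P0(1) p(3)]])
  also have "\<dots> = (Z (A - S) * Z (A - insert b B) * (?q * ?P)) * Z (A - B)" by (simp only: mult_ac)
  finally have "Z (A - S - insert b B) * Z A \<le> Z (A - S) * Z (A - insert b B) * (?q * ?P)"
    by (rule mult_right_le_imp_le[OF _ p(2)])
  then show ?case using insert.hyps by simp
qed

end

section \<open>The infinite cylinder\<close>

lemma cbd_cshift: "cbd (cshift k M) = cshift k (cbd M)"
proof (intro set_eqI)
  fix f :: cface
  obtain p t where f: "f = (p, t)" by (cases f)
  have 1: "fc1 f \<in> cshift k M \<longleftrightarrow> fc1 (p, t - k) \<in> M" "fc2 f \<in> cshift k M \<longleftrightarrow> fc2 (p, t - k) \<in> M"
    unfolding f by (simp_all add: fc1_def fc2_def mem_cshift algebra_simps)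
  show "f \<in> cbd (cshift k M) \<longleftrightarrow> f \<in> cshift k (cbd M)"
    using 1 unfolding f by (simp add: cbd_def mem_cshift)
qed

lemma card_cshift [simp]: "card (cshift k W) = card W"
  unfolding cshift_def by (rule card_image) (auto simp: inj_on_def prod_eq_iff)

lemma cshift_Diff: "cshift k (A - B) = cshift k A - cshift k B"
  by (auto simp: mem_cshift)

lemma cshift_mono: "cshift k A \<subseteq> cshift k B \<longleftrightarrow> A \<subseteq> B"
proof
  assume "cshift k A \<subseteq> cshift k B"
  then have "cshift (-k) (cshift k A) \<subseteq> cshift (-k) (cshift k B)" unfolding cshift_def by (rule image_mono)
  then show "A \<subseteq> B" by (simp add: cshift_cshift)
qed (auto simp: cshift_def)

lemma finite_cshift [simp]: "finite (cshift k A) \<longleftrightarrow> finite A"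
proof
  assume "finite (cshift k A)"
  then have "finite (cshift (-k) (cshift k A))" unfolding cshift_def by blast
  then show "finite A" by (simp add: cshift_cshift)
qed (simp add: cshift_def)

lemma Zp_cshift: "Zp \<beta> (cshift k A) = Zp \<beta> A"
proof -
  have "Zp \<beta> (cshift k A) = (\<Sum>M\<in>Pow (cshift k A). wt \<beta> M)" by (simp add: Zp_def)
  also have "\<dots> = (\<Sum>M\<in>Pow A. wt \<beta> M)"
  proof (rule sum.reindex_bij_witness[where i = "cshift k" and j = "cshift (-k)"])
    fix M assume "M \<in> Pow (cshift k A)"
    then have "cshift (-k) M \<subseteq> cshift (-k) (cshift k A)" by (simp only: cshift_mono Pow_iff)
    then show "cshift (-k) M \<in> Pow A" by (simp add: cshift_cshift)
  next
    fix M assume "M \<in> Pow A"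
    then show "cshift k M \<in> Pow (cshift k A)" by (simp only: cshift_mono Pow_iff)
  qed (simp_all add: cshift_cshift wt_def cbd_cshift)
  finally show ?thesis by (simp add: Zp_def)
qed

context ising begin

text \<open>The probability that no cell of \<open>S\<close> deviates in the cylinder of half-height
  \<open>m\<close>.\<close>

definition P :: "nat \<Rightarrow> cface set \<Rightarrow> real" where "P m S = Z (cyl U m - S) / Z (cyl U m)"

lemma finite_cyl [simp]: "finite (cyl U m)"
  by (simp add: cyl_def U)

lemma Z_ratio_mono:
  assumes "finite B" "A \<subseteq> B" shows "Z (B - S) / Z B \<le> Z (A - S) / Z A"
proof -
  have fA: "finite A" using assms finite_subset by blast
  have "Z A * Z (B - S) \<le> Z (A \<union> (B - S)) * Z (A \<inter> (B - S))"
    by (rule Z_supermodular) (use fA assms in auto)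
  also have "A \<inter> (B - S) = A - S" using assms by blast
  also have "Z (A \<union> (B - S)) * Z (A - S) \<le> Z B * Z (A - S)"
    by (rule mult_right_mono[OF Z_mono[OF assms(1)] less_imp_le[OF Z_pos]]) (use assms fA in auto)
  finally show ?thesis using Z_pos[OF fA] Z_pos[OF assms(1)] by (simp add: field_simps)
qed

lemma P_bounds: "0 < P m S" "P m S \<le> 1"
  unfolding P_def using Z_pos[of "cyl U m"] Z_pos[of "cyl U m - S"] Z_mono[of "cyl U m" "cyl U m - S"] by auto

lemma P_decreasing: "m \<le> m' \<Longrightarrow> P m' S \<le> P m S"
  unfolding P_def by (rule Z_ratio_mono) (simp_all add: cyl_mono)

lemma P_antimono: "S \<subseteq> T \<Longrightarrow> P m T \<le> P m S"
  unfolding P_def by (intro divide_right_mono Z_mono less_imp_le[OF Z_pos]) auto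

lemma P_Un_ge: "P m S * P m T \<le> P m (S \<union> T)"
proof -
  let ?L = "cyl U m"
  have "Z (?L - S) * Z (?L - T) \<le> Z ((?L - S) \<union> (?L - T)) * Z ((?L - S) \<inter> (?L - T))"
    by (rule Z_supermodular) auto
  also have "(?L - S) \<inter> (?L - T) = ?L - (S \<union> T)" by blast
  also have "Z ((?L - S) \<union> (?L - T)) * Z (?L - (S \<union> T)) \<le> Z ?L * Z (?L - (S \<union> T))"
    by (rule mult_right_mono[OF Z_mono less_imp_le[OF Z_pos]]) auto
  finally show ?thesis unfolding P_def using Z_pos[OF finite_cyl, of m] by (simp add: field_simps)
qed

lemma P_insert_ge: "P m S / 2 \<le> P m (insert b S)"
proof -
  have "Z (cyl U m - S) \<le> 2 * Z (cyl U m - S - {b})" by (rule Z_remove_ge(1)[of _ m]) blast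
  moreover have "cyl U m - S - {b} = cyl U m - insert b S" by blast
  ultimately show ?thesis unfolding P_def using Z_pos[OF finite_cyl, of m] by (simp add: field_simps)
qed

lemma P_decouple:
  assumes "finite B" "\<And>b s. b \<in> B \<Longrightarrow> s \<in> S \<Longrightarrow> 2 * int (d b) \<le> gdist (fst b) (fst s)"
  shows "P m (S \<union> B) \<le> P m S * P m B * (\<Prod>b\<in>B. 1 + 4 * x ^ Suc (d b))"
proof -
  have "Z (cyl U m - S - B) * Z (cyl U m) \<le> Z (cyl U m - S) * Z (cyl U m - B) * (\<Prod>b\<in>B. 1 + 4 * x ^ Suc (d b))"
    by (rule decouple[OF subset_refl assms(1)]) (use assms(2) in blast)
  moreover have "cyl U m - S - B = cyl U m - (S \<union> B)" by blast
  ultimately show ?thesis unfolding P_def using Z_pos[OF finite_cyl, of m] by (simp add: field_simps)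
qed

text \<open>The infimum is also the limit, because the probabilities decrease in
  \<open>m\<close>.\<close>

definition Pinf :: "cface set \<Rightarrow> real" where "Pinf S = (INF m. P m S)"

lemma P_limit: "(\<lambda>m. P m S) \<longlonglongrightarrow> Pinf S"
  unfolding Pinf_def
proof (rule LIMSEQ_decseq_INF)
  show "bdd_below (range (\<lambda>m. P m S))" using P_bounds(1) by (intro bdd_belowI[of _ 0]) (auto simp: less_imp_le)
  show "decseq (\<lambda>m. P m S)" using P_decreasing by (simp add: decseq_def)
qed

lemma Pinf_le_P: "Pinf S \<le> P m S"
  unfolding Pinf_def using P_bounds(1) by (intro cINF_lower bdd_belowI[of _ 0]) (auto simp: less_imp_le)

lemma Pinf_nonneg: "0 \<le> Pinf S"
  by (rule LIMSEQ_le_const[OF P_limit]) (use P_bounds(1) in \<open>auto simp: less_imp_le\<close>)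

lemma Pinf_antimono: "S \<subseteq> T \<Longrightarrow> Pinf T \<le> Pinf S"
  by (rule LIMSEQ_le[OF P_limit P_limit]) (use P_antimono in blast)

lemma Pinf_Un_ge: "Pinf S * Pinf T \<le> Pinf (S \<union> T)"
  by (rule LIMSEQ_le[OF tendsto_mult[OF P_limit P_limit] P_limit]) (use P_Un_ge in blast)

lemma Pinf_insert_ge: "Pinf S / 2 \<le> Pinf (insert b S)"
  by (rule LIMSEQ_le[OF tendsto_divide[OF P_limit tendsto_const] P_limit]) (use P_insert_ge in auto)

lemma Pinf_add_finite: "finite B \<Longrightarrow> Pinf S * (1/2) ^ card B \<le> Pinf (S \<union> B)"
proof (induction B rule: finite_induct)
  case (insert b B)
  have "Pinf S * (1/2) ^ card (insert b B) = (Pinf S * (1/2) ^ card B) / 2" using insert by simp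
  also have "\<dots> \<le> Pinf (S \<union> B) / 2" using insert.IH by simp
  also have "\<dots> \<le> Pinf (insert b (S \<union> B))" by (rule Pinf_insert_ge)
  finally show ?case by simp
qed simp

lemma Pinf_empty: "Pinf {} = 1"
proof -
  have "P m {} = 1" for m using Z_pos[OF finite_cyl, of m] by (simp add: P_def)
  then have "(\<lambda>m. P m {}) \<longlonglongrightarrow> 1" by simp
  then show ?thesis using LIMSEQ_unique P_limit by blast
qed

lemma Pinf_restrict: "Pinf S = Pinf (S \<inter> {c. fst c \<in> U})"
proof -
  have "P m S = P m (S \<inter> {c. fst c \<in> U})" for m
  proof -
    have "cyl U m - S = cyl U m - S \<inter> {c. fst c \<in> U}" by (auto simp: cyl_def)
    then show ?thesis by (simp add: P_def)
  qed
  then show ?thesis by (simp add: Pinf_def)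
qed

lemma Pinf_decouple:
  assumes "finite B" "\<And>b s. b \<in> B \<Longrightarrow> s \<in> S \<Longrightarrow> 2 * int (d b) \<le> gdist (fst b) (fst s)"
  shows "Pinf (S \<union> B) \<le> Pinf S * Pinf B * (\<Prod>b\<in>B. 1 + 4 * x ^ Suc (d b))"
  by (rule LIMSEQ_le[OF P_limit tendsto_mult_right[OF tendsto_mult[OF P_limit P_limit]]])
     (use P_decouple[OF assms] in blast)

text \<open>A shifted cylinder is contained in a taller centred one, and the probabilities decrease
  as the region grows. This is where the infinite height yields translation invariance.\<close>

lemma Pinf_cshift_ge: "Pinf S \<le> Pinf (cshift k S)"
proof -
  have "Pinf S \<le> P m (cshift k S)" for m
  proof -
    let ?A = "cshift (-k) (cyl U m)"
    have "P m (cshift k S) = Z (cshift k (?A - S)) / Z (cshift k ?A)"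
      unfolding P_def cshift_Diff by (simp add: cshift_cshift)
    also have "\<dots> = Z (?A - S) / Z ?A" by (simp add: Zp_cshift)
    also have "\<dots> \<ge> Z (cyl U (m + nat \<bar>k\<bar>) - S) / Z (cyl U (m + nat \<bar>k\<bar>))"
    proof (rule Z_ratio_mono)
      show "?A \<subseteq> cyl U (m + nat \<bar>k\<bar>)" by (auto simp: cshift_def cyl_def)
    qed simp
    finally show ?thesis using Pinf_le_P[of S "m + nat \<bar>k\<bar>"] unfolding P_def by linarith
  qed
  then show ?thesis using LIMSEQ_le_const[OF P_limit] by blast
qed

lemma Pinf_cshift: "Pinf (cshift k S) = Pinf S"
  using Pinf_cshift_ge[of S k] Pinf_cshift_ge[of "cshift k S" "-k"] by (simp add: cshift_cshift)

lemma Pinf_pos: assumes "finite (S \<inter> {c. fst c \<in> U})" shows "0 < Pinf S"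
proof -
  have "(1/2) ^ card (S \<inter> {c. fst c \<in> U}) \<le> Pinf ({} \<union> (S \<inter> {c. fst c \<in> U}))"
    using Pinf_add_finite[OF assms, of "{}"] Pinf_empty by simp
  moreover have "(0::real) < (1/2) ^ card (S \<inter> {c. fst c \<in> U})" by simp
  ultimately have "0 < Pinf (S \<inter> {c. fst c \<in> U})" unfolding Un_empty_left by linarith
  then show ?thesis using Pinf_restrict[of S] by linarith
qed

end

section \<open>Collections of standard walls\<close>

definition boxF :: "nat \<Rightarrow> gpt set" where "boxF n = {u. isF u \<and> u \<notin> gfar (2 * int n)}"

lemma finite_boxF: "finite (boxF n)"
proof -
  have "boxF n \<subseteq> {- (2 * int n)..2 * int n} \<times> {- (2 * int n)..2 * int n}" by (auto simp: boxF_def gfar_def)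
  then show ?thesis by (rule finite_subset) auto
qed

definition cexcess :: "cface set \<Rightarrow> real" where
  "cexcess V = real (card V) - real (card {u \<in> fst ` V. isF u})"

lemma fst_cshift: "fst ` cshift k V = fst ` V"
  by (force simp: cshift_def)

lemma cexcess_cshift [simp]: "cexcess (cshift k V) = cexcess V"
  unfolding cexcess_def fst_cshift by simp

lemma cverts_shift: "(v, h + k) \<in> cverts (p, t + k) \<longleftrightarrow> (v, h) \<in> cverts (p, t)"
  by (auto simp: cverts_def)

lemma cadj_shift: "cadj (fst f, snd f + k) (fst g, snd g + k) \<longleftrightarrow> cadj f g"
proof -
  have 1: "cadj (fst f, snd f + k) (fst g, snd g + k)" if c: "cadj f g" for f g k
  proof -
    obtain v h where vh: "(v, h) \<in> cverts f" "(v, h) \<in> cverts g" "f \<noteq> g" using c unfolding cadj_def by force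
    show ?thesis
    proof (rule cadjI)
      show "(fst f, snd f + k) \<noteq> (fst g, snd g + k)" using vh(3) by (auto simp: prod_eq_iff)
      show "(v, h + k) \<in> cverts (fst f, snd f + k)" "(v, h + k) \<in> cverts (fst g, snd g + k)"
        using vh(1,2) by (simp_all add: cverts_shift)
    qed
  qed
  show ?thesis using 1[of f g k] 1[of "(fst f, snd f + k)" "(fst g, snd g + k)" "- k"] by auto
qed

lemma linked_cshift:
  assumes "linked cadj V f g"
  shows "linked cadj (cshift k V) (fst f, snd f + k) (fst g, snd g + k)"
  using assms
proof (induction rule: linked_induct)
  case (step y z)
  have "linked cadj (cshift k V) (fst y, snd y + k) (fst z, snd z + k)"
    using step(2,3,4) by (intro linked_step) (simp_all add: mem_cshift cadj_shift)
  then show ?case by (rule linked_trans[OF step.IH])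
qed simp

text \<open>What the estimates use of a standard wall. The vertex at height 0 fixes its vertical
  position up to its size, which makes counting possible; the bound by twice the excess compares its
  number of faces with its energy.\<close>

definition stdwall :: "nat \<Rightarrow> cface set \<Rightarrow> bool" where
  "stdwall n V \<longleftrightarrow> finite V \<and> V \<noteq> {} \<and> (\<forall>f\<in>V. \<forall>g\<in>V. linked cadj V f g) \<and> (\<exists>f\<in>V. \<exists>v. (v, 0) \<in> cverts f) \<and>
     real (card V) \<le> 2 * cexcess V \<and> cproj V \<inter> gfar (2 * int n) = {} \<and>
     (\<forall>x\<in>cproj V. \<forall>y\<in>cproj V. linked gadj (cproj V) x y)"

lemma stdwallD:
  assumes "stdwall n V"
  shows "finite V" "V \<noteq> {}" "\<And>f g. f \<in> V \<Longrightarrow> g \<in> V \<Longrightarrow> linked cadj V f g" "\<exists>f\<in>V. \<exists>v. (v, 0) \<in> cverts f"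
    "real (card V) \<le> 2 * cexcess V" "cproj V \<inter> gfar (2 * int n) = {}"
    "\<And>x y. x \<in> cproj V \<Longrightarrow> y \<in> cproj V \<Longrightarrow> linked gadj (cproj V) x y" "finite (cproj V)" "cproj V \<noteq> {}"
    "0 \<le> cexcess V"
proof -
  show fin: "finite V" and ne: "V \<noteq> {}" using assms unfolding stdwall_def by blast+
  show "finite (cproj V)" unfolding cproj_def using fin finite_gclosure by blast
  show "cproj V \<noteq> {}" using ne gclosure_refl unfolding cproj_def by blast
  show l: "real (card V) \<le> 2 * cexcess V" using assms unfolding stdwall_def by blast
  then show "0 \<le> cexcess V" by linarith
qed (use assms in \<open>unfold stdwall_def, blast+\<close>)

context iface begin

text \<open>A horizontal wall face is never alone in its column, so every projected face carries at
  least two faces of the wall.\<close>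

lemma wall_excess:
  assumes W: "W \<in> cwalls I"
  shows "{u \<in> cproj W. isF u} = {u \<in> fst ` W. isF u}" "2 * card {u \<in> fst ` W. isF u} \<le> card W"
proof -
  interpret C: iface_comp n I "cproj W" by (rule wall_component[OF W])
  note Weq = wall_component(2)[OF W] and Wwf = wall_component(3)[OF W] and finW = wall_component(4)[OF W]
  show "{u \<in> cproj W. isF u} = {u \<in> fst ` W. isF u}"
  proof (intro set_eqI iffI)
    fix u assume u: "u \<in> {u \<in> cproj W. isF u}"
    then obtain g where g: "g \<in> W" "u \<in> gclosure (fst g)" unfolding cproj_def by blast
    then have "u = fst g" using isF_gclosureD[of u "fst g"] u by blast
    then show "u \<in> {u \<in> fst ` W. isF u}" using g u by blast
  next
    fix u assume "u \<in> {u \<in> fst ` W. isF u}"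
    then show "u \<in> {u \<in> cproj W. isF u}" using gclosure_refl unfolding cproj_def by blast
  qed
  let ?F = "{u \<in> fst ` W. isF u}"
  have finF: "finite ?F" using finW by simp
  have two: "2 \<le> card {g \<in> W. fst g = u}" if u: "u \<in> ?F" for u
  proof -
    obtain f where f: "f \<in> W" "fst f = u" using u by blast
    then have "f \<in> wf" using Wwf by blast
    then obtain g where g: "g \<in> I" "fst g = u" "g \<noteq> f" using f u unfolding wf_def by blast
    have "u \<in> cproj W" using f gclosure_refl unfolding cproj_def by blast
    then have "g \<in> W" using g(1,2) Weq by blast
    then have "{f, g} \<subseteq> {g \<in> W. fst g = u}" using f g by blast
    then have "card {f, g} \<le> card {g \<in> W. fst g = u}" using finW by (intro card_mono) auto
    then show ?thesis using g(3) by simp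
  qed
  have "2 * card ?F = (\<Sum>u\<in>?F. 2)" by simp
  also have "\<dots> \<le> (\<Sum>u\<in>?F. card {g \<in> W. fst g = u})" by (rule sum_mono[OF two])
  also have "\<dots> = card (\<Union>u\<in>?F. {g \<in> W. fst g = u})"
    by (rule card_UN_disjoint[symmetric]) (use finF finW in auto)
  also have "\<dots> \<le> card W" by (rule card_mono[OF finW]) blast
  finally show "2 * card ?F \<le> card W" .
qed

lemma stdwall_cstd: assumes "V \<in> cstd I" shows "stdwall n V"
proof -
  obtain W h where W: "W \<in> cwalls I" "cfloor I W h" "V = cshift (- h) W" using assms unfolding cstd_def by blast
  interpret C: iface_comp n I "cproj W" by (rule wall_component[OF W(1)])
  obtain f0 where f0: "f0 \<in> wf" "W = {g. linked cadj wf f0 g}" using W(1) by (auto simp: cwalls_def)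
  have link: "linked cadj W f g" if fg: "f \<in> W" "g \<in> W" for f g
  proof -
    have cl: "z \<in> W" if "y \<in> W" "z \<in> wf" "cadj y z" for y z
    proof -
      have "y \<in> wf" using that(1) wall_component(3)[OF W(1)] by blast
      then have "linked cadj wf y z" using that by (intro linked_step)
      moreover have "linked cadj wf f0 y" using that(1) f0(2) by simp
      ultimately have "linked cadj wf f0 z" using linked_trans by metis
      then show ?thesis using f0(2) by simp
    qed
    have l: "linked cadj wf f0 f" "linked cadj wf f0 g" using fg f0(2) by simp_all
    have "linked cadj wf f g" by (rule linked_trans[OF linked_sym[OF symp_cadj l(1)] l(2)])
    from linked_restrict[OF this fg(1)] cl show ?thesis by blast
  qed
  have sh: "(fst f, snd f - h) \<in> W \<longleftrightarrow> f \<in> cshift h W" for f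
    using mem_cshift[of "fst f" "snd f" h W] by simp
  have mem: "f \<in> V \<longleftrightarrow> (fst f, snd f + h) \<in> W" for f
    using mem_cshift[of "fst f" "snd f" "- h" W] W(3) by simp
  have "linked cadj V f g" if "f \<in> V" "g \<in> V" for f g
    using linked_cshift[OF link, of "(fst f, snd f + h)" "(fst g, snd g + h)" "- h"] that mem W(3) by simp
  moreover have "\<exists>f\<in>V. \<exists>v. (v, 0) \<in> cverts f"
  proof -
    obtain f g where fg: "f \<in> I - wf" "g \<in> W" "cadj f g" "snd f = h" using W(2) unfolding cfloor_def by blast
    have F: "isF (fst f)" using fg(1) by (auto simp: wf_def)
    obtain v r where v: "(v, r) \<in> cverts f" "(v, r) \<in> cverts g" using fg(3) unfolding cadj_def by force
    have "r = h" using v(1) F fg(4) by (auto simp: cverts_def)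
    then have "(v, 0 + h) \<in> cverts (fst g, (snd g - h) + h)" using v(2) by simp
    then have "(v, 0) \<in> cverts (fst g, snd g - h)" unfolding cverts_shift .
    moreover have "(fst g, snd g - h) \<in> V" using mem[of "(fst g, snd g - h)"] fg(2) by simp
    ultimately show ?thesis by blast
  qed
  moreover have "real (card V) \<le> 2 * cexcess V"
    using wall_excess(2)[OF W(1)] unfolding W(3) cexcess_cshift by (simp add: cexcess_def)
  moreover have "finite V" "V \<noteq> {}" using wall_component(4,5)[OF W(1)] W(3) by (auto simp: cshift_def)
  ultimately show ?thesis unfolding stdwall_def using C.K_far C.K_conn W(3) by auto
qed

lemma cstd_disjoint: assumes "V \<in> cstd I" "V' \<in> cstd I" "V \<noteq> V'" shows "cproj V \<inter> cproj V' = {}"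
proof -
  obtain W h where W: "W \<in> cwalls I" "cfloor I W h" "V = cshift (- h) W" using assms(1) unfolding cstd_def by blast
  obtain W' h' where W': "W' \<in> cwalls I" "cfloor I W' h'" "V' = cshift (- h') W'" using assms(2) unfolding cstd_def by blast
  have "W \<noteq> W'"
  proof
    assume "W = W'"
    then have "h = h'" using floor_unique[OF W(1)] W(2) W'(2) by metis
    then show False using assms(3) W(3) W'(3) \<open>W = W'\<close> by simp
  qed
  then show ?thesis using cwalls_disjoint[OF W(1) W'(1)] W(3) W'(3) by simp
qed

end

text \<open>The effect on an interface of deleting a wall: the floor closes, the interior components move vertically.\<close>
definition deleted :: "nat \<Rightarrow> cface set \<Rightarrow> gpt set \<Rightarrow> (gpt \<Rightarrow> int) \<Rightarrow> cface set \<Rightarrow> bool" where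
  "deleted n I K s J \<longleftrightarrow> iface n J \<and>
     (\<forall>p t. p \<notin> K \<longrightarrow> (p, t) \<in> J \<longleftrightarrow> (p, t + s p) \<in> I) \<and>
     (\<forall>x y. linked gadj (- K) x y \<longrightarrow> s x = s y) \<and> (\<forall>x. x \<notin> ghull K \<longrightarrow> s x = 0) \<and>
     (\<exists>h. \<forall>p\<in>K. \<forall>t. (p, t) \<in> J \<longrightarrow> isF p \<and> t = h)"

lemma delete_wall:
  assumes "iface n I" "V \<in> cstd I"
  obtains J s where "deleted n I (cproj V) s J" "cstd J = cstd I - {V}"
    "real (card (I - outL n)) = real (card (J - outL n)) + cexcess V"
    "card {u \<in> cproj V. isF u} \<le> cexcess V"
proof -
  interpret iface n I by fact
  obtain W h where W: "W \<in> cwalls I" "cfloor I W h" "V = cshift (- h) W" using assms(2) unfolding cstd_def by blast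
  have K: "cproj V = cproj W" using W(3) by simp
  interpret C: iface_comp n I "cproj W" by (rule wall_component[OF W(1)])
  have "deleted n I (cproj V) C.sft C.J"
    unfolding deleted_def K
    using C.iface_J C.J_notin C.sft_linked C.sft_outer C.J_in by blast
  moreover have "cstd C.J = cstd I - {V}" using cstd_delete(1)[OF W(1,2)] W(3) by simp
  moreover have "{g \<in> I. fst g \<in> cproj W} = W" using wall_component(2)[OF W(1)] by simp
  then have c: "card (I - outL n) + card {u \<in> fst ` W. isF u} = card (C.J - outL n) + card W"
    using C.card_J wall_excess(1)[OF W(1)] by simp
  have "cexcess V = cexcess W" using W(3) by simp
  then have "real (card (I - outL n)) = real (card (C.J - outL n)) + cexcess V"
    unfolding cexcess_def using c by linarith
  moreover have "card {u \<in> cproj V. isF u} \<le> cexcess V"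
    unfolding \<open>cexcess V = cexcess W\<close> K wall_excess(1)[OF W(1)] using wall_excess(2)[OF W(1)] by (simp add: cexcess_def)
  ultimately show thesis using that by blast
qed

text \<open>The collections that arise from interfaces. By \<open>cstd_inject\<close> a collection
  determines its interface, and \<open>Ifc\<close> is the inverse.\<close>

definition Col :: "nat \<Rightarrow> cface set set set" where "Col n = cstd ` {I. iface n I}"
definition Ifc :: "nat \<Rightarrow> cface set set \<Rightarrow> cface set" where "Ifc n X = (THE I. iface n I \<and> cstd I = X)"

lemma Ifc_cstd: "iface n I \<Longrightarrow> Ifc n (cstd I) = I"
  unfolding Ifc_def by (rule the_equality) (use cstd_inject in blast)+

lemma Ifc: assumes "X \<in> Col n" shows "iface n (Ifc n X)" "cstd (Ifc n X) = X"
  using assms Ifc_cstd unfolding Col_def by auto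

lemma Col_facts:
  assumes "X \<in> Col n"
  shows "finite X" "\<And>V. V \<in> X \<Longrightarrow> stdwall n V" "\<And>V V'. V \<in> X \<Longrightarrow> V' \<in> X \<Longrightarrow> V \<noteq> V' \<Longrightarrow> cproj V \<inter> cproj V' = {}"
  using iface.finite_cstd[OF Ifc(1)[OF assms]] iface.stdwall_cstd[OF Ifc(1)[OF assms]] iface.cstd_disjoint[OF Ifc(1)[OF assms]]
  unfolding Ifc(2)[OF assms] by blast+

lemma Col_delete:
  assumes "X \<in> Col n" "V \<in> X"
  obtains s where "X - {V} \<in> Col n" "deleted n (Ifc n X) (cproj V) s (Ifc n (X - {V}))"
    "real (card (Ifc n X - outL n)) = real (card (Ifc n (X - {V}) - outL n)) + cexcess V"
    "card {u \<in> cproj V. isF u} \<le> cexcess V"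
proof -
  obtain J s where J: "deleted n (Ifc n X) (cproj V) s J" "cstd J = X - {V}"
    "real (card (Ifc n X - outL n)) = real (card (J - outL n)) + cexcess V" "card {u \<in> cproj V. isF u} \<le> cexcess V"
    by (rule delete_wall[OF Ifc(1)[OF assms(1)], of V, unfolded Ifc(2)[OF assms(1)], OF assms(2)])
  have ij: "iface n J" using J(1) unfolding deleted_def by blast
  have "X - {V} \<in> Col n" using ij J(2) unfolding Col_def by blast
  moreover have "Ifc n (X - {V}) = J" using Ifc_cstd[OF ij] J(2) by simp
  ultimately show thesis using that J by blast
qed

lemma deleted_outside:
  assumes "deleted n I K s J" "p \<notin> ghull K" shows "(p, t) \<in> J \<longleftrightarrow> (p, t) \<in> I"
proof -
  have "p \<notin> K" using assms(2) subset_ghull by blast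
  then have "(p, t) \<in> J \<longleftrightarrow> (p, t + s p) \<in> I" using assms(1) unfolding deleted_def by blast
  moreover have "s p = 0" using assms unfolding deleted_def by blast
  ultimately show ?thesis by simp
qed

lemma Col_energy:
  assumes "X \<in> Col n"
  shows "real (card (Ifc n X - outL n)) = real (card {f. isF (fst f) \<and> snd f = 0 \<and> f \<notin> outL n}) + (\<Sum>V\<in>X. cexcess V)"
  using assms
proof (induction "card X" arbitrary: X rule: less_induct)
  case less
  show ?case
  proof (cases "X = {}")
    case True
    then have "cstd (Ifc n X) = {}" using Ifc(2)[OF less.prems] by simp
    then have "Ifc n X = {(u, 0) | u. isF u}" by (rule iface.cstd_empty[OF Ifc(1)[OF less.prems]])
    then have "Ifc n X - outL n = {f. isF (fst f) \<and> snd f = 0 \<and> f \<notin> outL n}" by force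
    then show ?thesis using True by simp
  next
    case False
    then obtain V where V: "V \<in> X" by blast
    obtain s where s: "X - {V} \<in> Col n"
      "real (card (Ifc n X - outL n)) = real (card (Ifc n (X - {V}) - outL n)) + cexcess V"
      by (rule Col_delete[OF less.prems V])
    have fX: "finite X" using Col_facts(1)[OF less.prems] .
    have "card (X - {V}) < card X" using fX V by (meson card_Diff1_less)
    then show ?thesis using less.hyps[OF _ s(1)] s(2) fX V by (simp add: sum.remove)
  qed
qed

lemma stdwall_interior:
  assumes V: "stdwall n V" and K: "stdwall m W" and d: "cproj V \<inter> cproj W = {}" and x: "cproj V \<inter> ghull (cproj W) \<noteq> {}"
  shows "ghull (cproj V) \<subseteq> ghull (cproj W) - cproj W"
proof -
  obtain p where p: "p \<in> cproj V" "p \<in> ghull (cproj W)" using x by blast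
  show ?thesis
    by (rule ghull_nested[OF stdwallD(8,9,7)[OF K] stdwallD(7)[OF V] d[unfolded Int_commute[of "cproj V"]] p])
qed

lemma Col_delete_set:
  assumes "X \<in> Col n" "finite Y" "Y \<subseteq> X"
  shows "X - Y \<in> Col n \<and> (\<forall>p t. (\<forall>V\<in>Y. p \<notin> ghull (cproj V)) \<longrightarrow> ((p, t) \<in> Ifc n (X - Y) \<longleftrightarrow> (p, t) \<in> Ifc n X))"
  using assms(2,3)
proof (induction Y rule: finite_induct)
  case empty
  then show ?case using assms(1) by simp
next
  case (insert V Y)
  have IH: "X - Y \<in> Col n" "\<And>p t. (\<forall>V\<in>Y. p \<notin> ghull (cproj V)) \<Longrightarrow> ((p, t) \<in> Ifc n (X - Y) \<longleftrightarrow> (p, t) \<in> Ifc n X)"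
    using insert by blast+
  have VX: "V \<in> X - Y" using insert by blast
  obtain s where s: "X - Y - {V} \<in> Col n" "deleted n (Ifc n (X - Y)) (cproj V) s (Ifc n (X - Y - {V}))"
    by (rule Col_delete[OF IH(1) VX])
  have eq: "X - insert V Y = X - Y - {V}" by blast
  show ?case unfolding eq using s(1) deleted_outside[OF s(2)] IH(2) by simp
qed

text \<open>At most \<open>(2 * k + 1) * (2 * k + 1)\<close> points have distance \<open>k\<close>
  from \<open>r\<close>, crudely \<open>9 ^ k\<close>; the sum is then a geometric series with ratio
  \<open>9 * z\<close>.\<close>

lemma gpt_sum_le:
  fixes z :: real
  assumes "finite X" "r \<notin> X" "0 \<le> z" "9 * z \<le> 1/2"
  shows "(\<Sum>p\<in>X. z ^ nat (gdist p r)) \<le> 18 * z"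
proof -
  have "(\<Sum>p\<in>X. z ^ nat (gdist p r)) \<le> 2 * (real 9 * z) ^ 1"
  proof (rule sum_power_le[OF assms(1)])
    show "1 \<le> nat (gdist p r)" if "p \<in> X" for p
    proof -
      have "p \<noteq> r" using that assms(2) by blast
      moreover have "p = r" if "gdist p r = 0" using that unfolding gdist_def prod_eq_iff by linarith
      ultimately have "gdist p r \<noteq> 0" by blast
      moreover have "0 \<le> gdist p r" unfolding gdist_def by simp
      ultimately show ?thesis by linarith
    qed
    show "card {p \<in> X. nat (gdist p r) = k} \<le> 9 ^ k" for k
    proof -
      have sub: "{p \<in> X. nat (gdist p r) = k} \<subseteq> {fst r - int k..fst r + int k} \<times> {snd r - int k..snd r + int k}"
      proof
        fix p assume "p \<in> {p \<in> X. nat (gdist p r) = k}"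
        then have "gdist p r \<le> int k" by auto
        then show "p \<in> {fst r - int k..fst r + int k} \<times> {snd r - int k..snd r + int k}"
          unfolding gdist_def mem_Times_iff atLeastAtMost_iff by linarith
      qed
      have "card {p \<in> X. nat (gdist p r) = k} \<le> card ({fst r - int k..fst r + int k} \<times> {snd r - int k..snd r + int k})"
        by (rule card_mono[OF _ sub]) simp
      also have "\<dots> = (2 * k + 1) * (2 * k + 1)" by (simp add: card_cartesian_product nat_add_distrib nat_mult_distrib algebra_simps)
      also have "\<dots> \<le> 3 ^ k * 3 ^ k"
      proof (rule mult_mono)
        show "2 * k + 1 \<le> 3 ^ k" by (induction k) auto
        then show "2 * k + 1 \<le> 3 ^ k" .
      qed auto
      also have "\<dots> = (3 * 3) ^ k" by (rule power_mult_distrib[symmetric])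
      finally show ?thesis by simp
    qed
  qed (use assms in auto)
  then show ?thesis by simp
qed

section \<open>Distance to the projection of a wall\<close>

definition dR :: "gpt set \<Rightarrow> gpt \<Rightarrow> nat" where "dR K p = nat (Min (gdist p ` K))"

lemma gdist_nonneg: "0 \<le> gdist p q"
  by (simp add: gdist_def)

lemma gdist_triangle: "gdist p r \<le> gdist p q + gdist q r"
  unfolding gdist_def by linarith

lemma gdist_sym: "gdist p q = gdist q p"
  unfolding gdist_def by (simp add: abs_minus_commute)

lemma dR_le: "finite K \<Longrightarrow> r \<in> K \<Longrightarrow> int (dR K p) \<le> gdist p r"
proof -
  assume "finite K" "r \<in> K"
  then have "Min (gdist p ` K) \<le> gdist p r" by simp
  then show ?thesis unfolding dR_def using gdist_nonneg[of p r] by linarith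
qed

lemma dR_attained: assumes "finite K" "K \<noteq> {}" obtains r where "r \<in> K" "gdist p r = int (dR K p)"
proof -
  have "Min (gdist p ` K) \<in> gdist p ` K" using assms by (intro Min_in) auto
  then obtain r where "r \<in> K" "Min (gdist p ` K) = gdist p r" by auto
  then show thesis using that[of r] gdist_nonneg[of p r] unfolding dR_def by simp
qed

lemma dR_pos: assumes "finite K" "K \<noteq> {}" "p \<notin> K" shows "1 \<le> dR K p"
proof -
  obtain r where r: "r \<in> K" "gdist p r = int (dR K p)" using dR_attained[OF assms(1,2)] .
  have "gdist p r \<noteq> 0"
  proof
    assume "gdist p r = 0"
    then have "p = r" unfolding gdist_def prod_eq_iff by linarith
    then show False using r assms(3) by blast
  qed
  then show ?thesis using r(2) by linarith
qed

lemma dR_sum_le: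
  fixes z :: real
  assumes "finite X" "finite K" "K \<noteq> {}" "X \<inter> K = {}" "0 \<le> z" "9 * z \<le> 1/2"
  shows "(\<Sum>p\<in>X. z ^ dR K p) \<le> real (card K) * (18 * z)"
proof -
  have z: "0 \<le> z" "z \<le> 1" using assms by auto
  have "(\<Sum>p\<in>X. z ^ dR K p) \<le> (\<Sum>p\<in>X. \<Sum>r\<in>K. z ^ nat (gdist p r))"
  proof (rule sum_mono)
    fix p assume "p \<in> X"
    obtain r where r: "r \<in> K" "gdist p r = int (dR K p)" using dR_attained[OF assms(2,3)] .
    have "z ^ dR K p = z ^ nat (gdist p r)" using r(2) by simp
    also have "\<dots> \<le> (\<Sum>r\<in>K. z ^ nat (gdist p r))" using r(1) assms(2) z(1) by (intro member_le_sum) auto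
    finally show "z ^ dR K p \<le> (\<Sum>r\<in>K. z ^ nat (gdist p r))" .
  qed
  also have "\<dots> = (\<Sum>r\<in>K. \<Sum>p\<in>X. z ^ nat (gdist p r))" by (rule sum.swap)
  also have "\<dots> \<le> (\<Sum>r\<in>K. 18 * z)" by (rule sum_mono[OF gpt_sum_le[OF assms(1)]]) (use assms in auto)
  also have "\<dots> = real (card K) * (18 * z)" by simp
  finally show ?thesis .
qed

section \<open>Estimates for a single wall\<close>

text \<open>The cells that have a vertex in common with the face. The interface determines their
  spins, and \<open>cint_fibre\<close> shows that it determines no others.\<close>

definition NC :: "cface \<Rightarrow> cface set" where
  "NC f = {c. isF (fst c) \<and> (\<exists>v k. (v, k) \<in> cverts f \<and> v \<in> gclosure (fst c) \<and> (snd c = k \<or> snd c = k - 1))}"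

definition NN :: "gpt set \<Rightarrow> cface set \<Rightarrow> cface set" where
  "NN D I = (\<Union>f\<in>{f \<in> I. fst f \<in> D}. NC f)"

lemma NC_near: assumes "c \<in> NC f" shows "gdist (fst c) (fst f) \<le> 2" "snd f - 1 \<le> snd c" "snd c \<le> snd f + 1"
proof -
  obtain v k where v: "(v, k) \<in> cverts f" "v \<in> gclosure (fst c)" "snd c = k \<or> snd c = k - 1"
    using assms unfolding NC_def by blast
  have c: "\<bar>fst q - fst p\<bar> \<le> 1 \<and> \<bar>snd q - snd p\<bar> \<le> 1" if "q \<in> gclosure p" for p q
    using that unfolding gclosure_def by auto
  have "v \<in> gclosure (fst f)" "k = snd f \<or> k = snd f + 1" using v(1) by (auto simp: cverts_def)
  with c[OF this(1)] c[OF v(2)] v(3) show "gdist (fst c) (fst f) \<le> 2" "snd f - 1 \<le> snd c" "snd c \<le> snd f + 1"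
    unfolding gdist_def by linarith+
qed

lemma NC_card: "finite (NC f)" "card (NC f) \<le> 75"
proof -
  let ?B = "({fst (fst f) - 2..fst (fst f) + 2} \<times> {snd (fst f) - 2..snd (fst f) + 2}) \<times> {snd f - 1..snd f + 1}"
  have sub: "NC f \<subseteq> ?B"
  proof
    fix c assume "c \<in> NC f"
    from NC_near[OF this] show "c \<in> ?B" unfolding mem_Times_iff atLeastAtMost_iff gdist_def by linarith
  qed
  have "card ?B = 75" by (simp only: card_cartesian_product card_atLeastAtMost_int) simp
  then show "finite (NC f)" "card (NC f) \<le> 75" using finite_subset[OF sub] card_mono[OF _ sub] by auto
qed

lemma NC_shift: "NC (p, t + k) = cshift k (NC (p, t))"
proof -
  have 1: "cshift k (NC (p, t)) \<subseteq> NC (p, t + k)" for k t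
  proof
    fix c assume "c \<in> cshift k (NC (p, t))"
    then have "(fst c, snd c - k) \<in> NC (p, t)" using mem_cshift[of "fst c" "snd c" k] by simp
    then obtain v j where v: "isF (fst c)" "(v, j) \<in> cverts (p, t)" "v \<in> gclosure (fst c)" "snd c - k = j \<or> snd c - k = j - 1"
      unfolding NC_def by auto
    have "(v, j + k) \<in> cverts (p, t + k)" using v(2) by (simp add: cverts_shift)
    moreover have "snd c = j + k \<or> snd c = j + k - 1" using v(4) by linarith
    ultimately show "c \<in> NC (p, t + k)" using v(1,3) unfolding NC_def by blast
  qed
  have "cshift k (cshift (- k) (NC (p, t + k))) \<subseteq> cshift k (NC (p, t))"
    using 1[of "- k" "t + k"] by (simp add: cshift_mono)
  then show ?thesis using 1 by (auto simp: cshift_cshift)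
qed

lemma NN_Un: "NN (D \<union> E) I = NN D I \<union> NN E I"
  unfolding NN_def by blast

lemma NN_cong: "(\<And>p t. p \<in> D \<Longrightarrow> (p, t) \<in> I \<longleftrightarrow> (p, t) \<in> J) \<Longrightarrow> NN D I = NN D J"
proof -
  assume a: "\<And>p t. p \<in> D \<Longrightarrow> (p, t) \<in> I \<longleftrightarrow> (p, t) \<in> J"
  have "{f \<in> I. fst f \<in> D} = {f \<in> J. fst f \<in> D}" using a by (intro set_eqI) (metis (mono_tags, lifting) mem_Collect_eq prod.collapse)
  then show ?thesis by (simp add: NN_def)
qed

lemma NN_shift:
  assumes "\<And>p t. p \<in> D \<Longrightarrow> (p, t) \<in> J \<longleftrightarrow> (p, t + k) \<in> I"
  shows "NN D I = cshift k (NN D J)"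
proof -
  have "{f \<in> I. fst f \<in> D} = (\<lambda>f. (fst f, snd f + k)) ` {f \<in> J. fst f \<in> D}"
  proof (intro set_eqI iffI)
    fix f assume f: "f \<in> {f \<in> I. fst f \<in> D}"
    then have "(fst f, snd f - k) \<in> J" using assms[of "fst f" "snd f - k"] by simp
    then show "f \<in> (\<lambda>f. (fst f, snd f + k)) ` {f \<in> J. fst f \<in> D}"
      using f by (intro image_eqI[of _ _ "(fst f, snd f - k)"]) auto
  next
    fix f assume "f \<in> (\<lambda>f. (fst f, snd f + k)) ` {f \<in> J. fst f \<in> D}"
    then obtain g where g: "g \<in> J" "fst g \<in> D" "f = (fst g, snd g + k)" by blast
    then show "f \<in> {f \<in> I. fst f \<in> D}" using assms[of "fst g" "snd g"] by simp
  qed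
  then have "NN D I = (\<Union>f\<in>{f \<in> J. fst f \<in> D}. NC (fst f, snd f + k))" by (simp add: NN_def)
  also have "\<dots> = (\<Union>f\<in>{f \<in> J. fst f \<in> D}. cshift k (NC f))" by (simp add: NC_shift)
  also have "\<dots> = cshift k (NN D J)" unfolding NN_def cshift_def by blast
  finally show ?thesis .
qed

lemma finite_faces_over: assumes "iface n I" "finite D" shows "finite {f \<in> I. fst f \<in> D}"
proof -
  have "{f \<in> I. fst f \<in> D} \<subseteq> (I - outL n) \<union> D \<times> {0}"
    by (auto simp: outL_def mem_Times_iff)
  then show ?thesis by (rule finite_subset) (use iface.fin[OF assms(1)] assms(2) in auto)
qed

lemma sum_UN_le:
  fixes g :: "'a \<Rightarrow> real"
  assumes "finite F" "\<And>f. f \<in> F \<Longrightarrow> finite (A f)" "\<And>y. 0 \<le> g y"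
  shows "sum g (\<Union>f\<in>F. A f) \<le> (\<Sum>f\<in>F. sum g (A f))"
  using assms(1,2)
proof (induction F rule: finite_induct)
  case (insert f F)
  let ?U = "\<Union>f\<in>F. A f"
  have fin: "finite (A f)" "finite ?U" using insert by auto
  have "sum g (A f \<union> ?U) + sum g (A f \<inter> ?U) = sum g (A f) + sum g ?U" by (rule sum.union_inter[OF fin])
  moreover have "0 \<le> sum g (A f \<inter> ?U)" using assms(3) by (rule sum_nonneg)
  moreover have "sum g ?U \<le> (\<Sum>f\<in>F. sum g (A f))" using insert by auto
  ultimately show ?case using insert by simp
qed simp

context iface begin

text \<open>Ceilings contribute at most one face per column. The other faces belong to walls, and
  passing to standard position changes no projection, so the values of \<open>g\<close> stay the
  same.\<close>

lemma face_sum_le: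
  fixes g :: "gpt \<Rightarrow> real"
  assumes D: "finite D" and g: "\<And>p. 0 \<le> g p"
  shows "(\<Sum>f\<in>{f \<in> I. fst f \<in> D}. g (fst f)) \<le>
    (\<Sum>p\<in>D. g p) + (\<Sum>V\<in>{V \<in> cstd I. cproj V \<inter> D \<noteq> {}}. \<Sum>f\<in>V. g (fst f))"
proof -
  let ?A = "{f \<in> I. fst f \<in> D \<and> f \<notin> wf}" and ?B = "{f \<in> wf. fst f \<in> D}"
  have fin: "finite {f \<in> I. fst f \<in> D}" by (rule finite_faces_over[OF iface_axioms D])
  have eq: "{f \<in> I. fst f \<in> D} = ?A \<union> ?B" using wf_subset by blast
  have fA: "finite ?A" by (rule finite_subset[OF _ fin]) blast
  have fB: "finite ?B" using finite_wf by simp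
  have "(\<Sum>f\<in>{f \<in> I. fst f \<in> D}. g (fst f)) = (\<Sum>f\<in>?A. g (fst f)) + (\<Sum>f\<in>?B. g (fst f))"
    unfolding eq by (rule sum.union_disjoint[OF fA fB]) blast
  moreover have "(\<Sum>f\<in>?A. g (fst f)) \<le> (\<Sum>p\<in>D. g p)"
  proof -
    have "inj_on fst ?A" unfolding inj_on_def wf_def by blast
    then have "(\<Sum>f\<in>?A. g (fst f)) = (\<Sum>p\<in>fst ` ?A. g p)" by (simp add: sum.reindex)
    also have "\<dots> \<le> (\<Sum>p\<in>D. g p)" by (rule sum_mono2[OF D]) (use g in auto)
    finally show ?thesis .
  qed
  moreover have "(\<Sum>f\<in>?B. g (fst f)) \<le> (\<Sum>V\<in>{V \<in> cstd I. cproj V \<inter> D \<noteq> {}}. \<Sum>f\<in>V. g (fst f))"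
  proof -
    let ?C = "{W \<in> cwalls I. cproj W \<inter> D \<noteq> {}}"
    define hh where "hh W = (SOME h. cfloor I W h)" for W
    have hh: "cfloor I W (hh W)" if "W \<in> cwalls I" for W
      unfolding hh_def by (rule someI_ex) (use floor_unique[OF that] in blast)
    define st where "st W = cshift (- hh W) W" for W
    have "cwalls I \<subseteq> (\<lambda>f. {g. linked cadj wf f g}) ` wf" unfolding cwalls_def by blast
    then have finC: "finite ?C" using finite_wf finite_subset by fastforce
    have "?B \<subseteq> (\<Union>W\<in>?C. W)"
    proof
      fix f assume f: "f \<in> ?B"
      let ?W = "{g. linked cadj wf f g}"
      have "f \<in> ?W" by simp
      then have "fst f \<in> cproj ?W" using gclosure_refl unfolding cproj_def by blast
      then have "?W \<in> ?C" using wall_of f by blast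
      then show "f \<in> (\<Union>W\<in>?C. W)" using \<open>f \<in> ?W\<close> by blast
    qed
    then have "(\<Sum>f\<in>?B. g (fst f)) \<le> (\<Sum>f\<in>(\<Union>W\<in>?C. W). g (fst f))"
      using finC wall_component(4) g by (intro sum_mono2) auto
    also have "\<dots> \<le> (\<Sum>W\<in>?C. \<Sum>f\<in>W. g (fst f))"
      by (rule sum_UN_le[OF finC]) (use wall_component(4) g in auto)
    also have "\<dots> = (\<Sum>W\<in>?C. \<Sum>f\<in>st W. g (fst f))"
    proof (rule sum.cong[OF refl])
      fix W show "(\<Sum>f\<in>W. g (fst f)) = (\<Sum>f\<in>st W. g (fst f))"
        unfolding st_def cshift_def by (subst sum.reindex) (auto simp: inj_on_def prod_eq_iff)
    qed
    also have "\<dots> = (\<Sum>V\<in>st ` ?C. \<Sum>f\<in>V. g (fst f))"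
    proof (rule sum.reindex[unfolded o_def, symmetric])
      show "inj_on st ?C"
      proof (rule inj_onI)
        fix W W' assume W: "W \<in> ?C" "W' \<in> ?C" "st W = st W'"
        show "W = W'"
        proof (rule ccontr)
          assume "W \<noteq> W'"
          then have "cproj W \<inter> cproj W' = {}" using cwalls_disjoint W(1,2) by blast
          then have "st W \<noteq> st W'" unfolding st_def using cshift_disjoint_neq wall_component(5) W(1) by blast
          then show False using W(3) by blast
        qed
      qed
    qed
    also have "\<dots> \<le> (\<Sum>V\<in>{V \<in> cstd I. cproj V \<inter> D \<noteq> {}}. \<Sum>f\<in>V. g (fst f))"
    proof (rule sum_mono2)
      show "finite {V \<in> cstd I. cproj V \<inter> D \<noteq> {}}" using finite_cstd by simp
      show "st ` ?C \<subseteq> {V \<in> cstd I. cproj V \<inter> D \<noteq> {}}"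
        using hh unfolding st_def cstd_def by auto
      show "0 \<le> (\<Sum>f\<in>V. g (fst f))" for V using g by (rule sum_nonneg)
    qed
    finally show ?thesis .
  qed
  ultimately show ?thesis by linarith
qed

end

text \<open>5400 = 300 * 18 makes the decoupling errors, summed over the interior of a wall, at most
  the number of points of its projection. The power 9 turns decay per contour face into decay per
  unit of grid distance. 28125 = 5 * 5625 is the base in counting standard walls through a point,
  and 1/600 compensates the factor 300 in \<open>aW\<close> and the factor 2 of the geometric
  series.\<close>

locale model = fixes n :: nat and \<beta> :: real
  assumes beta1: "11250 * exp (- \<beta>) \<le> (1/5400) ^ 9"
    and beta2: "28125 * exp (1 - (\<beta> - 120) / 2) \<le> 1/600"
begin

sublocale ising \<beta> "boxF n"
proof
  show "finite (boxF n)" by (rule finite_boxF)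
  show "isF u" if "u \<in> boxF n" for u using that by (simp add: boxF_def)
  have "(1/5400) ^ 9 \<le> (1/8 :: real)" by (simp add: power_one_over)
  then show "11250 * exp (- \<beta>) \<le> 1/8" using beta1 by linarith
qed

definition z :: real where "z = 1/5400"

lemma x_power_le:
  assumes "k \<le> 9 * Suc d" shows "x ^ Suc d \<le> z ^ k"
proof -
  have "x \<le> z ^ 9" using beta1 by (simp only: x_def z_def)
  then have "x ^ Suc d \<le> (z ^ 9) ^ Suc d" using x_bounds(1) by (intro power_mono) auto
  also have "\<dots> = z ^ (9 * Suc d)" by (rule power_mult[symmetric])
  also have "\<dots> \<le> z ^ k" by (rule power_decreasing[OF assms]) (auto simp: z_def)
  finally show ?thesis .
qed

text \<open>The components over \<open>X\<close> are split off one at a time. Each moves rigidly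
  under the deletion, so its factor is unchanged by translation invariance, and \<open>K\<close>
  separates it from everything else, so the decoupling error decays with the distance to
  \<open>K\<close>. Positive association puts the factors together again.\<close>

lemma decouple_component:
  assumes del: "deleted n I K s J" and I: "iface n I" and K: "finite K" "K \<noteq> {}"
    and X: "finite X" "X \<inter> K = {}" "\<And>p q. p \<in> X \<Longrightarrow> linked gadj (- K) p q \<Longrightarrow> q \<in> X"
    and A: "\<And>c. c \<in> A \<Longrightarrow> \<exists>f. c \<in> NC f \<and> fst f \<notin> X"
  shows "Pinf (A \<union> NN X I) \<le> Pinf A * Pinf (NN X J) * exp (300 * (\<Sum>f\<in>{f \<in> I. fst f \<in> X}. z ^ dR K (fst f)))"
  using X A
proof (induction "card X" arbitrary: X rule: less_induct)
  case less
  show ?case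
  proof (cases "X = {}")
    case True
    then show ?thesis by (simp add: NN_def Pinf_empty)
  next
    case False
    then obtain p where p: "p \<in> X" by blast
    define C where "C = {y. linked gadj (- K) p y}"
    have pC: "p \<in> C" by (simp add: C_def)
    have std_collections: "C \<subseteq> X" using less.prems(3)[OF p] by (auto simp: C_def)
    have finC: "finite C" using std_collections less.prems(1) finite_subset by blast
    have CK: "C \<inter> K = {}" using std_collections less.prems(2) by blast
    let ?X' = "X - C"
    let ?e = "\<lambda>X. \<Sum>f\<in>{f \<in> I. fst f \<in> X}. z ^ dR K (fst f)"
    have IH: "Pinf (A \<union> NN ?X' I) \<le> Pinf A * Pinf (NN ?X' J) * exp (300 * ?e ?X')"
    proof (rule less.hyps)
      show "card ?X' < card X" using p pC less.prems(1) by (intro psubset_card_mono) auto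
      show "q' \<in> ?X'" if q: "q \<in> ?X'" "linked gadj (- K) q q'" for q q'
      proof -
        have "q' \<notin> C"
        proof
          assume "q' \<in> C"
          then have "linked gadj (- K) p q" unfolding C_def
            using linked_trans[OF _ linked_sym[OF symp_gadj q(2)]] by blast
          then show False using q(1) by (simp add: C_def)
        qed
        then show ?thesis using less.prems(3)[of q q'] q by blast
      qed
      show "\<exists>f. c \<in> NC f \<and> fst f \<notin> ?X'" if "c \<in> A" for c using less.prems(4)[OF that] by blast
    qed (use less.prems in auto)
    define S where "S = A \<union> NN ?X' I"
    define B where "B = NN C I"
    define F where "F = {f \<in> I. fst f \<in> C}"
    have finF: "finite F" unfolding F_def by (rule finite_faces_over[OF I finC])
    have finB: "finite B" unfolding B_def NN_def using finF NC_card(1) by (auto simp: F_def)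
    \<comment> \<open>Each of the two cells is within distance 2 of its face, and measuring the
      distance to \<open>K\<close> from the cell instead of the face costs 2 more: together 6.
      Halving matches the hypothesis of the decoupling, where the distance is at least
      \<open>2 * d\<close>.\<close>
    define d where "d b = nat ((int (dR K (fst b)) - 6) div 2)" for b :: cface
    have far: "2 * int (d b) \<le> gdist (fst b) (fst c)" if b: "b \<in> B" and c: "c \<in> S" for b c
    proof -
      obtain f where f: "f \<in> I" "fst f \<in> C" "b \<in> NC f" using b unfolding B_def NN_def by blast
      obtain f' where f': "c \<in> NC f'" "fst f' \<notin> C" using c less.prems(4)[of c] std_collections unfolding S_def NN_def by blast
      have "\<not> linked gadj (- K) (fst f) (fst f')"
      proof
        assume "linked gadj (- K) (fst f) (fst f')"
        moreover have "linked gadj (- K) p (fst f)" using f(2) by (simp add: C_def)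
        ultimately have "linked gadj (- K) p (fst f')" by (rule linked_trans[rotated])
        then show False using f'(2) by (simp add: C_def)
      qed
      moreover have "fst f \<notin> K" using f(2) CK by blast
      ultimately obtain r where r: "r \<in> K" "gdist (fst f) r \<le> gdist (fst f) (fst f')" using gdist_boundary by blast
      have "int (dR K (fst b)) \<le> gdist (fst b) r" by (rule dR_le[OF K(1) r(1)])
      moreover have "gdist (fst b) r \<le> gdist (fst b) (fst f) + gdist (fst f) r" by (rule gdist_triangle)
      moreover have "gdist (fst f) (fst f') \<le> gdist (fst f) (fst b) + gdist (fst b) (fst f')" by (rule gdist_triangle)
      moreover have "gdist (fst b) (fst f') \<le> gdist (fst b) (fst c) + gdist (fst c) (fst f')" by (rule gdist_triangle)
      moreover have "gdist (fst b) (fst f) \<le> 2" "gdist (fst c) (fst f') \<le> 2" using NC_near(1) f(3) f'(1) by blast+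
      moreover have "gdist (fst f) (fst b) = gdist (fst b) (fst f)" by (rule gdist_sym)
      ultimately have "int (dR K (fst b)) - 6 \<le> gdist (fst b) (fst c)" using r(2) by linarith
      then show ?thesis unfolding d_def using gdist_nonneg[of "fst b" "fst c"] by linarith
    qed
    have pr: "(\<Prod>b\<in>B. 1 + 4 * x ^ Suc (d b)) \<le> exp (300 * ?e C)"
    proof -
      have "(\<Prod>b\<in>B. 1 + 4 * x ^ Suc (d b)) \<le> (\<Prod>b\<in>B. exp (4 * x ^ Suc (d b)))"
        using x_bounds(1) by (intro prod_mono) (auto intro: add_nonneg_nonneg exp_ge_add_one_self)
      also have "\<dots> = exp (\<Sum>b\<in>B. 4 * x ^ Suc (d b))" by (rule exp_sum[OF finB, symmetric])
      also have "\<dots> \<le> exp (300 * ?e C)"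
      proof -
        have "(\<Sum>b\<in>B. 4 * x ^ Suc (d b)) \<le> (\<Sum>f\<in>F. \<Sum>b\<in>NC f. 4 * x ^ Suc (d b))"
          unfolding B_def NN_def F_def[symmetric]
          by (rule sum_UN_le[OF finF NC_card(1)]) (use x_bounds(1) in simp)
        \<comment> \<open>300 = 4 * 75: at most 75 cells touch a face, and each contributes at most
          \<open>4 * z ^ dR K (fst f)\<close>.\<close>
        also have "\<dots> \<le> (\<Sum>f\<in>F. 300 * z ^ dR K (fst f))"
        proof (rule sum_mono)
          fix f assume f: "f \<in> F"
          have each: "4 * x ^ Suc (d b) \<le> 4 * z ^ dR K (fst f)" if b: "b \<in> NC f" for b
          proof -
            obtain r where r: "r \<in> K" "gdist (fst b) r = int (dR K (fst b))" using dR_attained[OF K] .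
            have "int (dR K (fst f)) \<le> gdist (fst f) r" by (rule dR_le[OF K(1) r(1)])
            moreover have "gdist (fst f) r \<le> gdist (fst f) (fst b) + gdist (fst b) r" by (rule gdist_triangle)
            moreover have "gdist (fst f) (fst b) \<le> 2" using NC_near(1)[OF b] gdist_sym by metis
            ultimately have D: "dR K (fst f) \<le> dR K (fst b) + 2" using r(2) by linarith
            \<comment> \<open>Rounding in the division turns 6 into 7, and passing from the cell to
              the face adds 2. The total 9 is the exponent in the hypothesis on
              \<open>\<beta>\<close>.\<close>
            have "int (dR K (fst b)) - 7 \<le> 2 * int (d b)" unfolding d_def by linarith
            then have "int (dR K (fst f)) \<le> int (9 * Suc (d b))" using D by simp
            then have "dR K (fst f) \<le> 9 * Suc (d b)" by (simp only: of_nat_le_iff)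
            then show ?thesis using x_power_le by simp
          qed
          have "(\<Sum>b\<in>NC f. 4 * x ^ Suc (d b)) \<le> (\<Sum>b\<in>NC f. 4 * z ^ dR K (fst f))" by (rule sum_mono[OF each])
          also have "\<dots> = real (card (NC f)) * (4 * z ^ dR K (fst f))" by simp
          also have "\<dots> \<le> 75 * (4 * z ^ dR K (fst f))"
            using NC_card(2)[of f] by (intro mult_right_mono) (auto simp: z_def)
          finally show "(\<Sum>b\<in>NC f. 4 * x ^ Suc (d b)) \<le> 300 * z ^ dR K (fst f)" by simp
        qed
        also have "\<dots> = 300 * ?e C" by (simp add: F_def sum_distrib_left)
        finally show ?thesis by simp
      qed
      finally show ?thesis .
    qed
    have BC: "Pinf B = Pinf (NN C J)"
    proof -
      have "NN C I = cshift (s p) (NN C J)"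
      proof (rule NN_shift)
        fix q t assume q: "q \<in> C"
        then have "s q = s p" using del unfolding deleted_def C_def by (metis mem_Collect_eq)
        moreover have "q \<notin> K" using q CK by blast
        ultimately show "(q, t) \<in> J \<longleftrightarrow> (q, t + s p) \<in> I" using del unfolding deleted_def by metis
      qed
      then show ?thesis by (simp add: B_def Pinf_cshift)
    qed
    have XX: "X = ?X' \<union> C" using std_collections by blast
    have NI: "A \<union> NN X I = S \<union> B" 
    proof -
      have "NN X I = NN ?X' I \<union> NN C I" by (subst XX) (rule NN_Un)
      then show ?thesis unfolding S_def B_def by blast
    qed
    have NJ: "NN X J = NN ?X' J \<union> NN C J" by (subst XX) (rule NN_Un)
    have eX: "?e X = ?e ?X' + ?e C"
    proof -
      have "{f \<in> I. fst f \<in> X} = {f \<in> I. fst f \<in> ?X'} \<union> {f \<in> I. fst f \<in> C}" using std_collections by blast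
      moreover have "{f \<in> I. fst f \<in> ?X'} \<inter> {f \<in> I. fst f \<in> C} = {}" by blast
      moreover have "finite {f \<in> I. fst f \<in> ?X'}" by (rule finite_faces_over[OF I]) (use less.prems(1) in simp)
      ultimately show ?thesis using finF by (simp add: F_def sum.union_disjoint)
    qed
    have "Pinf (S \<union> B) \<le> Pinf S * Pinf B * (\<Prod>b\<in>B. 1 + 4 * x ^ Suc (d b))" by (rule Pinf_decouple[OF finB far])
    also have "\<dots> \<le> Pinf S * Pinf B * exp (300 * ?e C)"
      by (rule mult_left_mono[OF pr]) (simp add: Pinf_nonneg)
    also have "\<dots> \<le> (Pinf A * Pinf (NN ?X' J) * exp (300 * ?e ?X')) * Pinf B * exp (300 * ?e C)"
      using IH unfolding S_def by (intro mult_right_mono) (auto simp: Pinf_nonneg)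
    also have "\<dots> = Pinf A * (Pinf (NN ?X' J) * Pinf (NN C J)) * exp (300 * ?e X)"
      unfolding BC eX distrib_left exp_add by (simp only: mult_ac)
    also have "\<dots> \<le> Pinf A * Pinf (NN X J) * exp (300 * ?e X)"
      unfolding NJ by (intro mult_right_mono mult_left_mono Pinf_Un_ge) (auto simp: Pinf_nonneg)
    finally show ?thesis unfolding NI .
  qed
qed


text \<open>The share of the wall \<open>V\<close> in the bound for the decoupling error when
  \<open>W\<close> is deleted.\<close>

definition aW :: "cface set \<Rightarrow> cface set \<Rightarrow> real" where
  "aW W V = 300 * (\<Sum>f\<in>V. z ^ dR (cproj W) (fst f))"

lemma aW_nonneg: "0 \<le> aW W V"
  unfolding aW_def by (intro mult_nonneg_nonneg sum_nonneg) (auto simp: z_def)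

text \<open>18 = 9 * 2: a closure has at most 9 points, and the number of faces is at most twice the
  excess.\<close>

lemma card_cproj: assumes "stdwall n W" shows "real (card (cproj W)) \<le> 18 * cexcess W"
proof -
  have "card (cproj W) \<le> (\<Sum>g\<in>W. card (gclosure (fst g)))"
    unfolding cproj_def by (rule card_UN_le[OF stdwallD(1)[OF assms]])
  also have "\<dots> \<le> (\<Sum>g\<in>W. 9)" by (rule sum_mono[OF card_gclosure])
  finally have "card (cproj W) \<le> 9 * card W" by simp
  then have "real (card (cproj W)) \<le> 9 * real (card W)" by linarith
  then show ?thesis using stdwallD(5)[OF assms] by linarith
qed

abbreviation inner :: "cface set \<Rightarrow> gpt set" where "inner W \<equiv> ghull (cproj W) - cproj W"

lemma finite_inner: "stdwall n W \<Longrightarrow> finite (inner W)"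
  using finite_ghull[OF stdwallD(8)] by blast

lemma inner_sum: assumes "stdwall n W" shows "300 * (\<Sum>p\<in>inner W. z ^ dR (cproj W) p) \<le> 18 * cexcess W"
proof -
  have "(\<Sum>p\<in>inner W. z ^ dR (cproj W) p) \<le> real (card (cproj W)) * (18 * z)"
    by (rule dR_sum_le[OF finite_inner[OF assms] stdwallD(8,9)[OF assms]]) (auto simp: z_def)
  then have "300 * (\<Sum>p\<in>inner W. z ^ dR (cproj W) p) \<le> real (card (cproj W))" by (simp add: z_def)
  then show ?thesis using card_cproj[OF assms] by linarith
qed

text \<open>The constraint near \<open>W\<close> itself is dropped and the interior is decoupled
  from the exterior. Among the faces over the interior, the ceilings give the factor
  \<open>exp (18 * cexcess W)\<close> and the nested walls the factors
  \<open>exp (aW W V)\<close>.\<close>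

lemma weight_upper:
  assumes X: "X \<in> Col n" "W \<in> X" and D: "ghull (cproj W) \<subseteq> D"
  shows "Pinf (NN D (Ifc n X)) \<le> Pinf (NN (D - ghull (cproj W)) (Ifc n (X - {W}))) * Pinf (NN (inner W) (Ifc n (X - {W})))
     * exp (18 * cexcess W) * (\<Prod>V\<in>{V \<in> X - {W}. cproj V \<inter> inner W \<noteq> {}}. exp (aW W V))"
proof -
  let ?K = "cproj W" and ?T = "inner W" and ?O = "D - ghull (cproj W)" and ?I = "Ifc n X" and ?J = "Ifc n (X - {W})"
  obtain s where s: "X - {W} \<in> Col n" "deleted n ?I ?K s ?J" by (rule Col_delete[OF X])
  note Ii = Ifc(1)[OF X(1)] and Ji = Ifc(1)[OF s(1)]
  have SW: "stdwall n W" using Col_facts(2)[OF X] .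
  have O_eq: "NN ?O ?I = NN ?O ?J" by (rule NN_cong) (use deleted_outside[OF s(2)] in blast)
  have "NN ?O ?I \<union> NN ?T ?I \<subseteq> NN D ?I" using D unfolding NN_def by blast
  then have "Pinf (NN D ?I) \<le> Pinf (NN ?O ?I \<union> NN ?T ?I)" by (rule Pinf_antimono)
  also have "\<dots> \<le> Pinf (NN ?O ?I) * Pinf (NN ?T ?J) * exp (300 * (\<Sum>f\<in>{f \<in> ?I. fst f \<in> ?T}. z ^ dR ?K (fst f)))"
  proof (rule decouple_component[OF s(2) Ii stdwallD(8,9)[OF SW] finite_inner[OF SW]])
    show "inner W \<inter> cproj W = {}" by blast
    show "q \<in> inner W" if p: "p \<in> inner W" and l: "linked gadj (- cproj W) p q" for p q
    proof -
      have pK: "p \<notin> cproj W" using p by blast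
      have "q \<in> ghull (cproj W)" using ghull_linked[OF l pK] p by blast
      moreover have "q \<in> - cproj W" by (rule linked_in[OF l]) (use pK in simp)
      ultimately show ?thesis by blast
    qed
    show "\<exists>f. c \<in> NC f \<and> fst f \<notin> inner W" if "c \<in> NN ?O ?I" for c using that unfolding NN_def by blast
  qed
  finally have 1: "Pinf (NN D ?I) \<le> Pinf (NN ?O ?J) * Pinf (NN ?T ?J) * exp (300 * (\<Sum>f\<in>{f \<in> ?I. fst f \<in> ?T}. z ^ dR ?K (fst f)))"
    unfolding O_eq .
  have "(\<Sum>f\<in>{f \<in> ?I. fst f \<in> ?T}. z ^ dR ?K (fst f)) = (\<Sum>f\<in>{f \<in> ?J. fst f \<in> ?T}. z ^ dR ?K (fst f))"
  proof (rule sum.reindex_bij_witness[where i = "\<lambda>f. (fst f, snd f + s (fst f))" and j = "\<lambda>f. (fst f, snd f - s (fst f))"])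
    fix f assume f: "f \<in> {f \<in> ?I. fst f \<in> ?T}"
    then have "(fst f, snd f - s (fst f)) \<in> ?J \<longleftrightarrow> (fst f, snd f - s (fst f) + s (fst f)) \<in> ?I"
      using s(2) unfolding deleted_def by blast
    then show "(fst f, snd f - s (fst f)) \<in> {f \<in> ?J. fst f \<in> ?T}" using f by simp
  next
    fix f assume f: "f \<in> {f \<in> ?J. fst f \<in> ?T}"
    then have "(fst f, snd f) \<in> ?J \<longleftrightarrow> (fst f, snd f + s (fst f)) \<in> ?I"
      using s(2) unfolding deleted_def by blast
    then show "(fst f, snd f + s (fst f)) \<in> {f \<in> ?I. fst f \<in> ?T}" using f by simp
  qed auto
  also have "\<dots> \<le> (\<Sum>p\<in>?T. z ^ dR ?K p) + (\<Sum>V\<in>{V \<in> cstd ?J. cproj V \<inter> ?T \<noteq> {}}. \<Sum>f\<in>V. z ^ dR ?K (fst f))"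
    by (rule iface.face_sum_le[OF Ji finite_inner[OF SW]]) (simp add: z_def)
  finally have "300 * (\<Sum>f\<in>{f \<in> ?I. fst f \<in> ?T}. z ^ dR ?K (fst f)) \<le>
      18 * cexcess W + (\<Sum>V\<in>{V \<in> X - {W}. cproj V \<inter> ?T \<noteq> {}}. aW W V)"
    using inner_sum[OF SW] unfolding Ifc(2)[OF s(1)] aW_def sum_distrib_left[symmetric] by linarith
  then have "exp (300 * (\<Sum>f\<in>{f \<in> ?I. fst f \<in> ?T}. z ^ dR ?K (fst f))) \<le>
      exp (18 * cexcess W) * (\<Prod>V\<in>{V \<in> X - {W}. cproj V \<inter> ?T \<noteq> {}}. exp (aW W V))"
  proof -
    have "finite {V \<in> X - {W}. cproj V \<inter> ?T \<noteq> {}}" using Col_facts(1)[OF X(1)] by simp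
    note e = exp_sum[OF this, of "aW W"]
    assume "300 * (\<Sum>f\<in>{f \<in> ?I. fst f \<in> ?T}. z ^ dR ?K (fst f)) \<le>
      18 * cexcess W + (\<Sum>V\<in>{V \<in> X - {W}. cproj V \<inter> ?T \<noteq> {}}. aW W V)"
    then show ?thesis unfolding e[symmetric] exp_add[symmetric] exp_le_cancel_iff .
  qed
  then have "Pinf (NN ?O ?J) * Pinf (NN ?T ?J) * exp (300 * (\<Sum>f\<in>{f \<in> ?I. fst f \<in> ?T}. z ^ dR ?K (fst f))) \<le>
     Pinf (NN ?O ?J) * Pinf (NN ?T ?J) * (exp (18 * cexcess W) * (\<Prod>V\<in>{V \<in> X - {W}. cproj V \<inter> ?T \<noteq> {}}. exp (aW W V)))"
    by (rule mult_left_mono) (simp add: Pinf_nonneg)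
  then show ?thesis using 1 by (simp only: mult.assoc)
qed

text \<open>Closing the floor adds at most 75 cells per face of the projection, hence at most
  \<open>75 * cexcess W\<close> cells, and each costs a factor of at most 2, which is below
  \<open>exp 1\<close>.\<close>

lemma weight_lower:
  assumes X: "X \<in> Col n" "W \<in> X" and D: "ghull (cproj W) \<subseteq> D"
  shows "Pinf (NN (D - ghull (cproj W)) (Ifc n (X - {W}))) * Pinf (NN (inner W) (Ifc n (X - {W}))) * exp (- (75 * cexcess W))
     \<le> Pinf (NN D (Ifc n (X - {W})))"
proof -
  let ?K = "cproj W" and ?T = "inner W" and ?O = "D - ghull (cproj W)" and ?J = "Ifc n (X - {W})"
  obtain s where s: "X - {W} \<in> Col n" "deleted n (Ifc n X) ?K s ?J" "real (card {u \<in> ?K. isF u}) \<le> cexcess W"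
    by (rule Col_delete[OF X])
  have SW: "stdwall n W" using Col_facts(2)[OF X] .
  obtain h where h: "\<And>p t. p \<in> ?K \<Longrightarrow> (p, t) \<in> ?J \<Longrightarrow> isF p \<and> t = h" using s(2) unfolding deleted_def by blast
  let ?L = "{f \<in> ?J. fst f \<in> ?K}"
  have "?L \<subseteq> (\<lambda>u. (u, h)) ` {u \<in> ?K. isF u}"
  proof
    fix f assume f: "f \<in> ?L"
    then have "isF (fst f) \<and> snd f = h" using h[of "fst f" "snd f"] by simp
    then show "f \<in> (\<lambda>u. (u, h)) ` {u \<in> ?K. isF u}" using f by (intro image_eqI[of _ _ "fst f"]) (auto simp: prod_eq_iff)
  qed
  moreover have fK: "finite {u \<in> ?K. isF u}" using stdwallD(8)[OF SW] by simp
  ultimately have L: "finite ?L" "card ?L \<le> card {u \<in> ?K. isF u}"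
    using finite_subset surj_card_le by blast+
  have finN: "finite (NN ?K ?J)" unfolding NN_def using L(1) NC_card(1) by blast
  have "card (NN ?K ?J) \<le> (\<Sum>f\<in>?L. card (NC f))" unfolding NN_def by (rule card_UN_le[OF L(1)])
  also have "\<dots> \<le> (\<Sum>f\<in>?L. 75)" by (rule sum_mono[OF NC_card(2)])
  also have "\<dots> \<le> 75 * card {u \<in> ?K. isF u}" using L(2) by simp
  finally have "real (card (NN ?K ?J)) \<le> 75 * cexcess W" using s(3) by linarith
  have "exp (- (75 * cexcess W)) \<le> exp (- real (card (NN ?K ?J)))" using \<open>real (card (NN ?K ?J)) \<le> 75 * cexcess W\<close> by simp
  also have "\<dots> = exp (-1) ^ card (NN ?K ?J)" by (simp flip: exp_of_nat_mult)
  also have "\<dots> \<le> (1/2) ^ card (NN ?K ?J)"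
  proof (rule power_mono)
    have "2 \<le> exp (1::real)" using exp_ge_add_one_self[of "1::real"] by simp
    then show "exp (-1) \<le> (1/2 :: real)" by (simp add: exp_minus field_simps)
  qed simp
  finally have e: "exp (- (75 * cexcess W)) \<le> (1/2) ^ card (NN ?K ?J)" .
  have "Pinf (NN ?O ?J) * Pinf (NN ?T ?J) * exp (- (75 * cexcess W)) \<le> Pinf (NN ?O ?J \<union> NN ?T ?J) * (1/2) ^ card (NN ?K ?J)"
    by (rule mult_mono[OF Pinf_Un_ge e]) (auto simp: Pinf_nonneg)
  also have "\<dots> \<le> Pinf (NN ?O ?J \<union> NN ?T ?J \<union> NN ?K ?J)" by (rule Pinf_add_finite[OF finN])
  also have "\<dots> \<le> Pinf (NN D ?J)" by (rule Pinf_antimono) (use D in \<open>unfold NN_def, blast\<close>)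
  finally show ?thesis .
qed

end

section \<open>The peeling estimate\<close>

context model begin

text \<open>The weight of a collection in the limit of infinite height, up to a common constant.
  Restricting the partition function to cells near the part over \<open>D\<close> allows the
  estimate to be used inside a larger wall.\<close>

definition omega :: "gpt set \<Rightarrow> cface set set \<Rightarrow> real" where
  "omega D X = exp (- \<beta> * (\<Sum>V\<in>X. cexcess V)) * Pinf (NN D (Ifc n X))"

lemma omega_nonneg: "0 \<le> omega D X"
  by (simp add: omega_def Pinf_nonneg)

text \<open>The factor per face of a nested wall: \<open>exp 1\<close> bounds the growth of
  \<open>exp (aW W V)\<close>, and the rest is the peeling factor, the excess being at least half
  the number of faces.\<close>

definition y :: real where "y = exp (1 - (\<beta> - 120) / 2)"

lemma y_bounds: "0 < y" "28125 * y \<le> 1/600" "120 \<le> \<beta>"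
proof -
  show "0 < y" by (simp add: y_def)
  show 1: "28125 * y \<le> 1/600" using beta2 by (simp only: y_def)
  show "120 \<le> \<beta>"
  proof (rule ccontr)
    assume "\<not> 120 \<le> \<beta>"
    then have "1 \<le> y" unfolding y_def by simp
    then show False using 1 by linarith
  qed
qed

text \<open>The loss 120 exceeds the sum 18 + 18 + 75 of the constants in the upper bound for the weight
  with the wall, the exponential moment of the walls inside it, and the lower bound without it.\<close>
definition peel :: "cface set \<Rightarrow> gpt set \<Rightarrow> bool" where
  "peel W D \<longleftrightarrow> (\<forall>F. finite F \<and> F \<subseteq> Col n \<and> (\<forall>X\<in>F. \<forall>V\<in>X. cproj V \<subseteq> ghull (cproj W) \<longrightarrow> X - {V} \<in> F) \<longrightarrow>
     (\<Sum>X\<in>{X \<in> F. W \<in> X}. omega D X) \<le> exp (- (\<beta> - 120) * cexcess W) * (\<Sum>X\<in>{X \<in> F. W \<notin> X}. omega D X))"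

text \<open>The wall with the smallest hull is removed first: no other wall of \<open>S\<close> lies
  inside its hull, so requiring the others to be present does not destroy the closure under
  deletions.\<close>

lemma peel_set:
  assumes "finite S" "\<And>V. V \<in> S \<Longrightarrow> peel V D" and F: "finite F" "F \<subseteq> Col n"
    and cl: "\<And>X V V0. X \<in> F \<Longrightarrow> V \<in> X \<Longrightarrow> V0 \<in> S \<Longrightarrow> cproj V \<subseteq> ghull (cproj V0) \<Longrightarrow> X - {V} \<in> F"
  shows "(\<Sum>X\<in>{X \<in> F. S \<subseteq> X}. omega D X) \<le> exp (- (\<beta> - 120) * (\<Sum>V\<in>S. cexcess V)) * (\<Sum>X\<in>F. omega D X)"
  using assms(1,2) cl
proof (induction "card S" arbitrary: S rule: less_induct)
  case less
  have R0: "0 \<le> (\<Sum>X\<in>F. omega D X)" using omega_nonneg by (rule sum_nonneg)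
  show ?case
  proof (cases "S = {} \<or> {X \<in> F. S \<subseteq> X} = {}")
    case True
    then show ?thesis
    proof
      assume "{X \<in> F. S \<subseteq> X} = {}"
      then show ?thesis using R0 by (simp only: sum.empty) simp
    qed simp
  next
    case False
    then obtain X0 where X0: "X0 \<in> F" "S \<subseteq> X0" by blast
    have "\<exists>V\<in>S. \<forall>V'\<in>S. card (ghull (cproj V)) \<le> card (ghull (cproj V'))"
      using False ex_min_if_finite[of "(\<lambda>V. card (ghull (cproj V))) ` S"] less.prems(1)
      by (metis (no_types, lifting) arg_min_least arg_min_on_def arg_min_if_finite(1))
    then obtain V where V: "V \<in> S" "\<And>V'. V' \<in> S \<Longrightarrow> card (ghull (cproj V)) \<le> card (ghull (cproj V'))" by blast
    let ?S = "S - {V}"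
    let ?F = "{X \<in> F. ?S \<subseteq> X}"
    note cf = Col_facts[OF subsetD[OF F(2) X0(1)]]
    have nV: "V' \<notin> ?S" if c: "cproj V' \<subseteq> ghull (cproj V)" for V'
    proof
      assume V': "V' \<in> ?S"
      have mem: "V' \<in> X0" "V \<in> X0" "V' \<noteq> V" using V' V(1) X0(2) by auto
      have sw: "stdwall n V'" "stdwall n V" using cf(2) mem by blast+
      have "cproj V' \<inter> ghull (cproj V) \<noteq> {}" using c stdwallD(9)[OF sw(1)] by blast
      then have sub: "ghull (cproj V') \<subseteq> ghull (cproj V) - cproj V"
        by (rule stdwall_interior[OF sw(1,2) cf(3)[OF mem]])
      have "cproj V \<subseteq> ghull (cproj V)" "cproj V \<noteq> {}" using subset_ghull stdwallD(9)[OF sw(2)] by blast+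
      then have "ghull (cproj V') \<subset> ghull (cproj V)" using sub by blast
      then have "card (ghull (cproj V')) < card (ghull (cproj V))"
        by (rule psubset_card_mono[OF finite_ghull[OF stdwallD(8)[OF sw(2)]]])
      then show False using V(2)[of V'] V' by simp
    qed
    have pV: "peel V D" using less.prems(2) V(1) by blast
    have "(\<Sum>X\<in>{X \<in> ?F. V \<in> X}. omega D X) \<le> exp (- (\<beta> - 120) * cexcess V) * (\<Sum>X\<in>{X \<in> ?F. V \<notin> X}. omega D X)"
    proof (rule pV[unfolded peel_def, rule_format], intro conjI ballI impI)
      show "finite ?F" using F(1) by simp
      show "?F \<subseteq> Col n" using F(2) by blast
      fix X V' assume X: "X \<in> ?F" "V' \<in> X" "cproj V' \<subseteq> ghull (cproj V)"
      then have "X - {V'} \<in> F" using less.prems(3) V(1) by blast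
      then show "X - {V'} \<in> ?F" using nV[OF X(3)] X(1) by blast
    qed
    moreover have "{X \<in> ?F. V \<in> X} = {X \<in> F. S \<subseteq> X}" using V(1) by blast
    ultimately have 1: "(\<Sum>X\<in>{X \<in> F. S \<subseteq> X}. omega D X) \<le> exp (- (\<beta> - 120) * cexcess V) * (\<Sum>X\<in>{X \<in> ?F. V \<notin> X}. omega D X)"
      by simp
    have 2: "(\<Sum>X\<in>{X \<in> ?F. V \<notin> X}. omega D X) \<le> (\<Sum>X\<in>?F. omega D X)"
      by (rule sum_mono2) (use F(1) omega_nonneg in auto)
    have "card ?S < card S" using V(1) less.prems(1) by (meson card_Diff1_less)
    then have 3: "(\<Sum>X\<in>?F. omega D X) \<le> exp (- (\<beta> - 120) * (\<Sum>V\<in>?S. cexcess V)) * (\<Sum>X\<in>F. omega D X)"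
      by (rule less.hyps) (use less.prems in blast)+
    have "(\<Sum>X\<in>{X \<in> F. S \<subseteq> X}. omega D X) \<le> exp (- (\<beta> - 120) * cexcess V) * (exp (- (\<beta> - 120) * (\<Sum>V\<in>?S. cexcess V)) * (\<Sum>X\<in>F. omega D X))"
      by (rule order_trans[OF 1 mult_left_mono[OF order_trans[OF 2 3]]]) simp
    also have "\<dots> = exp (- (\<beta> - 120) * (cexcess V + (\<Sum>V\<in>?S. cexcess V))) * (\<Sum>X\<in>F. omega D X)"
      by (simp only: distrib_left exp_add mult.assoc)
    also have "cexcess V + (\<Sum>V\<in>?S. cexcess V) = (\<Sum>V\<in>S. cexcess V)" by (rule sum.remove[OF less.prems(1) V(1), symmetric])
    finally show ?thesis .
  qed
qed

section \<open>Counting standard walls\<close>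

lemma stdwall_height:
  assumes "stdwall n V" "f \<in> V" shows "\<bar>snd f\<bar> \<le> int (card V)"
proof -
  obtain f0 v where f0: "f0 \<in> V" "(v, 0) \<in> cverts f0" using stdwallD(4)[OF assms(1)] by blast
  have "snd f0 = 0 \<or> snd f0 = -1" using f0(2) by (auto simp: cverts_def)
  moreover have "\<bar>snd f0 - snd f\<bar> + 1 \<le> int (card V)"
  proof (rule linked_int_card[OF stdwallD(3)[OF assms(1) f0(1) assms(2)] f0(1) _ stdwallD(1)[OF assms(1)]])
    fix a b :: cface assume "cadj a b"
    from cadj_near[OF this] show "\<bar>snd a - snd b\<bar> \<le> 1" unfolding mem_Times_iff atLeastAtMost_iff by linarith
  qed
  ultimately show ?thesis by linarith
qed

text \<open>The sum runs over pairs of a standard wall and a face of it over \<open>p\<close>. The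
  vertex at height 0 keeps the heights of a wall of size \<open>k\<close> between \<open>-k\<close>
  and \<open>k\<close>, so the marked face has \<open>2 * k + 1 \<le> 5 ^ k\<close> possible
  heights.\<close>

lemma animal_sum:
  assumes "finite VV" "\<And>V. V \<in> VV \<Longrightarrow> stdwall n V"
  shows "(\<Sum>q\<in>{q \<in> Sigma VV (\<lambda>V. V). fst (snd q) = p}. y ^ card (fst q)) \<le> 1/300"
proof -
  let ?Q = "{q \<in> Sigma VV (\<lambda>V. V). fst (snd q) = p}"
  have "finite (Sigma VV (\<lambda>V. V))" using assms stdwallD(1) by (intro finite_SigmaI) blast+
  then have finQ: "finite ?Q" by simp
  have "(\<Sum>q\<in>?Q. y ^ card (fst q)) \<le> 2 * (real 28125 * y) ^ 1"
  proof (rule sum_power_le[OF finQ])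
    show pos: "1 \<le> card (fst q)" if "q \<in> ?Q" for q
    proof -
      have "fst q \<in> VV" using that by auto
      then show ?thesis using stdwallD(1,2)[OF assms(2)] by (simp add: Suc_le_eq card_gt_0_iff)
    qed
    show "card {q \<in> ?Q. card (fst q) = k} \<le> 28125 ^ k" for k
    proof -
      let ?X = "\<lambda>t. {V. finite V \<and> (p, t) \<in> V \<and> card V = k \<and> (\<forall>f\<in>V. linked cadj V (p, t) f)}"
      have sub: "{q \<in> ?Q. card (fst q) = k} \<subseteq> (\<Union>t\<in>{- int k..int k}. (\<lambda>V. (V, (p, t))) ` ?X t)"
      proof
        fix q assume "q \<in> {q \<in> ?Q. card (fst q) = k}"
        then have q: "fst q \<in> VV" "snd q \<in> fst q" "fst (snd q) = p" "card (fst q) = k" by auto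
        obtain V t where Vt: "q = (V, (p, t))" using q(3) by (metis prod.collapse)
        have V: "V \<in> VV" "(p, t) \<in> V" "card V = k" using q Vt by auto
        note sw = assms(2)[OF V(1)]
        have "V \<in> ?X t" using V stdwallD(1)[OF sw] stdwallD(3)[OF sw V(2)] by blast
        moreover have "\<bar>t\<bar> \<le> int k" using stdwall_height[OF sw V(2)] V(3) by simp
        then have "t \<in> {- int k..int k}" by auto
        ultimately show "q \<in> (\<Union>t\<in>{- int k..int k}. (\<lambda>V. (V, (p, t))) ` ?X t)" unfolding Vt using UN_I[of t "{- int k..int k}" "(V, (p, t))" "\<lambda>t. (\<lambda>V. (V, (p, t))) ` ?X t"] imageI[of V "?X t" "\<lambda>V. (V, (p, t))"] by blast
      qed
      have fin: "finite ((\<lambda>V. (V, (p, t))) ` ?X t)" for t by (rule finite_imageI[OF star_sets_card(1)])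
      have "card {q \<in> ?Q. card (fst q) = k} \<le> card (\<Union>t\<in>{- int k..int k}. (\<lambda>V. (V, (p, t))) ` ?X t)"
        by (rule card_mono[OF _ sub]) (intro finite_UN_I finite_atLeastAtMost_int fin)
      also have "\<dots> \<le> (\<Sum>t\<in>{- int k..int k}. card ((\<lambda>V. (V, (p, t))) ` ?X t))" by (rule card_UN_le) simp
      also have "\<dots> \<le> (\<Sum>t\<in>{- int k..int k}. 5625 ^ k)"
        by (rule sum_mono) (rule order_trans[OF card_image_le[OF star_sets_card(1)] star_sets_card(2)])
      also have "\<dots> = nat (2 * int k + 1) * 5625 ^ k" unfolding sum_constant by simp
      also have "nat (2 * int k + 1) = 2 * k + 1" by simp
      also have "(2 * k + 1) * 5625 ^ k \<le> 5 ^ k * 5625 ^ k"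
      proof (rule mult_right_mono)
        show "2 * k + 1 \<le> 5 ^ k" by (induction k) auto
      qed simp
      also have "\<dots> = (5 * 5625) ^ k" by (rule power_mult_distrib[symmetric])
      also have "(5 * 5625 :: nat) = 28125" by simp
      finally show ?thesis .
    qed
    show "0 \<le> y" using y_bounds(1) by simp
    show "real 28125 * y \<le> 1/2" using y_bounds(2) by simp
  qed
  also have "\<dots> \<le> 1/300" using y_bounds(2) by simp
  finally show ?thesis .
qed

text \<open>Each factor is written as \<open>1 + b V\<close> and the product is expanded over sets
  \<open>S\<close> of nested walls. The presence of all of \<open>S\<close> costs the product of the
  factors \<open>c V\<close> by peeling, so everything is bounded by the product of
  \<open>1 + b V * c V\<close>, whose exponent is controlled by counting walls.\<close>

lemma moment:
  assumes W: "stdwall n W" and F: "finite F" "F \<subseteq> Col n"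
    and disj: "\<And>X V. X \<in> F \<Longrightarrow> V \<in> X \<Longrightarrow> cproj V \<inter> cproj W = {}"
    and cl: "\<And>X V. X \<in> F \<Longrightarrow> V \<in> X \<Longrightarrow> cproj V \<inter> inner W \<noteq> {} \<Longrightarrow> X - {V} \<in> F"
    and pl: "\<And>X V. X \<in> F \<Longrightarrow> V \<in> X \<Longrightarrow> cproj V \<inter> inner W \<noteq> {} \<Longrightarrow> peel V (inner W)"
  shows "(\<Sum>X\<in>F. omega (inner W) X * (\<Prod>V\<in>{V \<in> X. cproj V \<inter> inner W \<noteq> {}}. exp (aW W V)))
     \<le> exp (18 * cexcess W) * (\<Sum>X\<in>F. omega (inner W) X)"
proof -
  let ?T = "inner W"
  let ?in = "\<lambda>X. {V \<in> X. cproj V \<inter> ?T \<noteq> {}}"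
  define VV where "VV = (\<Union>X\<in>F. ?in X)"
  define b where "b V = exp (aW W V) - 1" for V
  define c where "c V = exp (- (\<beta> - 120) * cexcess V)" for V
  have b0: "0 \<le> b V" for V using aW_nonneg[of W V] by (simp add: b_def)
  have finX: "finite X" if "X \<in> F" for X using Col_facts(1) F(2) that by blast
  have finVV: "finite VV" unfolding VV_def using F(1) finX by auto
  have VVd: "stdwall n V" "cproj V \<subseteq> ?T" "ghull (cproj V) \<subseteq> ?T" "peel V ?T" "cproj V \<inter> ?T \<noteq> {}" if V: "V \<in> VV" for V
  proof -
    obtain X where X: "X \<in> F" "V \<in> X" "cproj V \<inter> ?T \<noteq> {}" using V unfolding VV_def by blast
    show sw: "stdwall n V" using Col_facts(2) F(2) X by blast
    have "cproj V \<inter> ghull (cproj W) \<noteq> {}" using X(3) by blast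
    from stdwall_interior[OF sw W disj[OF X(1,2)] this] show gh: "ghull (cproj V) \<subseteq> ?T" .
    then show "cproj V \<subseteq> ?T" using subset_ghull by blast
    show "peel V ?T" using pl[OF X] .
    show "cproj V \<inter> ?T \<noteq> {}" by (rule X(3))
  qed
  have prod_eq: "(\<Prod>V\<in>?in X. exp (aW W V)) = (\<Sum>S\<in>{S \<in> Pow VV. S \<subseteq> X}. prod b S)" if X: "X \<in> F" for X
  proof -
    have "(\<Prod>V\<in>?in X. exp (aW W V)) = (\<Prod>V\<in>?in X. b V + 1)" by (simp add: b_def)
    also have "\<dots> = (\<Sum>S\<in>Pow (?in X). prod b S * prod (\<lambda>_. 1) (?in X - S))"
      by (rule prod_add) (use finX[OF X] in simp)
    also have "\<dots> = (\<Sum>S\<in>Pow (?in X). prod b S)" by simp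
    also have "Pow (?in X) = {S \<in> Pow VV. S \<subseteq> X}"
    proof (intro set_eqI iffI)
      fix S assume "S \<in> Pow (?in X)"
      then show "S \<in> {S \<in> Pow VV. S \<subseteq> X}" using X unfolding VV_def by blast
    next
      fix S assume "S \<in> {S \<in> Pow VV. S \<subseteq> X}"
      then show "S \<in> Pow (?in X)" using VVd(5) by blast
    qed
    finally show ?thesis .
  qed
  have "(\<Sum>X\<in>F. omega ?T X * (\<Prod>V\<in>?in X. exp (aW W V))) = (\<Sum>X\<in>F. \<Sum>S\<in>Pow VV. if S \<subseteq> X then prod b S * omega ?T X else 0)"
  proof (rule sum.cong[OF refl])
    fix X assume X: "X \<in> F"
    have "omega ?T X * (\<Prod>V\<in>?in X. exp (aW W V)) = (\<Sum>S\<in>{S \<in> Pow VV. S \<subseteq> X}. prod b S * omega ?T X)"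
      unfolding prod_eq[OF X] sum_distrib_left by (simp only: mult.commute)
    also have "\<dots> = (\<Sum>S\<in>Pow VV. if S \<subseteq> X then prod b S * omega ?T X else 0)"
      by (rule sum.inter_filter) (use finVV in simp)
    finally show "omega ?T X * (\<Prod>V\<in>?in X. exp (aW W V)) = (\<Sum>S\<in>Pow VV. if S \<subseteq> X then prod b S * omega ?T X else 0)" .
  qed
  also have "\<dots> = (\<Sum>S\<in>Pow VV. \<Sum>X\<in>F. if S \<subseteq> X then prod b S * omega ?T X else 0)" by (rule sum.swap)
  also have "\<dots> \<le> (\<Sum>S\<in>Pow VV. prod (\<lambda>V. b V * c V) S * (\<Sum>X\<in>F. omega ?T X))"
  proof (rule sum_mono)
    fix S assume S: "S \<in> Pow VV"
    have finS: "finite S" using S finVV finite_subset by blast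
    have "(\<Sum>X\<in>F. if S \<subseteq> X then prod b S * omega ?T X else 0) = (\<Sum>X\<in>{X \<in> F. S \<subseteq> X}. prod b S * omega ?T X)"
      by (rule sum.inter_filter[symmetric]) (rule F(1))
    also have "\<dots> = prod b S * (\<Sum>X\<in>{X \<in> F. S \<subseteq> X}. omega ?T X)" by (rule sum_distrib_left[symmetric])
    also have "\<dots> \<le> prod b S * (exp (- (\<beta> - 120) * (\<Sum>V\<in>S. cexcess V)) * (\<Sum>X\<in>F. omega ?T X))"
    proof (rule mult_left_mono)
      show "(\<Sum>X\<in>{X \<in> F. S \<subseteq> X}. omega ?T X) \<le> exp (- (\<beta> - 120) * (\<Sum>V\<in>S. cexcess V)) * (\<Sum>X\<in>F. omega ?T X)"
      proof (rule peel_set[OF finS _ F])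
        show "peel V ?T" if "V \<in> S" for V using VVd(4) S that by blast
        fix X V V0 assume h: "X \<in> F" "V \<in> X" "V0 \<in> S" "cproj V \<subseteq> ghull (cproj V0)"
        have "cproj V \<subseteq> ?T" using VVd(3)[of V0] S h(3,4) by blast
        moreover have "cproj V \<noteq> {}" using stdwallD(9) Col_facts(2) F(2) h(1,2) by blast
        ultimately show "X - {V} \<in> F" using cl[OF h(1,2)] by blast
      qed
      show "0 \<le> prod b S" using b0 by (rule prod_nonneg)
    qed
    also have "exp (- (\<beta> - 120) * (\<Sum>V\<in>S. cexcess V)) = prod c S"
      unfolding c_def sum_distrib_left by (rule exp_sum[OF finS])
    also have "prod b S * (prod c S * (\<Sum>X\<in>F. omega ?T X)) = prod (\<lambda>V. b V * c V) S * (\<Sum>X\<in>F. omega ?T X)"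
      by (simp only: prod.distrib mult.assoc)
    finally show "(\<Sum>X\<in>F. if S \<subseteq> X then prod b S * omega ?T X else 0) \<le> prod (\<lambda>V. b V * c V) S * (\<Sum>X\<in>F. omega ?T X)" .
  qed
  also have "\<dots> = (\<Sum>S\<in>Pow VV. prod (\<lambda>V. b V * c V) S) * (\<Sum>X\<in>F. omega ?T X)" by (rule sum_distrib_right[symmetric])
  also have "(\<Sum>S\<in>Pow VV. prod (\<lambda>V. b V * c V) S) = (\<Prod>V\<in>VV. b V * c V + 1)"
    using prod_add[OF finVV, of "\<lambda>V. b V * c V" "\<lambda>_. 1"] by simp
  finally have 1: "(\<Sum>X\<in>F. omega ?T X * (\<Prod>V\<in>?in X. exp (aW W V))) \<le> (\<Prod>V\<in>VV. b V * c V + 1) * (\<Sum>X\<in>F. omega ?T X)" .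
  \<comment> \<open>A nested wall has distance at least 1 from \<open>W\<close> and
    \<open>300 * z \<le> 1\<close>, so \<open>aW W V\<close> is at most the number of faces of
    \<open>V\<close>. The exponential growth is thus absorbed in \<open>y\<close>, while one factor
    \<open>aW W V\<close> is kept for the decay.\<close>
  have bc: "b V * c V \<le> 300 * (\<Sum>f\<in>V. z ^ dR (cproj W) (fst f) * y ^ card V)" if V: "V \<in> VV" for V
  proof -
    note sw = VVd(1)[OF V]
    have d1: "z ^ dR (cproj W) (fst f) \<le> z" if f: "f \<in> V" for f
    proof -
      have "fst f \<in> cproj V" using f gclosure_refl unfolding cproj_def by blast
      then have "fst f \<notin> cproj W" using VVd(2)[OF V] by blast
      then have "1 \<le> dR (cproj W) (fst f)" by (rule dR_pos[OF stdwallD(8,9)[OF W]])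
      then have "z ^ dR (cproj W) (fst f) \<le> z ^ 1" by (rule power_decreasing) (auto simp: z_def)
      then show ?thesis by simp
    qed
    have "(\<Sum>f\<in>V. z ^ dR (cproj W) (fst f)) \<le> (\<Sum>f\<in>V. z)" by (rule sum_mono[OF d1])
    then have a1: "aW W V \<le> real (card V)" unfolding aW_def by (simp add: z_def)
    have "b V \<le> aW W V * exp (aW W V)"
    proof -
      have "1 - aW W V \<le> exp (- aW W V)" using exp_ge_add_one_self[of "- aW W V"] by simp
      then have "(1 - aW W V) * exp (aW W V) \<le> exp (- aW W V) * exp (aW W V)" by (rule mult_right_mono) simp
      then show ?thesis unfolding b_def exp_add[symmetric] by (simp add: algebra_simps)
    qed
    also have "\<dots> \<le> aW W V * exp (real (card V))" by (rule mult_left_mono) (use a1 aW_nonneg in auto)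
    finally have "b V * c V \<le> aW W V * exp (real (card V)) * c V" by (rule mult_right_mono) (simp add: c_def)
    also have "\<dots> = aW W V * exp (real (card V) - (\<beta> - 120) * cexcess V)" unfolding c_def mult.assoc exp_add[symmetric] by (simp add: algebra_simps)
    also have "\<dots> \<le> aW W V * y ^ card V"
    proof (rule mult_left_mono[OF _ aW_nonneg])
      have "(\<beta> - 120) * (real (card V) / 2) \<le> (\<beta> - 120) * cexcess V"
        using stdwallD(5)[OF sw] y_bounds(3) by (intro mult_left_mono) auto
      then have "exp (real (card V) - (\<beta> - 120) * cexcess V) \<le> exp (real (card V) * (1 - (\<beta> - 120) / 2))"
        unfolding exp_le_cancel_iff by (simp add: algebra_simps diff_divide_distrib)
      also have "\<dots> = y ^ card V" unfolding y_def by (rule exp_of_nat_mult)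
      finally show "exp (real (card V) - (\<beta> - 120) * cexcess V) \<le> y ^ card V" .
    qed
    also have "\<dots> = 300 * (\<Sum>f\<in>V. z ^ dR (cproj W) (fst f) * y ^ card V)"
      unfolding aW_def by (simp add: sum_distrib_right)
    finally show ?thesis .
  qed
  \<comment> \<open>The sum over walls and their faces is regrouped by the projection of the face:
    the walls through a point are counted first, and the decay in the distance to \<open>W\<close>
    is summed last.\<close>
  let ?Q = "Sigma VV (\<lambda>V. V)"
  have finT: "finite ?T" by (rule finite_inner[OF W])
  have finQ: "finite ?Q" using finVV VVd(1) stdwallD(1) by (intro finite_SigmaI) blast+
  have "(\<Sum>V\<in>VV. b V * c V) \<le> (\<Sum>V\<in>VV. 300 * (\<Sum>f\<in>V. z ^ dR (cproj W) (fst f) * y ^ card V))" by (rule sum_mono[OF bc])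
  also have "\<dots> = 300 * (\<Sum>V\<in>VV. \<Sum>f\<in>V. z ^ dR (cproj W) (fst f) * y ^ card V)" by (rule sum_distrib_left[symmetric])
  also have "(\<Sum>V\<in>VV. \<Sum>f\<in>V. z ^ dR (cproj W) (fst f) * y ^ card V) = (\<Sum>q\<in>?Q. z ^ dR (cproj W) (fst (snd q)) * y ^ card (fst q))"
    using sum.Sigma[OF finVV, of "\<lambda>V. V" "\<lambda>V f. z ^ dR (cproj W) (fst f) * y ^ card V"] stdwallD(1)[OF VVd(1)]
    by (simp add: case_prod_unfold)
  also have "\<dots> = (\<Sum>p\<in>?T. \<Sum>q\<in>{q \<in> ?Q. fst (snd q) = p}. z ^ dR (cproj W) (fst (snd q)) * y ^ card (fst q))"
  proof (rule sum.group[OF finQ finT, symmetric])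
    show "(\<lambda>q. fst (snd q)) ` ?Q \<subseteq> ?T"
    proof
      fix p assume "p \<in> (\<lambda>q. fst (snd q)) ` ?Q"
      then obtain V f where f: "V \<in> VV" "f \<in> V" "p = fst f" by auto
      then have "p \<in> cproj V" using gclosure_refl unfolding cproj_def by blast
      then show "p \<in> ?T" using VVd(2)[OF f(1)] by blast
    qed
  qed
  also have "\<dots> = (\<Sum>p\<in>?T. z ^ dR (cproj W) p * (\<Sum>q\<in>{q \<in> ?Q. fst (snd q) = p}. y ^ card (fst q)))"
    unfolding sum_distrib_left by (intro sum.cong refl) simp
  also have "300 * \<dots> \<le> 300 * (\<Sum>p\<in>?T. z ^ dR (cproj W) p * (1/300))"
    using animal_sum[OF finVV VVd(1)] by (intro mult_left_mono sum_mono) (auto simp: z_def)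
  also have "\<dots> = (\<Sum>p\<in>?T. z ^ dR (cproj W) p)" by (simp add: sum_distrib_left)
  also have "\<dots> \<le> 18 * cexcess W"
  proof -
    have "0 \<le> (\<Sum>p\<in>?T. z ^ dR (cproj W) p)" by (rule sum_nonneg) (simp add: z_def)
    then show ?thesis using inner_sum[OF W] by linarith
  qed
  finally have s: "(\<Sum>V\<in>VV. b V * c V) \<le> 18 * cexcess W" .
  have "(\<Prod>V\<in>VV. b V * c V + 1) \<le> (\<Prod>V\<in>VV. exp (b V * c V))"
  proof (rule prod_mono)
    fix V assume "V \<in> VV"
    have "0 \<le> b V * c V" using b0 by (simp add: c_def)
    then show "0 \<le> b V * c V + 1 \<and> b V * c V + 1 \<le> exp (b V * c V)"
      using exp_ge_add_one_self[of "b V * c V"] by (simp add: add.commute)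
  qed
  also have "\<dots> = exp (\<Sum>V\<in>VV. b V * c V)" by (rule exp_sum[OF finVV, symmetric])
  also have "\<dots> \<le> exp (18 * cexcess W)" using s by simp
  finally have "(\<Prod>V\<in>VV. b V * c V + 1) * (\<Sum>X\<in>F. omega ?T X) \<le> exp (18 * cexcess W) * (\<Sum>X\<in>F. omega ?T X)"
    by (rule mult_right_mono) (rule sum_nonneg[OF omega_nonneg])
  then show ?thesis using 1 by linarith
qed

text \<open>Collections containing \<open>W\<close> are compared with those obtained by deleting it.
  They are grouped by their walls that avoid the interior of \<open>W\<close>; within a group the
  exterior factor is constant, and \<open>moment\<close> absorbs the dependence on the nested
  walls.\<close>

lemma peel_wall:
  assumes "stdwall n W" "ghull (cproj W) \<subseteq> D" shows "peel W D"
  using assms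
proof (induction "card (ghull (cproj W))" arbitrary: W D rule: less_induct)
  case less
  note SW = less.prems(1) and D = less.prems(2)
  let ?T = "inner W" and ?O = "D - ghull (cproj W)"
  show ?case unfolding peel_def
  proof (intro allI impI, elim conjE)
    fix F assume F: "finite F" "F \<subseteq> Col n" and cl: "\<forall>X\<in>F. \<forall>V\<in>X. cproj V \<subseteq> ghull (cproj W) \<longrightarrow> X - {V} \<in> F"
    let ?in = "\<lambda>Y. {V \<in> Y. cproj V \<inter> ?T \<noteq> {}}"
    define TT where "TT = (\<lambda>X. X - {W}) ` {X \<in> F. W \<in> X}"
    define ext where "ext Y = {V \<in> Y. cproj V \<inter> ?T = {}}" for Y
    define h where "h Y = omega ?T Y * (\<Prod>V\<in>?in Y. exp (aW W V))" for Y
    define q where "q Y = Pinf (NN ?O (Ifc n Y))" for Y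
    have q0: "0 \<le> q Y" for Y by (simp add: q_def Pinf_nonneg)
    have TT: "insert W Y \<in> F" "W \<notin> Y" "Y \<in> F" "insert W Y - {W} = Y" if Y: "Y \<in> TT" for Y
    proof -
      obtain X where X: "X \<in> F" "W \<in> X" "Y = X - {W}" using Y unfolding TT_def by blast
      then show "insert W Y \<in> F" "W \<notin> Y" "insert W Y - {W} = Y" by (auto simp: insert_absorb)
      show "Y \<in> F" using cl X subset_ghull by blast
    qed
    have finTT: "finite TT" unfolding TT_def using F(1) by simp
    have disj: "cproj V \<inter> cproj W = {}" if "Y \<in> TT" "V \<in> Y" for Y V
    proof -
      have "insert W Y \<in> Col n" using TT(1)[OF that(1)] F(2) by blast
      moreover have "V \<noteq> W" using TT(2)[OF that(1)] that(2) by blast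
      ultimately show ?thesis using Col_facts(3) that(2) by blast
    qed
    have sV: "stdwall n V" if "Y \<in> TT" "V \<in> Y" for Y V
      using Col_facts(2) TT(3)[OF that(1)] F(2) that(2) by blast
    have inV: "ghull (cproj V) \<subseteq> ?T" if "Y \<in> TT" "V \<in> Y" "cproj V \<inter> ?T \<noteq> {}" for Y V
      by (rule stdwall_interior[OF sV[OF that(1,2)] SW disj[OF that(1,2)]]) (use that(3) in blast)
    \<comment> \<open>Deleting the nested walls changes nothing outside the hull of
      \<open>W\<close>.\<close>
    have qe: "q Y = q (ext Y)" if Y: "Y \<in> TT" for Y
    proof -
      have YC: "Y \<in> Col n" using TT(3)[OF Y] F(2) by blast
      have "finite (?in Y)" using Col_facts(1)[OF YC] by simp
      from Col_delete_set[OF YC this]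
      have a: "\<And>p t. (\<forall>V\<in>?in Y. p \<notin> ghull (cproj V)) \<Longrightarrow> (p, t) \<in> Ifc n (Y - ?in Y) \<longleftrightarrow> (p, t) \<in> Ifc n Y" by blast
      have e: "Y - ?in Y = ext Y" unfolding ext_def by blast
      have o: "\<forall>V\<in>?in Y. p \<notin> ghull (cproj V)" if "p \<in> ?O" for p
        using inV[OF Y] that by blast
      have "NN ?O (Ifc n (ext Y)) = NN ?O (Ifc n Y)"
        unfolding e[symmetric] by (rule NN_cong) (rule a[OF o])
      then show ?thesis unfolding q_def by simp
    qed
    have up: "omega D (insert W Y) \<le> exp ((18 - \<beta>) * cexcess W) * (q Y * h Y)" if Y: "Y \<in> TT" for Y
    proof -
      have X: "insert W Y \<in> Col n" using TT(1)[OF Y] F(2) by blast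
      have finY: "finite Y" using Col_facts(1)[OF X] by simp
      have "Pinf (NN D (Ifc n (insert W Y))) \<le> q Y * Pinf (NN ?T (Ifc n Y)) * exp (18 * cexcess W) * (\<Prod>V\<in>?in Y. exp (aW W V))"
        using weight_upper[OF X insertI1 D] unfolding TT(4)[OF Y] q_def .
      then have "omega D (insert W Y) \<le> exp (- \<beta> * (\<Sum>V\<in>insert W Y. cexcess V)) *
          (q Y * Pinf (NN ?T (Ifc n Y)) * exp (18 * cexcess W) * (\<Prod>V\<in>?in Y. exp (aW W V)))"
        unfolding omega_def by (rule mult_left_mono) simp
      also have "exp (- \<beta> * (\<Sum>V\<in>insert W Y. cexcess V)) = exp (- \<beta> * cexcess W) * exp (- \<beta> * (\<Sum>V\<in>Y. cexcess V))"
        using finY TT(2)[OF Y] by (simp add: distrib_left exp_add[symmetric])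
      also have "\<dots> * (q Y * Pinf (NN ?T (Ifc n Y)) * exp (18 * cexcess W) * (\<Prod>V\<in>?in Y. exp (aW W V)))
         = (exp (- \<beta> * cexcess W) * exp (18 * cexcess W)) * (q Y * h Y)"
        unfolding h_def omega_def by (simp only: mult_ac)
      also have "exp (- \<beta> * cexcess W) * exp (18 * cexcess W) = exp ((18 - \<beta>) * cexcess W)"
        by (simp add: exp_add[symmetric] algebra_simps)
      finally show ?thesis .
    qed
    have low: "q Y * omega ?T Y \<le> exp (75 * cexcess W) * omega D Y" if Y: "Y \<in> TT" for Y
    proof -
      have X: "insert W Y \<in> Col n" using TT(1)[OF Y] F(2) by blast
      have "q Y * Pinf (NN ?T (Ifc n Y)) * exp (- (75 * cexcess W)) \<le> Pinf (NN D (Ifc n Y))"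
        using weight_lower[OF X insertI1 D] unfolding TT(4)[OF Y] q_def .
      then have "exp (75 * cexcess W) * (q Y * Pinf (NN ?T (Ifc n Y)) * exp (- (75 * cexcess W))) \<le> exp (75 * cexcess W) * Pinf (NN D (Ifc n Y))"
        by (rule mult_left_mono) simp
      then have "q Y * Pinf (NN ?T (Ifc n Y)) \<le> exp (75 * cexcess W) * Pinf (NN D (Ifc n Y))"
        by (simp add: exp_minus field_simps)
      then have "exp (- \<beta> * (\<Sum>V\<in>Y. cexcess V)) * (q Y * Pinf (NN ?T (Ifc n Y))) \<le> exp (- \<beta> * (\<Sum>V\<in>Y. cexcess V)) * (exp (75 * cexcess W) * Pinf (NN D (Ifc n Y)))"
        by (rule mult_left_mono) simp
      then show ?thesis unfolding omega_def by (simp only: mult_ac)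
    qed
    \<comment> \<open>A group is closed under deleting nested walls. These have smaller hulls, so
      the induction hypothesis supplies their peeling estimates, with the interior of
      \<open>W\<close> as the region.\<close>
    have mom: "(\<Sum>Y\<in>{Y \<in> TT. ext Y = e}. h Y) \<le> exp (18 * cexcess W) * (\<Sum>Y\<in>{Y \<in> TT. ext Y = e}. omega ?T Y)" for e
      unfolding h_def
    proof (rule moment[OF SW])
      show "finite {Y \<in> TT. ext Y = e}" using finTT by simp
      show "{Y \<in> TT. ext Y = e} \<subseteq> Col n" using TT(3) F(2) by blast
      show "cproj V \<inter> cproj W = {}" if "Y \<in> {Y \<in> TT. ext Y = e}" "V \<in> Y" for Y V using disj that by blast
      fix Y V assume Y: "Y \<in> {Y \<in> TT. ext Y = e}" and V: "V \<in> Y" "cproj V \<inter> ?T \<noteq> {}"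
      have Y': "Y \<in> TT" "ext Y = e" using Y by blast+
      note g = inV[OF Y'(1) V]
      have sub: "cproj V \<subseteq> ghull (cproj W)" using g subset_ghull by blast
      have "insert W Y - {V} \<in> F" using cl TT(1)[OF Y'(1)] V(1) sub by blast
      moreover have VW: "V \<noteq> W" using V(1) TT(2)[OF Y'(1)] by blast
      moreover have "Y - {V} = (insert W Y - {V}) - {W}" using TT(2)[OF Y'(1)] by blast
      ultimately have "Y - {V} \<in> TT" unfolding TT_def by blast
      moreover have "ext (Y - {V}) = e" using Y'(2) V(2) unfolding ext_def by blast
      ultimately show "Y - {V} \<in> {Y \<in> TT. ext Y = e}" by blast
      show "peel V ?T"
      proof (rule less.hyps[OF _ sV[OF Y'(1) V(1)] g])
        have "cproj W \<subseteq> ghull (cproj W)" "cproj W \<noteq> {}" using subset_ghull stdwallD(9)[OF SW] by blast+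
        then have "ghull (cproj V) \<subset> ghull (cproj W)" using g by blast
        then show "card (ghull (cproj V)) < card (ghull (cproj W))"
          by (rule psubset_card_mono[OF finite_ghull[OF stdwallD(8)[OF SW]]])
      qed
    qed
    have grp: "(\<Sum>Y\<in>TT. q Y * k Y) = (\<Sum>e\<in>ext ` TT. q e * (\<Sum>Y\<in>{Y \<in> TT. ext Y = e}. k Y))" for k :: "cface set set \<Rightarrow> real"
    proof -
      have "(\<Sum>Y\<in>TT. q Y * k Y) = (\<Sum>e\<in>ext ` TT. \<Sum>Y\<in>{Y \<in> TT. ext Y = e}. q Y * k Y)"
        by (rule sum.group[symmetric]) (use finTT in auto)
      also have "\<dots> = (\<Sum>e\<in>ext ` TT. q e * (\<Sum>Y\<in>{Y \<in> TT. ext Y = e}. k Y))"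
        unfolding sum_distrib_left by (intro sum.cong refl) (use qe in auto)
      finally show ?thesis .
    qed
    have "(\<Sum>X\<in>{X \<in> F. W \<in> X}. omega D X) = (\<Sum>Y\<in>TT. omega D (insert W Y))"
    proof -
      have "inj_on (\<lambda>X. X - {W}) {X \<in> F. W \<in> X}" by (rule inj_onI) blast
      then have "(\<Sum>Y\<in>TT. omega D (insert W Y)) = (\<Sum>X\<in>{X \<in> F. W \<in> X}. omega D (insert W (X - {W})))"
        unfolding TT_def by (rule sum.reindex[unfolded o_def])
      also have "\<dots> = (\<Sum>X\<in>{X \<in> F. W \<in> X}. omega D X)" by (intro sum.cong refl) (simp add: insert_absorb)
      finally show ?thesis by simp
    qed
    also have "\<dots> \<le> (\<Sum>Y\<in>TT. exp ((18 - \<beta>) * cexcess W) * (q Y * h Y))" by (rule sum_mono[OF up])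
    also have "\<dots> = exp ((18 - \<beta>) * cexcess W) * (\<Sum>e\<in>ext ` TT. q e * (\<Sum>Y\<in>{Y \<in> TT. ext Y = e}. h Y))"
      unfolding sum_distrib_left[symmetric] grp ..
    also have "\<dots> \<le> exp ((18 - \<beta>) * cexcess W) * (\<Sum>e\<in>ext ` TT. q e * (exp (18 * cexcess W) * (\<Sum>Y\<in>{Y \<in> TT. ext Y = e}. omega ?T Y)))"
      by (intro mult_left_mono sum_mono mom) (auto simp: q0)
    also have "\<dots> = exp ((18 - \<beta>) * cexcess W) * (exp (18 * cexcess W) * (\<Sum>Y\<in>TT. q Y * omega ?T Y))"
      unfolding grp sum_distrib_left[of "exp (18 * cexcess W)" _ "ext ` TT"]
      by (intro arg_cong[where f = "times _"] sum.cong refl) (simp only: mult_ac)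
    also have "\<dots> \<le> exp ((18 - \<beta>) * cexcess W) * (exp (18 * cexcess W) * (\<Sum>Y\<in>TT. exp (75 * cexcess W) * omega D Y))"
      by (intro mult_left_mono sum_mono low) auto
    also have "exp ((18 - \<beta>) * cexcess W) * (exp (18 * cexcess W) * (\<Sum>Y\<in>TT. exp (75 * cexcess W) * omega D Y))
       = exp ((111 - \<beta>) * cexcess W) * (\<Sum>Y\<in>TT. omega D Y)"
    proof -
      have "exp ((111 - \<beta>) * cexcess W) = exp ((18 - \<beta>) * cexcess W) * (exp (18 * cexcess W) * exp (75 * cexcess W))"
        unfolding exp_add[symmetric] by (simp add: algebra_simps)
      then show ?thesis unfolding sum_distrib_left[symmetric] by (simp only: mult.assoc)
    qed
    also have "\<dots> \<le> exp (- (\<beta> - 120) * cexcess W) * (\<Sum>Y\<in>{X \<in> F. W \<notin> X}. omega D Y)"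
    proof (rule mult_mono)
      have "(111 - \<beta>) * cexcess W \<le> (- (\<beta> - 120)) * cexcess W" using stdwallD(10)[OF SW] by (intro mult_right_mono) auto
      then show "exp ((111 - \<beta>) * cexcess W) \<le> exp (- (\<beta> - 120) * cexcess W)" by simp
      show "(\<Sum>Y\<in>TT. omega D Y) \<le> (\<Sum>Y\<in>{X \<in> F. W \<notin> X}. omega D Y)"
        by (rule sum_mono2) (use F(1) TT(2,3) omega_nonneg in auto)
      show "0 \<le> (\<Sum>Y\<in>TT. omega D Y)" using omega_nonneg by (rule sum_nonneg)
    qed simp
    finally show "(\<Sum>X\<in>{X \<in> F. W \<in> X}. omega D X) \<le> exp (- (\<beta> - 120) * cexcess W) * (\<Sum>X\<in>{X \<in> F. W \<notin> X}. omega D X)" .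
  qed
qed

end

section \<open>The law of the interface\<close>

text \<open>Spin configurations as sets of minus cells; outside the cylinder these are the cells of
  nonnegative height.\<close>

definition spin_sets :: "nat \<Rightarrow> nat \<Rightarrow> cface set set" where
  "spin_sets n m = {M. M \<subseteq> cells \<and> (\<forall>c\<in>cells. c \<notin> cyl (boxF n) m \<longrightarrow> (c \<in> M \<longleftrightarrow> 0 \<le> snd c))}"

definition cint :: "nat \<Rightarrow> cface set \<Rightarrow> cface set" where
  "cint n M = {f \<in> cbd M. \<exists>g\<in>outL n. linked cadj (cbd M) g f}"

text \<open>The eight cells at a lattice vertex are joined through the faces at that vertex, none of
  which separates.\<close>

lemma vertex_uniform:
  assumes v: "isv v" and L: "\<And>f. f \<in> cbd L \<Longrightarrow> (v, k) \<notin> cverts f"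
    and c: "isF p" "v \<in> gclosure p" "h = k \<or> h = k - 1" and d: "isF p'" "v \<in> gclosure p'" "h' = k \<or> h' = k - 1"
  shows "(p, h) \<in> L \<longleftrightarrow> (p', h') \<in> L"
proof -
  have *: "(p, h) \<in> L \<longleftrightarrow> ((fst v + 1, snd v + 1), k) \<in> L"
    if pv: "isF p" "v \<in> gclosure p" "h = k \<or> h = k - 1" for p h
  proof -
    have "(p, k) \<in> L \<longleftrightarrow> (p, k - 1) \<in> L"
    proof -
      have "(v, k) \<in> cverts (p, k)" using that v by (simp add: cverts_face)
      then have "(p, k) \<notin> cbd L" using L by blast
      then show ?thesis using cbd_face[OF that(1)] by blast
    qed
    then have 1: "(p, h) \<in> L \<longleftrightarrow> (p, k) \<in> L" using that(3) by blast
    have edge: "(side 1 e, k) \<in> L \<longleftrightarrow> (side (-1) e, k) \<in> L" if e: "ise e" "v \<in> gclosure e" for e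
    proof -
      have "(v, k) \<in> cverts (e, k)" using e v by (simp add: cverts_edge)
      then have "(e, k) \<notin> cbd L" using L by blast
      then show ?thesis using cbd_edge[OF e(1)] by blast
    qed
    obtain s t where st: "\<bar>s\<bar> = 1" "\<bar>t\<bar> = 1" "p = (fst v + s, snd v + t)" by (rule isv_gclosure_face[OF pv(1) v pv(2)])
    have row: "((fst v + s, snd v + 1), k) \<in> L \<longleftrightarrow> ((fst v + s, snd v - 1), k) \<in> L"
      using edge[OF isv_star(1,4)[OF v st(1,2)]] isv_star(9)[OF v st(1), of 1] isv_star(9)[OF v st(1), of "-1"] by simp
    have col: "((fst v + 1, snd v + 1), k) \<in> L \<longleftrightarrow> ((fst v - 1, snd v + 1), k) \<in> L"
      using edge[OF isv_star(2,5)[OF v, of 1 1]] isv_star(10)[OF v, of 1 1] isv_star(10)[OF v, of "-1" 1] by simp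
    have "s = 1 \<or> s = -1" "t = 1 \<or> t = -1" using st by linarith+
    then show ?thesis using 1 row col st(3) by auto
  qed
  show ?thesis using *[OF c] *[OF d] by blast
qed

lemma fc_vertex:
  assumes "(v, k) \<in> cverts f" "\<not> isv (fst f)"
  shows "isF (fst (fc1 f))" "v \<in> gclosure (fst (fc1 f))" "snd (fc1 f) = k \<or> snd (fc1 f) = k - 1"
    "isF (fst (fc2 f))" "v \<in> gclosure (fst (fc2 f))" "snd (fc2 f) = k \<or> snd (fc2 f) = k - 1"
proof -
  have v: "isv v" "v \<in> gclosure (fst f)" "k = snd f \<or> \<not> isF (fst f) \<and> k = snd f + 1" using assms(1) by (auto simp: cverts_def)
  have e: "ise (fst f)" if "\<not> isF (fst f)" using that assms(2) kind_cases by blast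
  have s: "v \<in> gclosure (side s (fst f))" if "\<not> isF (fst f)" "\<bar>s\<bar> = 1" for s
    using gclosure_trans[OF edge_in_gclosure_side[OF e[OF that(1)] that(2)] v(2)] .
  show "isF (fst (fc1 f))" "isF (fst (fc2 f))" using fc_cells[OF assms(2)] by (auto simp: cells_def)
  show "v \<in> gclosure (fst (fc1 f))" "v \<in> gclosure (fst (fc2 f))"
    using v(2) s[of 1] s[of "-1"] by (auto simp: fc1_def fc2_def)
  show "snd (fc1 f) = k \<or> snd (fc1 f) = k - 1" "snd (fc2 f) = k \<or> snd (fc2 f) = k - 1"
    using v(3) by (auto simp: fc1_def fc2_def)
qed

lemma exists_vertex:
  assumes "\<not> isv (fst f)" obtains v k where "(v, k) \<in> cverts f"
proof -
  define v where "v = (if odd (fst (fst f)) then fst (fst f) + 1 else fst (fst f), if odd (snd (fst f)) then snd (fst f) + 1 else snd (fst f))"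
  have "(v, snd f) \<in> cverts f" by (auto simp: cverts_def v_def isv_def gclosure_def)
  then show thesis using that by blast
qed

lemma NC_uniform:
  assumes f: "\<not> isv (fst f)" and L: "\<And>g p. g \<in> cbd L \<Longrightarrow> p \<in> cverts f \<Longrightarrow> p \<notin> cverts g"
    and c: "c \<in> NC f"
  shows "c \<in> L \<longleftrightarrow> fc1 f \<in> L"
proof -
  obtain v k where v: "isF (fst c)" "(v, k) \<in> cverts f" "v \<in> gclosure (fst c)" "snd c = k \<or> snd c = k - 1"
    using c unfolding NC_def by blast
  have iv: "isv v" using v(2) by (simp add: cverts_def)
  have "(fst c, snd c) \<in> L \<longleftrightarrow> (fst (fc1 f), snd (fc1 f)) \<in> L"
    by (rule vertex_uniform[OF iv _ v(1,3,4) fc_vertex(1-3)[OF v(2) f]]) (use L v(2) in blast)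
  then show ?thesis by simp
qed

lemma outL_cyl: assumes "f \<in> outL n" shows "fc1 f \<notin> cyl (boxF n) m" "fc2 f \<notin> cyl (boxF n) m"
  using assms by (auto simp: outL_def fc1_def fc2_def cyl_def boxF_def)

lemma outL_cbd: assumes "M \<in> spin_sets n m" shows "outL n \<subseteq> cbd M"
proof
  fix f assume f: "f \<in> outL n"
  then have i: "isF (fst f)" "snd f = 0" by (auto simp: outL_def)
  then have ni: "\<not> isv (fst f)" using kind_disj(1) by blast
  have "fc1 f \<in> M \<longleftrightarrow> 0 \<le> snd (fc1 f)" "fc2 f \<in> M \<longleftrightarrow> 0 \<le> snd (fc2 f)"
    using assms outL_cyl[OF f] fc_cells[OF ni] unfolding spin_sets_def by blast+
  then show "f \<in> cbd M" using i ni by (auto simp: cbd_def fc1_def fc2_def)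
qed

lemma cbd_touch:
  assumes "M \<in> spin_sets n m" "1 \<le> m" "f \<in> cbd M" "f \<notin> outL n"
  shows "fc1 f \<in> cyl (boxF n) m \<or> fc2 f \<in> cyl (boxF n) m"
proof (rule ccontr)
  assume n: "\<not> ?thesis"
  have ni: "\<not> isv (fst f)" using assms(3) by (simp add: cbd_def)
  have *: "fc1 f \<in> M \<longleftrightarrow> 0 \<le> snd (fc1 f)" "fc2 f \<in> M \<longleftrightarrow> 0 \<le> snd (fc2 f)"
    using assms(1) n fc_cells[OF ni] unfolding spin_sets_def by blast+
  have d: "(fc1 f \<in> M) \<noteq> (fc2 f \<in> M)" using assms(3) by (simp add: cbd_def)
  have F: "isF (fst f)" using d * by (auto simp: fc1_def fc2_def split: if_splits)
  then have z: "snd f = 0" using d * by (auto simp: fc1_def fc2_def)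
  have "fst f \<in> boxF n" using F z assms(4) by (auto simp: outL_def boxF_def)
  then have "fc1 f \<in> cyl (boxF n) m" using F z assms(2) by (auto simp: fc1_def cyl_def mem_Times_iff)
  then show False using n by blast
qed

lemma touch_box:
  assumes "\<not> isv (fst f)" "fc1 f \<in> cyl (boxF n) m \<or> fc2 f \<in> cyl (boxF n) m"
  shows "fst f \<notin> gfar (2 * int n)" "\<bar>snd f\<bar> \<le> int m"
proof -
  show "\<bar>snd f\<bar> \<le> int m" using assms(2) by (auto simp: fc1_def fc2_def cyl_def mem_Times_iff split: if_splits)
  show "fst f \<notin> gfar (2 * int n)"
  proof (cases "isF (fst f)")
    case True then show ?thesis using assms(2) by (auto simp: fc1_def fc2_def cyl_def mem_Times_iff boxF_def)
  next
    case False
    then obtain s where s: "\<bar>s\<bar> = 1" "side s (fst f) \<in> boxF n"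
      using assms(2) that[of 1] that[of "-1"] by (auto simp: fc1_def fc2_def cyl_def mem_Times_iff)
    have sc: "s = 1 \<or> s = -1" using s(1) by linarith
    have odd_le: "\<bar>a\<bar> \<le> 2 * int n" if "odd (a + s)" "\<bar>a + s\<bar> \<le> 2 * int n" for a
    proof -
      have "a + s \<noteq> 2 * int n" "a + s \<noteq> - (2 * int n)" using that(1) by (metis even_mult_iff even_minus even_numeral)+
      then show ?thesis using that(2) sc by linarith
    qed
    show ?thesis using s(2) odd_le[of "fst (fst f)"] odd_le[of "snd (fst f)"]
      unfolding boxF_def gfar_def isF_def side_def by (auto split: if_splits)
  qed
qed

lemma finite_cbd_out: assumes "M \<in> spin_sets n m" "1 \<le> m" shows "finite (cbd M - outL n)"
proof -
  have "cbd M - outL n \<subseteq> ({- (2 * int n)..2 * int n} \<times> {- (2 * int n)..2 * int n}) \<times> {- int m..int m}"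
  proof
    fix f assume f: "f \<in> cbd M - outL n"
    then have ni: "\<not> isv (fst f)" by (simp add: cbd_def)
    have t: "fc1 f \<in> cyl (boxF n) m \<or> fc2 f \<in> cyl (boxF n) m" using cbd_touch[OF assms] f by blast
    from touch_box[OF ni this] show "f \<in> ({- (2 * int n)..2 * int n} \<times> {- (2 * int n)..2 * int n}) \<times> {- int m..int m}"
      unfolding gfar_def mem_Times_iff atLeastAtMost_iff by simp linarith
  qed
  then show ?thesis by (rule finite_subset) auto
qed

lemma cint_linked:
  assumes "f \<in> cint n M" "g \<in> outL n" "linked cadj (cbd M) g f" "outL n \<subseteq> cbd M"
  shows "linked cadj (cint n M) g f"
proof -
  have g: "g \<in> cint n M" using assms(2,4) linked_refl unfolding cint_def by blast
  have "linked cadj (cint n M) g f \<and> f \<in> cint n M"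
  proof (rule linked_restrict[OF assms(3) g])
    fix y z assume y: "y \<in> cint n M" and z: "z \<in> cbd M" "cadj y z"
    obtain g' where g': "g' \<in> outL n" "linked cadj (cbd M) g' y" "y \<in> cbd M" using y unfolding cint_def by blast
    have "linked cadj (cbd M) g' z" by (rule linked_trans[OF g'(2) linked_step[where R = cadj, OF g'(3) z]])
    then show "z \<in> cint n M" using g'(1) z(1) unfolding cint_def by blast
  qed
  then show ?thesis ..
qed

lemma iface_cint: assumes M: "M \<in> spin_sets n m" "1 \<le> m" shows "iface n (cint n M)"
proof
  note oc = outL_cbd[OF M(1)]
  have sub: "cint n M \<subseteq> cbd M" by (auto simp: cint_def)
  show "ceven (cint n M)"
  proof (rule ceven_closed_subset[OF ceven_cbd sub])
    fix y z assume y: "y \<in> cint n M" and z: "z \<in> cbd M" "cadj y z"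
    obtain g' where g': "g' \<in> outL n" "linked cadj (cbd M) g' y" "y \<in> cbd M" using y unfolding cint_def by blast
    have "linked cadj (cbd M) g' z" by (rule linked_trans[OF g'(2) linked_step[where R = cadj, OF g'(3) z]])
    then show "z \<in> cint n M" using g'(1) z(1) unfolding cint_def by blast
  qed
  show "outL n \<subseteq> cint n M" using oc linked_refl unfolding cint_def by blast
  show "finite (cint n M - outL n)" by (rule finite_subset[OF _ finite_cbd_out[OF M]]) (use sub in blast)
  fix f assume f: "f \<in> cint n M"
  show "f \<in> outL n \<or> fst f \<notin> gfar (2 * int n)"
  proof (cases "f \<in> outL n")
    case False
    have "f \<in> cbd M" using f sub by blast
    then show ?thesis using touch_box(1) cbd_touch[OF M _ False] by (simp add: cbd_def)
  qed simp
  show "\<exists>g\<in>outL n. linked cadj (cint n M) g f"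
    using cint_linked[OF f _ _ oc] f unfolding cint_def by blast
qed

lemma finite_spin_sets: "finite (spin_sets n m)"
proof -
  have "spin_sets n m \<subseteq> (\<lambda>A. A \<union> {c \<in> cells. c \<notin> cyl (boxF n) m \<and> 0 \<le> snd c}) ` Pow (cyl (boxF n) m)"
  proof
    fix M assume M: "M \<in> spin_sets n m"
    then have "M = (M \<inter> cyl (boxF n) m) \<union> {c \<in> cells. c \<notin> cyl (boxF n) m \<and> 0 \<le> snd c}" unfolding spin_sets_def by blast
    then show "M \<in> (\<lambda>A. A \<union> {c \<in> cells. c \<notin> cyl (boxF n) m \<and> 0 \<le> snd c}) ` Pow (cyl (boxF n) m)" by blast
  qed
  moreover have "finite (cyl (boxF n) m)" unfolding cyl_def using finite_boxF by simp
  ultimately show ?thesis using finite_subset by fastforce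
qed

text \<open>The minus cells of the configuration whose only separating faces are those of
  \<open>I\<close>. They have an even number of faces of \<open>I\<close> above them, so every cell
  far up belongs to this set.\<close>

definition lowpart :: "cface set \<Rightarrow> cface set" where "lowpart I = cells - cfill I"

lemma cbd_lowpart: assumes "iface n I" shows "cbd (lowpart I) = I"
proof -
  obtain N where N: "\<And>p t. (p, t) \<in> I \<Longrightarrow> \<bar>t\<bar> \<le> N" using iface.heights_bounded[OF assms] by blast
  have "cbd (cfill I) = I"
  proof (rule cbd_cfill[OF iface.even_I[OF assms]])
    show "t \<le> N" if "(p, t) \<in> I" for p t using N[OF that] by linarith
  qed
  moreover have "cbd (lowpart I) = cbd (cfill I)"
    using fc_cells unfolding cbd_def lowpart_def by blast
  ultimately show ?thesis by simp
qed

text \<open>The condition under which an interface occurs at half-height \<open>m\<close>: necessary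
  by \<open>cint_flat\<close>, sufficient by \<open>cint_fibre\<close>.\<close>

definition flat :: "nat \<Rightarrow> cface set \<Rightarrow> bool" where
  "flat m I \<longleftrightarrow> (\<forall>u t. isF u \<longrightarrow> (u, t) \<in> I \<longrightarrow> \<bar>t\<bar> \<le> int m)"

lemma lowpart_spin_sets: assumes I: "iface n I" and m: "flat m I" shows "lowpart I \<in> spin_sets n m"
  unfolding spin_sets_def
proof (intro CollectI conjI ballI impI)
  show "lowpart I \<subseteq> cells" by (simp add: lowpart_def)
  fix c assume c: "c \<in> cells" "c \<notin> cyl (boxF n) m"
  let ?u = "fst c" and ?h = "snd c"
  have u: "isF ?u" using c(1) by (simp add: cells_def)
  have lp: "c \<in> lowpart I \<longleftrightarrow> even (card {t. ?h < t \<and> (?u, t) \<in> I})"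
    using u c(1) by (simp add: lowpart_def cfill_def cpot_def)
  show "c \<in> lowpart I \<longleftrightarrow> 0 \<le> ?h"
  proof (cases "?u \<in> boxF n")
    case True
    then have hm: "int m \<le> ?h \<or> ?h < - int m" using c(2) unfolding cyl_def mem_Times_iff by auto
    have b: "\<bar>t\<bar> \<le> int m" if "(?u, t) \<in> I" for t using m u that unfolding flat_def by blast
    show ?thesis
    proof (cases "int m \<le> ?h")
      case True
      have "{t. ?h < t \<and> (?u, t) \<in> I} = {}" using b True by fastforce
      then have "c \<in> lowpart I" unfolding lp by (simp only: card.empty) simp
      then show ?thesis using True by simp
    next
      case False
      then have "{t. ?h < t \<and> (?u, t) \<in> I} = {t. (?u, t) \<in> I}" using b hm by fastforce
      then have "c \<notin> lowpart I" unfolding lp using iface.column_odd[OF I u] by simp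
      then show ?thesis using False hm by linarith
    qed
  next
    case False
    then have "?u \<in> gfar (2 * int n)" using u by (simp add: boxF_def)
    then have "{t. ?h < t \<and> (?u, t) \<in> I} = {t. ?h < t \<and> t = 0}" using iface.far_column[OF I u] by blast
    also have "\<dots> = (if ?h < 0 then {0} else {})" by auto
    finally show ?thesis using lp by simp
  qed
qed

lemma cint_flat: assumes "M \<in> spin_sets n m" "1 \<le> m" shows "flat m (cint n M)"
  unfolding flat_def
proof (intro allI impI)
  fix u t assume u: "isF u" "(u, t) \<in> cint n M"
  show "\<bar>t\<bar> \<le> int m"
  proof (cases "(u, t) \<in> outL n")
    case True then show ?thesis by (simp add: outL_def)
  next
    case False
    have f: "(u, t) \<in> cbd M" using u(2) by (simp add: cint_def)
    then have "\<not> isv (fst (u, t))" by (simp add: cbd_def)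
    from touch_box(2)[OF this cbd_touch[OF assms f False]] show ?thesis by simp
  qed
qed

text \<open>Given its interface, the remaining spins form an arbitrary configuration on the cells not touching the interface.\<close>
lemma cint_fibre:
  assumes I: "iface n I" and m: "flat m I" "1 \<le> m"
  shows "bij_betw (symd (lowpart I)) (Pow (cyl (boxF n) m - NN UNIV I)) {M \<in> spin_sets n m. cint n M = I}"
    "\<And>L. L \<subseteq> cyl (boxF n) m - NN UNIV I \<Longrightarrow> cbd (symd (lowpart I) L) = I \<union> cbd L \<and> I \<inter> cbd L = {} \<and> cbd L \<inter> outL n = {}"
proof -
  let ?C = "cyl (boxF n) m"
  let ?M0 = "lowpart I"
  note M0 = lowpart_spin_sets[OF I m(1)] and b0 = cbd_lowpart[OF I]
  have Ccells: "?C \<subseteq> cells" by (auto simp: cyl_def cells_def boxF_def)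
  have cs: "symd A B = symd B A" for A B :: "cface set" by (auto simp: symd_def)
  have low: "cbd (symd ?M0 L) = I \<union> cbd L" "I \<inter> cbd L = {}" "cint n (symd ?M0 L) = I" "symd ?M0 L \<in> spin_sets n m"
    if L: "L \<subseteq> ?C - NN UNIV I" for L
  proof -
    \<comment> \<open>The two cells beside \<open>g\<close> would both touch the interface at the
      vertex \<open>p\<close>, and \<open>L\<close> has no such cells.\<close>
    have nv: "g \<notin> cbd L" if f: "f \<in> I" and p: "p \<in> cverts f" "p \<in> cverts g" for f g p
    proof
      assume g: "g \<in> cbd L"
      then have ng: "\<not> isv (fst g)" by (simp add: cbd_def)
      obtain v k where vk: "p = (v, k)" by (cases p)
      note fv = fc_vertex[OF p(2)[unfolded vk] ng]
      have "fc1 g \<in> NC f" "fc2 g \<in> NC f" using fv p(1) unfolding NC_def vk by blast+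
      then have "fc1 g \<notin> L" "fc2 g \<notin> L" using L f unfolding NN_def by blast+
      then show False using g by (simp add: cbd_def)
    qed
    show dis: "I \<inter> cbd L = {}"
    proof -
      have "f \<notin> cbd L" if f: "f \<in> I" for f
      proof -
        obtain v k where "(v, k) \<in> cverts f" by (rule exists_vertex[OF iface.not_isv[OF I f]])
        then show ?thesis using nv f by blast
      qed
      then show ?thesis by blast
    qed
    show un: "cbd (symd ?M0 L) = I \<union> cbd L" 
    proof -
      have "cbd (symd ?M0 L) = symd I (cbd L)" by (simp only: cbd_symd b0)
      then show ?thesis using dis by (auto simp: mem_symd)
    qed
    show "cint n (symd ?M0 L) = I"
    proof (intro set_eqI iffI)
      fix f assume f: "f \<in> I"
      obtain g where g: "g \<in> outL n" "linked cadj I g f" using iface.conn[OF I f] by blast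
      have "linked cadj (cbd (symd ?M0 L)) g f" by (rule linked_mono[OF g(2)]) (use un in blast)
      then show "f \<in> cint n (symd ?M0 L)" using f g(1) un unfolding cint_def by blast
    next
      fix f assume "f \<in> cint n (symd ?M0 L)"
      then obtain g where g: "g \<in> outL n" "linked cadj (cbd (symd ?M0 L)) g f" unfolding cint_def by blast
      have gI: "g \<in> I" using g(1) iface.out[OF I] by blast
      have "linked cadj I g f \<and> f \<in> I"
      proof (rule linked_restrict[OF g(2) gI])
        fix y z assume y: "y \<in> I" and z: "z \<in> cbd (symd ?M0 L)" "cadj y z"
        obtain p where "p \<in> cverts y" "p \<in> cverts z" using z(2) unfolding cadj_def by blast
        then have "z \<notin> cbd L" using nv y by blast
        then show "z \<in> I" using z(1) un by blast
      qed
      then show "f \<in> I" ..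
    qed
    show "symd ?M0 L \<in> spin_sets n m"
      unfolding spin_sets_def
    proof (intro CollectI conjI ballI impI)
      have "?M0 \<subseteq> cells" using M0 unfolding spin_sets_def by blast
      then show "symd ?M0 L \<subseteq> cells" using L Ccells unfolding symd_def by blast
      fix c assume c: "c \<in> cells" "c \<notin> ?C"
      have "c \<in> ?M0 \<longleftrightarrow> 0 \<le> snd c" using M0 c unfolding spin_sets_def by blast
      moreover have "c \<notin> L" using c(2) L by blast
      ultimately show "c \<in> symd ?M0 L \<longleftrightarrow> 0 \<le> snd c" by (simp add: mem_symd)
    qed
  qed
  show "bij_betw (symd ?M0) (Pow (?C - NN UNIV I)) {M \<in> spin_sets n m. cint n M = I}"
  proof (rule bij_betwI[where g = "symd ?M0"])
    show "symd ?M0 \<in> Pow (?C - NN UNIV I) \<rightarrow> {M \<in> spin_sets n m. cint n M = I}" using low(3,4) by blast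
    show "symd ?M0 (symd ?M0 L) = L" for L by (auto simp: mem_symd set_eq_iff)
    show "symd ?M0 (symd ?M0 L) = L" for L by (auto simp: mem_symd set_eq_iff)
    show "symd ?M0 \<in> {M \<in> spin_sets n m. cint n M = I} \<rightarrow> Pow (?C - NN UNIV I)"
    proof
      fix M assume "M \<in> {M \<in> spin_sets n m. cint n M = I}"
      then have M: "M \<in> spin_sets n m" "cint n M = I" by blast+
      let ?L = "symd ?M0 M"
      have LC: "?L \<subseteq> ?C"
      proof
        fix c assume c: "c \<in> ?L"
        show "c \<in> ?C"
        proof (rule ccontr)
          assume n: "c \<notin> ?C"
          have "c \<in> cells" using c M(1) M0 unfolding spin_sets_def symd_def by blast
          then have "c \<in> M \<longleftrightarrow> 0 \<le> snd c" "c \<in> ?M0 \<longleftrightarrow> 0 \<le> snd c" using n M(1) M0 unfolding spin_sets_def by blast+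
          then show False using c by (simp add: mem_symd)
        qed
      qed
      have IM: "I \<subseteq> cbd M" using M(2) unfolding cint_def by blast
      have bL: "cbd ?L = cbd M - I" 
      proof -
        have "cbd ?L = symd I (cbd M)" by (simp only: cbd_symd b0)
        then show ?thesis using IM by (auto simp: mem_symd)
      qed
      have vx: "g \<notin> cbd ?L" if f: "f \<in> I" and p: "p \<in> cverts f" "p \<in> cverts g" for f g p
      proof
        assume g: "g \<in> cbd ?L"
        then have gM: "g \<in> cbd M" "g \<notin> I" using bL by blast+
        obtain g0 where g0: "g0 \<in> outL n" "linked cadj (cbd M) g0 f" using f unfolding M(2)[symmetric] cint_def by blast
        have "linked cadj (cbd M) f g" by (rule linked_common_vertex) (use IM f gM p in auto)
        then have "linked cadj (cbd M) g0 g" by (rule linked_trans[OF g0(2)])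
        then have "g \<in> cint n M" using g0(1) gM(1) unfolding cint_def by blast
        then show False using gM(2) M(2) by blast
      qed
      have uni: "c \<in> ?L \<longleftrightarrow> fc1 f \<in> ?L" if "f \<in> I" "c \<in> NC f" for c f
        by (rule NC_uniform[OF iface.not_isv[OF I that(1)] _ that(2)]) (use vx that(1) in blast)
      \<comment> \<open>The deviating set is constant on the cells around each face of the
        interface, hence along the whole connected interface; at the faces outside the box it is
        empty.\<close>
      have no: "NC f \<inter> ?L = {}" if f: "f \<in> I" for f
      proof -
        obtain g where g: "g \<in> outL n" "linked cadj I g f" using iface.conn[OF I f] by blast
        have gI: "g \<in> I" using g(1) iface.out[OF I] by blast
        have "linked cadj {f \<in> I. fc1 f \<notin> ?L} g f \<and> f \<in> {f \<in> I. fc1 f \<notin> ?L}"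
        proof (rule linked_restrict[OF g(2)])
          show "g \<in> {f \<in> I. fc1 f \<notin> ?L}" using gI outL_cyl(1)[OF g(1), of m] LC by blast
          fix y z assume y: "y \<in> {f \<in> I. fc1 f \<notin> ?L}" and z: "z \<in> I" "cadj y z"
          obtain p where p: "p \<in> cverts y" "p \<in> cverts z" using z(2) unfolding cadj_def by blast
          obtain v k where vk: "p = (v, k)" by (cases p)
          have "fc1 z \<in> NC y" using p fc_vertex[OF p(2)[unfolded vk] iface.not_isv[OF I z(1)]] unfolding NC_def vk by blast
          then show "z \<in> {f \<in> I. fc1 f \<notin> ?L}" using uni[of y "fc1 z"] y z(1) by blast
        qed
        then show ?thesis using uni f by blast
      qed
      then show "?L \<in> Pow (?C - NN UNIV I)" using LC unfolding NN_def by blast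
    qed
  qed
  fix L assume L: "L \<subseteq> ?C - NN UNIV I"
  show "cbd (symd ?M0 L) = I \<union> cbd L \<and> I \<inter> cbd L = {} \<and> cbd L \<inter> outL n = {}"
    using low(1,2)[OF L] iface.out[OF I] by blast
qed

lemma cint_weight:
  assumes I: "iface n I" and m: "flat m I" "1 \<le> m"
  shows "(\<Sum>M\<in>{M \<in> spin_sets n m. cint n M = I}. exp (- \<beta> * real (card (cbd M - outL n))))
     = exp (- \<beta> * real (card (I - outL n))) * Zp \<beta> (cyl (boxF n) m - NN UNIV I)"
proof -
  let ?A = "cyl (boxF n) m - NN UNIV I"
  have "(\<Sum>M\<in>{M \<in> spin_sets n m. cint n M = I}. exp (- \<beta> * real (card (cbd M - outL n))))
      = (\<Sum>L\<in>Pow ?A. exp (- \<beta> * real (card (cbd (symd (lowpart I) L) - outL n))))"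
    by (rule sum.reindex_bij_betw[OF cint_fibre(1)[OF assms], symmetric])
  also have "\<dots> = (\<Sum>L\<in>Pow ?A. exp (- \<beta> * real (card (I - outL n))) * wt \<beta> L)"
  proof (rule sum.cong[OF refl])
    fix L assume L: "L \<in> Pow ?A"
    have b: "cbd (symd (lowpart I) L) = I \<union> cbd L" "I \<inter> cbd L = {}" "cbd L \<inter> outL n = {}"
      using cint_fibre(2)[OF assms, of L] L by blast+
    have "finite (cyl (boxF n) m)" unfolding cyl_def using finite_boxF by simp
    then have "finite L" using L finite_subset by blast
    then have f: "finite (cbd L)" by (rule finite_cbd)
    have "cbd (symd (lowpart I) L) - outL n = (I - outL n) \<union> cbd L" using b by blast
    then have "card (cbd (symd (lowpart I) L) - outL n) = card (I - outL n) + card (cbd L)"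
      using card_Un_disjoint[OF iface.fin[OF I] f] b(2) by auto
    then show "exp (- \<beta> * real (card (cbd (symd (lowpart I) L) - outL n))) = exp (- \<beta> * real (card (I - outL n))) * wt \<beta> L"
      unfolding wt_def exp_add[symmetric] by (simp add: distrib_left)
  qed
  also have "\<dots> = exp (- \<beta> * real (card (I - outL n))) * Zp \<beta> ?A"
    unfolding Zp_def by (rule sum_distrib_left[symmetric])
  finally show ?thesis .
qed

section \<open>The limit of the finite-volume ratios\<close>

context model begin

text \<open>Every wall is counted once for each of its faces, hence at least once, and
  \<open>animal_sum\<close> is applied at each grid point of the box.\<close>

lemma wall_weight_sum:
  assumes "finite VV" "\<And>V. V \<in> VV \<Longrightarrow> stdwall n V"
  shows "(\<Sum>V\<in>VV. exp (- \<beta> * cexcess V)) \<le> real (card ({- (2 * int n)..2 * int n} \<times> {- (2 * int n)..2 * int n})) / 300"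
proof -
  let ?B = "{- (2 * int n)..2 * int n} \<times> {- (2 * int n)..2 * int n}" and ?Q = "Sigma VV (\<lambda>V. V)"
  have finQ: "finite ?Q" using assms stdwallD(1) by (intro finite_SigmaI) blast+
  have "(\<Sum>V\<in>VV. exp (- \<beta> * cexcess V)) \<le> (\<Sum>V\<in>VV. \<Sum>f\<in>V. y ^ card V)"
  proof (rule sum_mono)
    fix V assume V: "V \<in> VV"
    note sw = assms(2)[OF V]
    have "1 \<le> real (card V)" using stdwallD(1,2)[OF sw] by (simp add: Suc_le_eq card_gt_0_iff)
    moreover have "(\<beta> - 120) * (real (card V) / 2) \<le> \<beta> * cexcess V"
    proof -
      have "(\<beta> - 120) * (real (card V) / 2) \<le> (\<beta> - 120) * cexcess V"
        using stdwallD(5)[OF sw] y_bounds(3) by (intro mult_left_mono) auto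
      also have "\<dots> \<le> \<beta> * cexcess V" using stdwallD(10)[OF sw] by (intro mult_right_mono) auto
      finally show ?thesis .
    qed
    ultimately have "- \<beta> * cexcess V \<le> real (card V) * (1 - (\<beta> - 120) / 2)" by (simp add: algebra_simps diff_divide_distrib)
    then have "exp (- \<beta> * cexcess V) \<le> exp (real (card V) * (1 - (\<beta> - 120) / 2))" by (simp only: exp_le_cancel_iff)
    also have "\<dots> = y ^ card V" unfolding y_def by (rule exp_of_nat_mult)
    also have "\<dots> \<le> real (card V) * y ^ card V"
      using \<open>1 \<le> real (card V)\<close> mult_right_mono[of 1 "real (card V)" "y ^ card V"] y_bounds(1) by simp
    finally show "exp (- \<beta> * cexcess V) \<le> (\<Sum>f\<in>V. y ^ card V)" by simp
  qed
  also have "\<dots> = (\<Sum>q\<in>?Q. y ^ card (fst q))"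
    using sum.Sigma[OF assms(1), of "\<lambda>V. V" "\<lambda>V f. y ^ card V"] stdwallD(1)[OF assms(2)]
    by (simp add: case_prod_unfold)
  also have "\<dots> = (\<Sum>p\<in>?B. \<Sum>q\<in>{q \<in> ?Q. fst (snd q) = p}. y ^ card (fst q))"
  proof (rule sum.group[OF finQ, symmetric])
    show "(\<lambda>q. fst (snd q)) ` ?Q \<subseteq> ?B"
    proof
      fix p assume "p \<in> (\<lambda>q. fst (snd q)) ` ?Q"
      then obtain V f where f: "V \<in> VV" "f \<in> V" "p = fst f" by auto
      have "p \<in> cproj V" using f(2,3) gclosure_refl unfolding cproj_def by blast
      then have "p \<notin> gfar (2 * int n)" using stdwallD(6)[OF assms(2)[OF f(1)]] by blast
      then show "p \<in> ?B" unfolding gfar_def mem_Times_iff atLeastAtMost_iff by simp linarith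
    qed
  qed simp
  also have "\<dots> \<le> (\<Sum>p\<in>?B. 1/300)" by (rule sum_mono[OF animal_sum[OF assms]])
  finally show ?thesis by simp
qed

text \<open>Dropping the compatibility of the walls enlarges the sum, which is then at most a
  product over single walls. The bound depends on \<open>n\<close>, which suffices for exchanging
  the limit in \<open>m\<close> with the sum over collections.\<close>

lemma Col_sum_bounded:
  obtains K where "\<And>G. finite G \<Longrightarrow> G \<subseteq> Col n \<Longrightarrow> (\<Sum>X\<in>G. exp (- \<beta> * (\<Sum>V\<in>X. cexcess V))) \<le> K"
proof -
  let ?K = "exp (real (card ({- (2 * int n)..2 * int n} \<times> {- (2 * int n)..2 * int n})) / 300)"
  have "(\<Sum>X\<in>G. exp (- \<beta> * (\<Sum>V\<in>X. cexcess V))) \<le> ?K" if G: "finite G" "G \<subseteq> Col n" for G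
  proof -
    let ?VV = "\<Union>G"
    let ?e = "\<lambda>V. exp (- \<beta> * cexcess V)"
    have fX: "finite X" if "X \<in> G" for X using Col_facts(1) G(2) that by blast
    have fV: "finite ?VV" using G(1) fX by blast
    have sV: "stdwall n V" if "V \<in> ?VV" for V using Col_facts(2) G(2) that by blast
    have "(\<Sum>X\<in>G. exp (- \<beta> * (\<Sum>V\<in>X. cexcess V))) = (\<Sum>X\<in>G. prod ?e X)"
    proof (rule sum.cong[OF refl])
      fix X assume "X \<in> G"
      then show "exp (- \<beta> * (\<Sum>V\<in>X. cexcess V)) = prod ?e X" unfolding sum_distrib_left by (intro exp_sum fX)
    qed
    also have "\<dots> \<le> (\<Sum>X\<in>Pow ?VV. prod ?e X)" by (rule sum_mono2) (use fV in \<open>auto intro: prod_nonneg\<close>)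
    also have "\<dots> = (\<Prod>V\<in>?VV. ?e V + 1)" using prod_add[OF fV, of ?e "\<lambda>_. 1"] by simp
    also have "\<dots> \<le> (\<Prod>V\<in>?VV. exp (?e V))"
      by (rule prod_mono) (auto intro: add_nonneg_nonneg simp: add.commute exp_ge_add_one_self)
    also have "\<dots> = exp (\<Sum>V\<in>?VV. ?e V)" by (rule exp_sum[OF fV, symmetric])
    also have "\<dots> \<le> ?K" using wall_weight_sum[OF fV sV] by simp
    finally show ?thesis .
  qed
  then show thesis using that by blast
qed

text \<open>A finite family whose sum is within \<open>\<delta>\<close> of the supremum leaves at
  most \<open>\<delta>\<close> for every finite family disjoint from it.\<close>

lemma Col_tail:
  assumes "0 < \<delta>"
  obtains F where "finite F" "F \<subseteq> Col n"
    "\<And>G. finite G \<Longrightarrow> G \<subseteq> Col n \<Longrightarrow> G \<inter> F = {} \<Longrightarrow> (\<Sum>X\<in>G. exp (- \<beta> * (\<Sum>V\<in>X. cexcess V))) \<le> \<delta>"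
proof -
  let ?g = "\<lambda>X. exp (- \<beta> * (\<Sum>V\<in>X. cexcess V))"
  let ?T = "{sum ?g G | G. finite G \<and> G \<subseteq> Col n}"
  obtain K where K: "\<And>G. finite G \<Longrightarrow> G \<subseteq> Col n \<Longrightarrow> sum ?g G \<le> K" by (rule Col_sum_bounded) blast
  have bdd: "bdd_above ?T" unfolding bdd_above_def using K by blast
  have "sum ?g {} \<in> ?T" by blast
  then have ne: "?T \<noteq> {}" by blast
  have "Sup ?T - \<delta> < Sup ?T" using assms by simp
  then obtain t where t: "t \<in> ?T" "Sup ?T - \<delta> < t" using less_cSup_iff[OF ne bdd] by blast
  then obtain F where F: "finite F" "F \<subseteq> Col n" "t = sum ?g F" by blast
  have "sum ?g G \<le> \<delta>" if G: "finite G" "G \<subseteq> Col n" "G \<inter> F = {}" for G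
  proof -
    have "sum ?g (G \<union> F) \<in> ?T" using G F by blast
    then have "sum ?g (G \<union> F) \<le> Sup ?T" by (rule cSup_upper[OF _ bdd])
    moreover have "sum ?g (G \<union> F) = sum ?g G + sum ?g F" by (rule sum.union_disjoint[OF G(1) F(1) G(3)])
    ultimately show ?thesis using t(2) F(3) by linarith
  qed
  then show thesis using that[OF F(1,2)] by blast
qed

section \<open>Finite-volume weights of collections\<close>

definition spin_weight :: "cface set \<Rightarrow> real" where "spin_weight M = exp (- \<beta> * real (card (cbd M - outL n)))"

text \<open>The total weight of the configurations with a given collection, divided by the factors
  common to all collections: the energy of the flat interface and the partition function of the
  cylinder.\<close>

definition std_weight :: "nat \<Rightarrow> cface set set \<Rightarrow> real" where
  "std_weight m X = exp (- \<beta> * (\<Sum>V\<in>X. cexcess V)) * P m (NN UNIV (Ifc n X))"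

definition std_collections :: "nat \<Rightarrow> cface set set set" where "std_collections m = (\<lambda>M. cstd (cint n M)) ` spin_sets n m"

lemma std_weight_bounds: "0 \<le> std_weight m X" "std_weight m X \<le> exp (- \<beta> * (\<Sum>V\<in>X. cexcess V))"
  unfolding std_weight_def using P_bounds(1)[of m "NN UNIV (Ifc n X)"] P_bounds(2)[of m "NN UNIV (Ifc n X)"]
  by (auto intro: mult_left_le)

lemma std_weight_pos: "0 < std_weight m X"
  unfolding std_weight_def using P_bounds(1) by simp

lemma std_weight_limit: "(\<lambda>m. std_weight m X) \<longlonglongrightarrow> omega UNIV X"
  unfolding std_weight_def omega_def by (intro tendsto_mult tendsto_const P_limit)

lemma omega_pos: assumes "X \<in> Col n" shows "0 < omega UNIV X"
proof -
  let ?B = "{- (2 * int n) - 2..2 * int n + 2} \<times> {- (2 * int n) - 2..2 * int n + 2}"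
  let ?L = "{f \<in> Ifc n X. fst f \<in> ?B}"
  have "finite ?L" by (rule finite_faces_over[OF Ifc(1)[OF assms]]) simp
  then have "finite (\<Union>f\<in>?L. NC f)" using NC_card(1) by blast
  moreover have "NN UNIV (Ifc n X) \<inter> {c. fst c \<in> boxF n} \<subseteq> (\<Union>f\<in>?L. NC f)"
  proof
    fix c assume "c \<in> NN UNIV (Ifc n X) \<inter> {c. fst c \<in> boxF n}"
    then obtain f where f: "f \<in> Ifc n X" "c \<in> NC f" "fst c \<in> boxF n" unfolding NN_def by blast
    have "fst f \<in> ?B" using NC_near(1)[OF f(2)] f(3)
      unfolding gdist_def boxF_def gfar_def mem_Times_iff atLeastAtMost_iff by simp linarith
    then have "f \<in> ?L" using f(1) by (intro CollectI conjI)
    then show "c \<in> (\<Union>f\<in>?L. NC f)" by (rule UN_I) (rule f(2))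
  qed
  ultimately have "finite (NN UNIV (Ifc n X) \<inter> {c. fst c \<in> boxF n})" by (rule finite_subset[rotated])
  from Pinf_pos[OF this] show ?thesis by (simp add: omega_def)
qed

lemma std_collections_Col: "1 \<le> m \<Longrightarrow> std_collections m \<subseteq> Col n"
  unfolding std_collections_def Col_def using iface_cint by blast

lemma finite_std_collections: "finite (std_collections m)"
  unfolding std_collections_def using finite_spin_sets by simp

lemma eventually_std_collections: assumes "X \<in> Col n" shows "\<forall>\<^sub>F m in sequentially. X \<in> std_collections m"
proof -
  note I = Ifc(1)[OF assms]
  obtain N where N: "\<And>p t. (p, t) \<in> Ifc n X \<Longrightarrow> \<bar>t\<bar> \<le> N" using iface.heights_bounded[OF I] by blast
  have "X \<in> std_collections m" if m: "nat N + 1 \<le> m" for m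
  proof -
    have "flat m (Ifc n X)" unfolding flat_def
    proof (intro allI impI)
      fix u t assume "(u, t) \<in> Ifc n X"
      from N[OF this] show "\<bar>t\<bar> \<le> int m" using m by linarith
    qed
    moreover have "1 \<le> m" using m by simp
    ultimately have "\<forall>L\<in>Pow (cyl (boxF n) m - NN UNIV (Ifc n X)). symd (lowpart (Ifc n X)) L \<in> {M \<in> spin_sets n m. cint n M = Ifc n X}"
      by (rule bij_betwE[OF cint_fibre(1)[OF I]])
    then have "symd (lowpart (Ifc n X)) {} \<in> spin_sets n m" "cint n (symd (lowpart (Ifc n X)) {}) = Ifc n X" by blast+
    then have "symd (lowpart (Ifc n X)) {} \<in> spin_sets n m" "X = cstd (cint n (symd (lowpart (Ifc n X)) {}))" using Ifc(2)[OF assms] by simp_all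
    then show ?thesis unfolding std_collections_def by (intro image_eqI[rotated])
  qed
  then show ?thesis unfolding eventually_sequentially by blast
qed

lemma spin_sets_sum:
  assumes m: "1 \<le> m"
  shows "(\<Sum>M\<in>{M \<in> spin_sets n m. R (cstd (cint n M))}. spin_weight M)
    = exp (- \<beta> * real (card {f. isF (fst f) \<and> snd f = 0 \<and> f \<notin> outL n})) * Z (cyl (boxF n) m) * (\<Sum>X\<in>{X \<in> std_collections m. R X}. std_weight m X)"
proof -
  let ?A = "{M \<in> spin_sets n m. R (cstd (cint n M))}" and ?c = "\<lambda>M. cstd (cint n M)"
  let ?K = "exp (- \<beta> * real (card {f. isF (fst f) \<and> snd f = 0 \<and> f \<notin> outL n}))"
  have finA: "finite ?A" using finite_spin_sets by simp
  have finX: "finite {X \<in> std_collections m. R X}" using finite_std_collections by simp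
  have "(\<Sum>M\<in>?A. spin_weight M) = (\<Sum>X\<in>{X \<in> std_collections m. R X}. \<Sum>M\<in>{M \<in> ?A. ?c M = X}. spin_weight M)"
    by (rule sum.group[OF finA finX, symmetric]) (auto simp: std_collections_def)
  also have "\<dots> = (\<Sum>X\<in>{X \<in> std_collections m. R X}. ?K * Z (cyl (boxF n) m) * std_weight m X)"
  proof (rule sum.cong[OF refl])
    fix X assume X: "X \<in> {X \<in> std_collections m. R X}"
    then obtain M0 where M0: "M0 \<in> spin_sets n m" "X = ?c M0" unfolding std_collections_def by blast
    have XC: "X \<in> Col n" using std_collections_Col[OF m] X by blast
    let ?I = "Ifc n X"
    have eq: "?c M = X \<longleftrightarrow> cint n M = ?I" if "M \<in> spin_sets n m" for M
      using Ifc_cstd[OF iface_cint[OF that m]] Ifc(2)[OF XC] by metis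
    have "cint n M0 = ?I" using eq[OF M0(1)] M0(2) by blast
    then have fl: "flat m ?I" using cint_flat[OF M0(1) m] by simp
    have "{M \<in> ?A. ?c M = X} = {M \<in> spin_sets n m. cint n M = ?I}" using eq X by auto
    then have "(\<Sum>M\<in>{M \<in> ?A. ?c M = X}. spin_weight M) = exp (- \<beta> * real (card (?I - outL n))) * Z (cyl (boxF n) m - NN UNIV ?I)"
      unfolding spin_weight_def using cint_weight[OF Ifc(1)[OF XC] fl m] by simp
    also have "exp (- \<beta> * real (card (?I - outL n))) = ?K * exp (- \<beta> * (\<Sum>V\<in>X. cexcess V))"
      unfolding Col_energy[OF XC] exp_add[symmetric] by (simp add: distrib_left)
    also have "Z (cyl (boxF n) m - NN UNIV ?I) = Z (cyl (boxF n) m) * P m (NN UNIV ?I)"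
      unfolding P_def using Z_pos[of "cyl (boxF n) m"] by simp
    finally show "(\<Sum>M\<in>{M \<in> ?A. ?c M = X}. spin_weight M) = ?K * Z (cyl (boxF n) m) * std_weight m X"
      unfolding std_weight_def by (simp only: mult_ac)
  qed
  also have "\<dots> = ?K * Z (cyl (boxF n) m) * (\<Sum>X\<in>{X \<in> std_collections m. R X}. std_weight m X)" by (rule sum_distrib_left[symmetric])
  finally show ?thesis .
qed

text \<open>Dominated convergence by hand. Peeling is applied to a finite family closed under the
  deletions and containing all collections with \<open>R\<close> outside a tail of weight
  \<open>\<delta>\<close>; the finitely many weights converge, and the tail is controlled uniformly
  in \<open>m\<close>.\<close>

lemma ratio_bound:
  assumes cl: "\<And>X V V0. X \<in> Col n \<Longrightarrow> R X \<Longrightarrow> V \<in> X \<Longrightarrow> V0 \<in> S \<Longrightarrow> cproj V \<subseteq> ghull (cproj V0) \<Longrightarrow> R (X - {V})"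
    and e: "0 < \<epsilon>"
  shows "\<forall>\<^sub>F m in sequentially. (\<Sum>M\<in>{M \<in> spin_sets n m. S \<subseteq> cstd (cint n M) \<and> R (cstd (cint n M))}. spin_weight M) /
     (\<Sum>M\<in>{M \<in> spin_sets n m. R (cstd (cint n M))}. spin_weight M) \<le> exp (- (\<beta> - 120) * (\<Sum>V\<in>S. cexcess V)) + \<epsilon>"
proof -
  let ?B = "exp (- (\<beta> - 120) * (\<Sum>V\<in>S. cexcess V))"
  let ?N = "\<lambda>m. \<Sum>X\<in>{X \<in> std_collections m. S \<subseteq> X \<and> R X}. std_weight m X" and ?D = "\<lambda>m. \<Sum>X\<in>{X \<in> std_collections m. R X}. std_weight m X"
  have ratio: "(\<Sum>M\<in>{M \<in> spin_sets n m. S \<subseteq> cstd (cint n M) \<and> R (cstd (cint n M))}. spin_weight M) /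
     (\<Sum>M\<in>{M \<in> spin_sets n m. R (cstd (cint n M))}. spin_weight M) = ?N m / ?D m" if "1 \<le> m" for m
  proof -
    have "Z (cyl (boxF n) m) \<noteq> 0" using Z_pos[of "cyl (boxF n) m"] by simp
    then show ?thesis unfolding spin_sets_sum[OF that, of R] spin_sets_sum[OF that, of "\<lambda>X. S \<subseteq> X \<and> R X"]
      by (simp add: mult.assoc)
  qed
  have "\<forall>\<^sub>F m in sequentially. ?N m / ?D m \<le> ?B + \<epsilon>"
  proof (cases "\<exists>X1\<in>Col n. S \<subseteq> X1 \<and> R X1")
    \<comment> \<open>The two conditions exclude each other, so the numerator is 0 and so is the
      quotient, also when the denominator vanishes.\<close>
    case False
    have "?N m / ?D m \<le> ?B + \<epsilon>" if m: "1 \<le> m" for m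
    proof -
      have "{X \<in> std_collections m. S \<subseteq> X \<and> R X} = {}" using std_collections_Col[OF m] False by blast
      then have "?N m = 0" by (simp only: sum.empty)
      then show ?thesis using e by (simp add: add_nonneg_nonneg)
    qed
    then show ?thesis unfolding eventually_sequentially by blast
  next
    case True
    then obtain X1 where X1: "X1 \<in> Col n" "S \<subseteq> X1" "R X1" by blast
    have finS: "finite S" using Col_facts(1)[OF X1(1)] X1(2) finite_subset by blast
    have peelS: "peel V UNIV" if "V \<in> S" for V
      by (rule peel_wall) (use Col_facts(2)[OF X1(1)] X1(2) that in auto)
    define s where "s = omega UNIV X1"
    have s: "0 < s" unfolding s_def by (rule omega_pos[OF X1(1)])
    \<comment> \<open>In the limit the collection \<open>X1\<close> alone contributes
      \<open>s\<close> to the denominator, so a tail of weight \<open>\<epsilon> * s / 2\<close>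
      changes the quotient by less than \<open>\<epsilon>\<close>.\<close>
    define \<delta> where "\<delta> = \<epsilon> * s / 2"
    have d: "0 < \<delta>" using e s by (simp add: \<delta>_def)
    obtain F0 where F0: "finite F0" "F0 \<subseteq> Col n"
      "\<And>G. finite G \<Longrightarrow> G \<subseteq> Col n \<Longrightarrow> G \<inter> F0 = {} \<Longrightarrow> (\<Sum>X\<in>G. exp (- \<beta> * (\<Sum>V\<in>X. cexcess V))) \<le> \<delta>"
      by (rule Col_tail[OF d]) blast
    \<comment> \<open>Including all subcollections makes \<open>F\<close> closed under the deletions
      while keeping it finite.\<close>
    define F where "F = {X' \<in> (\<Union>X\<in>insert X1 F0. Pow X). X' \<in> Col n \<and> R X'}"
    have "finite (\<Union>X\<in>insert X1 F0. Pow X)"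
      using F0(1,2) X1(1) Col_facts(1) by (intro finite_UN_I) auto
    moreover have "F \<subseteq> (\<Union>X\<in>insert X1 F0. Pow X)" unfolding F_def by blast
    ultimately have finF: "finite F" by (rule finite_subset[rotated])
    have FC: "F \<subseteq> Col n" "\<And>X. X \<in> F \<Longrightarrow> R X" "X1 \<in> F" unfolding F_def using X1 by blast+
    have FF: "X \<in> F" if "X \<in> F0" "R X" for X unfolding F_def using that F0(2) by blast
    have clF: "X - {V} \<in> F" if X: "X \<in> F" "V \<in> X" and V: "V0 \<in> S" "cproj V \<subseteq> ghull (cproj V0)" for X V V0
    proof -
      have XC: "X \<in> Col n" using X(1) FC(1) by blast
      have "X - {V} \<in> Col n" by (rule Col_delete[OF XC X(2)])
      moreover have "R (X - {V})" by (rule cl[OF XC FC(2)[OF X(1)] X(2) V])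
      moreover have "X - {V} \<in> (\<Union>X\<in>insert X1 F0. Pow X)" using X(1) unfolding F_def by blast
      ultimately show ?thesis unfolding F_def by blast
    qed
    let ?a = "\<Sum>X\<in>{X \<in> F. S \<subseteq> X}. omega UNIV X" and ?b = "\<Sum>X\<in>F. omega UNIV X"
    have ab: "?a \<le> ?B * ?b" by (rule peel_set[OF finS peelS finF FC(1) clF])
    have bs: "s \<le> ?b" unfolding s_def using member_le_sum[OF FC(3) _ finF, of "omega UNIV"] omega_nonneg by blast
    have b0: "0 < ?b" using s bs by linarith
    have "(\<lambda>m. ((\<Sum>X\<in>{X \<in> F. S \<subseteq> X}. std_weight m X) + \<delta>) / (\<Sum>X\<in>F. std_weight m X)) \<longlonglongrightarrow> (?a + \<delta>) / ?b"
      using b0 by (intro tendsto_divide tendsto_add tendsto_sum std_weight_limit tendsto_const) simp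
    moreover have "(?a + \<delta>) / ?b < ?B + \<epsilon>"
    proof -
      have "\<delta> < \<epsilon> * ?b"
      proof -
        have "\<epsilon> * s \<le> \<epsilon> * ?b" using bs e by (intro mult_left_mono) auto
        moreover have "\<delta> < \<epsilon> * s" using e s by (simp add: \<delta>_def)
        ultimately show ?thesis by linarith
      qed
      then have "?a + \<delta> < (?B + \<epsilon>) * ?b" using ab unfolding distrib_right by linarith
      then show ?thesis using b0 by (simp only: pos_divide_less_eq)
    qed
    ultimately have lim: "\<forall>\<^sub>F m in sequentially. ((\<Sum>X\<in>{X \<in> F. S \<subseteq> X}. std_weight m X) + \<delta>) / (\<Sum>X\<in>F. std_weight m X) < ?B + \<epsilon>"
      by (rule order_tendstoD(2))
    have inC: "\<forall>\<^sub>F m in sequentially. \<forall>X\<in>F. X \<in> std_collections m"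
      using finF FC(1) eventually_std_collections by (intro eventually_ball_finite) blast+
    show ?thesis using lim inC eventually_ge_at_top[of 1]
    proof eventually_elim
      case (elim m)
      have FCX: "F \<subseteq> {X \<in> std_collections m. R X}" using elim(2) FC(2) by blast
      have pos: "0 < (\<Sum>X\<in>F. std_weight m X)" by (rule sum_pos[OF finF _ std_weight_pos]) (use FC(3) in blast)
      have D: "(\<Sum>X\<in>F. std_weight m X) \<le> ?D m"
        by (rule sum_mono2[OF _ FCX]) (use finite_std_collections std_weight_bounds in auto)
      let ?G = "{X \<in> std_collections m. S \<subseteq> X \<and> R X} - F"
      have "?N m = (\<Sum>X\<in>{X \<in> F. S \<subseteq> X}. std_weight m X) + (\<Sum>X\<in>?G. std_weight m X)"
      proof -
        have "{X \<in> std_collections m. S \<subseteq> X \<and> R X} = {X \<in> F. S \<subseteq> X} \<union> ?G" using FCX by blast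
        then show ?thesis using sum.union_disjoint[of "{X \<in> F. S \<subseteq> X}" ?G "std_weight m"] finF finite_std_collections by auto
      qed
      also have "(\<Sum>X\<in>?G. std_weight m X) \<le> (\<Sum>X\<in>?G. exp (- \<beta> * (\<Sum>V\<in>X. cexcess V)))" by (rule sum_mono[OF std_weight_bounds(2)])
      also have "\<dots> \<le> \<delta>"
      proof (rule F0(3))
        show "finite ?G" using finite_std_collections by simp
        show "?G \<subseteq> Col n" using std_collections_Col[OF elim(3)] by blast
        show "?G \<inter> F0 = {}" using FF by blast
      qed
      finally have N: "?N m \<le> (\<Sum>X\<in>{X \<in> F. S \<subseteq> X}. std_weight m X) + \<delta>" by simp
      have "0 \<le> (\<Sum>X\<in>{X \<in> F. S \<subseteq> X}. std_weight m X) + \<delta>" using d sum_nonneg[OF std_weight_bounds(1)] by (intro add_nonneg_nonneg) auto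
      then have "?N m / ?D m \<le> ((\<Sum>X\<in>{X \<in> F. S \<subseteq> X}. std_weight m X) + \<delta>) / (\<Sum>X\<in>F. std_weight m X)"
        by (rule frac_le[OF _ N pos D])
      then show ?case using elim(1) by linarith
    qed
  qed
  then show ?thesis using eventually_ge_at_top[of 1]
  proof eventually_elim
    case (elim m)
    then show ?case by (simp only: ratio)
  qed
qed

end

section \<open>Encoding the faces of the lattice\<close>

fun gp :: "l0cell \<Rightarrow> gpt" where
  "gp (LF i j) = (2 * i + 1, 2 * j + 1)"
| "gp (LE1 i j) = (2 * i + 1, 2 * j)"
| "gp (LE2 i j) = (2 * i, 2 * j + 1)"

definition enc :: "face \<Rightarrow> cface" where "enc f = (gp (rho_face f), height f)"

definition ec :: "pt \<Rightarrow> cface" where "ec c = (case c of (a, b, h) \<Rightarrow> ((2 * a + 1, 2 * b + 1), h))"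

lemma face_cases [case_names D1 D2 D3]:
  fixes f :: face
  obtains a b c where "f = ((a, b, c), D1)" | a b c where "f = ((a, b, c), D2)" | a b c where "f = ((a, b, c), D3)"
proof -
  assume c: "\<And>a b c. f = ((a, b, c), D1) \<Longrightarrow> thesis" "\<And>a b c. f = ((a, b, c), D2) \<Longrightarrow> thesis"
    "\<And>a b c. f = ((a, b, c), D3) \<Longrightarrow> thesis"
  obtain a b c' d where f: "f = ((a, b, c'), d)" by (cases f) auto
  show thesis using c[of a b c'] f by (cases d) simp_all
qed

lemma gp_inj: "gp u = gp v \<longleftrightarrow> u = v"
  by (cases u; cases v) (auto, presburger+)

lemma isF_gp: "isF (gp u) \<longleftrightarrow> is_L0_face_cell u"
  by (cases u) (auto simp: isF_def is_L0_face_cell_def)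

lemma gp_not_isv: "\<not> isv (gp u)"
  by (cases u) (auto simp: isv_def)

lemma enc_simps:
  "enc ((a, b, c), D1) = ((2 * a, 2 * b + 1), c)" "enc ((a, b, c), D2) = ((2 * a + 1, 2 * b), c)"
  "enc ((a, b, c), D3) = ((2 * a + 1, 2 * b + 1), c)"
  by (simp_all add: enc_def height_def)

lemma fst_enc: "fst (enc f) = gp (rho_face f)" and snd_enc: "snd (enc f) = height f"
  by (simp_all add: enc_def)

lemma enc_inj: "enc f = enc g \<longleftrightarrow> f = g"
  by (cases f rule: face_cases; cases g rule: face_cases) (auto simp: enc_simps, presburger+)

lemma inj_enc: "inj enc" by (simp add: inj_def enc_inj)

lemma enc_mem: "enc f \<in> enc ` T \<longleftrightarrow> f \<in> T"
  by (rule inj_image_mem_iff[OF inj_enc])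

lemma isF_enc: "isF (fst (enc f)) \<longleftrightarrow> horizontal f"
  by (cases f rule: face_cases) (auto simp: enc_simps isF_def horizontal_def)

lemma enc_not_isv: "\<not> isv (fst (enc f))"
  by (simp add: fst_enc gp_not_isv)

lemma enc_surj: assumes "\<not> isv (fst g)" obtains f where "g = enc f"
proof -
  obtain p q c where g: "g = ((p, q), c)" by (metis prod.exhaust)
  have "g = enc ((p div 2, q div 2, c), if even p then D1 else if even q then D2 else D3)"
    using assms by (auto simp: g enc_simps isv_def elim!: oddE)
  then show thesis by (rule that)
qed

lemma cverts_enc: "cverts (enc f) = (\<lambda>(a, b, c). ((2 * a, 2 * b), c)) ` face_verts f"
proof -
  have ev: "(even p \<and> \<bar>p - (2 * a + 1)\<bar> = 1) \<longleftrightarrow> p = 2 * a \<or> p = 2 * a + 2" for p a :: int by presburger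
  show ?thesis
  proof (cases f rule: face_cases)
    case (D1 a b c) show ?thesis unfolding D1
      by (intro set_eqI) (auto simp: enc_simps cverts_def face_verts_def padd_def unitv_def isF_def isv_def gclosure_def ev image_iff; presburger)
  next
    case (D2 a b c) show ?thesis unfolding D2
      by (intro set_eqI) (auto simp: enc_simps cverts_def face_verts_def padd_def unitv_def isF_def isv_def gclosure_def ev image_iff; presburger)
  next
    case (D3 a b c) show ?thesis unfolding D3
      by (intro set_eqI) (auto simp: enc_simps cverts_def face_verts_def padd_def unitv_def isF_def isv_def gclosure_def ev image_iff; presburger)
  qed
qed

lemma cadj_enc: "cadj (enc f) (enc g) \<longleftrightarrow> star_adj f g"
proof -
  have "inj (\<lambda>(a :: int, b :: int, c :: int). ((2 * a, 2 * b), c))" by (auto simp: inj_def)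
  then show ?thesis unfolding cadj_def star_adj_def cverts_enc enc_inj by (simp add: image_Int[symmetric])
qed

lemma fc_enc: "fc1 (enc f) = ec (cell_above f)" "fc2 (enc f) = ec (cell_below f)"
  by (cases f rule: face_cases; simp add: enc_simps fc1_def fc2_def isF_def side_def ec_def cell_above_def cell_below_def psub_def unitv_def)+

lemma ec_inj: "ec c = ec d \<longleftrightarrow> c = d"
  by (cases c; cases d) (auto simp: ec_def)

lemma ec_cells: "ec c \<in> cells"
  by (cases c) (simp add: ec_def cells_def isF_def)

lemma cells_ec: assumes "x \<in> cells" obtains c where "x = ec c"
proof -
  obtain p q h where x: "x = ((p, q), h)" by (metis prod.exhaust)
  have "x = ec (p div 2, q div 2, h)" using assms by (auto simp: x ec_def cells_def isF_def elim!: oddE)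
  then show thesis by (rule that)
qed

lemma outL_enc: "enc f \<in> outL n \<longleftrightarrow> outside_L0 n f"
proof (cases f rule: face_cases)
  case (D3 a b c)
  have "\<bar>2 * a + 1\<bar> > 2 * int n \<longleftrightarrow> \<not> (- int n \<le> a \<and> a \<le> int n - 1)" for a :: int by linarith
  then show ?thesis
    by (auto simp: D3 outL_def enc_simps isF_def gfar_def outside_L0_def L0_face_def horizontal_def height_def L0n_def)
qed (auto simp: outL_def enc_simps isF_def outside_L0_def L0_face_def horizontal_def)

lemma inbox_ec: "inbox n m c \<longleftrightarrow> ec c \<in> cyl (boxF n) m"
proof -
  have "\<bar>2 * a + 1\<bar> > 2 * int n \<longleftrightarrow> \<not> (- int n \<le> a \<and> a \<le> int n - 1)" for a :: int by linarith
  then show ?thesis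
    by (cases c) (auto simp: inbox_def ec_def cyl_def boxF_def isF_def gfar_def)
qed

lemma linked_image:
  assumes "inj h" "\<And>a b. R' (h a) (h b) \<longleftrightarrow> R a b"
  shows "linked R' (h ` T) (h f) y \<longleftrightarrow> (\<exists>g. y = h g \<and> linked R T f g)"
proof
  assume "linked R' (h ` T) (h f) y"
  then show "\<exists>g. y = h g \<and> linked R T f g"
  proof (induction rule: linked_induct)
    case base then show ?case by blast
  next
    case (step y z)
    then obtain g where g: "y = h g" "linked R T f g" by blast
    obtain k where k: "z = h k" "k \<in> T" using step(3) by blast
    have "g \<in> T" using step(2) g(1) inj_image_mem_iff[OF assms(1)] by blast
    moreover have "R g k" using step(4) g(1) k(1) assms(2) by blast
    ultimately have "linked R T g k" using k(2) by (intro linked_step)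
    then have "linked R T f k" by (rule linked_trans[OF g(2)])
    then show ?case using k(1) by blast
  qed
next
  assume "\<exists>g. y = h g \<and> linked R T f g"
  then obtain g where g: "y = h g" "linked R T f g" by blast
  have "linked R' (h ` T) (h f) (h g)" using g(2)
  proof (induction rule: linked_induct)
    case (step y z)
    have "linked R' (h ` T) (h y) (h z)" using step(2,3,4) assms(2) by (intro linked_step) auto
    then show ?case by (rule linked_trans[OF step.IH])
  qed simp
  then show "linked R' (h ` T) (h f) y" using g(1) by simp
qed

lemmas linked_enc = linked_image[where h = enc and R' = cadj and R = star_adj, OF inj_enc cadj_enc]

section \<open>The finite-volume measure in encoded form\<close>

definition Mof :: "(pt \<Rightarrow> bool) \<Rightarrow> cface set" where "Mof \<sigma> = ec ` {c. \<not> \<sigma> c}"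

lemma Mof_mem: "ec c \<in> Mof \<sigma> \<longleftrightarrow> \<not> \<sigma> c"
  unfolding Mof_def inj_image_mem_iff[of ec, unfolded inj_def ec_inj, simplified] by simp

lemma cbd_Mof: "cbd (Mof \<sigma>) = enc ` {f. separating \<sigma> f}"
proof -
  have *: "enc f \<in> cbd (Mof \<sigma>) \<longleftrightarrow> separating \<sigma> f" for f
    unfolding cbd_def separating_def by (auto simp: fc_enc Mof_mem enc_not_isv)
  show ?thesis
  proof (intro set_eqI iffI)
    fix g assume g: "g \<in> cbd (Mof \<sigma>)"
    then have "\<not> isv (fst g)" by (simp add: cbd_def)
    then obtain f where "g = enc f" by (rule enc_surj)
    then show "g \<in> enc ` {f. separating \<sigma> f}" using g * by blast
  qed (use * in blast)
qed

lemma cint_Mof: "cint n (Mof \<sigma>) = enc ` interface n \<sigma>"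
proof -
  let ?T = "{f. separating \<sigma> f}"
  have rel: "(\<lambda>a b. separating \<sigma> a \<and> separating \<sigma> b \<and> star_adj a b)\<^sup>*\<^sup>* g f \<longleftrightarrow> linked star_adj ?T g f" for f g
    by (simp add: linked_def)
  have *: "enc f \<in> cint n (Mof \<sigma>) \<longleftrightarrow> f \<in> interface n \<sigma>" for f
  proof
    assume "enc f \<in> cint n (Mof \<sigma>)"
    then obtain g where g: "enc f \<in> enc ` ?T" "g \<in> outL n" "linked cadj (enc ` ?T) g (enc f)"
      unfolding cint_def cbd_Mof by (elim CollectE conjE bexE)
    have "\<not> isv (fst g)" using g(2) kind_disj(1) by (auto simp: outL_def)
    then obtain k where k: "g = enc k" by (rule enc_surj)
    obtain f' where f': "enc f = enc f'" "linked star_adj ?T k f'"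
      using iffD1[OF linked_enc g(3)[unfolded k]] by (elim exE conjE)
    have ff: "f' = f" using f'(1) enc_inj by simp
    show "f \<in> interface n \<sigma>" unfolding interface_def rel
    proof (intro CollectI conjI exI)
      show "separating \<sigma> f" using g(1) unfolding enc_mem by simp
      show "outside_L0 n k" using g(2) unfolding k outL_enc .
      show "linked star_adj ?T k f" using f'(2) unfolding ff .
    qed
  next
    assume "f \<in> interface n \<sigma>"
    then obtain k where k: "separating \<sigma> f" "outside_L0 n k" "linked star_adj ?T k f"
      unfolding interface_def rel by (elim CollectE conjE exE)
    show "enc f \<in> cint n (Mof \<sigma>)" unfolding cint_def cbd_Mof
    proof (intro CollectI conjI bexI)
      show "enc f \<in> enc ` {f. separating \<sigma> f}" using k(1) by simp
      show "linked cadj (enc ` ?T) (enc k) (enc f)" by (rule iffD2[OF linked_enc]) (rule exI[of _ f], rule conjI[OF refl k(3)])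
      show "enc k \<in> outL n" using k(2) outL_enc by simp
    qed
  qed
  show ?thesis
  proof (intro set_eqI iffI)
    fix g assume g: "g \<in> cint n (Mof \<sigma>)"
    then have "\<not> isv (fst g)" by (simp add: cint_def cbd_def)
    then obtain f where "g = enc f" by (rule enc_surj)
    then show "g \<in> enc ` interface n \<sigma>" using g * by blast
  qed (use * in blast)
qed

lemma Mof_bij: "bij_betw Mof (configs n m) (spin_sets n m)"
proof (rule bij_betwI[where g = "\<lambda>M c. ec c \<notin> M"])
  show "Mof \<in> configs n m \<rightarrow> spin_sets n m"
  proof
    fix \<sigma> assume s: "\<sigma> \<in> configs n m"
    show "Mof \<sigma> \<in> spin_sets n m"
      unfolding spin_sets_def
    proof (intro CollectI conjI ballI impI)
      show "Mof \<sigma> \<subseteq> cells" unfolding Mof_def using ec_cells by blast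
      fix x assume x: "x \<in> cells" "x \<notin> cyl (boxF n) m"
      obtain c where c: "x = ec c" using x(1) by (rule cells_ec)
      have "\<not> inbox n m c" using x(2) c inbox_ec by blast
      then have "\<sigma> c = bc c" using s unfolding configs_def by blast
      then show "x \<in> Mof \<sigma> \<longleftrightarrow> 0 \<le> snd x" unfolding c Mof_mem by (cases c) (auto simp: bc_def ec_def)
    qed
  qed
  show "(\<lambda>M c. ec c \<notin> M) \<in> spin_sets n m \<rightarrow> configs n m"
  proof
    fix M assume M: "M \<in> spin_sets n m"
    have "(ec c \<notin> M) = bc c" if "\<not> inbox n m c" for c
    proof -
      have "ec c \<in> M \<longleftrightarrow> 0 \<le> snd (ec c)" using M that ec_cells inbox_ec unfolding spin_sets_def by blast
      then show ?thesis by (cases c) (auto simp: bc_def ec_def)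
    qed
    then show "(\<lambda>c. ec c \<notin> M) \<in> configs n m" by (simp add: configs_def)
  qed
  show "(\<lambda>c. ec c \<notin> Mof \<sigma>) = \<sigma>" for \<sigma> by (simp add: Mof_mem)
  show "Mof (\<lambda>c. ec c \<notin> M) = M" if "M \<in> spin_sets n m" for M
  proof -
    have "M \<subseteq> cells" using that by (simp add: spin_sets_def)
    then show ?thesis unfolding Mof_def using cells_ec by blast
  qed
qed

text \<open>For \<open>1 \<le> m\<close> a separating face touches the box unless it is one of the
  fixed faces outside it. For \<open>m = 0\<close> the separating faces in \<open>L0n n\<close>
  would touch no inside cell.\<close>

lemma hamiltonian_Mof:
  assumes "\<sigma> \<in> configs n m" "1 \<le> m"
  shows "hamiltonian n m \<sigma> = card (cbd (Mof \<sigma>) - outL n)"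
proof -
  have M: "Mof \<sigma> \<in> spin_sets n m" using Mof_bij bij_betwE assms(1) by blast
  have "cbd (Mof \<sigma>) - outL n = enc ` {f. touches n m f \<and> separating \<sigma> f}"
  proof (intro set_eqI iffI)
    fix g assume g: "g \<in> cbd (Mof \<sigma>) - outL n"
    obtain f where f: "g = enc f" "separating \<sigma> f" using g unfolding cbd_Mof by blast
    have "touches n m f" using cbd_touch[OF M assms(2), of g] g unfolding touches_def inbox_ec f fc_enc by blast
    then show "g \<in> enc ` {f. touches n m f \<and> separating \<sigma> f}" using f by blast
  next
    fix g assume "g \<in> enc ` {f. touches n m f \<and> separating \<sigma> f}"
    then obtain f where f: "g = enc f" "touches n m f" "separating \<sigma> f" by blast
    have "g \<notin> outL n" using outL_cyl[of g n m] f(2) unfolding touches_def inbox_ec f(1) fc_enc by blast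
    then show "g \<in> cbd (Mof \<sigma>) - outL n" unfolding cbd_Mof using f by blast
  qed
  then show ?thesis unfolding hamiltonian_def by (simp add: card_image inj_on_subset[OF inj_enc])
qed

lemma wf_enc: assumes "iface n (enc ` I)" shows "iface.wf (enc ` I) = enc ` wall_faces I"
proof -
  have "enc f \<in> iface.wf (enc ` I) \<longleftrightarrow> f \<in> wall_faces I" for f
    unfolding iface.wf_def[OF assms] wall_faces_def ceiling_faces_def mem_Collect_eq enc_mem isF_enc ball_simps(9)
    unfolding fst_enc gp_inj enc_inj by blast
  moreover have "iface.wf (enc ` I) \<subseteq> enc ` I" by (rule iface.wf_subset[OF assms])
  ultimately show ?thesis using wall_faces_def by blast
qed

lemma cwalls_enc: assumes "iface n (enc ` I)" shows "cwalls (enc ` I) = (`) enc ` walls I"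
proof -
  have *: "{g. linked cadj (enc ` wall_faces I) (enc f) g} = enc ` {g. linked star_adj (wall_faces I) f g}" for f
    unfolding linked_enc by blast
  have "cwalls (enc ` I) = (\<lambda>f. {g. linked cadj (enc ` wall_faces I) f g}) ` (enc ` wall_faces I)"
    unfolding cwalls_def wf_enc[OF assms] by blast
  also have "\<dots> = (\<lambda>f. enc ` {g. linked star_adj (wall_faces I) f g}) ` wall_faces I"
    unfolding image_image * ..
  also have "\<dots> = (`) enc ` walls I"
    unfolding walls_def linked_def by blast
  finally show ?thesis .
qed

lemma shift_enc: "enc ` shift k W = cshift k (enc ` W)"
proof -
  have "enc ((\<lambda>((a, b, c), d). ((a, b, c + k), d)) f) = (fst (enc f), snd (enc f) + k)" for f
    by (cases f rule: face_cases) (simp_all add: enc_simps)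
  then show ?thesis unfolding shift_def cshift_def image_image by simp
qed

lemma rho_shift: "rho (shift k W) = rho W"
proof -
  have "rho_face ((\<lambda>((a, b, c), d). ((a, b, c + k), d)) f) = rho_face f" for f
    by (cases f rule: face_cases) simp_all
  then show ?thesis unfolding rho_def shift_def image_image by simp
qed

lemma assigned_shift: "assigned z (shift k W) \<longleftrightarrow> assigned z W"
  by (simp add: assigned_def interior_to_def rho_pts_def rho_shift)

text \<open>Being assigned depends on the projection only, so it can be tested on the standard
  wall.\<close>

lemma assigned_std_eq: "assigned_std I z = {V \<in> std_walls I. assigned z V}"
proof -
  have "assigned_std I z \<subseteq> {V \<in> std_walls I. assigned z V}"
    unfolding assigned_std_def std_walls_def using assigned_shift by blast
  moreover have "{V \<in> std_walls I. assigned z V} \<subseteq> assigned_std I z"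
    unfolding assigned_std_def std_walls_def using assigned_shift by blast
  ultimately show ?thesis by blast
qed

lemma fst_enc_image: "fst ` enc ` W = gp ` rho W"
  unfolding rho_def image_image fst_enc ..

lemma excess_enc: "excess W = cexcess (enc ` W)"
proof -
  have "{u \<in> fst ` enc ` W. isF u} = gp ` {u \<in> rho W. is_L0_face_cell u}"
    unfolding fst_enc_image using isF_gp by blast
  moreover have "inj gp" by (simp add: inj_def gp_inj)
  ultimately show ?thesis
    unfolding excess_def cexcess_def by (simp add: card_image inj_on_subset[OF inj_enc] inj_on_subset[of gp UNIV])
qed

section \<open>Interiors of walls in the real plane\<close>

text \<open>This is 2x at integers and the odd number between 2 times the floor and 2 times the ceiling elsewhere.\<close>
definition fz :: "real \<Rightarrow> int" where "fz x = \<lfloor>x\<rfloor> + \<lceil>x\<rceil>"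
text \<open>The grid cell whose relative interior contains the point; conversely \<open>half\<close>
  gives the centre of a grid cell.\<close>

definition fpt :: "real \<times> real \<Rightarrow> gpt" where "fpt x = (fz (fst x), fz (snd x))"
definition half :: "gpt \<Rightarrow> real \<times> real" where "half p = (of_int (fst p) / 2, of_int (snd p) / 2)"

lemma fz_altdef: "fz x = (if x = of_int \<lfloor>x\<rfloor> then 2 * \<lfloor>x\<rfloor> else 2 * \<lfloor>x\<rfloor> + 1)"
  by (auto simp: fz_def ceiling_altdef)

lemma fz_even: "fz x = 2 * i \<longleftrightarrow> x = of_int i"
proof
  assume h: "fz x = 2 * i"
  have "x = of_int \<lfloor>x\<rfloor>"
  proof (rule ccontr)
    assume "x \<noteq> of_int \<lfloor>x\<rfloor>"
    then have "2 * \<lfloor>x\<rfloor> + 1 = 2 * i" using h by (simp add: fz_altdef)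
    then show False by presburger
  qed
  moreover from this have "\<lfloor>x\<rfloor> = i" using h by (simp add: fz_altdef)
  ultimately show "x = of_int i" by simp
qed (simp add: fz_altdef)

lemma fz_odd: "fz x = 2 * i + 1 \<longleftrightarrow> of_int i < x \<and> x < of_int i + 1"
proof
  assume h: "fz x = 2 * i + 1"
  have ne: "x \<noteq> of_int \<lfloor>x\<rfloor>"
  proof
    assume "x = of_int \<lfloor>x\<rfloor>"
    then have "2 * \<lfloor>x\<rfloor> = 2 * i + 1" using h by (simp add: fz_altdef)
    then show False by presburger
  qed
  then have "\<lfloor>x\<rfloor> = i" using h by (simp add: fz_altdef)
  then show "of_int i < x \<and> x < of_int i + 1" using ne by linarith
next
  assume h: "of_int i < x \<and> x < of_int i + 1"
  then have f: "\<lfloor>x\<rfloor> = i" by linarith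
  then show "fz x = 2 * i + 1" using h by (simp add: fz_altdef)
qed

lemma fz_unit_interval: "of_int i \<le> x \<and> x \<le> of_int i + 1 \<longleftrightarrow> fz x = 2 * i + 1 \<or> \<bar>fz x - (2 * i + 1)\<bar> = 1"
proof -
  have "\<bar>fz x - (2 * i + 1)\<bar> = 1 \<longleftrightarrow> fz x = 2 * i \<or> fz x = 2 * (i + 1)" by presburger
  then show ?thesis unfolding fz_even fz_odd by auto
qed

lemma fz_between: assumes "of_int a / 2 \<le> t" "t \<le> (of_int a + 1) / 2" shows "fz t = a \<or> fz t = a + 1"
proof (cases "even a")
  case True
  then obtain i where i: "a = 2 * i" by blast
  have "t = of_int i \<or> of_int i < t \<and> t < of_int i + 1" using assms unfolding i by auto
  then show ?thesis unfolding i fz_even fz_odd by blast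
next
  case False
  then obtain i where i: "a = 2 * i + 1" by (rule oddE)
  have "t = of_int (i + 1) \<or> of_int i < t \<and> t < of_int i + 1" using assms unfolding i by auto
  moreover have "a + 1 = 2 * (i + 1)" using i by simp
  ultimately show ?thesis unfolding i using fz_even[of t "i + 1"] fz_odd[of t i] by auto
qed

lemma fz_half: "fz (of_int a / 2) = a"
proof (cases "even a")
  case True
  then obtain i where i: "a = 2 * i" by blast
  show ?thesis unfolding i fz_even by simp
next
  case False
  then obtain i where i: "a = 2 * i + 1" by (rule oddE)
  show ?thesis unfolding i fz_odd by simp
qed

lemma fpt_half: "fpt (half p) = p"
  by (simp add: fpt_def half_def fz_half)

lemma midpt_half: "midpt u = half (gp u)"
  by (cases u) (simp_all add: half_def)

lemma cell_pts_fpt: "x \<in> cell_pts u \<longleftrightarrow> fpt x \<in> gclosure (gp u)"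
proof -
  obtain a b where x: "x = (a, b)" by (cases x)
  show ?thesis
  proof (cases u)
    case (LF i j)
    have "x \<in> cell_pts u \<longleftrightarrow> (of_int i \<le> a \<and> a \<le> of_int i + 1) \<and> (of_int j \<le> b \<and> b \<le> of_int j + 1)" by (simp add: x LF)
    then show ?thesis unfolding fz_unit_interval by (simp add: x LF fpt_def gclosure_def)
  next
    case (LE1 i j)
    have "x \<in> cell_pts u \<longleftrightarrow> (of_int i \<le> a \<and> a \<le> of_int i + 1) \<and> b = of_int j" by (simp add: x LE1)
    then show ?thesis unfolding fz_unit_interval fz_even[symmetric] by (simp add: x LE1 fpt_def gclosure_def)
  next
    case (LE2 i j)
    have "x \<in> cell_pts u \<longleftrightarrow> a = of_int i \<and> (of_int j \<le> b \<and> b \<le> of_int j + 1)" by (simp add: x LE2)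
    then show ?thesis unfolding fz_unit_interval fz_even[symmetric] by (simp add: x LE2 fpt_def gclosure_def)
  qed
qed

lemma cproj_enc: "cproj (enc ` W) = (\<Union>u\<in>rho W. gclosure (gp u))"
  unfolding cproj_def rho_def image_image fst_enc ..

lemma rho_pts_fpt: "x \<in> rho_pts W \<longleftrightarrow> fpt x \<in> cproj (enc ` W)"
  unfolding rho_pts_def cproj_enc by (simp add: cell_pts_fpt)

lemma fz_nbhd: "\<exists>e>0. \<forall>t. \<bar>t - s\<bar> < e \<longrightarrow> fz s = fz t \<or> odd (fz t) \<and> \<bar>fz s - fz t\<bar> = 1"
proof (cases "even (fz s)")
  case True
  then obtain i where i: "fz s = 2 * i" by blast
  then have s: "s = of_int i" by (simp add: fz_even)
  have "fz s = fz t \<or> odd (fz t) \<and> \<bar>fz s - fz t\<bar> = 1" if t: "\<bar>t - s\<bar> < 1" for t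
  proof -
    consider "t = s" | "of_int i < t \<and> t < of_int i + 1" | "of_int (i - 1) < t \<and> t < of_int (i - 1) + 1"
      using t unfolding s abs_less_iff of_int_diff of_int_1 by linarith
    then show ?thesis unfolding fz_odd[symmetric] using i by cases auto
  qed
  then show ?thesis using zero_less_one by blast
next
  case False
  then obtain i where i: "fz s = 2 * i + 1" by (rule oddE)
  then have s: "of_int i < s" "s < of_int i + 1" by (simp_all add: fz_odd)
  define e where "e = min (s - of_int i) (of_int i + 1 - s)"
  have "fz s = fz t" if t: "\<bar>t - s\<bar> < e" for t
    unfolding i using t fz_odd[of t i] unfolding e_def by auto
  moreover have "0 < e" using s by (simp add: e_def)
  ultimately show ?thesis by blast
qed

text \<open>Points close to \<open>x\<close> lie in cells that have the cell of \<open>x\<close> in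
  their closure. Hence sets of cells closed under passing to cofaces are open in the plane.\<close>

lemma fpt_nbhd: "\<exists>e>0. \<forall>y\<in>ball x e. fpt x \<in> gclosure (fpt y)"
proof -
  obtain e1 where e1: "0 < e1" "\<And>t. \<bar>t - fst x\<bar> < e1 \<Longrightarrow> fz (fst x) = fz t \<or> odd (fz t) \<and> \<bar>fz (fst x) - fz t\<bar> = 1"
    using fz_nbhd[of "fst x"] by blast
  obtain e2 where e2: "0 < e2" "\<And>t. \<bar>t - snd x\<bar> < e2 \<Longrightarrow> fz (snd x) = fz t \<or> odd (fz t) \<and> \<bar>fz (snd x) - fz t\<bar> = 1"
    using fz_nbhd[of "snd x"] by blast
  have "fpt x \<in> gclosure (fpt y)" if y: "y \<in> ball x (min e1 e2)" for y
  proof -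
    have "dist (fst x) (fst y) < e1" "dist (snd x) (snd y) < e2"
      using y dist_fst_le[of x y] dist_snd_le[of x y] by (auto simp: mem_ball)
    then have "\<bar>fst y - fst x\<bar> < e1" "\<bar>snd y - snd x\<bar> < e2" by (simp_all add: dist_real_def abs_minus_commute)
    then show ?thesis using e1(2) e2(2) unfolding gclosure_def fpt_def by simp
  qed
  moreover have "0 < min e1 e2" using e1(1) e2(1) by simp
  ultimately show ?thesis by blast
qed

lemma open_fpt: assumes "\<And>p q. p \<in> A \<Longrightarrow> p \<in> gclosure q \<Longrightarrow> q \<in> A" shows "open {x. fpt x \<in> A}"
  unfolding open_contains_ball
proof
  fix x assume x: "x \<in> {x. fpt x \<in> A}"
  obtain e where e: "0 < e" "\<forall>y\<in>ball x e. fpt x \<in> gclosure (fpt y)" using fpt_nbhd by blast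
  then have "ball x e \<subseteq> {x. fpt x \<in> A}" using assms x by blast
  then show "\<exists>e>0. ball x e \<subseteq> {x. fpt x \<in> A}" using e(1) by blast
qed

lemma segment_fpt: assumes "gadj p q" "x \<in> closed_segment (half p) (half q)" shows "fpt x \<in> {p, q}"
proof -
  have *: "fpt x \<in> {p, q}"
    if x: "x \<in> closed_segment (half p) (half q)" and pq: "q = (fst p + 1, snd p) \<or> q = (fst p, snd p + 1)" for p q
  proof -
    obtain u where u: "0 \<le> u" "u \<le> 1" "x = (1 - u) *\<^sub>R half p + u *\<^sub>R half q" using x unfolding in_segment by blast
    show ?thesis using pq
    proof
      assume q: "q = (fst p + 1, snd p)"
      have e: "fst x = of_int (fst p) / 2 + u / 2" "snd x = of_int (snd p) / 2" unfolding u(3) q half_def by (simp_all add: field_simps)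
      have "fz (fst x) = fst p \<or> fz (fst x) = fst p + 1" by (rule fz_between) (use u(1,2) in \<open>simp_all add: e(1)\<close>)
      moreover have "fz (snd x) = snd p" unfolding e(2) by (rule fz_half)
      ultimately show ?thesis unfolding q fpt_def by (auto simp: prod_eq_iff)
    next
      assume q: "q = (fst p, snd p + 1)"
      have e: "snd x = of_int (snd p) / 2 + u / 2" "fst x = of_int (fst p) / 2" unfolding u(3) q half_def by (simp_all add: field_simps)
      have "fz (snd x) = snd p \<or> fz (snd x) = snd p + 1" by (rule fz_between) (use u(1,2) in \<open>simp_all add: e(1)\<close>)
      moreover have "fz (fst x) = fst p" unfolding e(2) by (rule fz_half)
      ultimately show ?thesis unfolding q fpt_def by (auto simp: prod_eq_iff)
    qed
  qed
  have "q = (fst p + 1, snd p) \<or> q = (fst p, snd p + 1) \<or> p = (fst q + 1, snd q) \<or> p = (fst q, snd q + 1)"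
    using assms(1) unfolding gadj_def prod_eq_iff by simp linarith
  moreover have "x \<in> closed_segment (half q) (half p)" using assms(2) by (simp only: closed_segment_commute)
  ultimately have "fpt x \<in> {p, q} \<or> fpt x \<in> {q, p}" using *[OF assms(2)] *[of q p] by argo
  then show ?thesis by blast
qed

text \<open>The complement of the projection is a union of relative interiors of cells. The cells of
  one grid component form an open set, as do the remaining ones, so a topological component stays in
  one grid component. Conversely, segments between the centres of neighbouring cells join a grid
  component. Boundedness corresponds to finiteness.\<close>

lemma interior_to_ghull:
  assumes "finite W"
  shows "interior_to u W \<longleftrightarrow> gp u \<in> ghull (cproj (enc ` W))"
proof -
  let ?K = "cproj (enc ` W)" and ?p = "gp u"
  define C where "C = {y. linked gadj (- ?K) ?p y}"
  let ?S = "connected_component_set (- rho_pts W) (midpt u)"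
  have mid: "midpt u \<in> rho_pts W \<longleftrightarrow> ?p \<in> ?K" by (simp add: rho_pts_fpt midpt_half fpt_half)
  have "bounded ?S \<longleftrightarrow> finite C" if pK: "?p \<notin> ?K"
  proof
    assume fin: "finite C"
    have CK: "C \<subseteq> - ?K" unfolding C_def using linked_in pK by fastforce
    have up: "q \<in> - ?K \<and> linked gadj (- ?K) p q" if "p \<in> - ?K" "p \<in> gclosure q" for p q
    proof -
      have nK: "r \<notin> ?K" if "p \<in> gclosure r" for r
        using that \<open>p \<in> - ?K\<close> gclosed_cproj[of "enc ` W"] unfolding gclosed_def by blast
      let ?r = "(fst p, snd q)"
      have pr: "p \<in> gclosure ?r" "?r = q \<or> gadj ?r q" "p = ?r \<or> gadj p ?r"
        using that(2) by (auto simp: gclosure_def gadj_def prod_eq_iff)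
      have m: "p \<in> - ?K" "?r \<in> - ?K" "q \<in> - ?K" using that(1) nK[OF pr(1)] nK[OF that(2)] by simp_all
      have "linked gadj (- ?K) p ?r" using pr(3)
      proof
        assume "gadj p ?r" then show ?thesis by (rule linked_step[OF m(1,2)])
      qed (simp only: linked_refl)
      moreover have "linked gadj (- ?K) ?r q" using pr(2)
      proof
        assume "gadj ?r q" then show ?thesis by (rule linked_step[OF m(2,3)])
      qed (simp only: linked_refl)
      ultimately have "linked gadj (- ?K) p q" by (rule linked_trans)
      then show ?thesis using m(3) by blast
    qed
    have o1: "open {x. fpt x \<in> C}"
    proof (rule open_fpt)
      fix p q assume p: "p \<in> C" "p \<in> gclosure q"
      have "p \<in> - ?K" using p(1) CK by blast
      then have "linked gadj (- ?K) p q" using up p(2) by blast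
      then show "q \<in> C" using p(1) unfolding C_def by (blast intro: linked_trans)
    qed
    have o2: "open {x. fpt x \<in> - ?K - C}"
    proof (rule open_fpt)
      fix p q assume p: "p \<in> - ?K - C" "p \<in> gclosure q"
      have q: "q \<in> - ?K" "linked gadj (- ?K) p q" using up p by blast+
      have "q \<notin> C"
      proof
        assume "q \<in> C"
        then have "linked gadj (- ?K) ?p q" by (simp add: C_def)
        from linked_trans[OF this linked_sym[OF symp_gadj q(2)]] show False using p(1) by (simp add: C_def)
      qed
      then show "q \<in> - ?K - C" using q(1) by blast
    qed
    have "?S \<subseteq> {x. fpt x \<in> C}"
    proof -
      have conn: "connected ?S" by (rule connected_connected_component)
      have sub: "?S \<subseteq> - rho_pts W" by (rule connected_component_subset)
      have m: "midpt u \<in> ?S" using mid pK by (simp add: connected_component_refl_eq)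
      have mC: "fpt (midpt u) \<in> C" by (simp add: midpt_half fpt_half C_def)
      have cov: "?S \<subseteq> {x. fpt x \<in> C} \<union> {x. fpt x \<in> - ?K - C}" using sub by (auto simp: rho_pts_fpt)
      have "{x. fpt x \<in> C} \<inter> ?S = {} \<or> {x. fpt x \<in> - ?K - C} \<inter> ?S = {}"
        by (rule connectedD[OF conn o1 o2 _ cov]) blast
      moreover have "{x. fpt x \<in> C} \<inter> ?S \<noteq> {}" using m mC by blast
      ultimately show ?thesis using cov by blast
    qed
    moreover have "bounded {x. fpt x \<in> C}"
    proof -
      define N where "N = Max (insert 0 ((\<lambda>p. \<bar>fst p\<bar>) ` C \<union> (\<lambda>p. \<bar>snd p\<bar>) ` C))"
      have N: "\<bar>fst p\<bar> \<le> N" "\<bar>snd p\<bar> \<le> N" if "p \<in> C" for p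
        unfolding N_def using fin that by (auto intro!: Max_ge)
      have fb: "\<bar>t\<bar> \<le> of_int N + 1" if "\<bar>fz t\<bar> \<le> N" for t
        using that unfolding fz_def by linarith
      have "{x. fpt x \<in> C} \<subseteq> cbox (- (of_int N + 1), - (of_int N + 1)) (of_int N + 1, of_int N + 1)"
      proof
        fix x assume "x \<in> {x. fpt x \<in> C}"
        then have "\<bar>fz (fst x)\<bar> \<le> N" "\<bar>fz (snd x)\<bar> \<le> N" using N[of "fpt x"] by (simp_all add: fpt_def)
        from fb[OF this(1)] fb[OF this(2)]
        show "x \<in> cbox (- (of_int N + 1), - (of_int N + 1)) (of_int N + 1, of_int N + 1)"
          unfolding cbox_Pair_eq mem_Times_iff by (simp add: abs_le_iff)
      qed
      then show ?thesis using bounded_cbox bounded_subset by blast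
    qed
    ultimately show "bounded ?S" by (rule bounded_subset[rotated])
  next
    assume b: "bounded ?S"
    have "half q \<in> ?S" if "q \<in> C" for q
    proof -
      have "linked gadj (- ?K) ?p q" using that by (simp add: C_def)
      then show ?thesis
      proof (induction rule: linked_induct)
        case base
        then show ?case using mid pK by (simp add: midpt_half[symmetric] connected_component_refl_eq)
      next
        case (step q r)
        have seg: "closed_segment (half q) (half r) \<subseteq> - rho_pts W"
        proof
          fix x assume "x \<in> closed_segment (half q) (half r)"
          then have "fpt x \<in> {q, r}" by (rule segment_fpt[OF step(4)])
          then show "x \<in> - rho_pts W" using step(2,3) unfolding Compl_iff rho_pts_fpt by blast
        qed
        have "connected_component (- rho_pts W) (half q) (half r)"
          unfolding connected_component_def using seg connected_segment(1) ends_in_segment by blast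
        then show ?case using step.IH connected_component_trans by fastforce
      qed
    qed
    then have "half ` C \<subseteq> ?S" by blast
    then have "bounded (half ` C)" using b bounded_subset by blast
    then obtain B where B: "\<And>q. q \<in> C \<Longrightarrow> norm (half q) \<le> B" unfolding bounded_iff by blast
    have "C \<subseteq> {- \<lceil>2 * B\<rceil>..\<lceil>2 * B\<rceil>} \<times> {- \<lceil>2 * B\<rceil>..\<lceil>2 * B\<rceil>}"
    proof
      fix q assume "q \<in> C"
      have "norm (fst (half q)) \<le> norm (half q)" "norm (snd (half q)) \<le> norm (half q)"
        using norm_fst_le[of "fst (half q)" "snd (half q)"] norm_snd_le[of "snd (half q)" "fst (half q)"] by simp_all
      then have "\<bar>real_of_int (fst q)\<bar> \<le> 2 * B" "\<bar>real_of_int (snd q)\<bar> \<le> 2 * B"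
        using B[OF \<open>q \<in> C\<close>] by (simp_all add: half_def)
      then show "q \<in> {- \<lceil>2 * B\<rceil>..\<lceil>2 * B\<rceil>} \<times> {- \<lceil>2 * B\<rceil>..\<lceil>2 * B\<rceil>}"
        unfolding mem_Times_iff atLeastAtMost_iff by linarith
    qed
    then show "finite C" by (rule finite_subset) simp
  qed
  then show ?thesis unfolding interior_to_def mid ghull_def C_def by blast
qed

section \<open>The conditional probability\<close>

lemma cfloor_enc:
  assumes I: "iface n (enc ` I)" and W: "finite W"
  shows "cfloor (enc ` I) (enc ` W) h \<longleftrightarrow> floor_height I W h"
proof -
  have c: "enc ` I - iface.wf (enc ` I) = enc ` ceiling_faces I"
    unfolding wf_enc[OF I] image_set_diff[OF inj_enc, symmetric] wall_faces_def ceiling_faces_def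
    by (rule arg_cong[where f = "(`) enc"]) blast
  show ?thesis
    unfolding cfloor_def floor_height_def c bex_simps(7) cadj_enc fst_enc snd_enc interior_to_ghull[OF W] ..
qed

lemma cstd_enc: assumes I: "iface n (enc ` I)" shows "cstd (enc ` I) = (`) enc ` std_walls I"
proof -
  have fin: "finite W" if "W \<in> walls I" for W
  proof -
    have "enc ` W \<in> cwalls (enc ` I)" unfolding cwalls_enc[OF I] using that by (rule imageI)
    then have "finite (enc ` W)" by (rule iface.wall_component(4)[OF I])
    then show ?thesis by (rule finite_imageD) (rule inj_on_subset[OF inj_enc subset_UNIV])
  qed
  have "cstd (enc ` I) = {cshift (- h) (enc ` W) | W h. W \<in> walls I \<and> cfloor (enc ` I) (enc ` W) h}"
    unfolding cstd_def cwalls_enc[OF I] by blast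
  also have "\<dots> = {enc ` shift (- h) W | W h. W \<in> walls I \<and> floor_height I W h}"
    unfolding shift_enc using cfloor_enc[OF I fin] by blast
  also have "\<dots> = (`) enc ` std_walls I" unfolding std_walls_def by blast
  finally show ?thesis .
qed

lemma inj_image_enc: "inj ((`) enc)"
  using inj_enc by (simp add: inj_image_eq_iff inj_def[of "(`) enc"])

text \<open>The conditioning event as a property of the collection alone, the form in which
  \<open>ratio_bound\<close> accepts it.\<close>

definition std_event_IW :: "face set \<Rightarrow> (face \<Rightarrow> face set) \<Rightarrow> cface set set \<Rightarrow> bool" where
  "std_event_IW A WW X \<longleftrightarrow> (\<forall>z\<in>A. {V \<in> X. assigned z (enc -` V)} = (if WW z = {} then {} else {enc ` WW z}))"

lemma event_IW_enc:
  assumes "iface n (cint n (Mof \<sigma>))"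
  shows "event_IW n A WW \<sigma> \<longleftrightarrow> std_event_IW A WW (cstd (cint n (Mof \<sigma>)))"
proof -
  let ?I = "interface n \<sigma>"
  have X: "cstd (cint n (Mof \<sigma>)) = (`) enc ` std_walls ?I"
    unfolding cint_Mof by (rule cstd_enc) (use assms in \<open>simp only: cint_Mof\<close>)
  have "{V \<in> (`) enc ` std_walls ?I. assigned z (enc -` V)} = (if WW z = {} then {} else {enc ` WW z})
      \<longleftrightarrow> assigned_std ?I z = (if WW z = {} then {} else {WW z})" for z
  proof -
    have "{V \<in> (`) enc ` std_walls ?I. assigned z (enc -` V)} = (`) enc ` {V \<in> std_walls ?I. assigned z V}"
      using inj_vimage_image_eq[OF inj_enc] by auto
    moreover have "(if WW z = {} then {} else {enc ` WW z}) = (`) enc ` (if WW z = {} then {} else {WW z})" by simp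
    ultimately show ?thesis unfolding assigned_std_eq by (simp only: inj_image_eq_iff[OF inj_image_enc])
  qed
  then show ?thesis unfolding event_IW_def std_event_IW_def X by simp
qed

lemma event_walls_enc:
  assumes "iface n (cint n (Mof \<sigma>))"
  shows "event_walls n Ws \<sigma> \<longleftrightarrow> (`) enc ` set Ws \<subseteq> cstd (cint n (Mof \<sigma>))"
proof -
  have X: "cstd (cint n (Mof \<sigma>)) = (`) enc ` std_walls (interface n \<sigma>)"
    unfolding cint_Mof by (rule cstd_enc) (use assms in \<open>simp only: cint_Mof\<close>)
  show ?thesis unfolding X event_walls_def inj_image_subset_iff[OF inj_image_enc] by blast
qed

text \<open>A wall assigned to some \<open>z \<in> A\<close> is the prescribed wall
  \<open>WW z\<close>, whose projection avoids the hull of \<open>W\<close>. So the deleted wall is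
  assigned to no such \<open>z\<close>, and the event persists.\<close>

lemma std_event_IW_delete:
  assumes R: "std_event_IW A WW X" and V: "V \<in> X" "cproj V \<subseteq> ghull (cproj (enc ` W))" and W: "finite W"
    and disj: "(\<Union>z\<in>A. rho (WW z)) \<inter> hull_rho W = {}"
  shows "std_event_IW A WW (X - {V})"
  unfolding std_event_IW_def
proof
  fix z assume z: "z \<in> A"
  have eq: "{V \<in> X. assigned z (enc -` V)} = (if WW z = {} then {} else {enc ` WW z})" using R z unfolding std_event_IW_def by blast
  have "\<not> assigned z (enc -` V)"
  proof
    assume "assigned z (enc -` V)"
    then have "V \<in> (if WW z = {} then {} else {enc ` WW z})" using V(1) unfolding eq[symmetric] by blast
    then have V': "WW z \<noteq> {}" "V = enc ` WW z" by (auto split: if_splits)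
    then obtain f where f: "f \<in> WW z" by blast
    have "gp (rho_face f) \<in> cproj V" unfolding V'(2) cproj_enc rho_def using f gclosure_refl by blast
    then have "interior_to (rho_face f) W" unfolding interior_to_ghull[OF W] using V(2) by blast
    then show False using disj z f unfolding hull_rho_def rho_def by blast
  qed
  then have "{V' \<in> X - {V}. assigned z (enc -` V')} = {V \<in> X. assigned z (enc -` V)}" by blast
  then show "{V' \<in> X - {V}. assigned z (enc -` V')} = (if WW z = {} then {} else {enc ` WW z})" using eq by simp
qed

context model begin

lemma weight_sum:
  assumes m: "1 \<le> m" and Q: "\<And>\<sigma>. \<sigma> \<in> configs n m \<Longrightarrow> E \<sigma> \<longleftrightarrow> Q (Mof \<sigma>)"
  shows "(\<Sum>\<sigma>\<in>{\<sigma> \<in> configs n m. E \<sigma>}. weight \<beta> n m \<sigma>) = (\<Sum>M\<in>{M \<in> spin_sets n m. Q M}. spin_weight M)"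
proof -
  have bij: "bij_betw Mof {\<sigma> \<in> configs n m. E \<sigma>} {M \<in> spin_sets n m. Q M}"
  proof (rule bij_betw_subset[OF Mof_bij])
    have spin_sets: "spin_sets n m = Mof ` configs n m" using Mof_bij[of n m] by (simp add: bij_betw_def)
    show "Mof ` {\<sigma> \<in> configs n m. E \<sigma>} = {M \<in> spin_sets n m. Q M}"
    proof (intro set_eqI iffI)
      fix M assume "M \<in> Mof ` {\<sigma> \<in> configs n m. E \<sigma>}"
      then obtain \<sigma> where s: "M = Mof \<sigma>" "\<sigma> \<in> configs n m" "E \<sigma>" by (elim imageE CollectE conjE)
      then show "M \<in> {M \<in> spin_sets n m. Q M}" unfolding spin_sets using Q[OF s(2)] by simp
    next
      fix M assume "M \<in> {M \<in> spin_sets n m. Q M}"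
      then obtain \<sigma> where "\<sigma> \<in> configs n m" "M = Mof \<sigma>" "Q M" unfolding spin_sets by (elim CollectE conjE imageE)
      then show "M \<in> Mof ` {\<sigma> \<in> configs n m. E \<sigma>}" using Q by simp
    qed
  qed blast
  have "(\<Sum>\<sigma>\<in>{\<sigma> \<in> configs n m. E \<sigma>}. weight \<beta> n m \<sigma>) = (\<Sum>\<sigma>\<in>{\<sigma> \<in> configs n m. E \<sigma>}. spin_weight (Mof \<sigma>))"
    unfolding weight_def spin_weight_def using hamiltonian_Mof[OF _ m] by (intro sum.cong refl) simp
  also have "\<dots> = (\<Sum>M\<in>{M \<in> spin_sets n m. Q M}. spin_weight M)" by (rule sum.reindex_bij_betw[OF bij])
  finally show ?thesis .
qed

lemma condprob_enc:
  assumes m: "1 \<le> m"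
  shows "condprob \<beta> n m (event_walls n Ws) (event_IW n A WW) =
    (\<Sum>M\<in>{M \<in> spin_sets n m. (`) enc ` set Ws \<subseteq> cstd (cint n M) \<and> std_event_IW A WW (cstd (cint n M))}. spin_weight M) /
    (\<Sum>M\<in>{M \<in> spin_sets n m. std_event_IW A WW (cstd (cint n M))}. spin_weight M)"
proof -
  have ic: "iface n (cint n (Mof \<sigma>))" if "\<sigma> \<in> configs n m" for \<sigma>
    using iface_cint[OF _ m] bij_betwE[OF Mof_bij] that by blast
  have "finite (configs n m)" using bij_betw_finite[OF Mof_bij[of n m]] finite_spin_sets by simp
  moreover have "bc \<in> configs n m" by (simp add: configs_def)
  ultimately have Z: "0 < (\<Sum>\<sigma>\<in>configs n m. weight \<beta> n m \<sigma>)"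
    by (intro sum_pos2[of _ bc]) (auto simp: weight_def)
  have F: "event_IW n A WW \<sigma> \<longleftrightarrow> std_event_IW A WW (cstd (cint n (Mof \<sigma>)))" if "\<sigma> \<in> configs n m" for \<sigma>
    by (rule event_IW_enc[OF ic[OF that]])
  have EF: "(event_walls n Ws \<sigma> \<and> event_IW n A WW \<sigma>) \<longleftrightarrow>
      ((`) enc ` set Ws \<subseteq> cstd (cint n (Mof \<sigma>)) \<and> std_event_IW A WW (cstd (cint n (Mof \<sigma>))))" if "\<sigma> \<in> configs n m" for \<sigma>
    using F[OF that] event_walls_enc[OF ic[OF that]] by blast
  note sF = weight_sum[where E = "event_IW n A WW" and Q = "\<lambda>M. std_event_IW A WW (cstd (cint n M))", OF m F]
  note sEF = weight_sum[where E = "\<lambda>\<sigma>. event_walls n Ws \<sigma> \<and> event_IW n A WW \<sigma>"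
    and Q = "\<lambda>M. (`) enc ` set Ws \<subseteq> cstd (cint n M) \<and> std_event_IW A WW (cstd (cint n M))", OF m EF]
  have "condprob \<beta> n m (event_walls n Ws) (event_IW n A WW) =
     (\<Sum>\<sigma>\<in>{\<sigma> \<in> configs n m. event_walls n Ws \<sigma> \<and> event_IW n A WW \<sigma>}. weight \<beta> n m \<sigma>) /
     (\<Sum>\<sigma>\<in>{\<sigma> \<in> configs n m. event_IW n A WW \<sigma>}. weight \<beta> n m \<sigma>)"
    unfolding condprob_def prob_def using Z by simp
  then show ?thesis using sF sEF by simp
qed

end

text \<open>Equal entries of the list would be disjoint from themselves although walls are nonempty;
  so the entries are distinct and the sum over the list is a sum over a set.\<close>

lemma admissible_excess:
  assumes "admissible_list Ws"
  shows "(\<Sum>i<length Ws. excess (Ws ! i)) = (\<Sum>V\<in>(`) enc ` set Ws. cexcess V)"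
proof -
  have "distinct Ws" unfolding distinct_conv_nth
  proof (intro allI impI notI)
    fix i j assume ij: "i < length Ws" "j < length Ws" "i \<noteq> j" "Ws ! i = Ws ! j"
    then have "vdisjoint (Ws ! i) (Ws ! i)" "is_std_wall (Ws ! i)" using assms unfolding admissible_list_def by metis+
    then have "rho_pts (Ws ! i) = {}" "Ws ! i \<noteq> {}" unfolding vdisjoint_def is_std_wall_def by auto
    then obtain f where f: "f \<in> Ws ! i" by blast
    have "half (gp (rho_face f)) \<in> rho_pts (Ws ! i)"
      unfolding rho_pts_fpt fpt_half cproj_enc rho_def using f gclosure_refl by blast
    then show False using \<open>rho_pts (Ws ! i) = {}\<close> by blast
  qed
  then have "(\<Sum>W\<in>set Ws. excess W) = sum_list (map excess Ws)" by (simp add: sum_list_distinct_conv_sum_set)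
  also have "\<dots> = (\<Sum>i<length Ws. excess (Ws ! i))" by (simp add: sum_list_sum_nth atLeast0LessThan)
  finally have 1: "(\<Sum>i<length Ws. excess (Ws ! i)) = (\<Sum>W\<in>set Ws. excess W)" ..
  have "(\<Sum>V\<in>(`) enc ` set Ws. cexcess V) = (\<Sum>W\<in>set Ws. cexcess (enc ` W))"
    by (rule sum.reindex[unfolded o_def]) (rule inj_on_subset[OF inj_image_enc subset_UNIV])
  then show ?thesis unfolding 1 by (simp add: excess_enc)
qed

lemma model_eventually:
  obtains \<beta>0 where "\<And>\<beta>. \<beta>0 < \<beta> \<Longrightarrow> model \<beta>"
proof -
  \<comment> \<open>122 = 120 + 2: the exponent \<open>1 - (\<beta> - 120) / 2\<close> is at most
    \<open>- ln c\<close> exactly when \<open>\<beta> \<ge> 122 + 2 * ln c\<close>.\<close>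
  define b where "b = max (ln (11250 * 5400 ^ 9)) (122 + 2 * ln (28125 * 600 :: real))"
  have "model \<beta>" if "b < \<beta>" for \<beta>
  proof
    have e: "c * exp (- t) \<le> 1" if "0 < c" "ln c \<le> t" for c t :: real
    proof -
      have "exp (- t) \<le> exp (- ln c)" using that by simp
      also have "\<dots> = 1 / c" using that(1) by (simp add: exp_minus inverse_eq_divide)
      finally show ?thesis using that(1) by (simp add: field_simps)
    qed
    have b: "ln (11250 * 5400 ^ 9) \<le> \<beta>" "122 + 2 * ln (28125 * 600) \<le> \<beta>" using that unfolding b_def by linarith+
    have "11250 * 5400 ^ 9 * exp (- \<beta>) \<le> 1" by (rule e[OF _ b(1)]) simp
    then show "11250 * exp (- \<beta>) \<le> (1/5400) ^ 9" by (simp add: field_simps)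
    have "ln (28125 * 600) \<le> - (1 - (\<beta> - 120) / 2)" using b(2) by (simp add: field_simps)
    from e[OF _ this] show "28125 * exp (1 - (\<beta> - 120) / 2) \<le> 1/600" by (simp add: field_simps)
  qed
  then show thesis by (rule that)
qed

theorem theorem3p1:
  shows "\<exists>C > 0. \<exists>\<beta>0. \<forall>\<beta> > \<beta>0. \<beta> > 0 \<longrightarrow>
    (\<forall>n Ws A WW.
       admissible_list Ws \<and> A \<subseteq> L0n n \<and> admissible_family A WW \<and>
       (\<Union>z\<in>A. rho (WW z)) \<inter> (\<Union>W\<in>set Ws. hull_rho W) = {}
       \<longrightarrow> mu_cond \<beta> n (event_walls n Ws) (event_IW n A WW)
             \<le> ereal (exp (- (\<beta> - C) * (\<Sum>i<length Ws. excess (Ws ! i)))))"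
proof -
  obtain \<beta>0 where b0: "\<And>\<beta>. \<beta>0 < \<beta> \<Longrightarrow> model \<beta>" by (rule model_eventually) blast
  have main: "mu_cond \<beta> n (event_walls n Ws) (event_IW n A WW) \<le> ereal (exp (- (\<beta> - 120) * (\<Sum>i<length Ws. excess (Ws ! i))))"
    if b: "\<beta>0 < \<beta>" and adm: "admissible_list Ws" and disj: "(\<Union>z\<in>A. rho (WW z)) \<inter> (\<Union>W\<in>set Ws. hull_rho W) = {}"
    for \<beta> n Ws A WW
  proof -
    \<comment> \<open>The conditions on \<open>\<beta>\<close> do not involve \<open>n\<close>, so
      one threshold serves all boxes.\<close>
    interpret model n \<beta> by (rule b0[OF b])
    let ?S = "(`) enc ` set Ws"
    let ?B = "exp (- (\<beta> - 120) * (\<Sum>V\<in>?S. cexcess V))"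
    have cl: "std_event_IW A WW (X - {V})"
      if X: "std_event_IW A WW X" "V \<in> X" and V0: "V0 \<in> ?S" "cproj V \<subseteq> ghull (cproj V0)" for X V V0
    proof -
      obtain W where W: "W \<in> set Ws" "V0 = enc ` W" using V0(1) by blast
      then obtain i where "i < length Ws" "Ws ! i = W" unfolding in_set_conv_nth by blast
      then have "is_std_wall W" using adm unfolding admissible_list_def by blast
      then have "finite W" by (simp add: is_std_wall_def)
      then show ?thesis
        by (rule std_event_IW_delete[OF X V0(2)[unfolded W(2)]]) (use disj W(1) in blast)
    qed
    have rb: "\<forall>\<^sub>F m in sequentially. (\<Sum>M\<in>{M \<in> spin_sets n m. ?S \<subseteq> cstd (cint n M) \<and> std_event_IW A WW (cstd (cint n M))}. spin_weight M) /
        (\<Sum>M\<in>{M \<in> spin_sets n m. std_event_IW A WW (cstd (cint n M))}. spin_weight M) \<le> ?B + \<epsilon>" if e: "0 < \<epsilon>" for \<epsilon>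
      by (rule ratio_bound[OF _ e]) (rule cl)
    have "mu_cond \<beta> n (event_walls n Ws) (event_IW n A WW) \<le> ereal ?B + ereal \<epsilon>" if e: "0 < \<epsilon>" for \<epsilon>
      unfolding mu_cond_def
    proof (rule Limsup_bounded)
      show "\<forall>\<^sub>F m in sequentially. ereal (condprob \<beta> n m (event_walls n Ws) (event_IW n A WW)) \<le> ereal ?B + ereal \<epsilon>"
        using rb[OF e] eventually_ge_at_top[of 1]
      proof eventually_elim
        case (elim m)
        show ?case unfolding condprob_enc[OF elim(2)] plus_ereal.simps ereal_less_eq by (rule elim(1))
      qed
    qed
    then have "mu_cond \<beta> n (event_walls n Ws) (event_IW n A WW) \<le> ereal ?B"
      by (rule ereal_le_epsilon2)
    then show ?thesis unfolding admissible_excess[OF adm] .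
  qed
  have "\<forall>\<beta> > \<beta>0. \<beta> > 0 \<longrightarrow>
    (\<forall>n Ws A WW.
       admissible_list Ws \<and> A \<subseteq> L0n n \<and> admissible_family A WW \<and>
       (\<Union>z\<in>A. rho (WW z)) \<inter> (\<Union>W\<in>set Ws. hull_rho W) = {}
       \<longrightarrow> mu_cond \<beta> n (event_walls n Ws) (event_IW n A WW)
             \<le> ereal (exp (- (\<beta> - 120) * (\<Sum>i<length Ws. excess (Ws ! i)))))"
    using main by blast
  then show ?thesis by (intro exI[of _ "120 :: real"] conjI exI[of _ \<beta>0]) simp_all
qed

end
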